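(* Let $0<\beta<\alpha<1$, $\lambda>0$, $j\in\{0,1,2,\ldots\}$, and $$\vartheta^{(\lambda)}_{\beta,j\beta}(t)=\frac{e^{-\lambda t^{-\beta}}t^{-j\beta}}{\mathrm{E}^{(j+1)}_{\beta,j\beta+1}(-\lambda)\,\mathbb{E}[T_\beta^{-j\beta}]}.$$ Let $(\tilde V,Q)\sim\mathrm{P}^{\frac{\beta}{\alpha}}_\alpha(\vartheta^{(\lambda)}_{\beta,j\beta})$, let $V\in\mathcal P_\infty$ be the ranked masses of the coagulation $F_V:=F_{\tilde V}\circ G_Q$, and let $\hat T_1$ be the inverse local time at $1$ of $Q$. Then: (i) $V\sim\mathbb{L}^{(0)}_{\beta,j\beta}(\lambda):=\displaystyle\int_0^\infty\mathrm{PD}(\beta|s^{-1/\beta})\,\frac{e^{-\lambda s}g_{\beta,j\beta}(s)}{\mathrm{E}^{(j+1)}_{\beta,j\beta+1}(-\lambda)}\,ds$. (ii) $Q$ has marginal law $$\int_0^\infty\mathrm{PD}(\beta/\alpha|y)\,\frac{\mathbb{E}\big[e^{-\lambda y^{-\beta/\alpha}T_{\alpha,j\beta}^{-\beta}}\big]}{\mathrm{E}^{(j+1)}_{\beta,j\beta+1}(-\lambda)}f_{\frac{\beta}{\alpha},\frac{j\beta}{\alpha}}(y)\,dy,$$ where $\hat T_1$ has density $\mathbb{E}\big[e^{-\lambda y^{-\beta/\alpha}T_{\alpha,j\beta}^{-\beta}}\big]f_{\frac{\beta}{\alpha},\frac{j\beta}{\alpha}}(y)/\mathrm{E}^{(j+1)}_{\beta,j\beta+1}(-\lambda)$,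 which may be expressed through $$\mathbb{E}\big[e^{-\lambda y^{-\beta/\alpha}T_{\alpha,j\beta}^{-\beta}}\big]=\sum_{\ell=0}^\infty\frac{(-\lambda y^{-\beta/\alpha})^\ell}{\ell!}\,\frac{\Gamma\big(\frac{\beta(j+\ell)}{\alpha}+1\big)\Gamma(j\beta+1)}{\Gamma\big(\frac{j\beta}{\alpha}+1\big)\Gamma(j\beta+\ell\beta+1)}.$$ (iii) Given $\hat T_1=y$, $\tilde V$ has a stable Poisson-Kingman distribution with index $\alpha$ and mixing density $$\frac{e^{-\lambda s^{-\beta}y^{-\beta/\alpha}}}{\mathbb{E}\big[e^{-\lambda y^{-\beta/\alpha}T_{\alpha,j\beta}^{-\beta}}\big]}f_{\alpha,j\beta}(s).$$ (iv) $\tilde V$, equivalently (in distribution) $\mathrm{FRAG}_{\alpha,-\beta}(V)$, has a stable Poisson-Kingman distribution with index $\alpha$ and mixing density $$\frac{\mathrm{E}^{(j+1)}_{\frac{\beta}{\alpha},\frac{j\beta}{\alpha}+1}(-\lambda s^{-\beta})}{\mathrm{E}^{(j+1)}_{\beta,j\beta+1}(-\lambda)}f_{\alpha,j\beta}(s).$$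
   Context: $\mathcal P_\infty=\{(s_1,s_2,\ldots): s_1\ge s_2\ge\cdots\ge 0,\ \sum_k s_k=1\}$. For $\gamma\in(0,1)$ let $J_1>J_2>\cdots$ be the ranked points of a Poisson process on $(0,\infty)$ with intensity $\frac{\gamma}{\Gamma(1-\gamma)}x^{-\gamma-1}dx$ and $T_\gamma=\sum_i J_i$, a positive $\gamma$-stable variable with $\mathbb{E}[e^{-\lambda T_\gamma}]=e^{-\lambda^\gamma}$ and density $f_\gamma$; $g_\gamma(s)=f_\gamma(s^{-1/\gamma})s^{-1/\gamma-1}/\gamma$ is the density of $T_\gamma^{-\gamma}$. $\mathrm{PD}(\gamma,0)$ is the law of $(J_i/T_\gamma)_i$, and $\mathrm{PD}(\gamma|t)$ its regular conditional law given $T_\gamma=t$. The stable Poisson-Kingman distribution with index $\gamma$ and mixing density $\rho$ is $\int_0^\infty\mathrm{PD}(\gamma|s)\rho(s)\,ds$. If $P$ has such a law, its local time at $1$ is the a.s. limit $L=\Gamma(1-\gamma)\lim_{\epsilon\downarrow0}\epsilon^\gamma|\{i:P_i\ge\epsilon\}|$, and its inverse local time at $1$ is $L^{-1/\gamma}$. For $\theta>-\gamma$: $T_{\gamma,\theta}$ has density $f_{\gamma,\theta}(t)=t^{-\theta}f_\gamma(t)/\mathbb{E}[T_\gamma^{-\theta}]$, and $g_{\gamma,\theta}(s)=s^{\theta/\gamma}g_\gamma(s)/\mathbb{E}[T_\gamma^{-\theta}]$ is the density of $T_{\gamma,\theta}^{-\gamma}$. Also $$\mathrm{E}^{(\frac{\theta}{\gamma}+1)}_{\gamma,\theta+1}(-\lambda)=\sum_{\ell=0}^\infty\frac{(-\lambda)^\ell}{\ell!}\frac{\Gamma(\frac{\theta}{\gamma}+1+\ell)\Gamma(\theta+1)}{\Gamma(\frac{\theta}{\gamma}+1)\Gamma(\gamma\ell+\theta+1)}=\mathbb{E}\big[e^{-\lambda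 T_{\gamma,\theta}^{-\gamma}}\big].$$ For $h\ge0$ with $\mathbb{E}[h(T_\beta)]=1$, $\mathrm{P}^{\frac{\beta}{\alpha}}_{\alpha}(h)$ is the joint law $\int_0^\infty\int_0^\infty \mathrm{PD}(\alpha|s)\,\mathrm{PD}(\beta/\alpha|y)\,h(s y^{1/\alpha})f_{\beta/\alpha}(y)f_\alpha(s)\,dy\,ds$ on $\mathcal P_\infty\times\mathcal P_\infty$ (mixture of product measures). $F_{\tilde V}(y)=\sum_{k}\tilde V_k\mathbb{I}_{\{\tilde U_k\le y\}}$ and $G_Q(y)=\sum_\ell Q_\ell\mathbb{I}_{\{U_\ell\le y\}}$, $y\in[0,1]$, with $(\tilde U_k),(U_\ell)$ iid $\mathrm{Uniform}[0,1]$ independent of $(\tilde V,Q)$. $\mathrm{PD}(\gamma,\theta)$ is the law of the decreasing rearrangement of $(R_k\prod_{j<k}(1-R_j))_{k\ge1}$ with $R_k\sim\mathrm{Beta}(1-\gamma,\theta+k\gamma)$ independent. $\mathrm{FRAG}_{\alpha,-\beta}((P_i))$ is the decreasing rearrangement of all masses $P_i\hat Q^{(i)}_\ell$, where $\hat Q^{(i)}=(\hat Q^{(i)}_\ell)_\ell$, $i\ge1$, are iid $\mathrm{PD}(\alpha,-\beta)$, independent of $(P_i)$. *)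

theory Defs
  imports "HOL-Probability.Probability"
begin

text \<open>
  Sequences are indexed from 0, so the paper's k-th term is the term with index k - 1.
\<close>

definition Pinf :: "(nat \<Rightarrow> real) set" where
  "Pinf = {s. decseq s \<and> (\<forall>k. 0 \<le> s k) \<and> s sums 1}"

abbreviation seq_borel :: "(nat \<Rightarrow> real) measure" where
  "seq_borel \<equiv> PiM UNIV (\<lambda>_. borel)"

definition PinfM :: "(nat \<Rightarrow> real) measure" where
  "PinfM = restrict_space seq_borel Pinf"

text \<open>
  Decreasing rearrangement of a family of non-negative numbers with finite sum: the entry with
  index n is the (n+1)-st largest value, counted with multiplicity, and 0 if there are at most n
  positive values.
\<close>

definition ranked :: "'i set \<Rightarrow> ('i \<Rightarrow> real) \<Rightarrow> nat \<Rightarrow> real" where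
  "ranked I m n = Sup {x. x = 0 \<or> (\<exists>A\<subseteq>I. finite A \<and> card A = Suc n \<and> (\<forall>i\<in>A. x \<le> m i))}"


text \<open>
  \<open>J\<close> lists, in strictly decreasing order, the points of a Poisson process on (0, \<open>\<infinity>\<close>) with
  intensity \<open>\<nu>\<close>. As \<open>card\<close> of an infinite set is 0, finiteness of the counts is a separate clause.
\<close>

definition ranked_poisson_points :: "'w measure \<Rightarrow> real measure \<Rightarrow> (nat \<Rightarrow> 'w \<Rightarrow> real) \<Rightarrow> bool" where
  "ranked_poisson_points M \<nu> J \<longleftrightarrow>
     prob_space M \<and>
     (\<forall>i. J i \<in> borel_measurable M) \<and>
     (AE \<omega> in M. \<forall>i. 0 < J i \<omega> \<and> J (Suc i) \<omega> < J i \<omega>) \<and>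
     (\<forall>A\<in>sets borel. emeasure \<nu> A < \<infinity> \<longrightarrow>
        (AE \<omega> in M. finite {i. J i \<omega> \<in> A}) \<and>
        (\<forall>k. measure M {\<omega>\<in>space M. card {i. J i \<omega> \<in> A} = k}
             = measure \<nu> A ^ k / fact k * exp (- measure \<nu> A))) \<and>
     (\<forall>(n::nat) A. (\<forall>m<n. A m \<in> sets borel \<and> emeasure \<nu> (A m) < \<infinity>) \<and> disjoint_family_on A {..<n} \<longrightarrow>
        prob_space.indep_vars M (\<lambda>_. count_space UNIV)
          (\<lambda>m \<omega>. card {i. J i \<omega> \<in> A m}) {..<n})"

definition stable_intensity :: "real \<Rightarrow> real measure" where
  "stable_intensity \<gamma> =
     density lborel (\<lambda>x. ennreal (\<gamma> / Gamma (1 - \<gamma>) * x powr (- \<gamma> - 1)) * indicator {0<..} x)"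

definition total :: "(nat \<Rightarrow> 'w \<Rightarrow> real) \<Rightarrow> 'w \<Rightarrow> real" where
  "total J \<omega> = (\<Sum>i. J i \<omega>)"

definition normalized :: "(nat \<Rightarrow> 'w \<Rightarrow> real) \<Rightarrow> 'w \<Rightarrow> nat \<Rightarrow> real" where
  "normalized J \<omega> = (\<lambda>i. J i \<omega> / total J \<omega>)"

text \<open>
  \<open>\<kappa>\<close> is a version of the regular conditional law on \<open>S\<close> of \<open>X\<close> given the almost surely positive
  random variable \<open>T\<close>. \<open>X\<close> need only take its values in \<open>space S\<close> almost surely.
\<close>

definition regular_cond_law ::
  "'w measure \<Rightarrow> 'b measure \<Rightarrow> ('w \<Rightarrow> 'b) \<Rightarrow> ('w \<Rightarrow> real) \<Rightarrow> (real \<Rightarrow> 'b measure) \<Rightarrow> bool" where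
  "regular_cond_law M S X T \<kappa> \<longleftrightarrow>
     \<kappa> \<in> restrict_space borel {0<..} \<rightarrow>\<^sub>M prob_algebra S \<and>
     (\<forall>A\<in>sets S. \<forall>B\<in>sets borel. B \<subseteq> {0<..} \<longrightarrow>
        emeasure M {\<omega>\<in>space M. T \<omega> \<in> B \<and> X \<omega> \<in> A}
          = (\<integral>\<^sup>+ \<omega>. emeasure (\<kappa> (T \<omega>)) A * indicator B (T \<omega>) \<partial>M))"


text \<open>
  In the next four definitions \<open>\<phi>\<close> is the density of \<open>T\<^sub>\<gamma>\<close>.
\<close>

definition law_of :: "(real \<Rightarrow> real) \<Rightarrow> real measure" where
  "law_of \<phi> = density lborel (\<lambda>t. ennreal (\<phi> t))"

definition neg_moment :: "(real \<Rightarrow> real) \<Rightarrow> real \<Rightarrow> real" where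
  "neg_moment \<phi> \<theta> = (\<integral>t. t powr (- \<theta>) \<partial>law_of \<phi>)"

text \<open>The densities \<open>f\<^bsub>\<gamma>,\<theta>\<^esub>\<close> of \<open>T\<^bsub>\<gamma>,\<theta>\<^esub>\<close> and \<open>g\<^bsub>\<gamma>,\<theta>\<^esub>\<close> of its power with exponent \<open>-\<gamma>\<close>.\<close>

definition f_tilt :: "(real \<Rightarrow> real) \<Rightarrow> real \<Rightarrow> real \<Rightarrow> real" where
  "f_tilt \<phi> \<theta> t = t powr (- \<theta>) * \<phi> t / neg_moment \<phi> \<theta>"

definition g_tilt :: "real \<Rightarrow> (real \<Rightarrow> real) \<Rightarrow> real \<Rightarrow> real \<Rightarrow> real" where
  "g_tilt \<gamma> \<phi> \<theta> s =
     s powr (\<theta> / \<gamma>) * (\<phi> (s powr (- 1 / \<gamma>)) * s powr (- 1 / \<gamma> - 1) / \<gamma>) / neg_moment \<phi> \<theta>"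

text \<open>
  The function \<open>E\<^bsup>(\<delta>)\<^esup>\<^bsub>\<gamma>,\<mu>\<^esub>\<close>, with the normalization that gives it the value 1 at 0.
\<close>

definition mittag_leffler :: "real \<Rightarrow> real \<Rightarrow> real \<Rightarrow> real \<Rightarrow> real" where
  "mittag_leffler \<delta> \<gamma> \<mu> z =
     (\<Sum>l. z ^ l / fact l * (Gamma (\<delta> + real l) * Gamma \<mu>) / (Gamma \<delta> * Gamma (\<gamma> * real l + \<mu>)))"


text \<open>
  \<open>\<integral>\<^sub>0\<^sup>\<infinity> K(s) \<rho>(s) ds\<close>; when \<open>K\<close> is the kernel \<open>PD(\<gamma>|\<cdot>)\<close> this is the stable Poisson-Kingman
  distribution with index \<open>\<gamma>\<close> and mixing density \<open>\<rho>\<close>.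
\<close>

definition mixture :: "(real \<Rightarrow> (nat \<Rightarrow> real) measure) \<Rightarrow> (real \<Rightarrow> real) \<Rightarrow> (nat \<Rightarrow> real) measure" where
  "mixture K \<rho> = density (restrict_space lborel {0<..}) (\<lambda>s. ennreal (\<rho> s)) \<bind> K"

text \<open>
  The law \<open>P\<^bsup>\<beta>/\<alpha>\<^esup>\<^sub>\<alpha>(h)\<close>, for the density family \<open>f\<close> and the kernel family \<open>K\<close>.
\<close>

definition joint_law ::
  "(real \<Rightarrow> real \<Rightarrow> real) \<Rightarrow> (real \<Rightarrow> real \<Rightarrow> (nat \<Rightarrow> real) measure) \<Rightarrow> real \<Rightarrow> real \<Rightarrow>
   (real \<Rightarrow> real) \<Rightarrow> ((nat \<Rightarrow> real) \<times> (nat \<Rightarrow> real)) measure" where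
  "joint_law f K \<alpha> \<beta> h =
     density (restrict_space lborel {0<..} \<Otimes>\<^sub>M restrict_space lborel {0<..})
       (\<lambda>(s, y). ennreal (h (s * y powr (1 / \<alpha>)) * f (\<beta> / \<alpha>) y * f \<alpha> s))
     \<bind> (\<lambda>(s, y). K \<alpha> s \<Otimes>\<^sub>M K (\<beta> / \<alpha>) y)"

definition local_time :: "real \<Rightarrow> (nat \<Rightarrow> real) \<Rightarrow> real" where
  "local_time \<gamma> p =
     Gamma (1 - \<gamma>) * Lim (at_right 0) (\<lambda>\<epsilon>. \<epsilon> powr \<gamma> * real (card {i. \<epsilon> \<le> p i}))"

definition inverse_local_time :: "real \<Rightarrow> (nat \<Rightarrow> real) \<Rightarrow> real" where
  "inverse_local_time \<gamma> p = local_time \<gamma> p powr (- 1 / \<gamma>)"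


text \<open>
  \<open>bridge p u\<close> is the random distribution function with masses \<open>p k\<close> at \<open>u k\<close>, and \<open>mass_at F y\<close>
  is the mass at \<open>y\<close> of the distribution on [0,1] with distribution function \<open>F\<close>
  (with the convention that \<open>F\<close> vanishes to the left of 0).
\<close>

definition bridge :: "(nat \<Rightarrow> real) \<Rightarrow> (nat \<Rightarrow> real) \<Rightarrow> real \<Rightarrow> real" where
  "bridge p u y = (\<Sum>k. p k * (if u k \<le> y then 1 else 0))"

definition mass_at :: "(real \<Rightarrow> real) \<Rightarrow> real \<Rightarrow> real" where
  "mass_at F y = F y - (if y = 0 then 0 else Lim (at_left y) F)"

definition ranked_masses :: "(real \<Rightarrow> real) \<Rightarrow> nat \<Rightarrow> real" where
  "ranked_masses F = ranked {0..1} (mass_at F)"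


definition beta_law :: "real \<Rightarrow> real \<Rightarrow> real measure" where
  "beta_law a b = density (restrict_space lborel {0<..<1})
     (\<lambda>x. ennreal (x powr (a - 1) * (1 - x) powr (b - 1) / Beta a b))"

text \<open>
  The law \<open>PD(\<gamma>,\<theta>)\<close>. The stick lengths sum to 1 only almost surely, hence the law is formed on
  all sequences before it is restricted to \<open>Pinf\<close>.
\<close>

definition PD_law :: "real \<Rightarrow> real \<Rightarrow> (nat \<Rightarrow> real) measure" where
  "PD_law \<gamma> \<theta> = restrict_space
     (distr (PiM UNIV (\<lambda>k. beta_law (1 - \<gamma>) (\<theta> + real (Suc k) * \<gamma>))) seq_borel
        (\<lambda>r. ranked UNIV (\<lambda>k. r k * (\<Prod>i<k. 1 - r i)))) Pinf"

text \<open>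
  The law of \<open>FRAG\<^bsub>\<alpha>,-\<beta>\<^esub>(P)\<close> when \<open>P\<close> has law \<open>N\<close>.
\<close>

definition FRAG_law :: "real \<Rightarrow> real \<Rightarrow> (nat \<Rightarrow> real) measure \<Rightarrow> (nat \<Rightarrow> real) measure" where
  "FRAG_law \<alpha> \<beta> N =
     distr (N \<Otimes>\<^sub>M PiM (UNIV :: nat set) (\<lambda>_. PD_law \<alpha> (- \<beta>))) PinfM
       (\<lambda>(p, q). ranked UNIV (\<lambda>(i, l). p i * q i l))"

end

theory Submission
  imports Defs
begin

text \<open>
  Let \<open>A\<close> and \<open>B\<close> be independent stable Poisson processes with indices \<open>\<alpha>\<close> and \<open>\<beta> / \<alpha>\<close> and total masses
  \<open>T\<^sub>A\<close>, \<open>T\<^sub>B\<close>. Disintegrating along the total masses, the pair \<open>(Vt, Q)\<close> is the pair of normalized points of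
  \<open>A\<close> and \<open>B\<close> under the density \<open>h (T\<^sub>A * T\<^sub>B powr (1 / \<alpha>))\<close>. Given \<open>Q\<close>, the points of \<open>A\<close> carry uniform
  marks, so the sums over the classes are independent \<open>\<alpha>\<close>-stable variables scaled by the powers
  \<open>1 / \<alpha>\<close> of the points of \<open>Q\<close>; a comparison of Laplace functionals shows that, after multiplication by
  \<open>T\<^sub>B powr (1 / \<alpha>)\<close>, the coagulated masses are the points of a \<open>\<beta>\<close>-stable process whose total mass is
  \<open>T\<^sub>A * T\<^sub>B powr (1 / \<alpha>)\<close>. The density \<open>h\<close> is therefore a function of the total mass of that process, which is (i);
  integrating out \<open>T\<^sub>A\<close> or \<open>T\<^sub>B\<close> and expanding the exponential in moments gives (ii), (iii) and the law of
  \<open>Vt\<close>. For \<open>FRAG_law\<close>, the stick-breaking law \<open>PD_law \<gamma> \<theta>\<close> is identified with the law of the normalized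
  points under the density \<open>T powr (- \<theta>)\<close>, and fragmenting the \<open>\<beta>\<close>-stable points by \<open>PD_law \<alpha> (- \<beta>)\<close> gives back the
  points of \<open>A\<close> scaled by \<open>T\<^sub>B powr (1 / \<alpha>)\<close>.
\<close>

section \<open>Laplace functionals\<close>

text \<open>The kernels \<open>PDc\<close> are pinned down only up to null sets of the law of the
  total mass, and the three stable processes live on unrelated probability spaces. Nothing is
  therefore compared pathwise or at a fixed total mass: every mixture becomes the law of normalized
  points under a density in the total mass, and laws are compared by Laplace functionals. A
  normalized sequence has no tractable Laplace functional. For coagulation and fragmentation the
  scale is restored by a total mass at hand, and total and normalized masses are read off
  afterwards. For stick breaking an independent Gamma scale is supplied. Its density turns the
  comparison into one of Mellin transforms, where replacing l by T * l absorbs the factor 1 / T; the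
  exponent is chosen so that the tilt \<open>T powr (- \<theta>)\<close> leaves only the power 0 or
  1 of T. The constants match because the Gamma quotient in the image of the intensity under the
  power 1 / \<alpha> is the reciprocal of the \<beta>-moment of \<open>T\<^sub>A\<close>, the same
  moment that normalizes \<open>PD_law \<alpha> (- \<beta>)\<close>.\<close>

lemma nn_integral_cong_eventually:
  "AE x in M. P x \<Longrightarrow> (\<And>x. P x \<Longrightarrow> f x = g x) \<Longrightarrow> integral\<^sup>N M f = integral\<^sup>N M g"
  by (rule nn_integral_cong_AE) (rule eventually_mono)

text \<open>Test functions are arbitrary nonnegative functions, so sums over points may be infinite.
  With exp(-x) defined on all of [0, infinity], Laplace functionals carry no summability side
  conditions.\<close>

definition nexp :: "ennreal \<Rightarrow> ennreal" where
  "nexp x = (if x = \<top> then 0 else ennreal (exp (- enn2real x)))"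

lemma nexp_0 [simp]: "nexp 0 = 1" by (simp add: nexp_def)

lemma nexp_top [simp]: "nexp \<top> = 0" by (simp add: nexp_def)

lemma nexp_ennreal: "0 \<le> x \<Longrightarrow> nexp (ennreal x) = ennreal (exp (- x))" by (simp add: nexp_def)

lemma nexp_add: "nexp (x + y) = nexp x * nexp y" by (cases x rule: ennreal_cases; cases y rule: ennreal_cases)
     (auto simp: nexp_ennreal ennreal_plus[symmetric] exp_add[symmetric] ennreal_mult[symmetric] simp del: ennreal_plus)

lemma nexp_antimono: "x \<le> y \<Longrightarrow> nexp y \<le> nexp x" by (cases x rule: ennreal_cases; cases y rule: ennreal_cases)
     (auto simp: nexp_ennreal top_unique)

lemma nexp_le_1 [simp]: "nexp x \<le> 1" using nexp_antimono[of 0 x] by simp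

lemma nexp_neq_top [simp]: "nexp x \<noteq> \<top>" "nexp x < \<top>" by (simp_all add: nexp_def)

lemma nexp_sum: "finite A \<Longrightarrow> nexp (\<Sum>i\<in>A. f i) = (\<Prod>i\<in>A. nexp (f i))"
  by (induction A rule: finite_induct) (auto simp: nexp_add)

lemma measurable_nexp [measurable]: "nexp \<in> borel_measurable borel" unfolding nexp_def by measurable

text \<open>Monotone limits of test functions pass through \<open>nexp\<close>, also when the limit
  is infinite; this is the continuity behind every approximation of a Laplace functional.\<close>

lemma nexp_tendsto_SUP:
  assumes "incseq u"
  shows "(\<lambda>n. nexp (u n)) \<longlonglongrightarrow> nexp (SUP n. u n)"
proof (cases "(SUP n. u n) = \<top>")
  case False
  then obtain r where r: "0 \<le> r" "(SUP n. u n) = ennreal r" by (cases "SUP n. u n" rule: ennreal_cases) auto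
  have fin: "u n < \<top>" for n using SUP_upper[of n UNIV u] r le_less_trans by fastforce
  have "u \<longlonglongrightarrow> ennreal r" using LIMSEQ_SUP[OF assms] unfolding r(2) .
  then have "(\<lambda>n. enn2real (u n)) \<longlonglongrightarrow> r" by (rule tendsto_enn2real) (rule r)
  then have "(\<lambda>n. ennreal (exp (- enn2real (u n)))) \<longlonglongrightarrow> ennreal (exp (- r))"
    by (intro tendsto_ennrealI tendsto_exp tendsto_minus)
  then show ?thesis using fin r by (simp add: nexp_def less_top[symmetric])
next
  case True
  have "(\<lambda>n. nexp (u n)) \<longlonglongrightarrow> 0"
  proof (rule order_tendstoI)
    fix e :: ennreal assume "0 < e"
    then obtain z where "0 < z" "z < e" using dense by blast
    then obtain d where d: "0 < d" "ennreal d < e" by (cases z rule: ennreal_cases) auto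
    \<comment> \<open>\<open>K\<close> satisfies exp(-K) <= d; the maximum with 0 covers d > 1,
      where ln d is positive.\<close>
    define K where "K = max 0 (- ln d)"
    have K: "0 \<le> K" "exp (- K) \<le> d" using d by (auto simp: K_def max_def exp_minus)
    have "ennreal K < (SUP n. u n)" unfolding True by simp
    then obtain n0 where "ennreal K < u n0" by (auto simp: less_SUP_iff)
    then have "ennreal K \<le> u n" if "n \<ge> n0" for n using incseqD[OF assms that] by order
    then have "nexp (u n) \<le> ennreal d" if "n \<ge> n0" for n
      using nexp_antimono[of "ennreal K" "u n"] that K ennreal_leI[OF K(2)] by (simp add: nexp_ennreal)
    then show "\<forall>\<^sub>F n in sequentially. nexp (u n) < e"
      using d(2) by (auto simp: eventually_sequentially intro!: exI[of _ n0] intro: le_less_trans)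
  qed auto
  then show ?thesis unfolding True nexp_top .
qed

lemma nexp_suminf_tendsto: "(\<lambda>n. \<Prod>i<n. nexp (f i)) \<longlonglongrightarrow> nexp (\<Sum>i. f i)"
proof -
  have "incseq (\<lambda>n. \<Sum>i<n. f i)" by (intro incseq_SucI) simp
  from nexp_tendsto_SUP[OF this] show ?thesis by (simp add: nexp_sum suminf_eq_SUP)
qed

text \<open>Inverse of \<open>nexp\<close> on [0,1]. Writing an average over independent decorations
  as \<open>nexp\<close> of something makes it a test function again, to which the next Laplace
  functional can be applied.\<close>

definition nln :: "ennreal \<Rightarrow> ennreal" where
  "nln g = (if g = 0 then \<top> else ennreal (- ln (enn2real g)))"

lemma nexp_nln: "g \<le> 1 \<Longrightarrow> nexp (nln g) = g"
proof -
  assume g: "g \<le> 1"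
  then obtain r where r: "0 \<le> r" "g = ennreal r" by (cases g rule: ennreal_cases) (auto simp: top_unique)
  with g have "r \<le> 1" by simp
  with r show ?thesis by (auto simp: nln_def nexp_ennreal ennreal_eq_0_iff not_le)
qed

lemma nln_1 [simp]: "nln 1 = 0" by (simp add: nln_def)

lemma measurable_nln [measurable]: "nln \<in> borel_measurable borel" unfolding nln_def by measurable

lemma nn_integral_nexp_tendsto:
  assumes "prob_space M" and [measurable]: "\<And>n. g n \<in> borel_measurable M" 
    and l: "AE x in M. (\<lambda>n. g n x) \<longlonglongrightarrow> h x" and le: "\<And>n x. g n x \<le> (1::ennreal)"
    and [measurable]: "h \<in> borel_measurable M"
  shows "(\<lambda>n. \<integral>\<^sup>+x. g n x \<partial>M) \<longlonglongrightarrow> (\<integral>\<^sup>+x. h x \<partial>M)"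
proof -
  interpret prob_space M by fact
  show ?thesis by (rule nn_integral_dominated_convergence[where w="\<lambda>_. 1"])
     (use l le in \<open>auto simp: emeasure_space_1\<close>)
qed

lemma nn_integral_PiM_prod:
  fixes S :: "nat \<Rightarrow> 'a measure"
  assumes S: "\<And>i. prob_space (S i)" and [measurable]: "\<And>i. g i \<in> borel_measurable (S i)"
  shows "(\<integral>\<^sup>+x. (\<Prod>i<n. g i (x i)) \<partial>PiM UNIV S) = (\<Prod>i<n. \<integral>\<^sup>+x. g i x \<partial>S i)"
proof -
  interpret product_prob_space S UNIV
    using S by (auto simp: product_prob_space_def product_prob_space_axioms_def product_sigma_finite_def prob_space_imp_sigma_finite)
  have eq: "distr (PiM UNIV S) (PiM {..<n} S) (\<lambda>x. restrict x {..<n}) = PiM {..<n} S"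
    by (rule distr_PiM_restrict_finite[symmetric, THEN sym]) auto
  have "(\<integral>\<^sup>+x. (\<Prod>i<n. g i (x i)) \<partial>PiM UNIV S) = (\<integral>\<^sup>+x. (\<Prod>i<n. g i (restrict x {..<n} i)) \<partial>PiM UNIV S)"
    by (intro nn_integral_cong) auto
  also have "\<dots> = (\<integral>\<^sup>+x. (\<Prod>i<n. g i (x i)) \<partial>distr (PiM UNIV S) (PiM {..<n} S) (\<lambda>x. restrict x {..<n}))"
    by (subst nn_integral_distr) (auto intro!: borel_measurable_prod_ennreal measurable_restrict_subset)
  also have "\<dots> = (\<Prod>i<n. \<integral>\<^sup>+x. g i x \<partial>S i)" unfolding eq by (subst product_nn_integral_prod) auto
  finally show ?thesis .
qed

text \<open>The factors are independent and at most 1, so finite products converge boundedly. The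
  result is put back into the form \<open>nexp\<close> of a sum so that it can be averaged further
  over the points that index the factors.\<close>

lemma nn_integral_PiM_nexp_suminf:
  fixes S :: "nat \<Rightarrow> 'a measure"
  assumes S: "\<And>i. prob_space (S i)" and [measurable]: "\<And>i. g i \<in> borel_measurable (S i)"
  shows "(\<integral>\<^sup>+x. nexp (\<Sum>i. g i (x i)) \<partial>PiM UNIV S) = nexp (\<Sum>i. nln (\<integral>\<^sup>+x. nexp (g i x) \<partial>S i))"
proof (rule LIMSEQ_unique)
  have "prob_space (PiM UNIV S)" by (intro prob_space_PiM S)
  then show "(\<lambda>n. \<integral>\<^sup>+x. (\<Prod>i<n. nexp (g i (x i))) \<partial>PiM UNIV S) \<longlonglongrightarrow> (\<integral>\<^sup>+x. nexp (\<Sum>i. g i (x i)) \<partial>PiM UNIV S)"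
    by (rule nn_integral_nexp_tendsto)
       (auto intro!: nexp_suminf_tendsto prod_le_1)
  have "nexp (nln (\<integral>\<^sup>+x. nexp (g i x) \<partial>S i)) = (\<integral>\<^sup>+x. nexp (g i x) \<partial>S i)" for i
  proof (rule nexp_nln)
    have "(\<integral>\<^sup>+x. nexp (g i x) \<partial>S i) \<le> (\<integral>\<^sup>+x. 1 \<partial>S i)" by (intro nn_integral_mono) simp
    then show "(\<integral>\<^sup>+x. nexp (g i x) \<partial>S i) \<le> 1" using S[of i] by (simp add: prob_space.emeasure_space_1)
  qed
  then show "(\<lambda>n. \<integral>\<^sup>+x. (\<Prod>i<n. nexp (g i (x i))) \<partial>PiM UNIV S) \<longlonglongrightarrow> nexp (\<Sum>i. nln (\<integral>\<^sup>+x. nexp (g i x) \<partial>S i))"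
    using nexp_suminf_tendsto[of "\<lambda>i. nln (\<integral>\<^sup>+x. nexp (g i x) \<partial>S i)"] by (subst nn_integral_PiM_prod[OF S]) auto
qed

section \<open>Ranked sequences\<close>

text \<open>Everything about \<open>ranked\<close> is derived from this description by level counts.
  With infinite level sets the supremum could be infinite or not attained.\<close>

lemma ranked_facts:
  fixes m :: "'i \<Rightarrow> real"
  assumes fin: "\<And>x. 0 < x \<Longrightarrow> finite {i\<in>I. x \<le> m i}"
  shows ranked_nonneg: "0 \<le> ranked I m n"
    and le_ranked_iff: "0 < x \<Longrightarrow> x \<le> ranked I m n \<longleftrightarrow> Suc n \<le> card {i\<in>I. x \<le> m i}"
proof -
  let ?S = "{x. x = 0 \<or> (\<exists>A\<subseteq>I. finite A \<and> card A = Suc n \<and> (\<forall>i\<in>A. x \<le> m i))}"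
  have S_iff: "y \<in> ?S \<longleftrightarrow> Suc n \<le> card {i\<in>I. y \<le> m i}" if y0: "0 < y" for y
  proof
    assume "y \<in> ?S"
    then obtain A where A: "A \<subseteq> I" "finite A" "card A = Suc n" "\<forall>i\<in>A. y \<le> m i" using y0 by auto
    then have "card A \<le> card {i\<in>I. y \<le> m i}" by (intro card_mono fin that) auto
    then show "Suc n \<le> card {i\<in>I. y \<le> m i}" using A by simp
  next
    assume "Suc n \<le> card {i\<in>I. y \<le> m i}"
    then obtain A where "A \<subseteq> {i\<in>I. y \<le> m i}" "card A = Suc n" "finite A" by (rule obtain_subset_with_card_n)
    then show "y \<in> ?S" by auto
  qed
  have bdd: "bdd_above ?S"
  proof -
    have f1: "finite {i\<in>I. 1 \<le> m i}" by (rule fin) simp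
    define K where "K = Max (insert 1 (m ` {i\<in>I. 1 \<le> m i}))"
    have "y \<le> K" if yS: "y \<in> ?S" for y
    proof (cases "y \<le> 1")
      case True
      have "1 \<le> K" unfolding K_def using f1 by simp
      with True show ?thesis by simp
    next
      case False
      then obtain i where i: "i \<in> I" "y \<le> m i" using yS by (auto simp: card_Suc_eq)
      have "m i \<le> K" unfolding K_def using f1 i False by (intro Max_ge) auto
      with i show ?thesis by simp
    qed
    then show ?thesis by (rule bdd_aboveI)
  qed
  show "0 \<le> ranked I m n" unfolding ranked_def by (rule cSup_upper[OF _ bdd]) simp
  show "x \<le> ranked I m n \<longleftrightarrow> Suc n \<le> card {i\<in>I. x \<le> m i}" if x: "0 < x"
  proof
    assume "Suc n \<le> card {i\<in>I. x \<le> m i}"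
    then have "x \<in> ?S" using S_iff[OF x] by simp
    then show "x \<le> ranked I m n" unfolding ranked_def by (rule cSup_upper[OF _ bdd])
  next
    assume le: "x \<le> ranked I m n"
    show "Suc n \<le> card {i\<in>I. x \<le> m i}"
    proof (rule ccontr)
      assume neg: "\<not> ?thesis"
      have f2: "finite {i\<in>I. x/2 \<le> m i}" by (rule fin) (use x in simp)
      \<comment> \<open>Every value of m below x is at most \<open>y\<close>, and \<open>y\<close> <
        x. A candidate above \<open>y\<close> would require n + 1 values above \<open>y\<close>,
        hence n + 1 values that are at least x; so the supremum is at most \<open>y\<close>.\<close>
      define y where "y = Max (insert (x/2) (m ` {i\<in>I. x/2 \<le> m i \<and> m i < x}))"
      have f3: "finite {i\<in>I. x/2 \<le> m i \<and> m i < x}" by (rule finite_subset[OF _ f2]) auto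
      have "x/2 \<le> y" unfolding y_def using f3 by (intro Max_ge) auto
      moreover have "y < x" unfolding y_def using f3 x by (subst Max_less_iff) auto
      ultimately have y: "x/2 \<le> y" "y < x" .
      have gt: "x \<le> m i" if "i \<in> I" "y < m i" for i
      proof (rule ccontr)
        assume "\<not> x \<le> m i"
        then have "m i \<le> y" unfolding y_def using f3 that y by (intro Max_ge) auto
        with that show False by simp
      qed
      have "z \<le> y" if "z \<in> ?S" for z
      proof (rule ccontr)
        assume z: "\<not> z \<le> y"
        then have "Suc n \<le> card {i\<in>I. z \<le> m i}" using S_iff[of z] that y x by auto
        also have "\<dots> \<le> card {i\<in>I. x \<le> m i}"
        proof (intro card_mono fin x subsetI)
          fix i assume "i \<in> {i\<in>I. z \<le> m i}"
          then show "i \<in> {i\<in>I. x \<le> m i}" using gt[of i] z by simp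
        qed
        finally show False using neg by simp
      qed
      then have "ranked I m n \<le> y" unfolding ranked_def by (intro cSup_least) auto
      with le y show False by simp
    qed
  qed
qed

lemma ranked_decseq:
  assumes fin: "\<And>x. 0 < x \<Longrightarrow> finite {i\<in>I. x \<le> m i}"
  shows "decseq (ranked I m)"
proof (intro decseq_SucI)
  fix n
  show "ranked I m (Suc n) \<le> ranked I m n"
  proof (cases "0 < ranked I m (Suc n)")
    case True
    have "Suc (Suc n) \<le> card {i\<in>I. ranked I m (Suc n) \<le> m i}" using le_ranked_iff[where n="Suc n", OF fin True] by simp
    then show ?thesis using le_ranked_iff[where n=n, OF fin True] by simp
  next
    case False
    then show ?thesis using ranked_nonneg[where n=n, OF fin] by simp
  qed
qed

lemma ranked_level_set:
  assumes fin: "\<And>x. 0 < x \<Longrightarrow> finite {i\<in>I. x \<le> m i}" and x: "0 < x"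
  shows "{n. x \<le> ranked I m n} = {..<card {i\<in>I. x \<le> m i}}" by (simp add: set_eq_iff le_ranked_iff[OF fin x] Suc_le_eq)

lemma ranked_cong_card:
  assumes "\<And>x. 0 < x \<Longrightarrow> finite {i\<in>I. x \<le> m i}" "\<And>x. 0 < x \<Longrightarrow> finite {i\<in>I'. x \<le> m' i}"
    and "\<And>x. 0 < x \<Longrightarrow> card {i\<in>I. x \<le> m i} = card {i\<in>I'. x \<le> m' i}"
  shows "ranked I m = ranked I' m'"
proof
  fix n
  have *: "x \<le> ranked I m n \<longleftrightarrow> x \<le> ranked I' m' n" if "0 < x" for x
    using le_ranked_iff[where n=n, OF assms(1) that] le_ranked_iff[where n=n, OF assms(2) that] assms(3)[OF that] by simp
  have "0 \<le> ranked I m n" "0 \<le> ranked I' m' n"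
    using ranked_nonneg[where n=n, OF assms(1)] ranked_nonneg[where n=n, OF assms(2)] by simp_all
  with *[of "ranked I m n"] *[of "ranked I' m' n"] show "ranked I m n = ranked I' m' n" by linarith
qed

text \<open>Only the counts on the half-lines \<open>{x..}\<close> with \<open>x > 0\<close> matter, since \<open>\<phi>\<close> vanishes on the rest.\<close>

lemma nn_integral_count_cong:
  fixes m :: "'i \<Rightarrow> real" and m' :: "'k \<Rightarrow> real"
  assumes fin: "\<And>x. 0 < x \<Longrightarrow> finite {i\<in>I. x \<le> m i}" "\<And>x. 0 < x \<Longrightarrow> finite {i\<in>I'. x \<le> m' i}"
    and eq: "\<And>x. 0 < x \<Longrightarrow> card {i\<in>I. x \<le> m i} = card {i\<in>I'. x \<le> m' i}"
    and [measurable]: "\<phi> \<in> borel_measurable borel" and \<phi>0: "\<And>x. x \<le> 0 \<Longrightarrow> \<phi> x = (0::ennreal)"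
  shows "(\<integral>\<^sup>+i. \<phi> (m i) \<partial>count_space I) = (\<integral>\<^sup>+i. \<phi> (m' i) \<partial>count_space I')"
proof -
  \<comment> \<open>The cut-off at \<open>e\<close> > 0 turns the counting measure of the values
    into a finite measure, which is determined by its values on half-lines; it is removed by
    monotone convergence at the end.\<close>
  define N where "N e = distr (density (count_space I) (\<lambda>i. indicator {e..} (m i))) borel m" for e :: real
  define N' where "N' e = distr (density (count_space I') (\<lambda>i. indicator {e..} (m' i))) borel m'" for e :: real
  have N: "N e {x..} = card {i\<in>I. max e x \<le> m i}" if "0 < e" for e x
  proof -
    have "N e {x..} = (\<integral>\<^sup>+i. indicator {i\<in>I. max e x \<le> m i} i \<partial>count_space I)" unfolding N_def
      by (subst emeasure_distr, simp, simp, subst emeasure_density, simp, simp)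
         (rule nn_integral_cong, auto split: split_indicator)
    also have "\<dots> = emeasure (count_space I) {i\<in>I. max e x \<le> m i}" by (intro nn_integral_indicator) auto
    finally show ?thesis using fin(1)[of "max e x"] that by (simp add: emeasure_count_space_finite)
  qed
  have N': "N' e {x..} = card {i\<in>I'. max e x \<le> m' i}" if "0 < e" for e x
  proof -
    have "N' e {x..} = (\<integral>\<^sup>+i. indicator {i\<in>I'. max e x \<le> m' i} i \<partial>count_space I')" unfolding N'_def
      by (subst emeasure_distr, simp, simp, subst emeasure_density, simp, simp)
         (rule nn_integral_cong, auto split: split_indicator)
    also have "\<dots> = emeasure (count_space I') {i\<in>I'. max e x \<le> m' i}" by (intro nn_integral_indicator) auto
    finally show ?thesis using fin(2)[of "max e x"] that by (simp add: emeasure_count_space_finite)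
  qed
  have NN: "N e = N' e" if e: "0 < e" for e
  proof (rule measure_eqI_generator_eq[where E="range (\<lambda>x. {x..})" and \<Omega>=UNIV and A="\<lambda>n. {- real n..}"])
    show "Int_stable (range (\<lambda>x::real. {x..}))"
    proof (clarsimp simp: Int_stable_def)
      fix a b :: real show "{a..} \<inter> {b..} \<in> range atLeast" by (rule image_eqI[where x="max a b"]) auto
    qed
    show "sets (N e) = sigma_sets UNIV (range (\<lambda>x. {x..}))" "sets (N' e) = sigma_sets UNIV (range (\<lambda>x. {x..}))"
      by (simp_all add: N_def N'_def borel_Ici)
    show "emeasure (N e) X = emeasure (N' e) X" if "X \<in> range (\<lambda>x. {x..})" for X
    proof -
      from that obtain x where "X = {x..}" by auto
      then show ?thesis using N[OF e, of x] N'[OF e, of x] eq[of "max e x"] e by simp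
    qed
    show "(\<Union>i. {- real i..}) = (UNIV :: real set)"
    proof (intro UNIV_eq_I[symmetric] UN_I UNIV_I)
      fix x :: real
      show "x \<in> {- real (nat \<lceil>- x\<rceil>)..}" using real_nat_ceiling_ge[of "- x"] by simp
    qed
    show "emeasure (N e) {- real i..} \<noteq> \<infinity>" for i using N[OF e] by simp
  qed auto
  have lim: "(\<integral>\<^sup>+i. \<phi> (f i) \<partial>count_space K) = (SUP n. \<integral>\<^sup>+i. \<phi> (f i) * indicator {1 / real (Suc n)..} (f i) \<partial>count_space K)"
    for f :: "'z \<Rightarrow> real" and K
  proof -
    have "(SUP n. \<phi> (f i) * indicator {1 / real (Suc n)..} (f i)) = \<phi> (f i)" for i
    proof (cases "f i \<le> 0")
      case False
      then obtain n where n: "1 / real (Suc n) < f i" using nat_approx_posE[of "f i"] by (auto simp: not_le)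
      show ?thesis
      proof (rule antisym)
        show "\<phi> (f i) \<le> (SUP n. \<phi> (f i) * indicator {1 / real (Suc n)..} (f i))"
          by (rule SUP_upper2[of n]) (use n in \<open>auto split: split_indicator\<close>)
      qed (auto intro!: SUP_least split: split_indicator)
    qed (simp add: \<phi>0)
    then have "(\<integral>\<^sup>+i. \<phi> (f i) \<partial>count_space K) = (\<integral>\<^sup>+i. (SUP n. \<phi> (f i) * indicator {1 / real (Suc n)..} (f i)) \<partial>count_space K)"
      by simp
    also have "\<dots> = (SUP n. \<integral>\<^sup>+i. \<phi> (f i) * indicator {1 / real (Suc n)..} (f i) \<partial>count_space K)"
    proof (intro nn_integral_monotone_convergence_SUP)
      have "1 / real (Suc n) \<le> f i \<Longrightarrow> 1 / real (Suc (Suc n)) \<le> f i" for n i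
        by (erule order_trans[rotated]) (intro divide_left_mono, auto)
      then show "incseq (\<lambda>n i. \<phi> (f i) * indicator {1 / real (Suc n)..} (f i))"
        by (intro incseq_SucI le_funI) (auto split: split_indicator)
    qed auto
    finally show ?thesis .
  qed
  have "(\<integral>\<^sup>+i. \<phi> (m i) * indicator {e..} (m i) \<partial>count_space I) = (\<integral>\<^sup>+x. \<phi> x \<partial>N e)"
       "(\<integral>\<^sup>+i. \<phi> (m' i) * indicator {e..} (m' i) \<partial>count_space I') = (\<integral>\<^sup>+x. \<phi> x \<partial>N' e)" for e
    unfolding N_def N'_def by (auto simp: nn_integral_distr nn_integral_density mult.commute)
  then show ?thesis by (subst (1 2) lim) (simp add: NN)
qed

text \<open>A sum over a family does not see its order, so the Laplace functional of a ranked
  sequence can be computed on the unranked family.\<close>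

lemma suminf_ranked:
  fixes m :: "'i \<Rightarrow> real"
  assumes fin: "\<And>x. 0 < x \<Longrightarrow> finite {i\<in>I. x \<le> m i}"
    and [measurable]: "\<phi> \<in> borel_measurable borel" and \<phi>0: "\<And>x. x \<le> 0 \<Longrightarrow> \<phi> x = (0::ennreal)"
  shows "(\<Sum>n. \<phi> (ranked I m n)) = (\<integral>\<^sup>+i. \<phi> (m i) \<partial>count_space I)"
proof -
  have "(\<integral>\<^sup>+n. \<phi> (ranked I m n) \<partial>count_space UNIV) = (\<integral>\<^sup>+i. \<phi> (m i) \<partial>count_space I)"
    by (rule nn_integral_count_cong) (use fin in \<open>simp_all add: ranked_level_set \<phi>0\<close>)
  then show ?thesis by (simp add: nn_integral_count_space_nat)
qed

lemma decseq_level_set: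
  fixes a :: "nat \<Rightarrow> real"
  assumes "decseq a" "a \<longlonglongrightarrow> 0" "0 < x"
  shows "finite {i. x \<le> a i}" "x \<le> a n \<longleftrightarrow> Suc n \<le> card {i. x \<le> a i}"
proof -
  from order_tendstoD(2)[OF assms(2,3)] obtain k where k: "\<And>i. i \<ge> k \<Longrightarrow> a i < x" by (auto simp: eventually_sequentially)
  have "{i. x \<le> a i} \<subseteq> {..<k}"
    using k by (metis (mono_tags, lifting) lessThan_iff linorder_not_less mem_Collect_eq subsetI)
  then show fin: "finite {i. x \<le> a i}" by (rule finite_subset) simp
  show "x \<le> a n \<longleftrightarrow> Suc n \<le> card {i. x \<le> a i}"
  proof
    assume "x \<le> a n"
    have "{..n} \<subseteq> {i. x \<le> a i}"
    proof
      fix i assume "i \<in> {..n}"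
      then have "a n \<le> a i" using decseqD[OF assms(1)] by simp
      with \<open>x \<le> a n\<close> show "i \<in> {i. x \<le> a i}" by simp
    qed
    from card_mono[OF fin this] show "Suc n \<le> card {i. x \<le> a i}" by simp
  next
    assume c: "Suc n \<le> card {i. x \<le> a i}"
    show "x \<le> a n"
    proof (rule ccontr)
      assume "\<not> x \<le> a n"
      have "{i. x \<le> a i} \<subseteq> {..<n}"
      proof
        fix i assume i: "i \<in> {i. x \<le> a i}"
        show "i \<in> {..<n}"
        proof (rule ccontr)
          assume "i \<notin> {..<n}"
          then have "a i \<le> a n" using decseqD[OF assms(1), of n i] by simp
          with \<open>\<not> x \<le> a n\<close> i show False by simp
        qed
      qed
      from card_mono[OF _ this] c show False by simp
    qed
  qed
qed

lemma summable_level_set: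
  fixes a :: "nat \<Rightarrow> real"
  assumes "summable a" "0 < x"
  shows "finite {i. x \<le> a i}"
proof -
  from order_tendstoD(2)[OF summable_LIMSEQ_zero[OF assms(1)] assms(2)] obtain k where k: "\<And>i. i \<ge> k \<Longrightarrow> a i < x"
    by (auto simp: eventually_sequentially)
  have "{i. x \<le> a i} \<subseteq> {..<k}"
    using k by (metis (mono_tags, lifting) lessThan_iff linorder_not_less mem_Collect_eq subsetI)
  then show ?thesis by (rule finite_subset) simp
qed

lemma ranked_tendsto_0:
  assumes fin: "\<And>x. 0 < x \<Longrightarrow> finite {i\<in>I. x \<le> m i}"
  shows "ranked I m \<longlonglongrightarrow> 0"
proof (rule order_tendstoI)
  fix a :: real assume "a < 0"
  then show "\<forall>\<^sub>F n in sequentially. a < ranked I m n"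
    using ranked_nonneg[OF fin] by (intro always_eventually allI) (rule less_le_trans)
next
  fix a :: real assume a: "0 < a"
  have "finite {n. a \<le> ranked I m n}" by (simp add: ranked_level_set[OF fin a])
  then show "\<forall>\<^sub>F n in sequentially. ranked I m n < a"
    by (simp add: cofinite_eq_sequentially[symmetric] eventually_cofinite not_less)
qed

text \<open>For x > 0 the event that the entry with index n is at least x is a union over the finite
  index sets with n + 1 elements, of which there are countably many; for x <= 0 it is the whole
  space.\<close>

lemma measurable_ranked:
  assumes m: "\<And>i. i \<in> I \<Longrightarrow> (\<lambda>w. m w i) \<in> borel_measurable M" and I: "countable I"
    and fin: "\<And>w x. w \<in> space M \<Longrightarrow> 0 < x \<Longrightarrow> finite {i\<in>I. x \<le> m w i}"
  shows "(\<lambda>w. ranked I (m w)) \<in> M \<rightarrow>\<^sub>M seq_borel"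
proof (rule measurable_PiM_single')
  fix n :: nat
  show "(\<lambda>w. ranked I (m w) n) \<in> borel_measurable M"
  proof (rule borel_measurableI_ge)
    fix x :: real
    show "{w \<in> space M. x \<le> ranked I (m w) n} \<in> sets M"
    proof (cases "0 < x")
      case False
      have "x \<le> ranked I (m w) n" if "w \<in> space M" for w
        using ranked_nonneg[where n=n, OF fin[OF that]] False by linarith
      then have "{w \<in> space M. x \<le> ranked I (m w) n} = space M" by auto
      then show ?thesis by simp
    next
      case True
      have iff: "x \<le> ranked I (m w) n \<longleftrightarrow> (\<exists>A\<in>{A. A \<subseteq> I \<and> finite A \<and> card A = Suc n}. \<forall>i\<in>A. x \<le> m w i)"
        if "w \<in> space M" for w
      proof -
        have "x \<le> ranked I (m w) n \<longleftrightarrow> Suc n \<le> card {i\<in>I. x \<le> m w i}" by (rule le_ranked_iff[OF fin[OF that] True])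
        also have "\<dots> \<longleftrightarrow> (\<exists>A\<in>{A. A \<subseteq> I \<and> finite A \<and> card A = Suc n}. \<forall>i\<in>A. x \<le> m w i)"
        proof
          assume "Suc n \<le> card {i\<in>I. x \<le> m w i}"
          then obtain A where "A \<subseteq> {i\<in>I. x \<le> m w i}" "card A = Suc n" "finite A" by (rule obtain_subset_with_card_n)
          then show "\<exists>A\<in>{A. A \<subseteq> I \<and> finite A \<and> card A = Suc n}. \<forall>i\<in>A. x \<le> m w i" by auto
        next
          assume "\<exists>A\<in>{A. A \<subseteq> I \<and> finite A \<and> card A = Suc n}. \<forall>i\<in>A. x \<le> m w i"
          then obtain A where A: "A \<subseteq> I" "card A = Suc n" "\<forall>i\<in>A. x \<le> m w i" by auto
          then have "card A \<le> card {i\<in>I. x \<le> m w i}" by (intro card_mono fin that True) auto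
          then show "Suc n \<le> card {i\<in>I. x \<le> m w i}" using A by simp
        qed
        finally show ?thesis .
      qed
      have c: "countable {A. A \<subseteq> I \<and> finite A \<and> card A = Suc n}"
        by (rule countable_subset[OF _ countable_Collect_finite_subset[OF I]]) auto
      have "{w \<in> space M. x \<le> ranked I (m w) n} =
        (\<Union>A\<in>{A. A \<subseteq> I \<and> finite A \<and> card A = Suc n}. {w \<in> space M. \<forall>i\<in>A. x \<le> m w i})" using iff by auto
      also have "\<dots> \<in> sets M"
      proof (rule sets.countable_UN''[OF c])
        fix A assume A: "A \<in> {A. A \<subseteq> I \<and> finite A \<and> card A = Suc n}"
        have "{w \<in> space M. x \<le> m w i} \<in> sets M" if "i \<in> A" for i
          using m[of i] A that by (intro borel_measurable_le) auto
        then show "{w \<in> space M. \<forall>i\<in>A. x \<le> m w i} \<in> sets M" using A by (intro sets.sets_Collect_finite_All) auto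
      qed
      finally show ?thesis .
    qed
  qed
qed auto

section \<open>Laws determined by Laplace transforms\<close>

text \<open>Weierstrass approximation on [0,1] extends the equality from powers to continuous
  functions; continuous functions decreasing to the indicator of \<open>{..x}\<close> then give
  equal distribution functions.\<close>

lemma finite_measure_eqI_moments:
  fixes \<mu> \<nu> :: "real measure"
  assumes "finite_measure \<mu>" "finite_measure \<nu>" and S[measurable_cong]: "sets \<mu> = sets borel" "sets \<nu> = sets borel"
    and AE: "AE x in \<mu>. x \<in> {0..1}" "AE x in \<nu>. x \<in> {0..1}"
    and mom: "\<And>n::nat. (\<integral>x. x ^ n \<partial>\<mu>) = (\<integral>x. x ^ n \<partial>\<nu>)"
  shows "\<mu> = \<nu>"
proof -
  interpret \<mu>: finite_measure \<mu> by fact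
  interpret \<nu>: finite_measure \<nu> by fact
  interpret fb1: finite_borel_measure \<mu>
    by (intro finite_borel_measure.intro finite_borel_measure_axioms.intro) (use assms in auto)
  interpret fb2: finite_borel_measure \<nu>
    by (intro finite_borel_measure.intro finite_borel_measure_axioms.intro) (use assms in auto)
  have pw: "integrable \<mu> (\<lambda>x. x ^ n)" "integrable \<nu> (\<lambda>x. x ^ n)" for n
  proof -
    have "norm (x ^ n) \<le> 1" if "x \<in> {0..1}" for x :: real using that by (simp add: power_le_one)
    then show "integrable \<mu> (\<lambda>x. x ^ n)" "integrable \<nu> (\<lambda>x. x ^ n)"
      by (intro \<mu>.integrable_const_bound[where B=1] eventually_mono[OF AE(1)]; simp add: power_le_one)
         (intro \<nu>.integrable_const_bound[where B=1] eventually_mono[OF AE(2)]; simp add: power_le_one)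
  qed
  have cont_int: "integrable \<mu> g" "integrable \<nu> g" if g: "continuous_on UNIV g" for g :: "real \<Rightarrow> real"
  proof -
    have [measurable]: "g \<in> borel_measurable borel" using g by (rule borel_measurable_continuous_onI)
    have "compact (g ` {0..1})" by (rule compact_continuous_image[OF continuous_on_subset[OF g]]) auto
    then obtain B where B: "\<forall>x\<in>{0..1}. norm (g x) \<le> B" using compact_imp_bounded bounded_iff by (metis image_eqI)
    then show "integrable \<mu> g" "integrable \<nu> g"
      by (intro \<mu>.integrable_const_bound[where B=B] eventually_mono[OF AE(1)]; use B in simp)
         (intro \<nu>.integrable_const_bound[where B=B] eventually_mono[OF AE(2)]; use B in simp)
  qed
  have eq: "(\<integral>x. g x \<partial>\<mu>) = (\<integral>x. g x \<partial>\<nu>)" if g: "continuous_on UNIV g" for g :: "real \<Rightarrow> real"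
  proof -
    have near: "\<bar>(\<integral>x. g x - p x \<partial>M)\<bar> \<le> e * measure M UNIV"
      if "\<forall>x\<in>{0..1}. \<bar>g x - p x\<bar> < e" "finite_measure M" "sets M = sets borel" "AE x in M. x \<in> {0..1}" "integrable M (\<lambda>x. g x - p x)"
      for M e and p :: "real \<Rightarrow> real"
    proof -
      interpret finite_measure M by fact
      have "\<bar>(\<integral>x. g x - p x \<partial>M)\<bar> \<le> (\<integral>x. \<bar>g x - p x\<bar> \<partial>M)" by (rule integral_abs_bound)
      also have "\<dots> \<le> (\<integral>x. e \<partial>M)"
        by (intro integral_mono_AE eventually_mono[OF that(4)]) (use that in \<open>auto intro: less_imp_le\<close>)
      finally show ?thesis using sets_eq_imp_space_eq[OF that(3)] by (simp add: mult.commute)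
    qed
    let ?K = "measure \<mu> UNIV + measure \<nu> UNIV"
    have "\<bar>(\<integral>x. g x \<partial>\<mu>) - (\<integral>x. g x \<partial>\<nu>)\<bar> \<le> e * ?K" if e: "0 < e" for e
    proof -
      obtain p where p: "real_polynomial_function p" "\<forall>x\<in>{0..1}. \<bar>g x - p x\<bar> < e"
        by (rule Stone_Weierstrass_real_polynomial_function[of "{0..1::real}" g e])
           (use continuous_on_subset[OF g] e in auto)
      then obtain a n where pa: "\<And>x. p x = (\<Sum>i\<le>n. a i * x ^ i)"
        by (auto simp: real_polynomial_function_iff_sum)
      have ip: "integrable \<mu> p" "integrable \<nu> p" unfolding pa[abs_def] using pw by auto
      have "(\<integral>x. p x \<partial>\<mu>) = (\<integral>x. p x \<partial>\<nu>)"
        unfolding pa using pw mom by (simp add: Bochner_Integration.integral_sum)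
      then show ?thesis
        using near[OF p(2) assms(1) S(1) AE(1)] near[OF p(2) assms(2) S(2) AE(2)] ip cont_int[OF g]
        by (simp add: algebra_simps)
    qed
    then have "\<forall>\<^sub>F e in at_right 0. \<bar>(\<integral>x. g x \<partial>\<mu>) - (\<integral>x. g x \<partial>\<nu>)\<bar> \<le> e * ?K"
      by (rule eventually_mono[OF eventually_at_right_less])
    from tendsto_lowerbound[OF tendsto_mult_left_zero[OF tendsto_ident_at] this]
    have "\<bar>(\<integral>x. g x \<partial>\<mu>) - (\<integral>x. g x \<partial>\<nu>)\<bar> \<le> 0" by simp
    then show ?thesis by simp
  qed
  have "cdf \<mu> x = cdf \<nu> x" for x
  proof -
    define g where "g n y = (1 / (1 + max 0 (y - x))) ^ n" for n :: nat and y :: real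
    have g: "continuous_on UNIV (g n)" for n unfolding g_def by (intro continuous_intros) (simp add: add_nonneg_eq_0_iff)
    have [measurable]: "g n \<in> borel_measurable borel" for n using g by (rule borel_measurable_continuous_onI)
    have lim: "(\<lambda>n. g n y) \<longlonglongrightarrow> indicator {..x} y" for y
    proof (cases "y \<le> x")
      case False
      then show ?thesis unfolding g_def by (auto intro!: LIMSEQ_power_zero)
    qed (simp add: g_def)
    have g1: "norm (g n y) \<le> 1" for n y by (simp add: g_def power_le_one)
    have "(\<lambda>n. \<integral>y. g n y \<partial>\<mu>) \<longlonglongrightarrow> (\<integral>y. indicator {..x} y \<partial>\<mu>)"
      by (rule integral_dominated_convergence[where w="\<lambda>_. 1"]) (auto simp: lim g1[simplified])
    moreover have "(\<lambda>n. \<integral>y. g n y \<partial>\<nu>) \<longlonglongrightarrow> (\<integral>y. indicator {..x} y \<partial>\<nu>)"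
      by (rule integral_dominated_convergence[where w="\<lambda>_. 1"]) (auto simp: lim g1[simplified])
    ultimately have "(\<integral>y. indicator {..x} y \<partial>\<mu>) = (\<integral>y. indicator {..x} y \<partial>\<nu> :: real)"
      unfolding eq[OF g] by (rule LIMSEQ_unique)
    then show ?thesis by (simp add: cdf_def)
  qed
  then show ?thesis by (intro cdf_unique' fb1.finite_borel_measure_axioms fb2.finite_borel_measure_axioms ext)
qed

text \<open>The map exp(-x) sends both measures to [0,1] and turns Laplace transforms at the
  integers into moments, so integer arguments suffice.\<close>

lemma finite_measure_eqI_laplace:
  fixes \<mu> \<nu> :: "real measure"
  assumes "finite_measure \<mu>" "finite_measure \<nu>" and S[measurable_cong]: "sets \<mu> = sets borel" "sets \<nu> = sets borel"
    and AE: "AE x in \<mu>. 0 \<le> x" "AE x in \<nu>. 0 \<le> x"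
    and eq: "\<And>n::nat. (\<integral>\<^sup>+x. ennreal (exp (- (real n * x))) \<partial>\<mu>) = (\<integral>\<^sup>+x. ennreal (exp (- (real n * x))) \<partial>\<nu>)"
  shows "\<mu> = \<nu>"
proof -
  let ?e = "\<lambda>x::real. exp (- x)"
  have "distr \<mu> borel ?e = distr \<nu> borel ?e"
  proof (rule finite_measure_eqI_moments)
    have pos: "exp (- x) ^ n = exp (- (real n * x))" for n :: nat and x :: real
      by (simp add: exp_of_nat_mult[symmetric])
    fix n :: nat
    show "(\<integral>x. x ^ n \<partial>distr \<mu> borel ?e) = (\<integral>x. x ^ n \<partial>distr \<nu> borel ?e)"
      using eq[of n] by (simp add: integral_distr pos integral_eq_nn_integral)
  qed (use AE in \<open>auto simp: AE_distr_iff intro: finite_measure.finite_measure_distr assms\<close>)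
  then have "distr (distr \<mu> borel ?e) borel (\<lambda>x. - ln x) = distr (distr \<nu> borel ?e) borel (\<lambda>x. - ln x)" by simp
  then have "distr \<mu> borel (\<lambda>x. x) = distr \<nu> borel (\<lambda>x. x)" by (simp add: distr_distr comp_def)
  then show ?thesis using S by (simp add: distr_id2)
qed

text \<open>The weight \<open>D\<close> collects the factors of all other coordinates; since it is
  at most 1, the weighted law of the remaining coordinate is a finite measure to which
  one-dimensional uniqueness applies.\<close>

lemma weighted_law:
  assumes "finite_measure M" and [measurable]: "D \<in> borel_measurable M" "Y \<in> borel_measurable M"
    and D: "AE w in M. D w \<le> (1::ennreal)" and Y: "AE w in M. 0 \<le> (Y w :: real)"
  defines "\<mu> \<equiv> distr (density M D) borel Y"
  shows "finite_measure \<mu>" "AE x in \<mu>. 0 \<le> x"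
    "g \<in> borel_measurable borel \<Longrightarrow> (\<integral>\<^sup>+x. g x \<partial>\<mu>) = (\<integral>\<^sup>+w. D w * g (Y w) \<partial>M)"
proof -
  interpret finite_measure M by fact
  have "(\<integral>\<^sup>+w. D w \<partial>M) \<le> (\<integral>\<^sup>+w. 1 \<partial>M)" using D by (intro nn_integral_mono_AE)
  also have "\<dots> < \<top>" using emeasure_finite[of "space M"] by (simp add: less_top[symmetric])
  finally have "emeasure (density M D) (space M) \<noteq> \<top>"
    by (simp add: emeasure_density nn_integral_cong[of M "\<lambda>x. D x * indicator (space M) x" D])
  then show "finite_measure \<mu>" unfolding \<mu>_def by (intro finite_measure.finite_measure_distr finite_measureI) auto
  show "AE x in \<mu>. 0 \<le> x" unfolding \<mu>_def using Y by (auto simp: AE_distr_iff AE_density)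
  show "(\<integral>\<^sup>+x. g x \<partial>\<mu>) = (\<integral>\<^sup>+w. D w * g (Y w) \<partial>M)" if "g \<in> borel_measurable borel"
    using that unfolding \<mu>_def by (simp add: nn_integral_distr nn_integral_density)
qed

text \<open>The coordinates are treated one at a time: after \<open>k\<close> steps, the first \<open>k\<close> Laplace factors have
  been replaced by indicators.\<close>

lemma emeasure_eq_laplace:
  fixes Y :: "nat \<Rightarrow> 'a \<Rightarrow> real" and Z :: "nat \<Rightarrow> 'b \<Rightarrow> real"
  assumes fin: "finite_measure M1" "finite_measure M2"
    and meas: "\<And>i. i < n \<Longrightarrow> Y i \<in> borel_measurable M1" "\<And>i. i < n \<Longrightarrow> Z i \<in> borel_measurable M2"
    and pos: "\<And>i. i < n \<Longrightarrow> AE w in M1. 0 \<le> Y i w" "\<And>i. i < n \<Longrightarrow> AE w in M2. 0 \<le> Z i w"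
    and eq: "\<And>l. (\<And>i. 0 \<le> l i) \<Longrightarrow> (\<integral>\<^sup>+w. ennreal (exp (- (\<Sum>i<n. l i * Y i w))) \<partial>M1) = (\<integral>\<^sup>+w. ennreal (exp (- (\<Sum>i<n. l i * Z i w))) \<partial>M2)"
    and A: "\<And>i. i < n \<Longrightarrow> A i \<in> sets borel"
  shows "emeasure M1 {w\<in>space M1. \<forall>i<n. Y i w \<in> A i} = emeasure M2 {w\<in>space M2. \<forall>i<n. Z i w \<in> A i}"
proof -
  define F where "F k l y = (\<Prod>i<k. indicator (A i) (y i)) * ennreal (exp (- (\<Sum>i\<in>{k..<n}. l i * y i)))"
    for k and l y :: "nat \<Rightarrow> real"
  \<comment> \<open>\<open>D k\<close> omits the factor of coordinate k. Multiplied by an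
    exponential in that coordinate it is \<open>F k\<close>, multiplied by an indicator it is
    \<open>F (Suc k)\<close>.\<close>
  define D where "D k l y = (\<Prod>i<k. indicator (A i) (y i)) * ennreal (exp (- (\<Sum>i\<in>{Suc k..<n}. l i * y i)))"
    for k and l y :: "nat \<Rightarrow> real"
  have D_meas: "(\<lambda>w. D k l (\<lambda>i. W i w)) \<in> borel_measurable M" 
    if "k < n" "\<And>i. i < n \<Longrightarrow> W i \<in> borel_measurable M" for k l M and W :: "nat \<Rightarrow> 'z \<Rightarrow> real"
  proof -
    have [measurable]: "(\<lambda>w. indicator (A i) (W i w) :: ennreal) \<in> borel_measurable M" if "i < n" for i
      using A[OF that] that \<open>\<And>i. i < n \<Longrightarrow> W i \<in> borel_measurable M\<close> by measurable
    have [measurable]: "(\<lambda>w. \<Sum>i\<in>{Suc k..<n}. l i * W i w) \<in> borel_measurable M"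
      using that by (intro borel_measurable_sum borel_measurable_times) auto
    have [measurable]: "(\<lambda>w. \<Prod>i<k. indicator (A i) (W i w) :: ennreal) \<in> borel_measurable M"
      using that(1) by (intro borel_measurable_prod_ennreal) auto
    show ?thesis unfolding D_def by measurable
  qed
  have D_le: "AE w in M. D k l (\<lambda>i. W i w) \<le> 1"
    if "\<And>i. 0 \<le> l i" "\<And>i. i < n \<Longrightarrow> AE w in M. 0 \<le> W i w" for k l M and W :: "nat \<Rightarrow> 'z \<Rightarrow> real"
  proof -
    have "AE w in M. \<forall>i\<in>{..<n}. 0 \<le> W i w" using that(2) by (intro AE_finite_allI) auto
    then show ?thesis
    proof eventually_elim
      case (elim w)
      have "(\<Prod>i<k. indicator (A i) (W i w)) \<le> (1::ennreal)" by (rule prod_le_1) (auto split: split_indicator)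
      moreover have "0 \<le> (\<Sum>i\<in>{Suc k..<n}. l i * W i w)" using elim that(1) by (intro sum_nonneg mult_nonneg_nonneg) auto
      ultimately show ?case unfolding D_def using mult_mono[of "\<Prod>i<k. indicator (A i) (W i w)" 1 _ "1::ennreal"] by simp
    qed
  qed
  have F_split: "F k (l(k := t)) y = D k l y * ennreal (exp (- (t * y k)))" if "k < n" for k l t y
  proof -
    have split: "{k..<n} = insert k {Suc k..<n}" using that by auto
    have "(\<Sum>i\<in>{Suc k..<n}. (l(k := t)) i * y i) = (\<Sum>i\<in>{Suc k..<n}. l i * y i)" by (intro sum.cong) auto
    then show ?thesis
      unfolding F_def D_def split by (simp add: exp_add exp_diff ennreal_mult mult_ac exp_minus divide_inverse)
  qed
  have F_Suc: "F (Suc k) l y = D k l y * indicator (A k) (y k)" for k l y by (simp add: F_def D_def mult_ac)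
  have main: "(\<integral>\<^sup>+w. F k l (\<lambda>i. Y i w) \<partial>M1) = (\<integral>\<^sup>+w. F k l (\<lambda>i. Z i w) \<partial>M2)" if "k \<le> n" "\<And>i. 0 \<le> l i" for k l using that
  proof (induction k arbitrary: l)
    case 0
    then show ?case using eq[of l] by (simp add: F_def atLeast0LessThan)
  next
    case (Suc k)
    then have k: "k < n" by simp
    let ?\<mu> = "distr (density M1 (\<lambda>w. D k l (\<lambda>i. Y i w))) borel (Y k)"
    let ?\<nu> = "distr (density M2 (\<lambda>w. D k l (\<lambda>i. Z i w))) borel (Z k)"
    note w1 = weighted_law[OF fin(1) D_meas[OF k meas(1)] meas(1)[OF k] D_le[OF Suc.prems(2) pos(1)] pos(1)[OF k]]
    note w2 = weighted_law[OF fin(2) D_meas[OF k meas(2)] meas(2)[OF k] D_le[OF Suc.prems(2) pos(2)] pos(2)[OF k]]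
    have "?\<mu> = ?\<nu>"
    proof (rule finite_measure_eqI_laplace)
      fix t :: nat
      show "(\<integral>\<^sup>+x. ennreal (exp (- (real t * x))) \<partial>?\<mu>) = (\<integral>\<^sup>+x. ennreal (exp (- (real t * x))) \<partial>?\<nu>)"
      proof -
        \<comment> \<open>The induction hypothesis holds for all parameters, hence the k-th one can
          run through the integers while the others stay fixed.\<close>
        have "(\<integral>\<^sup>+w. F k (l(k := real t)) (\<lambda>i. Y i w) \<partial>M1) = (\<integral>\<^sup>+w. F k (l(k := real t)) (\<lambda>i. Z i w) \<partial>M2)"
          by (rule Suc.IH) (use Suc.prems in auto)
        then show ?thesis unfolding F_split[OF k] by (simp add: w1 w2)
      qed
    qed (use w1 w2 in simp_all)
    have mm: "indicator (A k) \<in> borel_measurable borel" using A[OF k] by simp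
    have "(\<integral>\<^sup>+w. F (Suc k) l (\<lambda>i. Y i w) \<partial>M1) = (\<integral>\<^sup>+x. indicator (A k) x \<partial>?\<mu>)"
      unfolding F_Suc by (rule w1(3)[symmetric]) (use mm in simp_all)
    also have "\<dots> = (\<integral>\<^sup>+w. F (Suc k) l (\<lambda>i. Z i w) \<partial>M2)" unfolding F_Suc \<open>?\<mu> = ?\<nu>\<close> by (rule w2(3)) (use mm in simp_all)
    finally show ?case .
  qed
  have ind: "emeasure M {w\<in>space M. \<forall>i<n. W i w \<in> A i} = (\<integral>\<^sup>+w. F n (\<lambda>_. 0) (\<lambda>i. W i w) \<partial>M)"
    if W: "\<And>i. i < n \<Longrightarrow> W i \<in> borel_measurable M" for M and W :: "nat \<Rightarrow> 'z \<Rightarrow> real"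
  proof -
    let ?S = "{w\<in>space M. \<forall>i<n. W i w \<in> A i}"
    have "{w\<in>space M. \<forall>i\<in>{..<n}. W i w \<in> A i} \<in> sets M" using W A by (intro sets.sets_Collect_finite_All) auto
    also have "{w\<in>space M. \<forall>i\<in>{..<n}. W i w \<in> A i} = ?S" by blast
    finally have s: "?S \<in> sets M" .
    have "emeasure M ?S = (\<integral>\<^sup>+w. indicator ?S w \<partial>M)" by (rule nn_integral_indicator[OF s, symmetric])
    also have "\<dots> = (\<integral>\<^sup>+w. F n (\<lambda>_. 0) (\<lambda>i. W i w) \<partial>M)"
    proof (rule nn_integral_cong)
      fix w assume "w \<in> space M"
      then show "indicator ?S w = F n (\<lambda>_. 0) (\<lambda>i. W i w)"
      proof (cases "\<forall>i<n. W i w \<in> A i")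
        case False
        then obtain i where "i < n" "W i w \<notin> A i" by blast
        then have "(\<Prod>i<n. indicator (A i) (W i w)) = (0::ennreal)" by (intro prod_zero bexI[of _ i]) auto
        with False show ?thesis by (simp add: F_def)
      qed (simp add: F_def)
    qed
    finally show ?thesis .
  qed
  have "emeasure M1 {w\<in>space M1. \<forall>i<n. Y i w \<in> A i} = (\<integral>\<^sup>+w. F n (\<lambda>_. 0) (\<lambda>i. Y i w) \<partial>M1)" by (rule ind[OF meas(1)])
  also have "\<dots> = (\<integral>\<^sup>+w. F n (\<lambda>_. 0) (\<lambda>i. Z i w) \<partial>M2)" by (rule main) auto
  also have "\<dots> = emeasure M2 {w\<in>space M2. \<forall>i<n. Z i w \<in> A i}" by (rule ind[OF meas(2), symmetric])
  finally show ?thesis .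
qed

lemma seq_law_eqI_laplace:
  fixes Y :: "nat \<Rightarrow> 'a \<Rightarrow> real" and Z :: "nat \<Rightarrow> 'b \<Rightarrow> real"
  assumes fin: "prob_space M1" "prob_space M2"
    and [measurable]: "\<And>i. Y i \<in> borel_measurable M1" "\<And>i. Z i \<in> borel_measurable M2"
    and pos: "\<And>i. AE w in M1. 0 \<le> Y i w" "\<And>i. AE w in M2. 0 \<le> Z i w"
    and eq: "\<And>l n. (\<And>i. 0 \<le> l i) \<Longrightarrow> (\<integral>\<^sup>+w. ennreal (exp (- (\<Sum>i<n. l i * Y i w))) \<partial>M1) = (\<integral>\<^sup>+w. ennreal (exp (- (\<Sum>i<n. l i * Z i w))) \<partial>M2)"
  shows "distr M1 seq_borel (\<lambda>w i. Y i w) = distr M2 seq_borel (\<lambda>w i. Z i w)"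
proof (rule measure_eqI_PiM_infinite)
  interpret M1: prob_space M1 by fact
  interpret M2: prob_space M2 by fact
  have m[measurable]: "(\<lambda>w i. Y i w) \<in> M1 \<rightarrow>\<^sub>M seq_borel" "(\<lambda>w i. Z i w) \<in> M2 \<rightarrow>\<^sub>M seq_borel"
    by (auto intro!: measurable_PiM_single')
  show "finite_measure (distr M1 seq_borel (\<lambda>w i. Y i w))"
    by (intro finite_measure.finite_measure_distr M1.finite_measure_axioms m)
  fix A :: "nat \<Rightarrow> real set" and J :: "nat set"
  assume J: "finite J" "J \<subseteq> UNIV" and A: "\<And>i. i \<in> J \<Longrightarrow> A i \<in> sets borel"
  obtain n where n: "J \<subseteq> {..<n}" using J(1) finite_nat_bounded by blast
  \<comment> \<open>Padding with the whole line replaces the cylinder over \<open>J\<close> by one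
    over an initial segment.\<close>
  define A' where "A' i = (if i \<in> J then A i else UNIV)" for i
  have emb: "prod_emb UNIV (\<lambda>_. borel) J (Pi\<^sub>E J A) = {v. \<forall>i<n. v i \<in> A' i}"
    using n by (auto simp: prod_emb_def A'_def space_PiM PiE_iff subset_eq extensional_def)
  have s: "{v::nat\<Rightarrow>real. \<forall>i<n. v i \<in> A' i} \<in> sets seq_borel"
    unfolding emb[symmetric] using J A by (intro sets_PiM_I) auto
  have "emeasure M1 {w\<in>space M1. \<forall>i<n. Y i w \<in> A' i} = emeasure M2 {w\<in>space M2. \<forall>i<n. Z i w \<in> A' i}"
    by (rule emeasure_eq_laplace)
       (use pos eq A in \<open>auto simp: A'_def M1.finite_measure_axioms M2.finite_measure_axioms\<close>)
  then show "emeasure (distr M1 seq_borel (\<lambda>w i. Y i w)) (prod_emb UNIV (\<lambda>_. borel) J (Pi\<^sub>E J A)) =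
    emeasure (distr M2 seq_borel (\<lambda>w i. Z i w)) (prod_emb UNIV (\<lambda>_. borel) J (Pi\<^sub>E J A))"
    unfolding emb using s by (simp add: emeasure_distr vimage_def Int_def conj_commute)
qed simp_all

lemma suminf_indicator_card:
  assumes "finite {i::nat. P i}"
  shows "(\<Sum>i. indicator {i. P i} i :: ennreal) = of_nat (card {i. P i})"
proof -
  have "(\<Sum>i. indicator {i. P i} i :: ennreal) = (\<integral>\<^sup>+i. indicator {i. P i} i \<partial>count_space UNIV)"
    by (simp only: nn_integral_count_space_nat)
  also have "\<dots> = emeasure (count_space UNIV) {i. P i}" by (rule nn_integral_indicator) simp
  finally show ?thesis using assms by (simp add: emeasure_count_space_finite)
qed

text \<open>Thresholds for counting. The range is the set of positive rationals, the value 1 being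
  repeated for the codes of the others, since counts above a threshold are finite only if the
  threshold is positive.\<close>

definition pos_rat_seq :: "nat \<Rightarrow> real" where
  "pos_rat_seq k = (if 0 < (from_nat k :: rat) then of_rat (from_nat k) else 1)"

lemma pos_rat_seq_pos: "0 < pos_rat_seq k" by (simp add: pos_rat_seq_def)

lemma pos_rat_seq_dense:
  assumes "0 \<le> a" "a < b"
  obtains k where "a < pos_rat_seq k" "pos_rat_seq k < b"
proof -
  obtain r :: rat where r: "a < of_rat r" "of_rat r < b" using of_rat_dense[OF assms(2)] by auto
  then have "0 < (of_rat r :: real)" using assms by linarith
  then have "pos_rat_seq (to_nat r) = of_rat r" by (simp add: pos_rat_seq_def)
  then show ?thesis using that r by metis
qed

text \<open>A decreasing null sequence is a measurable function of its counts on the half-lines with rational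
  end points, and the Laplace transforms of those counts are instances of the hypothesis.\<close>

lemma ranked_law_eqI:
  fixes A :: "'a \<Rightarrow> nat \<Rightarrow> real" and B :: "'b \<Rightarrow> nat \<Rightarrow> real"
  assumes M: "prob_space M1" "prob_space M2"
    and [measurable]: "A \<in> M1 \<rightarrow>\<^sub>M seq_borel" "B \<in> M2 \<rightarrow>\<^sub>M seq_borel"
    and dec: "AE w in M1. decseq (A w) \<and> A w \<longlonglongrightarrow> 0" "AE w in M2. decseq (B w) \<and> B w \<longlonglongrightarrow> 0"
    and eq: "\<And>\<phi> e. \<phi> \<in> borel_measurable borel \<Longrightarrow> 0 < e \<Longrightarrow> (\<And>x. x < e \<Longrightarrow> \<phi> x = 0) \<Longrightarrow>
      (\<integral>\<^sup>+w. nexp (\<Sum>i. \<phi> (A w i)) \<partial>M1) = (\<integral>\<^sup>+w. nexp (\<Sum>i. \<phi> (B w i)) \<partial>M2)"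
  shows "distr M1 seq_borel A = distr M2 seq_borel B"
proof -
  let ?q = pos_rat_seq
  define N where "N k a = enn2real (\<Sum>i. indicator {?q k..} (a i))" for k and a :: "nat \<Rightarrow> real"
  \<comment> \<open>Inverse of the map to counts: the entry with index n is the supremum of the
    thresholds reached by at least n + 1 entries.\<close>
  define G where "G v n = enn2real (SUP k. if real (Suc n) \<le> v k then ennreal (?q k) else 0)"
    for v :: "nat \<Rightarrow> real" and n :: nat
  have N_meas[measurable]: "N k \<in> borel_measurable seq_borel" for k unfolding N_def by measurable
  have G_meas[measurable]: "G \<in> seq_borel \<rightarrow>\<^sub>M seq_borel"
  proof (rule measurable_PiM_single')
    show "(\<lambda>v. G v n) \<in> borel_measurable seq_borel" for n unfolding G_def by measurable
  qed auto
  have cnt: "(\<Sum>i. indicator {?q k..} (a i) :: ennreal) = of_nat (card {i. ?q k \<le> a i})" "N k a = card {i. ?q k \<le> a i}"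
    if "decseq a \<and> a \<longlonglongrightarrow> 0" for a :: "nat \<Rightarrow> real" and k
  proof -
    have "(\<Sum>i. indicator {?q k..} (a i) :: ennreal) = (\<Sum>i. indicator {i. ?q k \<le> a i} i :: ennreal)"
      by (intro suminf_cong) (auto split: split_indicator)
    also have "\<dots> = of_nat (card {i. ?q k \<le> a i})"
      by (rule suminf_indicator_card) (use that decseq_level_set(1)[OF _ _ pos_rat_seq_pos] in auto)
    finally show *: "(\<Sum>i. indicator {?q k..} (a i) :: ennreal) = of_nat (card {i. ?q k \<le> a i})" .
    show "N k a = card {i. ?q k \<le> a i}" unfolding N_def * by simp
  qed
  have G_N: "G (\<lambda>k. N k a) = a" if a: "decseq a \<and> a \<longlonglongrightarrow> 0" for a
  proof
    fix n
    let ?s = "SUP k. if ?q k \<le> a n then ennreal (?q k) else 0"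
    have iff: "real (Suc n) \<le> N k a \<longleftrightarrow> ?q k \<le> a n" for k
      using decseq_level_set(2)[of a "?q k" n] a pos_rat_seq_pos[of k] by (simp only: cnt[OF a] of_nat_le_iff)
    have a0: "0 \<le> a n" using decseq_ge[of a 0 n] a by simp
    have "?s = ennreal (a n)"
    proof (rule antisym)
      show "?s \<le> ennreal (a n)" by (rule SUP_least) (auto intro: ennreal_leI)
      show "ennreal (a n) \<le> ?s"
      proof (rule ccontr)
        assume "\<not> ?thesis"
        then have less: "?s < ennreal (a n)" by simp
        define S where "S = ?s"
        have less': "S < ennreal (a n)" using less unfolding S_def .
        then obtain s where s: "0 \<le> s" "S = ennreal s" by (cases S rule: ennreal_cases) auto
        with less' have "s < a n" by (simp add: ennreal_less_iff)
        then obtain k where k: "s < ?q k" "?q k < a n" using pos_rat_seq_dense s(1) by blast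
        have "ennreal (?q k) \<le> S" unfolding S_def by (rule SUP_upper2[of k]) (use k in auto)
        with s k show False by simp
      qed
    qed
    then show "G (\<lambda>k. N k a) n = a n" unfolding G_def iff using a0 by simp
  qed
  have laplace: "ennreal (exp (- (\<Sum>k<n. l k * N k a))) = nexp (\<Sum>i. \<Sum>k<n. ennreal (l k) * indicator {?q k..} (a i))"
    if l: "\<And>k. 0 \<le> l k" and a: "decseq a \<and> a \<longlonglongrightarrow> 0" for l a and n :: nat
  proof -
    have "(\<Sum>i. \<Sum>k<n. ennreal (l k) * indicator {?q k..} (a i)) = (\<Sum>k<n. \<Sum>i. ennreal (l k) * indicator {?q k..} (a i))"
      by (intro suminf_sum) auto
    also have "\<dots> = (\<Sum>k<n. ennreal (l k * N k a))"
      using l by (intro sum.cong refl) (simp add: cnt[OF a] ennreal_mult ennreal_of_nat_eq_real_of_nat)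
    also have "\<dots> = ennreal (\<Sum>k<n. l k * N k a)" using l by (intro sum_ennreal) (simp add: cnt[OF a])
    finally show ?thesis using l by (simp add: nexp_ennreal sum_nonneg cnt[OF a])
  qed
  have law_N: "distr M1 seq_borel (\<lambda>w k. N k (A w)) = distr M2 seq_borel (\<lambda>w k. N k (B w))"
  proof (rule seq_law_eqI_laplace[OF M])
    fix l :: "nat \<Rightarrow> real" and n :: nat assume l: "\<And>k. 0 \<le> l k"
    define \<phi> where "\<phi> x = (\<Sum>k<n. ennreal (l k) * indicator {?q k..} x)" for x
    \<comment> \<open>\<open>e\<close> is a positive lower bound of the thresholds in use, so \<phi>
      vanishes below it; the inserted 1 covers n = 0.\<close>
    define e where "e = Min (insert 1 (?q ` {..<n}))"
    have "e \<le> ?q k" if "k < n" for k unfolding e_def using that by (intro Min_le) auto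
    then have \<phi>0: "\<phi> x = 0" if "x < e" for x
      using that unfolding \<phi>_def by (intro sum.neutral) (force split: split_indicator)
    have "0 < e" unfolding e_def using pos_rat_seq_pos by (subst Min_gr_iff) auto
    have "(\<integral>\<^sup>+w. ennreal (exp (- (\<Sum>k<n. l k * N k (A w)))) \<partial>M1) = (\<integral>\<^sup>+w. nexp (\<Sum>i. \<phi> (A w i)) \<partial>M1)"
      using dec(1) by (intro nn_integral_cong_AE) (auto simp: laplace[OF l] \<phi>_def)
    also have "\<dots> = (\<integral>\<^sup>+w. nexp (\<Sum>i. \<phi> (B w i)) \<partial>M2)" by (rule eq[OF _ \<open>0 < e\<close> \<phi>0]) (unfold \<phi>_def[abs_def], measurable)
    also have "\<dots> = (\<integral>\<^sup>+w. ennreal (exp (- (\<Sum>k<n. l k * N k (B w)))) \<partial>M2)"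
      using dec(2) by (intro nn_integral_cong_AE) (auto simp: laplace[OF l] \<phi>_def)
    finally show "(\<integral>\<^sup>+w. ennreal (exp (- (\<Sum>k<n. l k * N k (A w)))) \<partial>M1)
      = (\<integral>\<^sup>+w. ennreal (exp (- (\<Sum>k<n. l k * N k (B w)))) \<partial>M2)" .
  qed (auto simp: N_def)
  have Nm: "(\<lambda>a k. N k a) \<in> seq_borel \<rightarrow>\<^sub>M seq_borel" by (rule measurable_PiM_single') auto
  have "distr M1 seq_borel A = distr M1 seq_borel (\<lambda>w. G (\<lambda>k. N k (A w)))"
    using dec(1) by (intro distr_cong_AE) (auto simp: G_N intro!: measurable_compose[OF _ G_meas] measurable_compose[OF _ Nm])
  also have "\<dots> = distr (distr M1 seq_borel (\<lambda>w k. N k (A w))) seq_borel G"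
    by (subst distr_distr) (auto simp: comp_def intro!: measurable_compose[OF _ Nm])
  also have "\<dots> = distr (distr M2 seq_borel (\<lambda>w k. N k (B w))) seq_borel G" unfolding law_N ..
  also have "\<dots> = distr M2 seq_borel (\<lambda>w. G (\<lambda>k. N k (B w)))"
    by (subst distr_distr) (auto simp: comp_def intro!: measurable_compose[OF _ Nm])
  also have "\<dots> = distr M2 seq_borel B"
    using dec(2) by (intro distr_cong_AE) (auto simp: G_N intro!: measurable_compose[OF _ G_meas] measurable_compose[OF _ Nm])
  finally show ?thesis .
qed

section \<open>Ranked points of a stable Poisson process\<close>

lemma emeasure_stable_intensity_Ici:
  assumes "0 < \<gamma>" "\<gamma> < 1" "0 < e"
  shows "emeasure (stable_intensity \<gamma>) {e..} = ennreal (e powr (- \<gamma>) / Gamma (1 - \<gamma>))"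
proof -
  have G: "0 < Gamma (1 - \<gamma>)" using assms by (intro Gamma_real_pos) simp
  have "emeasure (stable_intensity \<gamma>) {e..} = (\<integral>\<^sup>+x\<in>{e..}. ennreal (\<gamma> / Gamma (1 - \<gamma>) * x powr (- \<gamma> - 1)) \<partial>lborel)"
    unfolding stable_intensity_def using assms
    by (subst emeasure_density) (auto intro!: nn_integral_cong split: split_indicator)
  also have "\<dots> = ennreal (0 - (- (e powr (- \<gamma>) / Gamma (1 - \<gamma>))))"
  proof (rule nn_integral_FTC_atLeast)
    fix x assume "e \<le> x"
    then show "((\<lambda>x. - (x powr (- \<gamma>) / Gamma (1 - \<gamma>))) has_real_derivative \<gamma> / Gamma (1 - \<gamma>) * x powr (- \<gamma> - 1)) (at x)"
      using assms less_imp_neq[OF G] by (auto intro!: derivative_eq_intros simp: field_simps)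
    show "0 \<le> \<gamma> / Gamma (1 - \<gamma>) * x powr (- \<gamma> - 1)" using assms G by auto
  next
    have "((\<lambda>x. x powr (- \<gamma>)) \<longlongrightarrow> 0) at_top" using assms by (intro tendsto_neg_powr filterlim_ident) auto
    then have "((\<lambda>x. - (x powr (- \<gamma>) / Gamma (1 - \<gamma>))) \<longlongrightarrow> - (0 / Gamma (1 - \<gamma>))) at_top"
      using G by (intro tendsto_intros) auto
    then show "((\<lambda>x. - (x powr (- \<gamma>) / Gamma (1 - \<gamma>))) \<longlongrightarrow> 0) at_top" by simp
  qed measurable
  finally show ?thesis by simp
qed

lemma sets_stable_intensity [measurable_cong, simp]: "sets (stable_intensity \<gamma>) = sets borel"
  by (simp add: stable_intensity_def)

lemma space_stable_intensity [simp]: "space (stable_intensity \<gamma>) = UNIV" by (simp add: stable_intensity_def)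

lemma AE_stable_intensity_pos: "AE x in stable_intensity \<gamma>. 0 < x"
  unfolding stable_intensity_def by (subst AE_density) (auto split: split_indicator)

lemma (in prob_space) nn_integral_poisson_count:
  fixes N :: "'a \<Rightarrow> nat"
  assumes [measurable]: "N \<in> M \<rightarrow>\<^sub>M count_space UNIV" and m: "0 \<le> m" and c: "0 \<le> c"
    and pois: "\<And>k. measure M {w\<in>space M. N w = k} = m ^ k / fact k * exp (- m)"
  shows "(\<integral>\<^sup>+w. ennreal (exp (- c * real (N w))) \<partial>M) = ennreal (exp (- ((1 - exp (- c)) * m)))"
proof -
  have "(\<integral>\<^sup>+w. ennreal (exp (- c * real (N w))) \<partial>M) = (\<integral>\<^sup>+w. (\<Sum>k. ennreal (exp (- c * real k)) * indicator {w\<in>space M. N w = k} w) \<partial>M)"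
  proof (intro nn_integral_cong)
    fix w assume "w \<in> space M"
    then have "(\<Sum>k. ennreal (exp (- c * real k)) * indicator {w\<in>space M. N w = k} w) = (\<Sum>k\<in>{N w}. ennreal (exp (- c * real k)) * indicator {w\<in>space M. N w = k} w)"
      by (intro suminf_finite) (auto split: split_indicator)
    then show "ennreal (exp (- c * real (N w))) = (\<Sum>k. ennreal (exp (- c * real k)) * indicator {w\<in>space M. N w = k} w)"
      using \<open>w \<in> space M\<close> by simp
  qed
  also have "\<dots> = (\<Sum>k. \<integral>\<^sup>+w\<in>{w\<in>space M. N w = k}. ennreal (exp (- c * real k)) \<partial>M)"
    by (intro nn_integral_suminf) measurable
  also have "\<dots> = (\<Sum>k. ennreal (exp (- c * real k)) * emeasure M {w\<in>space M. N w = k})"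
    by (intro suminf_cong nn_integral_cmult_indicator) measurable
  also have "\<dots> = (\<Sum>k. ennreal (exp (- m) * ((exp (- c) * m) ^ k /\<^sub>R fact k)))" using m by (intro suminf_cong)
       (simp add: emeasure_eq_measure pois ennreal_mult[symmetric] power_mult_distrib exp_of_nat_mult[symmetric] field_simps)
  also have "\<dots> = ennreal (exp (- m) * exp (exp (- c) * m))"
    using m by (intro suminf_ennreal_eq sums_mult exp_converges) auto
  also have "exp (- m) * exp (exp (- c) * m) = exp (- ((1 - exp (- c)) * m))"
    by (simp add: exp_add[symmetric] algebra_simps)
  finally show ?thesis .
qed

lemma one_minus_nexp: "0 \<le> c \<Longrightarrow> 1 - nexp (ennreal c) = ennreal (1 - exp (- c))"
  using ennreal_minus[of "exp (- c)" 1] by (simp add: nexp_ennreal)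

locale stable_points =
  fixes \<gamma> :: real and W :: "'w measure" and J :: "nat \<Rightarrow> 'w \<Rightarrow> real"
  assumes \<gamma>: "0 < \<gamma>" "\<gamma> < 1" and points: "ranked_poisson_points W (stable_intensity \<gamma>) J"

sublocale stable_points \<subseteq> prob_space W using points by (simp add: ranked_poisson_points_def)

context stable_points
begin

abbreviation \<nu> :: "real measure" where "\<nu> \<equiv> stable_intensity \<gamma>"

lemma J_meas [measurable]: "J i \<in> borel_measurable W" using points by (simp add: ranked_poisson_points_def)

lemma AE_J: "AE w in W. \<forall>i. 0 < J i w \<and> J (Suc i) w < J i w" using points by (simp add: ranked_poisson_points_def)

lemma finite_count: "A \<in> sets borel \<Longrightarrow> emeasure \<nu> A < \<infinity> \<Longrightarrow> AE w in W. finite {i. J i w \<in> A}"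
  using points by (simp add: ranked_poisson_points_def)

lemma count_law:
  assumes "A \<in> sets borel" "emeasure \<nu> A < \<infinity>"
  shows "measure W {w\<in>space W. card {i. J i w \<in> A} = k} = measure \<nu> A ^ k / fact k * exp (- measure \<nu> A)"
proof -
  from points have "\<forall>A\<in>sets borel. emeasure \<nu> A < \<infinity> \<longrightarrow> (AE w in W. finite {i. J i w \<in> A}) \<and>
      (\<forall>k. measure W {w\<in>space W. card {i. J i w \<in> A} = k} = measure \<nu> A ^ k / fact k * exp (- measure \<nu> A))"
    unfolding ranked_poisson_points_def by (elim conjE) assumption
  from this[rule_format, OF assms] show ?thesis by simp
qed

lemma count_indep:
  fixes n :: nat
  assumes "\<And>m. m < n \<Longrightarrow> A m \<in> sets borel \<and> emeasure \<nu> (A m) < \<infinity>" "disjoint_family_on A {..<n}"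
  shows "indep_vars (\<lambda>_. count_space UNIV) (\<lambda>m w. card {i. J i w \<in> A m}) {..<n}"
proof -
  from points have "\<forall>(n::nat) A. (\<forall>m<n. A m \<in> sets borel \<and> emeasure \<nu> (A m) < \<infinity>) \<and> disjoint_family_on A {..<n} \<longrightarrow>
        indep_vars (\<lambda>_. count_space UNIV) (\<lambda>m w. card {i. J i w \<in> A m}) {..<n}"
    unfolding ranked_poisson_points_def by (elim conjE) assumption
  from this[THEN spec[of _ n], THEN spec[of _ A]] show ?thesis by (rule mp) (use assms in simp)
qed

lemma count_meas:
  assumes "A \<in> sets borel" "emeasure \<nu> A < \<infinity>"
  shows "(\<lambda>w. card {i. J i w \<in> A}) \<in> W \<rightarrow>\<^sub>M count_space UNIV"
  using count_indep[of 1 "\<lambda>_. A"] assms by (simp add: indep_vars_def disjoint_family_on_def)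

lemma emeasure_\<nu>_Ici: "0 < e \<Longrightarrow> emeasure \<nu> {e..} = ennreal (e powr (- \<gamma>) / Gamma (1 - \<gamma>))"
  using emeasure_stable_intensity_Ici \<gamma> by blast

lemma AE_J_tendsto: "AE w in W. (\<lambda>i. J i w) \<longlonglongrightarrow> 0"
proof -
  have "AE w in W. \<forall>k. finite {i. J i w \<in> {1 / real (Suc k)..}}" unfolding AE_all_countable
    by (intro allI finite_count) (auto simp: emeasure_\<nu>_Ici)
  with AE_J show ?thesis
  proof eventually_elim
    case (elim w)
    show ?case
    proof (rule order_tendstoI)
      fix a :: real assume "a < 0"
      then show "\<forall>\<^sub>F i in sequentially. a < J i w" 
        using elim(1) by (intro always_eventually allI) (rule less_trans[of a 0], auto)
    next
      fix a :: real assume "0 < a"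
      then obtain k where k: "1 / real (Suc k) < a" using nat_approx_posE by blast
      have "finite {i. \<not> J i w < a}" using elim(2)[rule_format, of k] by (rule finite_subset[rotated]) (use k in auto)
      then show "\<forall>\<^sub>F i in sequentially. J i w < a"
        by (simp add: cofinite_eq_sequentially[symmetric] eventually_cofinite)
    qed
  qed
qed

lemma AE_J_decseq: "AE w in W. decseq (\<lambda>i. J i w) \<and> (\<lambda>i. J i w) \<longlonglongrightarrow> 0"
  using AE_J AE_J_tendsto by eventually_elim (auto intro!: decseq_SucI less_imp_le)

text \<open>Exponent of the Laplace functional of the Poisson process: by
  \<open>laplace_functional\<close>, the mean of exp(- sum \<phi>(J i)) is exp(- pexp
  \<phi>).\<close>

definition pexp :: "(real \<Rightarrow> ennreal) \<Rightarrow> ennreal" where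
  "pexp \<phi> = (\<integral>\<^sup>+x. (1 - nexp (\<phi> x)) \<partial>\<nu>)"

text \<open>For a step function over disjoint sets the sum over the points is a linear combination
  of independent Poisson counts; this is where the independence of the counts enters.\<close>

lemma laplace_functional_step:
  fixes c :: "nat \<Rightarrow> real"
  assumes c: "\<And>m. m < n \<Longrightarrow> 0 \<le> c m" and A: "\<And>m. m < n \<Longrightarrow> A m \<in> sets borel" "\<And>m. m < n \<Longrightarrow> emeasure \<nu> (A m) < \<infinity>"
    and disj: "disjoint_family_on A {..<n}"
  defines "\<phi> \<equiv> \<lambda>x. \<Sum>m<n. ennreal (c m) * indicator (A m) x"
  shows "(\<integral>\<^sup>+w. nexp (\<Sum>i. \<phi> (J i w)) \<partial>W) = nexp (pexp \<phi>)"
proof -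
  let ?N = "\<lambda>m w. card {i. J i w \<in> A m}"
  have "AE w in W. \<forall>m\<in>{..<n}. finite {i. J i w \<in> A m}" using A by (intro AE_finite_allI finite_count) auto
  then have "(\<integral>\<^sup>+w. nexp (\<Sum>i. \<phi> (J i w)) \<partial>W) = (\<integral>\<^sup>+w. (\<Prod>m<n. ennreal (exp (- c m * real (?N m w)))) \<partial>W)"
  proof (intro nn_integral_cong_AE, eventually_elim)
    case (elim w)
    have "(\<Sum>i. \<phi> (J i w)) = (\<Sum>m<n. \<Sum>i. ennreal (c m) * indicator (A m) (J i w))"
      unfolding \<phi>_def by (intro suminf_sum) auto
    also have "\<dots> = (\<Sum>m<n. ennreal (c m * real (?N m w)))"
    proof (intro sum.cong refl)
      fix m assume m: "m \<in> {..<n}"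
      have "(\<Sum>i. indicator (A m) (J i w) :: ennreal) = (\<Sum>i. indicator {i. J i w \<in> A m} i)"
        by (intro suminf_cong) (auto split: split_indicator)
      also have "\<dots> = (\<integral>\<^sup>+i. indicator {i. J i w \<in> A m} i \<partial>count_space UNIV)" by (simp only: nn_integral_count_space_nat)
      also have "\<dots> = emeasure (count_space UNIV) {i. J i w \<in> A m}" by (rule nn_integral_indicator) simp
      also have "\<dots> = of_nat (?N m w)" using elim m by (simp add: emeasure_count_space_finite)
      finally show "(\<Sum>i. ennreal (c m) * indicator (A m) (J i w)) = ennreal (c m * real (?N m w))"
        using c[of m] m by (simp add: ennreal_mult ennreal_of_nat_eq_real_of_nat)
    qed
    finally show ?case using c by (auto simp: nexp_sum nexp_ennreal intro!: prod.cong)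
  qed
  also have "\<dots> = (\<Prod>m<n. \<integral>\<^sup>+w. ennreal (exp (- c m * real (?N m w))) \<partial>W)"
  proof (rule indep_vars_nn_integral)
    have "indep_vars (\<lambda>_. borel) (\<lambda>m. (\<lambda>k. ennreal (exp (- c m * real k))) \<circ> (\<lambda>w. ?N m w)) {..<n}"
      using A disj by (intro indep_vars_compose[OF count_indep]) auto
    then show "indep_vars (\<lambda>_. borel) (\<lambda>m w. ennreal (exp (- c m * real (?N m w)))) {..<n}" by (simp add: comp_def)
  qed auto
  also have "\<dots> = (\<Prod>m<n. nexp (ennreal ((1 - exp (- c m)) * measure \<nu> (A m))))"
  proof (rule prod.cong[OF refl])
    fix m assume "m \<in> {..<n}"
    then have m: "m < n" by simp
    show "(\<integral>\<^sup>+w. ennreal (exp (- c m * real (?N m w))) \<partial>W) = nexp (ennreal ((1 - exp (- c m)) * measure \<nu> (A m)))"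
      using nn_integral_poisson_count[OF count_meas[OF A[OF m]] measure_nonneg c[OF m] count_law[OF A[OF m]]] c[OF m]
      by (simp add: nexp_ennreal)
  qed
  also have "\<dots> = nexp (\<Sum>m<n. ennreal ((1 - exp (- c m)) * measure \<nu> (A m)))" by (simp add: nexp_sum)
  also have "(\<Sum>m<n. ennreal ((1 - exp (- c m)) * measure \<nu> (A m))) = pexp \<phi>"
  proof -
    \<comment> \<open>At most one of the disjoint sets contains x, so 1 - exp(- \<phi> x) is linear
      in the indicators although the exponential is not.\<close>
    have "1 - nexp (\<phi> x) = (\<Sum>m<n. ennreal (1 - exp (- c m)) * indicator (A m) x)" for x
    proof (cases "\<exists>m<n. x \<in> A m")
      case True
      then obtain m where m: "m < n" "x \<in> A m" by auto
      have other: "x \<notin> A k" if "k < n" "k \<noteq> m" for k using disj m that by (auto simp: disjoint_family_on_def)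
      have "\<phi> x = ennreal (c m) * indicator (A m) x"
        unfolding \<phi>_def using m other by (subst sum.remove[of _ m]) (auto intro!: sum.neutral split: split_indicator)
      moreover have "(\<Sum>m<n. ennreal (1 - exp (- c m)) * indicator (A m) x) = ennreal (1 - exp (- c m)) * indicator (A m) x"
        using m other by (subst sum.remove[of _ m]) (auto intro!: sum.neutral split: split_indicator)
      ultimately show ?thesis using m one_minus_nexp[OF c[OF m(1)]] by simp
    next
      case False
      then have "\<phi> x = 0" "(\<Sum>m<n. ennreal (1 - exp (- c m)) * indicator (A m) x) = 0"
        unfolding \<phi>_def by (auto intro!: sum.neutral split: split_indicator)
      then show ?thesis by simp
    qed
    then have "pexp \<phi> = (\<integral>\<^sup>+x. (\<Sum>m<n. ennreal (1 - exp (- c m)) * indicator (A m) x) \<partial>\<nu>)" by (simp add: pexp_def)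
    also have "\<dots> = (\<Sum>m<n. \<integral>\<^sup>+x. ennreal (1 - exp (- c m)) * indicator (A m) x \<partial>\<nu>)"
      using A by (intro nn_integral_sum borel_measurable_times_ennreal) auto
    also have "\<dots> = (\<Sum>m<n. ennreal ((1 - exp (- c m)) * measure \<nu> (A m)))"
    proof (rule sum.cong[OF refl])
      fix m assume "m \<in> {..<n}"
      then have m: "m < n" by simp
      have "(\<integral>\<^sup>+x. ennreal (1 - exp (- c m)) * indicator (A m) x \<partial>\<nu>) = ennreal (1 - exp (- c m)) * emeasure \<nu> (A m)"
        using A(1)[OF m] by (intro nn_integral_cmult_indicator) simp
      also have "emeasure \<nu> (A m) = ennreal (measure \<nu> (A m))"
        using A(2)[OF m] by (intro emeasure_eq_ennreal_measure) auto
      finally show "(\<integral>\<^sup>+x. ennreal (1 - exp (- c m)) * indicator (A m) x \<partial>\<nu>) = ennreal ((1 - exp (- c m)) * measure \<nu> (A m))"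
        using c[OF m] by (simp add: ennreal_mult)
    qed
    finally show ?thesis by simp
  qed
  finally show ?thesis .
qed

text \<open>A simple function is a step function over the level sets of its non-zero values; these
  are disjoint and lie in \<open>{e..}\<close>, which has finite intensity.\<close>

lemma laplace_functional_simple:
  assumes u: "simple_function borel u" "\<And>x. u x < \<top>" and e: "0 < e" and u0: "\<And>x. x < e \<Longrightarrow> u x = 0"
  shows "(\<integral>\<^sup>+w. nexp (\<Sum>i. u (J i w)) \<partial>W) = nexp (pexp u)"
proof -
  have "finite (u ` UNIV - {0})" using simple_functionD(1)[OF u(1)] by simp
  then obtain n :: nat and c where c: "u ` UNIV - {0} = c ` {i. i < n}" "inj_on c {i. i < n}"
    using finite_imp_nat_seg_image_inj_on by metis
  define A where "A m = u -` {c m}" for m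
  have cm: "c m \<noteq> 0" "c m < \<top>" if "m < n" for m
  proof -
    from that c(1) have "c m \<in> u ` UNIV - {0}" by auto
    then show "c m \<noteq> 0" "c m < \<top>" using u(2) by auto
  qed
  have A: "A m \<in> sets borel" for m unfolding A_def using simple_functionD(2)[OF u(1), of "{c m}"] by simp
  have eqphi: "u = (\<lambda>x. \<Sum>m<n. ennreal (enn2real (c m)) * indicator (A m) x)"
  proof
    fix x
    show "u x = (\<Sum>m<n. ennreal (enn2real (c m)) * indicator (A m) x)"
    proof (cases "u x = 0")
      case True
      have "ennreal (enn2real (c m)) * indicator (A m) x = 0" if "m < n" for m
        using cm(1)[OF that] True by (auto simp: A_def split: split_indicator)
      then have "(\<Sum>m<n. ennreal (enn2real (c m)) * indicator (A m) x) = 0" by (intro sum.neutral) auto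
      with True show ?thesis by simp
    next
      case False
      then have "u x \<in> c ` {i. i < n}" unfolding c(1)[symmetric] by simp
      then obtain m where m: "m < n" "u x = c m" by auto
      have z: "ennreal (enn2real (c k)) * indicator (A k) x = 0" if "k \<in> {..<n} - {m}" for k
        using that m c(2) by (auto simp: A_def inj_on_def indicator_def)
      have "(\<Sum>m<n. ennreal (enn2real (c m)) * indicator (A m) x) = ennreal (enn2real (c m)) * indicator (A m) x
          + (\<Sum>k\<in>{..<n}-{m}. ennreal (enn2real (c k)) * indicator (A k) x)" by (rule sum.remove) (use m in auto)
      also have "(\<Sum>k\<in>{..<n}-{m}. ennreal (enn2real (c k)) * indicator (A k) x) = 0"
        using z by (rule sum.neutral[OF ballI])
      finally have "(\<Sum>m<n. ennreal (enn2real (c m)) * indicator (A m) x) = ennreal (enn2real (c m)) * indicator (A m) x"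
        by simp
      then show ?thesis using m cm(2)[OF m(1)] by (simp add: A_def)
    qed
  qed
  show ?thesis unfolding eqphi
  proof (rule laplace_functional_step)
    fix m assume m: "m < n"
    have "A m \<subseteq> {e..}"
    proof
      fix x assume "x \<in> A m"
      then show "x \<in> {e..}" using cm(1)[OF m] u0[of x] by (auto simp: A_def not_less[symmetric])
    qed
    then have "emeasure \<nu> (A m) \<le> emeasure \<nu> {e..}" by (intro emeasure_mono) auto
    then show "emeasure \<nu> (A m) < \<infinity>" using e by (simp add: emeasure_\<nu>_Ici le_less_trans)
  next
    show "disjoint_family_on A {..<n}" using c(2) by (auto simp: disjoint_family_on_def A_def inj_on_def)
  qed (use A in auto)
qed

lemma measurable_pexp_arg [measurable]: "\<phi> \<in> borel_measurable borel \<Longrightarrow> (\<lambda>x. 1 - nexp (\<phi> x)) \<in> borel_measurable borel"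
  by measurable

text \<open>The intensity is infinite near 0, so the approximating simple functions are also cut off
  below 1 / (n + 1). Nothing is lost in the limit, because the points and the intensity live on the
  positive half-line.\<close>

theorem laplace_functional:
  assumes [measurable]: "\<phi> \<in> borel_measurable borel"
  shows "(\<integral>\<^sup>+w. nexp (\<Sum>i. \<phi> (J i w)) \<partial>W) = nexp (pexp \<phi>)"
proof -
  obtain f where f: "\<And>i. simple_function borel (f i)" "incseq f" "\<And>i x. f i x < top" "\<And>x. (SUP i. f i x) = \<phi> x"
    using borel_measurable_implies_simple_function_sequence'[of \<phi> borel] assms by metis
  define u where "u n x = f n x * indicator {1 / real (Suc n)..} x" for n x
  have u_simple: "simple_function borel (u n)" for n
    unfolding u_def using f(1) by (intro simple_function_mult simple_function_indicator) auto
  have u_fin: "u n x < \<top>" for n x using f(3) by (auto simp: u_def split: split_indicator)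
  have u_0: "u n x = 0" if "x < 1 / real (Suc n)" for n x using that by (simp add: u_def)
  have u_inc: "incseq (\<lambda>n. u n x)" for x
  proof (intro incseq_SucI)
    fix n
    have "1 / real (Suc n) \<le> x \<Longrightarrow> 1 / real (Suc (Suc n)) \<le> x"
      by (erule order_trans[rotated]) (intro divide_left_mono, auto)
    moreover have "f n x \<le> f (Suc n) x" using f(2) by (simp add: incseq_def le_fun_def)
    ultimately show "u n x \<le> u (Suc n) x" by (auto simp: u_def split: split_indicator)
  qed
  have u_SUP: "(SUP n. u n x) = \<phi> x" if x0: "0 < x" for x
  proof -
    obtain k where k: "1 / real (Suc k) < x" using nat_approx_posE[OF x0] by blast
    have "(\<lambda>n. f n x) \<longlonglongrightarrow> \<phi> x" using LIMSEQ_SUP[of "\<lambda>n. f n x"] f(2,4) by (auto simp: incseq_def le_fun_def)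
    moreover have "f n x = u n x" if "n \<ge> k" for n
    proof -
      have "1 / real (Suc n) \<le> 1 / real (Suc k)" using that by (intro divide_left_mono) auto
      then show ?thesis using k by (simp add: u_def)
    qed
    ultimately have "(\<lambda>n. u n x) \<longlonglongrightarrow> \<phi> x" by (rule Lim_transform_eventually[OF _ eventually_sequentiallyI[of k]]) auto
    then show ?thesis using LIMSEQ_unique[OF LIMSEQ_SUP[OF u_inc]] by auto
  qed
  have um[measurable]: "u n \<in> borel_measurable borel" for n using u_simple by (rule borel_measurable_simple_function)
  have "(\<lambda>n. \<integral>\<^sup>+w. nexp (\<Sum>i. u n (J i w)) \<partial>W) \<longlonglongrightarrow> (\<integral>\<^sup>+w. nexp (\<Sum>i. \<phi> (J i w)) \<partial>W)"
  proof (rule nn_integral_nexp_tendsto[OF prob_space_axioms])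
    show "AE w in W. (\<lambda>n. nexp (\<Sum>i. u n (J i w))) \<longlonglongrightarrow> nexp (\<Sum>i. \<phi> (J i w))" using AE_J
    proof eventually_elim
      case (elim w)
      have "(\<Sum>i. \<phi> (J i w)) = (\<Sum>i. SUP n. u n (J i w))" using elim by (simp add: u_SUP)
      also have "\<dots> = (SUP n. \<Sum>i. u n (J i w))" by (rule ennreal_suminf_SUP_eq[OF u_inc])
      finally have *: "(\<Sum>i. \<phi> (J i w)) = (SUP n. \<Sum>i. u n (J i w))" .
      have "incseq (\<lambda>n. \<Sum>i. u n (J i w))" using u_inc by (auto simp: incseq_def intro!: suminf_le)
      from nexp_tendsto_SUP[OF this] show ?case unfolding * .
    qed
  qed simp_all
  moreover have "(\<lambda>n. nexp (pexp (u n))) \<longlonglongrightarrow> nexp (pexp \<phi>)"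
  proof -
    have inc: "incseq (\<lambda>n x. 1 - nexp (u n x))"
      using u_inc by (auto simp: incseq_def le_fun_def intro!: ennreal_minus_mono nexp_antimono)
    have "pexp \<phi> = (\<integral>\<^sup>+x. (SUP n. 1 - nexp (u n x)) \<partial>\<nu>)" unfolding pexp_def
    proof (rule nn_integral_cong_AE)
      show "AE x in \<nu>. 1 - nexp (\<phi> x) = (SUP n. 1 - nexp (u n x))" using AE_stable_intensity_pos
      proof eventually_elim
        case (elim x)
        have "(\<lambda>n. 1 - nexp (u n x)) \<longlonglongrightarrow> 1 - nexp (SUP n. u n x)"
          by (intro tendsto_diff_ennreal tendsto_const nexp_tendsto_SUP u_inc) auto
        moreover have "(\<lambda>n. 1 - nexp (u n x)) \<longlonglongrightarrow> (SUP n. 1 - nexp (u n x))"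
          using inc by (intro LIMSEQ_SUP) (auto simp: incseq_def le_fun_def)
        ultimately show ?case using LIMSEQ_unique u_SUP[OF elim] by metis
      qed
    qed
    also have "\<dots> = (SUP n. pexp (u n))"
      unfolding pexp_def by (intro nn_integral_monotone_convergence_SUP inc) measurable
    finally have *: "pexp \<phi> = (SUP n. pexp (u n))" .
    have "incseq (\<lambda>n. pexp (u n))"
      unfolding pexp_def using inc by (auto simp: incseq_def le_fun_def intro!: nn_integral_mono)
    from nexp_tendsto_SUP[OF this] show ?thesis unfolding * .
  qed
  moreover have "(\<integral>\<^sup>+w. nexp (\<Sum>i. u n (J i w)) \<partial>W) = nexp (pexp (u n))" for n
    by (rule laplace_functional_simple[OF u_simple u_fin _ u_0]) auto
  ultimately show ?thesis using LIMSEQ_unique by auto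
qed

end

section \<open>Changes of variables on the half-line and integrals against the stable
  intensity\<close>

lemma nn_integral_exp_subst:
  fixes h :: "real \<Rightarrow> ennreal"
  assumes [measurable]: "h \<in> borel_measurable borel"
  shows "(\<integral>\<^sup>+x\<in>{0<..}. h x \<partial>lborel) = (\<integral>\<^sup>+y. h (exp y) * ennreal (exp y) \<partial>lborel)"
proof -
  \<comment> \<open>Substitution is applied on the compact intervals \<open>A n\<close>, which
    exhaust the line; their images \<open>B n\<close> under exp exhaust the positive
    half-line.\<close>
  define A where "A n = {- real (Suc n)..real (Suc n)}" for n
  define B where "B n = {exp (- real (Suc n))..exp (real (Suc n))}" for n
  have Ainc: "incseq (\<lambda>n y. g y * indicator (A n) y)" for g :: "real \<Rightarrow> ennreal"
    by (intro incseq_SucI le_funI) (auto simp: A_def split: split_indicator)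
  have Binc: "incseq (\<lambda>n y. g y * indicator (B n) y)" for g :: "real \<Rightarrow> ennreal"
  proof (intro incseq_SucI le_funI)
    fix n y
    have "exp (- real (Suc (Suc n))) \<le> exp (- real (Suc n))" "exp (real (Suc n)) \<le> exp (real (Suc (Suc n)))" by simp_all
    then have "B n \<subseteq> B (Suc n)" by (simp add: B_def)
    then show "g y * indicator (B n) y \<le> g y * indicator (B (Suc n)) y" by (auto split: split_indicator)
  qed
  have ASUP: "(SUP n. g y * indicator (A n) y) = g y" for g :: "real \<Rightarrow> ennreal" and y
  proof (rule antisym)
    obtain n where "\<bar>y\<bar> < real n" using reals_Archimedean2 by blast
    then have "y \<in> A n" by (auto simp: A_def)
    then show "g y \<le> (SUP n. g y * indicator (A n) y)" by (intro SUP_upper2[of n]) auto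
  qed (auto intro!: SUP_least split: split_indicator)
  have BSUP: "(SUP n. g y * indicator (B n) y) = g y * indicator {0<..} y" for g :: "real \<Rightarrow> ennreal" and y
  proof (cases "0 < y")
    case True
    show ?thesis
    proof (rule antisym)
      obtain n where "\<bar>ln y\<bar> < real n" using reals_Archimedean2 by blast
      then have "- real (Suc n) \<le> ln y" "ln y \<le> real (Suc n)" by auto
      then have "exp (- real (Suc n)) \<le> exp (ln y)" "exp (ln y) \<le> exp (real (Suc n))"
        by (simp_all only: exp_le_cancel_iff)
      then have "y \<in> B n" unfolding B_def using True by simp
      then show "g y * indicator {0<..} y \<le> (SUP n. g y * indicator (B n) y)" by (intro SUP_upper2[of n]) (auto split: split_indicator)
    qed (use True in \<open>auto intro!: SUP_least split: split_indicator\<close>)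
  next
    case False
    have "y \<notin> B n" for n unfolding B_def using False exp_gt_zero[of "- real (Suc n)"] by (auto simp del: exp_gt_zero)
    with False show ?thesis by simp
  qed
  have "(\<integral>\<^sup>+x\<in>{0<..}. h x \<partial>lborel) = (SUP n. \<integral>\<^sup>+x. h x * indicator (B n) x \<partial>lborel)"
    unfolding BSUP[symmetric] by (intro nn_integral_monotone_convergence_SUP Binc) (auto simp: B_def)
  also have "\<dots> = (SUP n. \<integral>\<^sup>+y. h (exp y) * ennreal (exp y) * indicator (A n) y \<partial>lborel)" unfolding A_def B_def
    by (intro SUP_cong refl nn_integral_substitution_aux) (auto intro!: DERIV_exp continuous_intros)
  also have "\<dots> = (\<integral>\<^sup>+y. (SUP n. h (exp y) * ennreal (exp y) * indicator (A n) y) \<partial>lborel)"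
    by (intro nn_integral_monotone_convergence_SUP[symmetric] Ainc) (auto simp: A_def)
  finally show ?thesis by (simp add: ASUP[where g="\<lambda>y. h (exp y) * ennreal (exp y)"])
qed

text \<open>On the logarithmic scale the power map is multiplication by p, so an affine substitution
  covers both signs of p.\<close>

lemma nn_integral_powr_subst:
  fixes h :: "real \<Rightarrow> ennreal"
  assumes [measurable]: "h \<in> borel_measurable borel" and p: "p \<noteq> 0"
  shows "(\<integral>\<^sup>+x\<in>{0<..}. h x \<partial>lborel)
    = (\<integral>\<^sup>+u\<in>{0<..}. h (u powr p) * ennreal (\<bar>p\<bar> * u powr (p - 1)) \<partial>lborel)"
proof -
  have "(\<integral>\<^sup>+x\<in>{0<..}. h x \<partial>lborel) = (\<integral>\<^sup>+y. h (exp y) * ennreal (exp y) \<partial>lborel)" by (rule nn_integral_exp_subst) simp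
  also have "\<dots> = ennreal \<bar>p\<bar> * (\<integral>\<^sup>+y. h (exp (0 + p * y)) * ennreal (exp (0 + p * y)) \<partial>lborel)"
    by (rule nn_integral_real_affine[OF _ p]) simp
  also have "\<dots> = (\<integral>\<^sup>+y. ennreal \<bar>p\<bar> * (h (exp (0 + p * y)) * ennreal (exp (0 + p * y))) \<partial>lborel)"
    by (rule nn_integral_cmult[symmetric]) simp
  also have "\<dots> = (\<integral>\<^sup>+y. h (exp y powr p) * ennreal (\<bar>p\<bar> * exp y powr (p - 1)) * ennreal (exp y) \<partial>lborel)"
  proof (rule nn_integral_cong)
    fix y
    have "exp (p * y) = exp y powr (p - 1) * exp y" by (simp add: powr_def exp_add[symmetric] algebra_simps)
    then show "ennreal \<bar>p\<bar> * (h (exp (0 + p * y)) * ennreal (exp (0 + p * y))) = h (exp y powr p) * ennreal (\<bar>p\<bar> * exp y powr (p - 1)) * ennreal (exp y)"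
      by (simp add: powr_def[of "exp y" p] ennreal_mult mult_ac)
  qed
  also have "\<dots> = (\<integral>\<^sup>+u\<in>{0<..}. h (u powr p) * ennreal (\<bar>p\<bar> * u powr (p - 1)) \<partial>lborel)"
    by (rule nn_integral_exp_subst[symmetric]) simp
  finally show ?thesis .
qed

lemma nn_integral_scale_subst:
  fixes h :: "real \<Rightarrow> ennreal"
  assumes [measurable]: "h \<in> borel_measurable borel" and c: "0 < c"
  shows "(\<integral>\<^sup>+x\<in>{0<..}. h x \<partial>lborel) = ennreal c * (\<integral>\<^sup>+x\<in>{0<..}. h (c * x) \<partial>lborel)"
proof -
  have "(\<integral>\<^sup>+x\<in>{0<..}. h x \<partial>lborel) = ennreal \<bar>c\<bar> * (\<integral>\<^sup>+x. h (0 + c * x) * indicator {0<..} (0 + c * x) \<partial>lborel)"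
    by (rule nn_integral_real_affine) (use c in auto)
  also have "(\<integral>\<^sup>+x. h (0 + c * x) * indicator {0<..} (0 + c * x) \<partial>lborel) = (\<integral>\<^sup>+x\<in>{0<..}. h (c * x) \<partial>lborel)"
    using c by (intro nn_integral_cong) (auto simp: zero_less_mult_iff split: split_indicator)
  finally show ?thesis using c by simp
qed

lemma nn_integral_Gamma:
  assumes s: "0 < s" and c: "0 < c"
  shows "(\<integral>\<^sup>+x\<in>{0<..}. ennreal (x powr (s - 1) * exp (- (c * x))) \<partial>lborel) = ennreal (Gamma s / c powr s)"
proof -
  have "ennreal (Gamma s) = (\<integral>\<^sup>+x\<in>{0<..}. ennreal (x powr (s - 1) * exp (- x)) \<partial>lborel)"
  proof -
    have "ennreal (Gamma s) = (\<integral>\<^sup>+t. ennreal (indicator {0..} t * t powr (s - 1) / exp t) \<partial>lborel)"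
      by (rule Gamma_conv_nn_integral_real[OF s])
    also have "\<dots> = (\<integral>\<^sup>+x\<in>{0<..}. ennreal (x powr (s - 1) * exp (- x)) \<partial>lborel)"
      by (intro nn_integral_cong) (auto simp: exp_minus field_simps split: split_indicator)
    finally show ?thesis .
  qed
  also have "\<dots> = ennreal c * (\<integral>\<^sup>+x\<in>{0<..}. ennreal ((c * x) powr (s - 1) * exp (- (c * x))) \<partial>lborel)"
    by (rule nn_integral_scale_subst[OF _ c]) simp
  also have "\<dots> = (\<integral>\<^sup>+x. ennreal c * (ennreal ((c * x) powr (s - 1) * exp (- (c * x))) * indicator {0<..} x) \<partial>lborel)"
    by (rule nn_integral_cmult[symmetric]) simp
  also have "\<dots> = (\<integral>\<^sup>+x. ennreal (c powr s) * (ennreal (x powr (s - 1) * exp (- (c * x))) * indicator {0<..} x) \<partial>lborel)"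
  proof (rule nn_integral_cong)
    fix x :: real
    show "ennreal c * (ennreal ((c * x) powr (s - 1) * exp (- (c * x))) * indicator {0<..} x) = ennreal (c powr s) * (ennreal (x powr (s - 1) * exp (- (c * x))) * indicator {0<..} x)"
    proof (cases "0 < x")
      case True
      have "c * (c * x) powr (s - 1) = c powr s * x powr (s - 1)" using c True by (simp add: powr_mult powr_diff)
      then show ?thesis using c True by (simp add: ennreal_mult[symmetric] mult.assoc[symmetric])
    qed simp
  qed
  also have "\<dots> = ennreal (c powr s) * (\<integral>\<^sup>+x\<in>{0<..}. ennreal (x powr (s - 1) * exp (- (c * x))) \<partial>lborel)"
    by (rule nn_integral_cmult) simp
  finally have eq: "ennreal (Gamma s) = ennreal (c powr s) * (\<integral>\<^sup>+x\<in>{0<..}. ennreal (x powr (s - 1) * exp (- (c * x))) \<partial>lborel)" .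
  have "ennreal (Gamma s / c powr s) = ennreal (1 / c powr s) * ennreal (Gamma s)"
    using s by (subst ennreal_mult[symmetric]) (auto intro: less_imp_le)
  also have "\<dots> = ennreal (1 / c powr s * c powr s) * (\<integral>\<^sup>+x\<in>{0<..}. ennreal (x powr (s - 1) * exp (- (c * x))) \<partial>lborel)"
    unfolding eq by (subst ennreal_mult) (auto simp: mult.assoc)
  also have "1 / c powr s * c powr s = 1" using c by simp
  finally show ?thesis by simp
qed

lemma nn_integral_stable:
  fixes g :: "real \<Rightarrow> ennreal"
  assumes [measurable]: "g \<in> borel_measurable borel"
  shows "(\<integral>\<^sup>+x. g x \<partial>stable_intensity \<gamma>)
    = (\<integral>\<^sup>+x\<in>{0<..}. g x * ennreal (\<gamma> / Gamma (1 - \<gamma>) * x powr (- \<gamma> - 1)) \<partial>lborel)" unfolding stable_intensity_def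
  by (subst nn_integral_density) (auto simp: mult_ac intro!: nn_integral_cong)

text \<open>Comes from the homogeneity of the density x powr (-\<gamma> - 1); it is the source of
  the scaling relations for the points and their Laplace exponents.\<close>

lemma nn_integral_stable_scale:
  fixes g :: "real \<Rightarrow> ennreal"
  assumes [measurable]: "g \<in> borel_measurable borel" and c: "0 < c" and \<gamma>: "0 < \<gamma>" "\<gamma> < 1"
  shows "(\<integral>\<^sup>+x. g (c * x) \<partial>stable_intensity \<gamma>) = ennreal (c powr \<gamma>) * (\<integral>\<^sup>+x. g x \<partial>stable_intensity \<gamma>)"
proof -
  let ?k = "\<gamma> / Gamma (1 - \<gamma>)"
  have k: "0 \<le> ?k" using \<gamma> by (auto intro!: divide_nonneg_pos)
  have "ennreal (c powr \<gamma>) * (\<integral>\<^sup>+x. g x \<partial>stable_intensity \<gamma>)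
      = ennreal (c powr \<gamma>) * (ennreal c * (\<integral>\<^sup>+x\<in>{0<..}. g (c * x) * ennreal (?k * (c * x) powr (- \<gamma> - 1)) \<partial>lborel))"
    by (subst nn_integral_stable, simp, subst nn_integral_scale_subst[OF _ c]) simp_all
  also have "\<dots> = (\<integral>\<^sup>+x. ennreal (c powr \<gamma> * c) * (g (c * x) * ennreal (?k * (c * x) powr (- \<gamma> - 1)) * indicator {0<..} x) \<partial>lborel)"
    using c by (subst nn_integral_cmult) (simp_all add: ennreal_mult mult.assoc)
  also have "\<dots> = (\<integral>\<^sup>+x\<in>{0<..}. g (c * x) * ennreal (?k * x powr (- \<gamma> - 1)) \<partial>lborel)"
  proof (rule nn_integral_cong)
    fix x :: real
    show "ennreal (c powr \<gamma> * c) * (g (c * x) * ennreal (?k * (c * x) powr (- \<gamma> - 1)) * indicator {0<..} x)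
      = g (c * x) * ennreal (?k * x powr (- \<gamma> - 1)) * indicator {0<..} x"
    proof (cases "0 < x")
      case True
      have "c powr \<gamma> * c * (c * x) powr (- \<gamma> - 1) = x powr (- \<gamma> - 1) * (c powr \<gamma> * c powr 1 * c powr (- \<gamma> - 1))"
        using c True by (simp add: powr_mult)
      also have "c powr \<gamma> * c powr 1 * c powr (- \<gamma> - 1) = 1" using c by (simp only: powr_add[symmetric]) simp
      finally have *: "?k * x powr (- \<gamma> - 1) = c powr \<gamma> * c * (?k * (c * x) powr (- \<gamma> - 1))" by simp
      have "ennreal (?k * x powr (- \<gamma> - 1)) = ennreal (c powr \<gamma> * c) * ennreal (?k * (c * x) powr (- \<gamma> - 1))"
        unfolding * by (intro ennreal_mult mult_nonneg_nonneg) (use c k in simp_all)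
      then show ?thesis by (simp add: mult_ac)
    qed simp
  qed
  also have "\<dots> = (\<integral>\<^sup>+x. g (c * x) \<partial>stable_intensity \<gamma>)" by (rule nn_integral_stable[symmetric]) simp
  finally show ?thesis by simp
qed

text \<open>The power map carries one homogeneous density to another. The constant is the reciprocal
  of the moment of order \<beta> of an \<alpha>-stable total mass and cancels against that moment
  later.\<close>

lemma nn_integral_stable_powr:
  fixes g :: "real \<Rightarrow> ennreal"
  assumes [measurable]: "g \<in> borel_measurable borel" and ab: "0 < \<beta>" "\<beta> < \<alpha>" "\<alpha> < 1"
  shows "(\<integral>\<^sup>+x. g (x powr (1 / \<alpha>)) \<partial>stable_intensity (\<beta> / \<alpha>))
    = ennreal (Gamma (1 - \<beta>) / Gamma (1 - \<beta> / \<alpha>)) * (\<integral>\<^sup>+x. g x \<partial>stable_intensity \<beta>)"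
proof -
  let ?b = "\<beta> / \<alpha>"
  have b: "0 < ?b" "?b < 1" using ab by auto
  have G: "0 < Gamma (1 - ?b)" "0 < Gamma (1 - \<beta>)" using b ab by auto
  have G0: "Gamma (1 - ?b) \<noteq> 0" "Gamma (1 - \<beta>) \<noteq> 0" using G by (metis less_irrefl)+
  have "(\<integral>\<^sup>+x. g (x powr (1 / \<alpha>)) \<partial>stable_intensity ?b)
     = (\<integral>\<^sup>+x\<in>{0<..}. g (x powr (1 / \<alpha>)) * ennreal (?b / Gamma (1 - ?b) * x powr (- ?b - 1)) \<partial>lborel)"
    by (rule nn_integral_stable) simp
  also have "\<dots> = (\<integral>\<^sup>+u\<in>{0<..}. g ((u powr \<alpha>) powr (1 / \<alpha>)) * ennreal (?b / Gamma (1 - ?b) * (u powr \<alpha>) powr (- ?b - 1))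
      * ennreal (\<bar>\<alpha>\<bar> * u powr (\<alpha> - 1)) \<partial>lborel)" by (rule nn_integral_powr_subst) (use ab in auto)
  also have "\<dots> = (\<integral>\<^sup>+u. ennreal (Gamma (1 - \<beta>) / Gamma (1 - ?b)) * (g u * ennreal (\<beta> / Gamma (1 - \<beta>) * u powr (- \<beta> - 1)) * indicator {0<..} u) \<partial>lborel)"
  proof (rule nn_integral_cong)
    fix u :: real
    show "g ((u powr \<alpha>) powr (1 / \<alpha>)) * ennreal (?b / Gamma (1 - ?b) * (u powr \<alpha>) powr (- ?b - 1))
      * ennreal (\<bar>\<alpha>\<bar> * u powr (\<alpha> - 1)) * indicator {0<..} u
      = ennreal (Gamma (1 - \<beta>) / Gamma (1 - ?b)) * (g u * ennreal (\<beta> / Gamma (1 - \<beta>) * u powr (- \<beta> - 1)) * indicator {0<..} u)"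
    proof (cases "0 < u")
      case True
      have 1: "(u powr \<alpha>) powr (1 / \<alpha>) = u" using True ab by (simp add: powr_powr)
      have "(u powr \<alpha>) powr (- ?b - 1) * u powr (\<alpha> - 1) = u powr (\<alpha> * (- ?b - 1) + (\<alpha> - 1))"
        by (simp add: powr_powr powr_add)
      also have "\<alpha> * (- ?b - 1) + (\<alpha> - 1) = - \<beta> - 1" using ab by (simp add: field_simps)
      finally have 2: "(u powr \<alpha>) powr (- ?b - 1) * u powr (\<alpha> - 1) = u powr (- \<beta> - 1)" .
      have gen: "\<And>a1 a2 z::real. a1 \<noteq> 0 \<Longrightarrow> a2 \<noteq> 0 \<Longrightarrow> ?b / a1 * \<alpha> * z = a2 / a1 * (\<beta> / a2 * z)"
        using ab by (simp add: field_simps)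
      have "?b / Gamma (1 - ?b) * (u powr \<alpha>) powr (- ?b - 1) * (\<bar>\<alpha>\<bar> * u powr (\<alpha> - 1))
        = ?b / Gamma (1 - ?b) * \<alpha> * ((u powr \<alpha>) powr (- ?b - 1) * u powr (\<alpha> - 1))" using ab by simp
      also have "\<dots> = Gamma (1 - \<beta>) / Gamma (1 - ?b) * (\<beta> / Gamma (1 - \<beta>) * u powr (- \<beta> - 1))"
        unfolding 2 using G0 by (rule gen)
      finally have 3: "?b / Gamma (1 - ?b) * (u powr \<alpha>) powr (- ?b - 1) * (\<bar>\<alpha>\<bar> * u powr (\<alpha> - 1))
        = Gamma (1 - \<beta>) / Gamma (1 - ?b) * (\<beta> / Gamma (1 - \<beta>) * u powr (- \<beta> - 1))" .
      have nn: "0 \<le> ?b / Gamma (1 - ?b) * (u powr \<alpha>) powr (- ?b - 1)" "0 \<le> \<bar>\<alpha>\<bar> * u powr (\<alpha> - 1)"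
        "0 \<le> Gamma (1 - \<beta>) / Gamma (1 - ?b)" "0 \<le> \<beta> / Gamma (1 - \<beta>) * u powr (- \<beta> - 1)"
        using b ab G[THEN less_imp_le] by (intro mult_nonneg_nonneg divide_nonneg_nonneg; simp)+
      have 4: "ennreal (?b / Gamma (1 - ?b) * (u powr \<alpha>) powr (- ?b - 1)) * ennreal (\<bar>\<alpha>\<bar> * u powr (\<alpha> - 1))
        = ennreal (Gamma (1 - \<beta>) / Gamma (1 - ?b)) * ennreal (\<beta> / Gamma (1 - \<beta>) * u powr (- \<beta> - 1))"
        using 3 ennreal_mult[OF nn(1,2)] ennreal_mult[OF nn(3,4)] by metis
      show ?thesis unfolding 1 using 4 by (simp add: mult.assoc mult.left_commute)
    qed simp
  qed
  also have "\<dots> = ennreal (Gamma (1 - \<beta>) / Gamma (1 - ?b)) * (\<integral>\<^sup>+x. g x \<partial>stable_intensity \<beta>)"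
    by (subst nn_integral_cmult, simp, subst nn_integral_stable) simp_all
  finally show ?thesis .
qed

text \<open>Fubini for \<open>1 - exp (- l * x) = (\<integral>u\<in>{0..x}. l * exp (- l * u))\<close> turns this into a Gamma integral.\<close>

lemma nn_integral_stable_laplace:
  assumes \<gamma>: "0 < \<gamma>" "\<gamma> < 1" and l: "0 < l"
  shows "(\<integral>\<^sup>+x. ennreal (1 - exp (- (l * x))) \<partial>stable_intensity \<gamma>) = ennreal (l powr \<gamma>)"
proof -
  let ?d = "\<lambda>x. ennreal (\<gamma> / Gamma (1 - \<gamma>) * x powr (- \<gamma> - 1)) * indicator {0<..} x"
  let ?e = "\<lambda>u. ennreal (l * exp (- (l * u)))"
  have G: "0 < Gamma (1 - \<gamma>)" using \<gamma> by auto
  have FTC: "(\<integral>\<^sup>+u\<in>{0..x}. ?e u \<partial>lborel) = ennreal (1 - exp (- (l * x)))" if "0 < x" for x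
  proof -
    have "(\<integral>\<^sup>+u\<in>{0..x}. ?e u \<partial>lborel) = ennreal (- exp (- (l * x)) - (- exp (- (l * 0))))"
      by (rule nn_integral_FTC_Icc) (use that l in \<open>auto intro!: derivative_eq_intros\<close>)
    then show ?thesis by simp
  qed
  have "(\<integral>\<^sup>+x. ennreal (1 - exp (- (l * x))) \<partial>stable_intensity \<gamma>) = (\<integral>\<^sup>+x. ennreal (1 - exp (- (l * x))) * ?d x \<partial>lborel)"
    by (subst nn_integral_stable) (simp_all add: mult.assoc)
  also have "\<dots> = (\<integral>\<^sup>+x. (\<integral>\<^sup>+u\<in>{0..x}. ?e u \<partial>lborel) * ?d x \<partial>lborel)"
    by (intro nn_integral_cong) (simp add: FTC split: split_indicator)
  also have "\<dots> = (\<integral>\<^sup>+x. (\<integral>\<^sup>+u. ?e u * indicator {0..x} u * ?d x \<partial>lborel) \<partial>lborel)"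
    by (intro nn_integral_cong nn_integral_multc[symmetric]) simp
  also have "\<dots> = (\<integral>\<^sup>+x. (\<integral>\<^sup>+u. ?e u * indicator {(u, x). 0 \<le> u \<and> u \<le> x} (u, x) * ?d x \<partial>lborel) \<partial>lborel)"
    by (intro nn_integral_cong) (auto split: split_indicator)
  also have "\<dots> = (\<integral>\<^sup>+u. (\<integral>\<^sup>+x. ?e u * indicator {(u, x). 0 \<le> u \<and> u \<le> x} (u, x) * ?d x \<partial>lborel) \<partial>lborel)"
    by (rule lborel_pair.Fubini') (simp add: split_beta')
  also have "\<dots> = (\<integral>\<^sup>+u. ennreal (l / Gamma (1 - \<gamma>)) * (ennreal (u powr ((1 - \<gamma>) - 1) * exp (- (l * u))) * indicator {0<..} u) \<partial>lborel)"
  proof (rule nn_integral_cong_AE)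
    \<comment> \<open>At u = 0 the inner integral is the whole mass of the intensity, which is
      infinite; the null set is removed first.\<close>
    have "AE u in lborel. u \<noteq> (0::real)" by (rule AE_lborel_singleton)
    then show "AE u in lborel. (\<integral>\<^sup>+x. ?e u * indicator {(u, x). 0 \<le> u \<and> u \<le> x} (u, x) * ?d x \<partial>lborel)
       = ennreal (l / Gamma (1 - \<gamma>)) * (ennreal (u powr ((1 - \<gamma>) - 1) * exp (- (l * u))) * indicator {0<..} u)"
    proof eventually_elim
      case (elim u)
      show ?case
      proof (cases "0 < u")
        case False
        with elim have "u < 0" by simp
        then show ?thesis by simp
      next
        case True
        have "(\<integral>\<^sup>+x. ?e u * indicator {(u, x). 0 \<le> u \<and> u \<le> x} (u, x) * ?d x \<partial>lborel) = (\<integral>\<^sup>+x. ?e u * (indicator {u..} x * ?d x) \<partial>lborel)"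
          using True by (intro nn_integral_cong) (auto split: split_indicator simp: mult_ac)
        also have "\<dots> = ?e u * (\<integral>\<^sup>+x. indicator {u..} x * ?d x \<partial>lborel)" by (rule nn_integral_cmult) simp
        also have "(\<integral>\<^sup>+x. indicator {u..} x * ?d x \<partial>lborel) = emeasure (stable_intensity \<gamma>) {u..}"
          unfolding stable_intensity_def by (subst emeasure_density) (auto simp: mult_ac)
        also have "\<dots> = ennreal (u powr (- \<gamma>) / Gamma (1 - \<gamma>))" by (rule emeasure_stable_intensity_Ici[OF \<gamma> True])
        finally show ?thesis using True l G by (simp add: ennreal_mult[symmetric] mult_ac)
      qed
    qed
  qed
  also have "\<dots> = ennreal (l / Gamma (1 - \<gamma>)) * ennreal (Gamma (1 - \<gamma>) / l powr (1 - \<gamma>))"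
    using \<gamma> l by (subst nn_integral_cmult, simp, subst nn_integral_Gamma) simp_all
  also have "\<dots> = ennreal (l powr \<gamma>)"
    using l G less_imp_neq[OF G] by (subst ennreal_mult[symmetric]) (auto simp: powr_diff)
  finally show ?thesis .
qed

section \<open>Mass partitions and local times\<close>

text \<open>Replaces the convergence of a real series by an identity between extended reals, from
  which measurability of \<open>Pinf\<close> is read off.\<close>

lemma Pinf_iff: "s \<in> Pinf \<longleftrightarrow> (\<forall>n. s (Suc n) \<le> s n) \<and> (\<forall>k. 0 \<le> s k) \<and> (\<Sum>i. ennreal (s i)) = 1"
proof -
  have "s sums 1 \<longleftrightarrow> (\<Sum>i. ennreal (s i)) = 1" if nn: "\<forall>k. 0 \<le> s k"
  proof
    assume "s sums 1"
    with nn have "(\<Sum>i. ennreal (s i)) = ennreal 1" by (intro suminf_ennreal_eq) auto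
    then show "(\<Sum>i. ennreal (s i)) = 1" by simp
  next
    assume 1: "(\<Sum>i. ennreal (s i)) = 1"
    have sm: "summable s" by (rule summable_suminf_not_top) (use nn 1 in auto)
    have "ennreal (suminf s) = (\<Sum>i. ennreal (s i))" by (rule suminf_ennreal2[symmetric]) (use nn sm in auto)
    then have "ennreal (suminf s) = ennreal 1" unfolding 1 by simp
    moreover have "0 \<le> suminf s" using sm nn by (intro suminf_nonneg) auto
    ultimately have "suminf s = 1" by (subst (asm) ennreal_inj) auto
    then show "s sums 1" using summable_sums[OF sm] by simp
  qed
  then show ?thesis unfolding Pinf_def decseq_Suc_iff by blast
qed

lemma Pinf_sets [measurable]: "Pinf \<in> sets seq_borel"
proof -
  have [measurable]: "(\<lambda>s. s i) \<in> borel_measurable seq_borel" for i :: nat by (rule measurable_component_singleton) simp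
  have [measurable]: "(\<lambda>s. \<Sum>i. ennreal (s i)) \<in> borel_measurable seq_borel" by measurable
  have "{s \<in> space seq_borel. (\<forall>n. s (Suc n) \<le> s n) \<and> (\<forall>k. 0 \<le> s k) \<and> (\<Sum>i. ennreal (s i)) = 1} \<in> sets seq_borel"
    by (intro sets.sets_Collect_conj sets.sets_Collect_countable_All borel_measurable_le borel_measurable_eq) simp_all
  moreover have "Pinf = {s \<in> space seq_borel. (\<forall>n. s (Suc n) \<le> s n) \<and> (\<forall>k. 0 \<le> s k) \<and> (\<Sum>i. ennreal (s i)) = 1}"
    by (rule set_eqI) (simp add: Pinf_iff space_PiM)
  ultimately show ?thesis by simp
qed

lemma space_PinfM [simp]: "space PinfM = Pinf" by (simp add: PinfM_def space_restrict_space space_PiM)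

lemma PinfM_measurable_id: "(\<lambda>p. p) \<in> PinfM \<rightarrow>\<^sub>M seq_borel" unfolding PinfM_def by (rule measurable_restrict_space1) simp

lemma PinfM_component: "(\<lambda>p. p i) \<in> borel_measurable PinfM"
  using measurable_compose[OF PinfM_measurable_id measurable_component_singleton[of i UNIV]] by simp

lemma measurable_PinfM: "f \<in> M \<rightarrow>\<^sub>M seq_borel \<Longrightarrow> (\<And>x. x \<in> space M \<Longrightarrow> f x \<in> Pinf) \<Longrightarrow> f \<in> M \<rightarrow>\<^sub>M PinfM"
  unfolding PinfM_def by (rule measurable_restrict_space2) auto

lemma sets_PinfM_subset: "A \<in> sets PinfM \<Longrightarrow> A \<in> sets seq_borel \<and> A \<subseteq> Pinf"
  using Pinf_sets by (auto simp: PinfM_def sets_restrict_space)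

lemma Pinf_props: assumes "p \<in> Pinf"
  shows "decseq p" "p \<longlonglongrightarrow> 0" "0 \<le> p i" "summable p" "suminf p = 1" "0 < x \<Longrightarrow> finite {i. x \<le> p i}"
proof -
  show *: "decseq p" "0 \<le> p i" "summable p" "suminf p = 1" using assms by (auto simp: Pinf_def sums_iff)
  show "p \<longlonglongrightarrow> 0" by (rule summable_LIMSEQ_zero) fact
  show "0 < x \<Longrightarrow> finite {i. x \<le> p i}" using summable_level_set[OF *(3)] by simp
qed

definition unit_seq :: "nat \<Rightarrow> real" where "unit_seq i = (if i = 0 then 1 else 0)"

lemma unit_seq_Pinf: "unit_seq \<in> Pinf"
proof -
  have "unit_seq sums (\<Sum>i\<in>{0}. unit_seq i)" by (rule sums_finite) (auto simp: unit_seq_def)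
  then show ?thesis by (auto simp: Pinf_def decseq_Suc_iff) (auto simp: unit_seq_def)
qed

text \<open>A random sequence of points is normalizable only almost surely; the default
  \<open>unit_seq\<close> makes the map total with values in \<open>Pinf\<close>, so that it can be
  composed with maps on \<open>PinfM\<close>.\<close>

definition normseq :: "(nat \<Rightarrow> real) \<Rightarrow> nat \<Rightarrow> real" where
  "normseq a = (let p = (\<lambda>i. a i / suminf a) in if p \<in> Pinf then p else unit_seq)"

lemma normseq_Pinf [simp]: "normseq a \<in> Pinf" by (simp add: normseq_def Let_def unit_seq_Pinf)

lemma normseq_measurable [measurable]: "normseq \<in> seq_borel \<rightarrow>\<^sub>M PinfM"
proof (rule measurable_PinfM)
  have *: "(\<lambda>a i. a i / suminf a) \<in> seq_borel \<rightarrow>\<^sub>M seq_borel" by (rule measurable_PiM_single') auto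
  have "{a \<in> space seq_borel. (\<lambda>i. a i / suminf a) \<in> Pinf} \<in> sets seq_borel"
    using measurable_sets[OF * Pinf_sets] by (simp add: vimage_def Int_def conj_commute)
  then show "normseq \<in> seq_borel \<rightarrow>\<^sub>M seq_borel"
    unfolding normseq_def Let_def by (intro measurable_If * measurable_const) (auto simp: space_PiM)
qed simp

lemma normseq_eqI:
  assumes "decseq a" "\<And>i. 0 \<le> a i" "summable a" "0 < suminf a"
  shows "normseq a = (\<lambda>i. a i / suminf a)"
proof -
  have "(\<lambda>i. a i / suminf a) \<in> Pinf" using assms sums_divide[OF summable_sums[OF assms(3)], of "suminf a"]
    by (auto simp: Pinf_def decseq_def intro!: divide_right_mono)
  then show ?thesis by (simp add: normseq_def)
qed

text \<open>The limit defining the local time may be taken along \<open>\<epsilon> = k\<^sup>2 powr (- 1 / \<gamma>)\<close>: the counts are monotone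
  in \<open>\<epsilon>\<close> and consecutive squares are asymptotically equal.\<close>

definition lt_eps :: "real \<Rightarrow> nat \<Rightarrow> real" where
  "lt_eps \<gamma> k = (real (Suc k))\<^sup>2 powr (- 1 / \<gamma>)"

lemma lt_eps_pos: "0 < lt_eps \<gamma> k" by (simp add: lt_eps_def)

lemma lt_eps_powr: "0 < \<gamma> \<Longrightarrow> lt_eps \<gamma> k powr \<gamma> = 1 / (real (Suc k))\<^sup>2"
  unfolding lt_eps_def powr_powr by (simp add: powr_neg_one del: of_nat_Suc)

lemma local_time_limit_iff:
  fixes p :: "nat \<Rightarrow> real"
  assumes \<gamma>: "0 < \<gamma>" and fin: "\<And>x. 0 < x \<Longrightarrow> finite {i. x \<le> p i}"
  shows "((\<lambda>\<epsilon>. \<epsilon> powr \<gamma> * real (card {i. \<epsilon> \<le> p i})) \<longlongrightarrow> L) (at_right 0) \<longleftrightarrow>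
    (\<lambda>k. real (card {i. lt_eps \<gamma> k \<le> p i}) / (real (Suc k))\<^sup>2) \<longlonglongrightarrow> L"
    (is "(?f \<longlongrightarrow> L) _ \<longleftrightarrow> ?c \<longlonglongrightarrow> L")
proof
  assume f: "(?f \<longlongrightarrow> L) (at_right 0)"
  have "filterlim (lt_eps \<gamma>) (at_right 0) sequentially"
  proof (rule tendsto_imp_filterlim_at_right)
    have "filterlim (\<lambda>k. (real (Suc k))\<^sup>2) at_top sequentially"
      by (intro filterlim_pow_at_top filterlim_compose[OF filterlim_real_sequentially filterlim_Suc]) simp
    then show "lt_eps \<gamma> \<longlonglongrightarrow> 0" unfolding lt_eps_def using \<gamma> by (intro tendsto_neg_powr) auto
  qed (simp add: lt_eps_pos)
  from filterlim_compose[OF f this] show "?c \<longlonglongrightarrow> L" using \<gamma> by (simp add: lt_eps_powr mult.commute)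
next
  assume c: "?c \<longlonglongrightarrow> L"
  define a where "a k = (real (Suc k))\<^sup>2" for k
  have a0: "0 < a k" for k by (simp add: a_def)
  \<comment> \<open>For \<epsilon> < 1 the value \<epsilon> powr (-\<gamma>) lies between the
    squares of \<kappa> + 1 and \<kappa> + 2; the subtracted 1 matches the \<open>Suc\<close> in
    \<open>lt_eps\<close>.\<close>
  define \<kappa> where "\<kappa> \<epsilon> = nat \<lfloor>sqrt (\<epsilon> powr (- \<gamma>))\<rfloor> - 1" for \<epsilon>
  have \<kappa>lim: "filterlim \<kappa> at_top (at_right 0)"
  proof -
    have "filterlim (\<lambda>\<epsilon>::real. \<epsilon> powr (- \<gamma>)) at_top (at_right 0)"
    proof -
      have 1: "((\<lambda>\<epsilon>::real. \<epsilon> powr \<gamma>) \<longlongrightarrow> 0) (at_right 0)"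
        by (rule tendsto_zero_powrI[OF tendsto_ident_at tendsto_const _ \<gamma>])
           (rule eventually_mono[OF eventually_at_right_less], simp)
      have "\<forall>\<^sub>F \<epsilon> in at_right (0::real). \<epsilon> powr \<gamma> \<in> {0<..}"
        using eventually_at_right_less[of "0::real"] by eventually_elim simp
      then have "filterlim (\<lambda>\<epsilon>::real. \<epsilon> powr \<gamma>) (at_right 0) (at_right 0)"
        using 1 by (intro tendsto_imp_filterlim_at_right) auto
      from filterlim_compose[OF filterlim_inverse_at_top_right this]
      show ?thesis by (simp add: powr_minus)
    qed
    then have "filterlim (\<lambda>\<epsilon>::real. nat \<lfloor>sqrt (\<epsilon> powr (- \<gamma>))\<rfloor>) at_top (at_right 0)"
      by (intro filterlim_compose[OF filterlim_nat_sequentially] filterlim_compose[OF filterlim_floor_sequentially] filterlim_compose[OF sqrt_at_top])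
    then show ?thesis unfolding \<kappa>_def by (rule filterlim_compose[OF filterlim_minus_const_nat_at_top])
  qed
  have ratio: "(\<lambda>k. a k / a (Suc k)) \<longlonglongrightarrow> 1"
  proof -
    have "(\<lambda>k. real (Suc k) / real (Suc (Suc k))) \<longlonglongrightarrow> 1" using LIMSEQ_Suc[OF LIMSEQ_n_over_Suc_n] by simp
    from tendsto_power[OF this, of 2] show ?thesis by (simp add: a_def power_divide del: of_nat_Suc)
  qed
  have lower: "(\<lambda>k. (a k / a (Suc k)) * ?c k) \<longlonglongrightarrow> L" using tendsto_mult[OF ratio c] by simp
  have upper: "(\<lambda>k. inverse (a k / a (Suc k)) * ?c (Suc k)) \<longlonglongrightarrow> L"
    using tendsto_mult[OF tendsto_inverse[OF ratio] LIMSEQ_Suc[OF c]] by simp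
  have sandwich: "\<forall>\<^sub>F \<epsilon> in at_right 0. (a (\<kappa> \<epsilon>) / a (Suc (\<kappa> \<epsilon>))) * ?c (\<kappa> \<epsilon>) \<le> ?f \<epsilon> \<and>
     ?f \<epsilon> \<le> inverse (a (\<kappa> \<epsilon>) / a (Suc (\<kappa> \<epsilon>))) * ?c (Suc (\<kappa> \<epsilon>))"
  proof -
    have "\<forall>\<^sub>F \<epsilon> in at_right (0::real). \<epsilon> < 1"
      using eventually_at_right_real[of 0 "1::real"] by (auto elim: eventually_mono)
    then show ?thesis using eventually_at_right_less[of "0::real"]
    proof eventually_elim
      case (elim \<epsilon>)
      let ?k = "\<kappa> \<epsilon>" and ?x = "\<epsilon> powr (- \<gamma>)"
      have x1: "1 \<le> ?x" using elim \<gamma> powr_mono2'[of "- \<gamma>" \<epsilon> 1] by simp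
      then have s1: "1 \<le> \<lfloor>sqrt ?x\<rfloor>" by (simp add: le_floor_iff)
      then have Suck: "real (Suc ?k) = of_int \<lfloor>sqrt ?x\<rfloor>" unfolding \<kappa>_def by simp
      have l: "a ?k \<le> ?x"
      proof -
        have "real (Suc ?k) \<le> sqrt ?x" unfolding Suck by (rule of_int_floor_le)
        then have "(real (Suc ?k))\<^sup>2 \<le> (sqrt ?x)\<^sup>2" by (intro power_mono) auto
        then show ?thesis using x1 by (simp add: a_def)
      qed
      have u: "?x \<le> a (Suc ?k)"
      proof -
        have "real (Suc (Suc ?k)) = of_int \<lfloor>sqrt ?x\<rfloor> + 1" using Suck by simp
        then have "sqrt ?x \<le> real (Suc (Suc ?k))" using real_of_int_floor_add_one_ge[of "sqrt ?x"] by linarith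
        then have "(sqrt ?x)\<^sup>2 \<le> (real (Suc (Suc ?k)))\<^sup>2" using x1 by (intro power_mono) auto
        then show ?thesis using x1 by (simp add: a_def)
      qed
      have bk: "?x powr (- 1 / \<gamma>) = \<epsilon>" using elim \<gamma> by (simp add: powr_powr)
      have e1: "\<epsilon> \<le> lt_eps \<gamma> ?k"
        unfolding lt_eps_def a_def[symmetric] using powr_mono2'[of "- 1 / \<gamma>" "a ?k" ?x] l a0 \<gamma> bk by simp
      have e2: "lt_eps \<gamma> (Suc ?k) \<le> \<epsilon>"
        unfolding lt_eps_def a_def[symmetric] using powr_mono2'[of "- 1 / \<gamma>" ?x "a (Suc ?k)"] u x1 \<gamma> bk elim by simp
      have c1: "card {i. lt_eps \<gamma> ?k \<le> p i} \<le> card {i. \<epsilon> \<le> p i}" using e1 elim by (intro card_mono fin) auto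
      have c2: "card {i. \<epsilon> \<le> p i} \<le> card {i. lt_eps \<gamma> (Suc ?k) \<le> p i}" using e2 by (intro card_mono fin lt_eps_pos) auto
      have einv: "\<epsilon> powr \<gamma> = 1 / ?x" by (simp add: powr_minus_divide)
      have p1: "1 / a (Suc ?k) \<le> \<epsilon> powr \<gamma>" unfolding einv using u x1 a0[of "Suc ?k"] by (intro divide_left_mono mult_pos_pos) linarith+
      have p2: "\<epsilon> powr \<gamma> \<le> 1 / a ?k" unfolding einv using l x1 a0[of ?k] by (intro divide_left_mono mult_pos_pos) linarith+
      have "(a ?k / a (Suc ?k)) * ?c ?k = 1 / a (Suc ?k) * real (card {i. lt_eps \<gamma> ?k \<le> p i})"
        using a0[of ?k] by (simp add: a_def del: of_nat_Suc)
      also have "\<dots> \<le> ?f \<epsilon>" using p1 c1 by (intro mult_mono) auto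
      finally have A: "(a ?k / a (Suc ?k)) * ?c ?k \<le> ?f \<epsilon>" .
      have "?f \<epsilon> \<le> 1 / a ?k * real (card {i. lt_eps \<gamma> (Suc ?k) \<le> p i})" using p2 c2 a0[of ?k] by (intro mult_mono) auto
      also have "\<dots> = inverse (a ?k / a (Suc ?k)) * ?c (Suc ?k)"
        using a0[of "Suc ?k"] by (simp add: a_def del: of_nat_Suc)
      finally show ?case using A by simp
    qed
  qed
  show "(?f \<longlongrightarrow> L) (at_right 0)"
    by (rule real_tendsto_sandwich[OF _ _ filterlim_compose[OF lower \<kappa>lim] filterlim_compose[OF upper \<kappa>lim]];
        rule eventually_mono[OF sandwich]) auto
qed

text \<open>Holds whether or not the limit exists: both limits are chosen by description from
  equivalent predicates, since \<open>local_time_limit_iff\<close> is an equivalence for every L.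
  The right side is a countable limit, hence measurable.\<close>

lemma local_time_eq_lim:
  assumes "0 < \<gamma>" "p \<in> Pinf"
  shows "local_time \<gamma> p = Gamma (1 - \<gamma>) * lim (\<lambda>k. enn2real (\<Sum>i. indicator {lt_eps \<gamma> k..} (p i)) / (real (Suc k))\<^sup>2)"
proof -
  have fin: "0 < x \<Longrightarrow> finite {i. x \<le> p i}" for x using Pinf_props(6)[OF assms(2)] .
  have "(\<Sum>i. indicator {e..} (p i) :: ennreal) = (\<Sum>i. indicator {i. e \<le> p i} i)" for e
    by (intro suminf_cong) (auto split: split_indicator)
  then have "enn2real (\<Sum>i. indicator {lt_eps \<gamma> k..} (p i)) = real (card {i. lt_eps \<gamma> k \<le> p i})" for k
    by (simp add: suminf_indicator_card[OF fin[OF lt_eps_pos]])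
  moreover have "Lim (at_right 0) (\<lambda>\<epsilon>. \<epsilon> powr \<gamma> * real (card {i. \<epsilon> \<le> p i}))
      = lim (\<lambda>k. real (card {i. lt_eps \<gamma> k \<le> p i}) / (real (Suc k))\<^sup>2)"
    by (simp only: Topological_Spaces.Lim_def local_time_limit_iff[OF assms(1) fin])
  ultimately show ?thesis unfolding local_time_def by (simp only:)
qed

lemma inverse_local_time_measurable [measurable]:
  assumes "0 < \<gamma>"
  shows "inverse_local_time \<gamma> \<in> borel_measurable PinfM"
proof -
  note [measurable] = PinfM_component
  have [measurable]: "(\<lambda>p. lim (\<lambda>k. enn2real (\<Sum>i. indicator {lt_eps \<gamma> k..} (p i)) / (real (Suc k))\<^sup>2)) \<in> borel_measurable PinfM"
    by (rule borel_measurable_lim_metric) measurable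
  have "local_time \<gamma> \<in> borel_measurable PinfM \<longleftrightarrow> (\<lambda>p. Gamma (1 - \<gamma>) * lim (\<lambda>k. enn2real (\<Sum>i. indicator {lt_eps \<gamma> k..} (p i)) / (real (Suc k))\<^sup>2)) \<in> borel_measurable PinfM"
    by (rule measurable_cong) (simp add: local_time_eq_lim[OF assms])
  then have [measurable]: "local_time \<gamma> \<in> borel_measurable PinfM" by simp
  show ?thesis unfolding inverse_local_time_def[abs_def] by measurable
qed

lemma Gamma_plus1_pos: "0 < x \<Longrightarrow> Gamma (x + 1) = x * Gamma (x :: real)"
  by (rule Gamma_plus1) (auto dest: nonpos_Ints_nonpos)

lemma ennreal_frac_inverse:
  assumes "0 < a" "0 < b"
  shows "z = ennreal (a / b) * (ennreal (b / a) * z)"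
  using assms by (simp add: mult.assoc[symmetric] ennreal_mult[symmetric])

context stable_points
begin

abbreviation T :: "'w \<Rightarrow> real" where "T \<equiv> total J"

lemma T_meas [measurable]: "T \<in> borel_measurable W" unfolding total_def[abs_def] by measurable

lemma pexp_linear:
  assumes l: "0 < l"
  shows "pexp (\<lambda>x. ennreal (l * x)) = ennreal (l powr \<gamma>)"
proof -
  have "pexp (\<lambda>x. ennreal (l * x)) = (\<integral>\<^sup>+x. ennreal (1 - exp (- (l * x))) \<partial>\<nu>)" unfolding pexp_def
    by (rule nn_integral_cong_eventually[OF AE_stable_intensity_pos])
       (use l in \<open>simp add: one_minus_nexp\<close>)
  then show ?thesis using nn_integral_stable_laplace[OF \<gamma> l] by simp
qed

lemma AE_sum_scale: "AE w in W. \<forall>l\<ge>0. (\<Sum>i. ennreal (l * J i w)) = ennreal l * (\<Sum>i. ennreal (J i w))" using AE_J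
proof eventually_elim
  case (elim w)
  have "ennreal (l * J i w) = ennreal l * ennreal (J i w)" if "0 \<le> l" for l i
    using that elim by (intro ennreal_mult) (auto intro: less_imp_le)
  then show ?case by simp
qed

lemma laplace_sum:
  assumes l: "0 < l"
  shows "(\<integral>\<^sup>+w. nexp (ennreal l * (\<Sum>i. ennreal (J i w))) \<partial>W) = ennreal (exp (- (l powr \<gamma>)))"
proof -
  have "(\<integral>\<^sup>+w. nexp (ennreal l * (\<Sum>i. ennreal (J i w))) \<partial>W) = (\<integral>\<^sup>+w. nexp (\<Sum>i. ennreal (l * J i w)) \<partial>W)"
    by (rule nn_integral_cong_eventually[OF AE_sum_scale]) (use l in simp)
  also have "\<dots> = nexp (pexp (\<lambda>x. ennreal (l * x)))" by (rule laplace_functional) simp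
  finally show ?thesis using pexp_linear[OF l] by (simp add: nexp_ennreal)
qed

text \<open>As l decreases to 0, the mean of exp(-l S) tends to the probability that S is finite,
  while its value exp(- l powr \<gamma>) tends to 1.\<close>

lemma AE_sum_finite: "AE w in W. (\<Sum>i. ennreal (J i w)) < \<top>"
proof -
  define S where "S w = (\<Sum>i. ennreal (J i w))" for w
  have [measurable]: "S \<in> borel_measurable W" unfolding S_def by measurable
  define l where "l n = 1 / real (Suc n)" for n
  have l0: "0 < l n" for n by (simp add: l_def)
  have l_lim: "l \<longlonglongrightarrow> 0" unfolding l_def using LIMSEQ_inverse_real_of_nat by (simp add: inverse_eq_divide)
  have "(\<lambda>n. \<integral>\<^sup>+w. nexp (ennreal (l n) * S w) \<partial>W) \<longlonglongrightarrow> (\<integral>\<^sup>+w. indicator {w\<in>space W. S w < \<top>} w \<partial>W)"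
  proof (rule nn_integral_nexp_tendsto[OF prob_space_axioms])
    show "AE w in W. (\<lambda>n. nexp (ennreal (l n) * S w)) \<longlonglongrightarrow> indicator {w\<in>space W. S w < \<top>} w"
    proof (rule AE_I2)
      fix w assume w: "w \<in> space W"
      show "(\<lambda>n. nexp (ennreal (l n) * S w)) \<longlonglongrightarrow> indicator {w\<in>space W. S w < \<top>} w"
      proof (cases "S w" rule: ennreal_cases)
        case (real r)
        have "(\<lambda>n. ennreal (exp (- (l n * r)))) \<longlonglongrightarrow> ennreal (exp (- (0 * r)))"
          by (intro tendsto_ennrealI tendsto_exp tendsto_minus tendsto_mult l_lim tendsto_const)
        moreover have "nexp (ennreal (l n) * S w) = ennreal (exp (- (l n * r)))" for n
          using real l0[of n] by (simp add: ennreal_mult[symmetric] nexp_ennreal)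
        ultimately show ?thesis using real w by simp
      next
        case top
        then have "nexp (ennreal (l n) * S w) = 0" for n using l0[of n] by (simp add: ennreal_mult_top)
        then show ?thesis using top by simp
      qed
    qed
  qed auto
  moreover have "(\<lambda>n. \<integral>\<^sup>+w. nexp (ennreal (l n) * S w) \<partial>W) \<longlonglongrightarrow> ennreal (exp (- 0))"
  proof -
    have "(\<lambda>n. ennreal (exp (- (l n powr \<gamma>)))) \<longlonglongrightarrow> ennreal (exp (- 0))"
      by (intro tendsto_ennrealI tendsto_exp tendsto_minus tendsto_zero_powrI[OF l_lim tendsto_const _ \<gamma>(1)])
         (use l0 in \<open>auto intro!: always_eventually less_imp_le\<close>)
    then show ?thesis using laplace_sum[OF l0] by (simp add: S_def)
  qed
  ultimately have "(\<integral>\<^sup>+w. indicator {w\<in>space W. S w < \<top>} w \<partial>W) = 1" using LIMSEQ_unique by fastforce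
  then have "emeasure W {w\<in>space W. S w < \<top>} = 1" by simp
  then have "AE w in W. w \<in> {w\<in>space W. S w < \<top>}" by (intro AE_in_set_eq_1[THEN iffD2]) (auto simp: measure_def)
  then show ?thesis unfolding S_def by (rule eventually_mono) auto
qed

lemma AE_T: "AE w in W. summable (\<lambda>i. J i w) \<and> (\<Sum>i. ennreal (J i w)) = ennreal (T w) \<and> 0 < T w" using AE_sum_finite AE_J
proof eventually_elim
  case (elim w)
  have pos: "0 < J i w" for i using elim(2) by simp
  have sm: "summable (\<lambda>i. J i w)" by (rule summable_suminf_not_top) (use elim(1) pos in \<open>auto intro: less_imp_le\<close>)
  moreover have "(\<Sum>i. ennreal (J i w)) = ennreal (T w)"
    unfolding total_def by (rule suminf_ennreal2[OF _ sm]) (use pos in \<open>auto intro: less_imp_le\<close>)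
  moreover have "0 < T w" unfolding total_def by (rule suminf_pos[OF sm pos])
  ultimately show ?case by simp
qed

lemma laplace_T:
  assumes l: "0 \<le> l"
  shows "(\<integral>\<^sup>+w. ennreal (exp (- (l * T w))) \<partial>W) = ennreal (exp (- (l powr \<gamma>)))"
proof (cases "l = 0")
  case False
  with l have l: "0 < l" by simp
  have "(\<integral>\<^sup>+w. ennreal (exp (- (l * T w))) \<partial>W) = (\<integral>\<^sup>+w. nexp (ennreal l * (\<Sum>i. ennreal (J i w))) \<partial>W)"
    by (rule nn_integral_cong_eventually[OF AE_T])
       (use l in \<open>simp add: ennreal_mult[symmetric] nexp_ennreal\<close>)
  then show ?thesis using laplace_sum[OF l] by simp
qed (simp add: emeasure_space_1)

text \<open>Version of \<open>normalized J\<close> that lies in \<open>Pinf\<close> for every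
  outcome; the two agree almost surely by \<open>AE_X\<close>.\<close>

definition X :: "'w \<Rightarrow> nat \<Rightarrow> real" where "X w = normseq (\<lambda>i. J i w)"

lemma J_seq_meas [measurable]: "(\<lambda>w i. J i w) \<in> W \<rightarrow>\<^sub>M seq_borel" by (rule measurable_PiM_single') auto

lemma X_meas [measurable]: "X \<in> W \<rightarrow>\<^sub>M PinfM" unfolding X_def by measurable

lemma X_Pinf [simp]: "X w \<in> Pinf" by (simp add: X_def)

lemma AE_X: "AE w in W. normalized J w = X w \<and> (\<forall>i. J i w = T w * X w i)" using AE_T AE_J_decseq AE_J
proof eventually_elim
  case (elim w)
  have "X w = (\<lambda>i. J i w / suminf (\<lambda>i. J i w))"
    unfolding X_def using elim by (intro normseq_eqI) (auto simp: total_def intro: less_imp_le)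
  with elim show ?case by (auto simp: normalized_def total_def)
qed

end

section \<open>Tilting by powers of the total mass\<close>

text \<open>Difference quotient of 1 - exp(- c x) in c with c = 1 / 2 ^ n. Halving c makes it
  increase, because the increment is a multiple of a square; monotone convergence then takes the
  derivative at c = 0.\<close>

definition hexp :: "nat \<Rightarrow> real \<Rightarrow> real" where "hexp n x = 2 ^ n * (1 - exp (- x / 2 ^ n))"

lemma hexp_nonneg: "0 \<le> x \<Longrightarrow> 0 \<le> hexp n x" by (simp add: hexp_def)

lemma hexp_le: "hexp n x \<le> x" using exp_ge_add_one_self[of "- x / 2 ^ n"] by (simp add: hexp_def field_simps)

lemma hexp_Suc: "hexp n x \<le> hexp (Suc n) x"
proof -
  define e where "e = exp (- x / 2 ^ Suc n)"
  have e2: "exp (- x / 2 ^ n) = e ^ 2" by (simp add: e_def exp_double[symmetric])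
  have "hexp (Suc n) x = 2 ^ Suc n * (1 - e)" "hexp n x = 2 ^ n * (1 - e\<^sup>2)" by (simp_all only: hexp_def e_def e2)
  then have "hexp (Suc n) x - hexp n x = 2 ^ n * (1 - e)\<^sup>2" by (simp add: power2_eq_square algebra_simps)
  then show ?thesis by (metis diff_ge_0_iff_ge mult_nonneg_nonneg zero_le_power zero_le_numeral zero_le_power2)
qed

lemma hexp_ge: "0 \<le> x \<Longrightarrow> x / (1 + x / 2 ^ n) \<le> hexp n x"
proof -
  assume x: "0 \<le> x"
  define y where "y = x / 2 ^ n"
  have y: "0 \<le> y" "x = 2 ^ n * y" using x by (simp_all add: y_def)
  have "exp (- y) \<le> 1 / (1 + y)" using exp_ge_add_one_self[of y] y by (simp add: exp_minus inverse_eq_divide frac_le)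
  then have "y / (1 + y) \<le> 1 - exp (- y)" using y by (simp add: field_simps)
  then have "2 ^ n * (y / (1 + y)) \<le> 2 ^ n * (1 - exp (- y))" by (intro mult_left_mono) auto
  moreover have "hexp n x = 2 ^ n * (1 - exp (- y))" unfolding hexp_def by (simp add: y_def)
  moreover have "x / (1 + x / 2 ^ n) = 2 ^ n * (y / (1 + y))" unfolding y_def[symmetric] using y by simp
  ultimately show ?thesis by simp
qed

text \<open>The argument may vary with n, because the exponent of the Laplace functional is itself
  approximated at step n.\<close>

lemma hexp_tendsto:
  assumes y: "y \<longlonglongrightarrow> l" "\<And>n. 0 \<le> y n"
  shows "(\<lambda>n. hexp n (y n)) \<longlonglongrightarrow> l"
proof (rule real_tendsto_sandwich[OF _ _ _ y(1)])
  have i2: "(\<lambda>n. inverse (2::real) ^ n) \<longlonglongrightarrow> 0" by (rule LIMSEQ_power_zero) simp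
  have "(\<lambda>n. y n / (1 + y n * inverse 2 ^ n)) \<longlonglongrightarrow> l / (1 + l * 0)"
    by (intro tendsto_divide tendsto_add tendsto_mult tendsto_const y(1) i2) simp
  then show "(\<lambda>n. y n / (1 + y n / 2 ^ n)) \<longlonglongrightarrow> l" by (simp add: inverse_eq_divide power_one_over)
  show "\<forall>\<^sub>F n in sequentially. y n / (1 + y n / 2 ^ n) \<le> hexp n (y n)" using hexp_ge y(2) by simp
  show "\<forall>\<^sub>F n in sequentially. hexp n (y n) \<le> y n" using hexp_le by simp
qed

text \<open>Coordinates x = l * r and y = l * (1 - r): total size and proportion of the first part,
  with Jacobian l.\<close>

lemma nn_integral_convolution:
  fixes f g :: "real \<Rightarrow> ennreal"
  assumes [measurable]: "f \<in> borel_measurable borel" "g \<in> borel_measurable borel"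
  shows "(\<integral>\<^sup>+x\<in>{0<..}. f x \<partial>lborel) * (\<integral>\<^sup>+y\<in>{0<..}. g y \<partial>lborel)
    = (\<integral>\<^sup>+l. ennreal l * (\<integral>\<^sup>+r\<in>{0<..<1}. f (l * r) * g (l * (1 - r)) \<partial>lborel) * indicator {0<..} l \<partial>lborel)"
proof -
  let ?i = "indicator {0<..} :: real \<Rightarrow> ennreal"
  have "(\<integral>\<^sup>+x. f x * ?i x \<partial>lborel) * (\<integral>\<^sup>+y. g y * ?i y \<partial>lborel) = (\<integral>\<^sup>+x. f x * ?i x * (\<integral>\<^sup>+y. g y * ?i y \<partial>lborel) \<partial>lborel)"
    by (rule nn_integral_multc[symmetric]) simp
  also have "\<dots> = (\<integral>\<^sup>+x. (\<integral>\<^sup>+l. f x * ?i x * (g (l - x) * ?i (l - x)) \<partial>lborel) \<partial>lborel)"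
  proof (rule nn_integral_cong)
    fix x :: real
    have "(\<integral>\<^sup>+y. g y * ?i y \<partial>lborel) = (\<integral>\<^sup>+l. g (l - x) * ?i (l - x) \<partial>lborel)"
      using nn_integral_real_affine[of "\<lambda>y. g y * ?i y" 1 "- x"] by (simp add: algebra_simps)
    then show "f x * ?i x * (\<integral>\<^sup>+y. g y * ?i y \<partial>lborel) = (\<integral>\<^sup>+l. f x * ?i x * (g (l - x) * ?i (l - x)) \<partial>lborel)"
      by (simp add: nn_integral_cmult)
  qed
  also have "\<dots> = (\<integral>\<^sup>+l. (\<integral>\<^sup>+x. f x * ?i x * (g (l - x) * ?i (l - x)) \<partial>lborel) \<partial>lborel)"
    by (rule lborel_pair.Fubini') simp
  also have "\<dots> = (\<integral>\<^sup>+l. ennreal l * (\<integral>\<^sup>+r\<in>{0<..<1}. f (l * r) * g (l * (1 - r)) \<partial>lborel) * ?i l \<partial>lborel)"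
  proof (rule nn_integral_cong)
    fix l :: real
    show "(\<integral>\<^sup>+x. f x * ?i x * (g (l - x) * ?i (l - x)) \<partial>lborel)
      = ennreal l * (\<integral>\<^sup>+r\<in>{0<..<1}. f (l * r) * g (l * (1 - r)) \<partial>lborel) * ?i l"
    proof (cases "0 < l")
      case False
      then have z: "f x * ?i x * (g (l - x) * ?i (l - x)) = 0" for x by (auto split: split_indicator)
      show ?thesis unfolding z using False by simp
    next
      case True
      have "(\<integral>\<^sup>+x. f x * ?i x * (g (l - x) * ?i (l - x)) \<partial>lborel)
        = ennreal \<bar>l\<bar> * (\<integral>\<^sup>+r. f (0 + l * r) * ?i (0 + l * r) * (g (l - (0 + l * r)) * ?i (l - (0 + l * r))) \<partial>lborel)"
        by (rule nn_integral_real_affine) (use True in auto)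
      also have "(\<integral>\<^sup>+r. f (0 + l * r) * ?i (0 + l * r) * (g (l - (0 + l * r)) * ?i (l - (0 + l * r))) \<partial>lborel)
        = (\<integral>\<^sup>+r\<in>{0<..<1}. f (l * r) * g (l * (1 - r)) \<partial>lborel)"
      proof (rule nn_integral_cong)
        fix r :: real
        have "l - l * r = l * (1 - r)" by (simp add: algebra_simps)
        moreover have "0 < l * r \<longleftrightarrow> 0 < r" "0 < l * (1 - r) \<longleftrightarrow> r < 1" using True by (simp_all add: zero_less_mult_iff)
        ultimately show "f (0 + l * r) * ?i (0 + l * r) * (g (l - (0 + l * r)) * ?i (l - (0 + l * r))) = f (l * r) * g (l * (1 - r)) * indicator {0<..<1} r"
          by (auto split: split_indicator)
      qed
      finally show ?thesis using True by simp
    qed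
  qed
  finally show ?thesis .
qed

lemma ennreal_one_minus_mult: "a \<le> 1 \<Longrightarrow> b \<le> 1 \<Longrightarrow> 1 - a * b = (1 - a) + a * (1 - b :: ennreal)"
proof -
  assume a: "a \<le> 1" and b: "b \<le> 1"
  then obtain x y where xy: "a = ennreal x" "b = ennreal y" "0 \<le> x" "0 \<le> y" "x \<le> 1" "y \<le> 1"
    by (cases a rule: ennreal_cases; cases b rule: ennreal_cases) (auto simp: top_unique)
  have "x * y \<le> 1" using xy by (simp add: mult_le_one)
  have m: "1 - ennreal z = ennreal (1 - z)" if "0 \<le> z" for z using ennreal_minus[OF that, of 1] by simp
  have "(1 - a) + a * (1 - b) = ennreal (1 - x) + ennreal (x * (1 - y))"
    unfolding xy using xy by (simp add: m ennreal_mult)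
  also have "\<dots> = ennreal (1 - x + x * (1 - y))" by (rule ennreal_plus[symmetric]) (use xy in auto)
  also have "1 - x + x * (1 - y) = 1 - x * y" by (simp add: algebra_simps)
  also have "ennreal (1 - x * y) = 1 - a * b" unfolding xy using xy by (simp add: m ennreal_mult[symmetric])
  finally show ?thesis by simp
qed

text \<open>Applied twice in \<open>nn_integral_T_nexp\<close>: with t the total mass for a fixed
  outcome, and with t = d n for the exponent.\<close>

lemma ennreal_diff_quotient:
  assumes c: "0 < c" and r: "0 \<le> r" and t: "0 \<le> t"
  shows "ennreal (1 / c) * (ennreal r - ennreal r * ennreal (exp (- (c * t)))) = ennreal (1 / c * (1 - exp (- (c * t)))) * ennreal r"
proof -
  define e where "e = exp (- (c * t))"
  have e: "0 \<le> e" "e \<le> 1" using c t by (auto simp: e_def)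
  have "ennreal r - ennreal r * ennreal e = ennreal (r - r * e)"
    using r e by (simp add: ennreal_mult[symmetric] ennreal_minus)
  then have "ennreal (1 / c) * (ennreal r - ennreal r * ennreal e) = ennreal (1 / c) * ennreal (r - r * e)" by simp
  also have "\<dots> = ennreal (1 / c * (r - r * e))"
    by (rule ennreal_mult[symmetric]) (use c mult_left_mono[OF e(2) r] in auto)
  also have "1 / c * (r - r * e) = 1 / c * (1 - e) * r" using c by (simp add: field_simps)
  also have "ennreal \<dots> = ennreal (1 / c * (1 - e)) * ennreal r" using c r e by (intro ennreal_mult) auto
  finally show ?thesis unfolding e_def .
qed

context stable_points
begin

text \<open>Directional derivative of \<open>pexp\<close> at \<phi> along the identity; it is the
  factor in the Palm formula for the total mass.\<close>

definition tilt_int :: "(real \<Rightarrow> ennreal) \<Rightarrow> ennreal" where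
  "tilt_int \<phi> = (\<integral>\<^sup>+x. ennreal x * nexp (\<phi> x) \<partial>\<nu>)"

lemma pexp_add_linear:
  assumes [measurable]: "\<phi> \<in> borel_measurable borel" and c: "0 \<le> c"
  shows "pexp (\<lambda>x. \<phi> x + ennreal (c * x)) = pexp \<phi> + (\<integral>\<^sup>+x. nexp (\<phi> x) * ennreal (1 - exp (- (c * x))) \<partial>\<nu>)"
proof -
  have "pexp (\<lambda>x. \<phi> x + ennreal (c * x)) = (\<integral>\<^sup>+x. (1 - nexp (\<phi> x)) + nexp (\<phi> x) * ennreal (1 - exp (- (c * x))) \<partial>\<nu>)"
    unfolding pexp_def
  proof (rule nn_integral_cong_eventually[OF AE_stable_intensity_pos])
    fix x :: real assume "0 < x"
    then have "1 - nexp (ennreal (c * x)) = ennreal (1 - exp (- (c * x)))" using c by (intro one_minus_nexp) simp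
    then show "1 - nexp (\<phi> x + ennreal (c * x)) = (1 - nexp (\<phi> x)) + nexp (\<phi> x) * ennreal (1 - exp (- (c * x)))"
      unfolding nexp_add by (subst ennreal_one_minus_mult) auto
  qed
  also have "\<dots> = pexp \<phi> + (\<integral>\<^sup>+x. nexp (\<phi> x) * ennreal (1 - exp (- (c * x))) \<partial>\<nu>)"
    unfolding pexp_def by (rule nn_integral_add) measurable
  finally show ?thesis .
qed

text \<open>The derivative of the Laplace functional in the direction of the identity, taken along the monotone
  difference quotients \<open>hexp\<close>.\<close>

lemma nn_integral_T_nexp:
  assumes [measurable]: "\<phi> \<in> borel_measurable borel" and fin: "tilt_int \<phi> < \<top>"
  shows "(\<integral>\<^sup>+w. ennreal (T w) * nexp (\<Sum>i. \<phi> (J i w)) \<partial>W) = tilt_int \<phi> * nexp (pexp \<phi>)"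
proof -
  define N where "N w = nexp (\<Sum>i. \<phi> (J i w))" for w
  define c where "c n = 1 / (2::real) ^ n" for n
  let ?e = "\<lambda>n w. ennreal (exp (- (c n * T w)))"
  have c0: "0 < c n" for n by (simp add: c_def)
  have hx: "hexp n x = 1 / c n * (1 - exp (- (c n * x)))" for n x by (simp add: hexp_def c_def)
  have [measurable]: "N \<in> borel_measurable W" unfolding N_def by measurable
  have [measurable]: "hexp n \<in> borel_measurable borel" for n unfolding hexp_def[abs_def] by measurable
  have inc: "incseq (\<lambda>n w. ennreal (hexp n (f w)) * g w)" for f :: "'z \<Rightarrow> real" and g
    by (intro incseq_SucI le_funI mult_right_mono ennreal_leI hexp_Suc) simp
  have lim: "(\<lambda>n. ennreal (hexp n (max 0 x)) * z) \<longlonglongrightarrow> ennreal (max 0 x) * z" if "z < \<top>" for x and z :: ennreal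
    using ennreal_tendsto_cmult[OF that tendsto_ennrealI[OF hexp_tendsto[OF tendsto_const]], of "max 0 x"]
    by (simp add: mult.commute)
  \<comment> \<open>\<open>T\<close> is nonnegative only almost surely; the maximum with 0 lets the
    limit of \<open>hexp\<close> be taken at every outcome.\<close>
  have T0: "AE w in W. max 0 (T w) = T w" using AE_T by eventually_elim simp
  define D where "D n = (\<integral>\<^sup>+x. ennreal (hexp n (max 0 x)) * nexp (\<phi> x) \<partial>\<nu>)" for n
  have Dlim: "D \<longlonglongrightarrow> tilt_int \<phi>"
  proof -
    have "(\<lambda>n. \<integral>\<^sup>+x. ennreal (hexp n (max 0 x)) * nexp (\<phi> x) \<partial>\<nu>) \<longlonglongrightarrow> (\<integral>\<^sup>+x. ennreal (max 0 x) * nexp (\<phi> x) \<partial>\<nu>)"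
      by (rule nn_integral_LIMSEQ[OF inc _ lim]) auto
    moreover have "(\<integral>\<^sup>+x. ennreal (max 0 x) * nexp (\<phi> x) \<partial>\<nu>) = tilt_int \<phi>"
      unfolding tilt_int_def by (intro nn_integral_cong) (simp add: max_def ennreal_neg)
    ultimately show ?thesis by (simp add: D_def[abs_def])
  qed
  have Dle: "D n \<le> tilt_int \<phi>" for n unfolding D_def tilt_int_def
  proof (intro nn_integral_mono mult_right_mono)
    fix x show "ennreal (hexp n (max 0 x)) \<le> ennreal x"
      using ennreal_leI[OF hexp_le[of n "max 0 x"]] by (simp add: max_def ennreal_neg split: if_splits)
  qed simp
  obtain d where d: "\<And>n. D n = ennreal (d n)" "\<And>n. 0 \<le> d n"
  proof
    show "D n = ennreal (enn2real (D n))" "0 \<le> enn2real (D n)" for n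
      using le_less_trans[OF Dle fin, of n] by (simp_all add: ennreal_enn2real)
  qed
  obtain \<delta> where \<delta>: "tilt_int \<phi> = ennreal \<delta>" "0 \<le> \<delta>" using fin by (cases "tilt_int \<phi>" rule: ennreal_cases) auto
  have dlim: "d \<longlonglongrightarrow> \<delta>" using Dlim unfolding d(1) \<delta>(1) by (rule tendsto_ennrealD) (use d \<delta> in auto)
  \<comment> \<open>The factor exp(- c * T) adds c times the identity to the test function, so the
    Laplace functional evaluates both terms of the difference quotient; the exponent increases by c
    * d n.\<close>
  have step: "(\<integral>\<^sup>+w. ennreal (hexp n (max 0 (T w))) * N w \<partial>W) = ennreal (hexp n (d n)) * nexp (pexp \<phi>)" for n
  proof -
    have int1: "(\<integral>\<^sup>+w. N w * ?e n w \<partial>W) = nexp (pexp \<phi>) * ennreal (exp (- (c n * d n)))"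
    proof -
      have "(\<integral>\<^sup>+w. N w * ?e n w \<partial>W) = (\<integral>\<^sup>+w. nexp (\<Sum>i. \<phi> (J i w) + ennreal (c n * J i w)) \<partial>W)"
      proof (rule nn_integral_cong_AE)
        show "AE w in W. N w * ?e n w = nexp (\<Sum>i. \<phi> (J i w) + ennreal (c n * J i w))" using AE_T AE_sum_scale
        proof eventually_elim
          case (elim w)
          have "(\<Sum>i. \<phi> (J i w) + ennreal (c n * J i w)) = (\<Sum>i. \<phi> (J i w)) + ennreal (c n * T w)"
            using elim c0[of n] by (subst suminf_add[symmetric]) (auto simp: ennreal_mult)
          then show ?case using elim c0[of n] by (simp add: nexp_add N_def nexp_ennreal)
        qed
      qed
      also have "\<dots> = nexp (pexp (\<lambda>x. \<phi> x + ennreal (c n * x)))" by (rule laplace_functional) simp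
      also have "pexp (\<lambda>x. \<phi> x + ennreal (c n * x)) = pexp \<phi> + ennreal (c n * d n)"
      proof -
        have "(\<integral>\<^sup>+x. nexp (\<phi> x) * ennreal (1 - exp (- (c n * x))) \<partial>\<nu>) = (\<integral>\<^sup>+x. ennreal (c n) * (ennreal (hexp n (max 0 x)) * nexp (\<phi> x)) \<partial>\<nu>)"
        proof (rule nn_integral_cong_eventually[OF AE_stable_intensity_pos])
          fix x :: real assume x: "0 < x"
          have "ennreal (c n) * ennreal (hexp n x) = ennreal (1 - exp (- (c n * x)))"
            using c0[of n] x by (subst ennreal_mult[symmetric]) (auto simp: hexp_nonneg hx)
          moreover have "max 0 x = x" using x by simp
          ultimately show "nexp (\<phi> x) * ennreal (1 - exp (- (c n * x))) = ennreal (c n) * (ennreal (hexp n (max 0 x)) * nexp (\<phi> x))"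
            by (metis mult.assoc mult.commute)
        qed
        also have "\<dots> = ennreal (c n * d n)"
          using c0[of n] d by (subst nn_integral_cmult) (auto simp: D_def[symmetric] ennreal_mult)
        finally show ?thesis using pexp_add_linear[of \<phi> "c n"] c0[of n] by simp
      qed
      finally show ?thesis using c0[of n] d(2)[of n] by (simp add: nexp_add nexp_ennreal)
    qed
    have N1: "(\<integral>\<^sup>+w. N w \<partial>W) = nexp (pexp \<phi>)" unfolding N_def by (rule laplace_functional) simp
    have "(\<integral>\<^sup>+w. ennreal (hexp n (max 0 (T w))) * N w \<partial>W) = (\<integral>\<^sup>+w. ennreal (1 / c n) * (N w - N w * ?e n w) \<partial>W)"
    proof (rule nn_integral_cong_eventually[OF AE_T])
      fix w assume "summable (\<lambda>i. J i w) \<and> (\<Sum>i. ennreal (J i w)) = ennreal (T w) \<and> 0 < T w"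
      then have T: "0 < T w" by simp
      obtain r where r: "N w = ennreal r" "0 \<le> r" by (cases "N w" rule: ennreal_cases) (auto simp: N_def)
      have "ennreal (1 / c n) * (N w - N w * ?e n w) = ennreal (hexp n (T w)) * N w"
        unfolding r(1) hx by (rule ennreal_diff_quotient) (use r c0 T in auto)
      then show "ennreal (hexp n (max 0 (T w))) * N w = ennreal (1 / c n) * (N w - N w * ?e n w)"
        using T by (simp add: max_def)
    qed
    also have "\<dots> = ennreal (1 / c n) * (\<integral>\<^sup>+w. N w - N w * ?e n w \<partial>W)" by (rule nn_integral_cmult) measurable
    also have "(\<integral>\<^sup>+w. N w - N w * ?e n w \<partial>W) = (\<integral>\<^sup>+w. N w \<partial>W) - (\<integral>\<^sup>+w. N w * ?e n w \<partial>W)"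
    proof (rule nn_integral_diff)
      show "(\<integral>\<^sup>+w. N w * ?e n w \<partial>W) \<noteq> \<infinity>" unfolding int1 by (simp add: ennreal_mult_eq_top_iff)
      show "AE w in W. N w * ?e n w \<le> N w"
      proof (rule eventually_mono[OF AE_T])
        fix w assume *: "summable (\<lambda>i. J i w) \<and> (\<Sum>i. ennreal (J i w)) = ennreal (T w) \<and> 0 < T w"
        have "N w * ?e n w \<le> N w * 1" using * c0[of n] by (intro mult_left_mono) (auto simp: ennreal_le_1)
        then show "N w * ?e n w \<le> N w" by (simp only: mult_1_right)
      qed
    qed simp_all
    also have "\<dots> = nexp (pexp \<phi>) - nexp (pexp \<phi>) * ennreal (exp (- (c n * d n)))" unfolding int1 N1 ..
    also have "ennreal (1 / c n) * \<dots> = ennreal (hexp n (d n)) * nexp (pexp \<phi>)"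
    proof -
      obtain r where r: "nexp (pexp \<phi>) = ennreal r" "0 \<le> r" by (cases "nexp (pexp \<phi>)" rule: ennreal_cases) auto
      show ?thesis unfolding r(1) hx by (rule ennreal_diff_quotient) (use r c0 d in auto)
    qed
    finally show ?thesis .
  qed
  have "(\<lambda>n. \<integral>\<^sup>+w. ennreal (hexp n (max 0 (T w))) * N w \<partial>W) \<longlonglongrightarrow> (\<integral>\<^sup>+w. ennreal (max 0 (T w)) * N w \<partial>W)"
    by (rule nn_integral_LIMSEQ[OF inc _ lim]) (auto simp: N_def)
  moreover have "(\<lambda>n. ennreal (hexp n (d n)) * nexp (pexp \<phi>)) \<longlonglongrightarrow> ennreal \<delta> * nexp (pexp \<phi>)"
    unfolding mult.commute[of _ "nexp (pexp \<phi>)"]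
    by (rule ennreal_tendsto_cmult[OF nexp_neq_top(2) tendsto_ennrealI[OF hexp_tendsto[OF dlim d(2)]]])
  ultimately have "(\<integral>\<^sup>+w. ennreal (max 0 (T w)) * N w \<partial>W) = tilt_int \<phi> * nexp (pexp \<phi>)"
    unfolding step \<delta>(1) by (rule LIMSEQ_unique)
  moreover have "(\<integral>\<^sup>+w. ennreal (max 0 (T w)) * N w \<partial>W) = (\<integral>\<^sup>+w. ennreal (T w) * N w \<partial>W)"
    by (rule nn_integral_cong_eventually[OF T0]) simp
  ultimately show ?thesis by (simp add: N_def)
qed

end

section \<open>Beta and Gamma laws; Mellin transforms in the scale\<close>

lemma nn_integral_Beta:
  assumes "0 < a" "0 < b"
  shows "(\<integral>\<^sup>+x\<in>{0<..<1}. ennreal (x powr (a - 1) * (1 - x) powr (b - 1)) \<partial>lborel) = ennreal (Beta a b)"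
proof -
  have "((\<lambda>t. t powr (a - 1) * (1 - t) powr (b - 1)) has_integral Beta a b) {0<..<1}"
    using has_integral_Beta_real[OF assms] by (simp add: has_integral_Icc_iff_Ioo)
  from nn_integral_has_integral_lebesgue[OF _ this]
  have "(\<integral>\<^sup>+x. ennreal (indicator {0<..<1} x * (x powr (a - 1) * (1 - x) powr (b - 1))) \<partial>lborel) = ennreal (Beta a b)"
    by simp
  moreover have "ennreal (indicator {0<..<1} x * (x powr (a - 1) * (1 - x) powr (b - 1))) = ennreal (x powr (a - 1) * (1 - x) powr (b - 1)) * indicator {0<..<1} x" for x :: real
    by (simp split: split_indicator)
  ultimately show ?thesis by simp
qed

lemma Beta_pos: "0 < a \<Longrightarrow> 0 < b \<Longrightarrow> 0 < Beta a (b :: real)"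
  unfolding Beta_def by (intro divide_pos_pos mult_pos_pos Gamma_real_pos) auto

lemma beta_law_space [simp]: "space (beta_law a b) = {0<..<1}" by (simp add: beta_law_def space_restrict_space)

lemma beta_law_sets [measurable_cong]: "sets (beta_law a b) = sets (restrict_space borel {0<..<1})"
  by (simp add: beta_law_def sets_restrict_space)

lemma measurable_beta_law:
  fixes f :: "real \<Rightarrow> ennreal"
  shows "f \<in> borel_measurable borel \<Longrightarrow> f \<in> borel_measurable (beta_law a b)"
  using measurable_restrict_space1[of f borel borel "{0<..<1}"] measurable_cong_sets[OF beta_law_sets refl, of a b "borel :: ennreal measure"] by metis

lemma nn_integral_beta_law:
  assumes [measurable]: "f \<in> borel_measurable borel" and ab: "0 < a" "0 < b"
  shows "(\<integral>\<^sup>+x. f x \<partial>beta_law a b) =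
    ennreal (1 / Beta a b) * (\<integral>\<^sup>+x\<in>{0<..<1}. ennreal (x powr (a - 1) * (1 - x) powr (b - 1)) * f x \<partial>lborel)"
proof -
  let ?d = "\<lambda>x. ennreal (x powr (a - 1) * (1 - x) powr (b - 1) / Beta a b)"
  have "(\<integral>\<^sup>+x. f x \<partial>beta_law a b) = (\<integral>\<^sup>+x. ?d x * f x \<partial>restrict_space lborel {0<..<1})"
    unfolding beta_law_def by (rule nn_integral_density; rule measurable_restrict_space1) simp_all
  also have "\<dots> = (\<integral>\<^sup>+x\<in>{0<..<1}. ?d x * f x \<partial>lborel)" by (rule nn_integral_restrict_space) simp
  also have "\<dots> = (\<integral>\<^sup>+x. ennreal (1 / Beta a b) * (ennreal (x powr (a - 1) * (1 - x) powr (b - 1)) * f x * indicator {0<..<1} x) \<partial>lborel)"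
  proof (rule nn_integral_cong)
    fix x :: real
    have "?d x = ennreal (1 / Beta a b) * ennreal (x powr (a - 1) * (1 - x) powr (b - 1))"
      using Beta_pos[OF ab] by (subst ennreal_mult[symmetric]) auto
    then show "?d x * f x * indicator {0<..<1} x = ennreal (1 / Beta a b) * (ennreal (x powr (a - 1) * (1 - x) powr (b - 1)) * f x * indicator {0<..<1} x)"
      by (simp add: mult.assoc)
  qed
  also have "\<dots> = ennreal (1 / Beta a b) * (\<integral>\<^sup>+x\<in>{0<..<1}. ennreal (x powr (a - 1) * (1 - x) powr (b - 1)) * f x \<partial>lborel)"
    by (rule nn_integral_cmult) simp
  finally show ?thesis .
qed

lemma prob_space_beta_law: "0 < a \<Longrightarrow> 0 < b \<Longrightarrow> prob_space (beta_law a b)"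
proof
  assume ab: "0 < a" "0 < b"
  have "emeasure (beta_law a b) (space (beta_law a b)) = (\<integral>\<^sup>+x. 1 \<partial>beta_law a b)" by simp
  also have "\<dots> = ennreal (1 / Beta a b) * ennreal (Beta a b)"
    using nn_integral_beta_law[of "\<lambda>_. 1" a b] nn_integral_Beta[OF ab] ab by simp
  also have "\<dots> = 1" using Beta_pos[OF ab] by (simp add: ennreal_mult[symmetric])
  finally show "emeasure (beta_law a b) (space (beta_law a b)) = 1" .
qed

text \<open>Gamma law of shape \<theta> + 1; it serves as a random scale independent of a mass
  partition.\<close>

definition gamma_law :: "real \<Rightarrow> real measure" where
  "gamma_law \<theta> = density lborel (\<lambda>x. ennreal (x powr \<theta> * exp (- x) / Gamma (\<theta> + 1)) * indicator {0<..} x)"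

lemma gamma_law_sets [measurable_cong, simp]: "sets (gamma_law \<theta>) = sets borel" by (simp add: gamma_law_def)

lemma nn_integral_gamma_law:
  assumes [measurable]: "f \<in> borel_measurable borel" and \<theta>: "0 < \<theta> + 1"
  shows "(\<integral>\<^sup>+x. f x \<partial>gamma_law \<theta>) = ennreal (1 / Gamma (\<theta> + 1)) * (\<integral>\<^sup>+x\<in>{0<..}. ennreal (x powr \<theta>) * (ennreal (exp (- x)) * f x) \<partial>lborel)"
proof -
  have G: "0 < Gamma (\<theta> + 1)" using \<theta> by (rule Gamma_real_pos)
  have "(\<integral>\<^sup>+x. f x \<partial>gamma_law \<theta>) = (\<integral>\<^sup>+x. ennreal (x powr \<theta> * exp (- x) / Gamma (\<theta> + 1)) * indicator {0<..} x * f x \<partial>lborel)"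
    unfolding gamma_law_def by (rule nn_integral_density) simp_all
  also have "\<dots> = (\<integral>\<^sup>+x. ennreal (1 / Gamma (\<theta> + 1)) * (ennreal (x powr \<theta>) * (ennreal (exp (- x)) * f x) * indicator {0<..} x) \<partial>lborel)"
  proof (rule nn_integral_cong)
    fix x :: real
    have "ennreal (x powr \<theta> * exp (- x) / Gamma (\<theta> + 1)) = ennreal (1 / Gamma (\<theta> + 1) * (x powr \<theta> * exp (- x)))" by simp
    also have "\<dots> = ennreal (1 / Gamma (\<theta> + 1)) * (ennreal (x powr \<theta>) * ennreal (exp (- x)))"
      using divide_nonneg_nonneg[OF zero_le_one less_imp_le[OF G]] by (simp only: ennreal_mult ennreal_mult' powr_ge_zero exp_ge_zero)
    finally show "ennreal (x powr \<theta> * exp (- x) / Gamma (\<theta> + 1)) * indicator {0<..} x * f x = ennreal (1 / Gamma (\<theta> + 1)) * (ennreal (x powr \<theta>) * (ennreal (exp (- x)) * f x) * indicator {0<..} x)"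
      by (simp add: mult_ac)
  qed
  also have "\<dots> = ennreal (1 / Gamma (\<theta> + 1)) * (\<integral>\<^sup>+x\<in>{0<..}. ennreal (x powr \<theta>) * (ennreal (exp (- x)) * f x) \<partial>lborel)"
    by (rule nn_integral_cmult) simp
  finally show ?thesis .
qed

lemma prob_space_gamma_law: "0 < \<theta> + 1 \<Longrightarrow> prob_space (gamma_law \<theta>)"
proof
  assume \<theta>: "0 < \<theta> + 1"
  have G: "0 < Gamma (\<theta> + 1)" using \<theta> by (rule Gamma_real_pos)
  have "emeasure (gamma_law \<theta>) (space (gamma_law \<theta>)) = (\<integral>\<^sup>+x. 1 \<partial>gamma_law \<theta>)" by simp
  also have "\<dots> = ennreal (1 / Gamma (\<theta> + 1)) * (\<integral>\<^sup>+x\<in>{0<..}. ennreal (x powr \<theta>) * (ennreal (exp (- x)) * 1) \<partial>lborel)"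
    by (rule nn_integral_gamma_law[OF _ \<theta>]) simp
  also have "(\<integral>\<^sup>+x\<in>{0<..}. ennreal (x powr \<theta>) * (ennreal (exp (- x)) * 1) \<partial>lborel) = ennreal (Gamma (\<theta> + 1))"
    using nn_integral_Gamma[OF \<theta>, of 1] by (simp add: ennreal_mult)
  also have "ennreal (1 / Gamma (\<theta> + 1)) * ennreal (Gamma (\<theta> + 1)) = 1"
    using ennreal_frac_inverse[of 1 "Gamma (\<theta> + 1)" 1] G by simp
  finally show "emeasure (gamma_law \<theta>) (space (gamma_law \<theta>)) = 1" .
qed

lemma AE_gamma_law_pos: "AE x in gamma_law \<theta>. 0 < x"
  unfolding gamma_law_def by (subst AE_density) (auto split: split_indicator)

definition split_seq :: "real \<Rightarrow> (nat \<Rightarrow> real) \<Rightarrow> nat \<Rightarrow> real" where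
  "split_seq r p = case_nat r (\<lambda>i. (1 - r) * p i)"

lemma suminf_split_seq: "(\<Sum>i. g (split_seq r p i)) = g r + (\<Sum>i. g ((1 - r) * p i) :: ennreal)"
  using suminf_offset[of "\<lambda>i. g (split_seq r p i)" 1] by (simp add: split_seq_def)

lemma split_seq_sum:
  assumes "p \<in> Pinf" "0 < r" "r < 1"
  shows "(\<Sum>i. ennreal (split_seq r p i)) = 1" "0 \<le> split_seq r p i"
proof -
  have "(\<Sum>i. ennreal ((1 - r) * p i)) = ennreal (1 - r) * (\<Sum>i. ennreal (p i))"
    using assms Pinf_props(3)[OF assms(1)] by (simp add: ennreal_mult)
  then show "(\<Sum>i. ennreal (split_seq r p i)) = 1"
    using assms Pinf_iff[of p] unfolding suminf_split_seq by (simp add: ennreal_plus[symmetric] del: ennreal_plus)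
  show "0 \<le> split_seq r p i" using assms Pinf_props(3)[OF assms(1)] by (cases i) (auto simp: split_seq_def)
qed

text \<open>Integrating over all scales l makes normalization harmless: replacing l by T * l turns a
  functional of J / T into one of J and costs only a power of T.\<close>

definition mellin :: "real \<Rightarrow> (real \<Rightarrow> ennreal) \<Rightarrow> ennreal" where
  "mellin p F = (\<integral>\<^sup>+l\<in>{0<..}. ennreal (l powr p) * F l \<partial>lborel)"

lemma mellin_cong: "(\<And>l. 0 < l \<Longrightarrow> F l = G l) \<Longrightarrow> mellin p F = mellin p G"
  unfolding mellin_def by (intro nn_integral_cong) (simp split: split_indicator)

lemma mellin_cmult: "F \<in> borel_measurable borel \<Longrightarrow> mellin p (\<lambda>l. c * F l) = c * mellin p F"
  unfolding mellin_def by (subst nn_integral_cmult[symmetric]) (simp_all add: mult_ac)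

lemma mellin_scale:
  assumes [measurable]: "F \<in> borel_measurable borel" and t: "0 < t"
  shows "mellin p F = ennreal (t powr (p + 1)) * mellin p (\<lambda>l. F (t * l))"
proof -
  have "mellin p F = ennreal t * (\<integral>\<^sup>+l\<in>{0<..}. ennreal ((t * l) powr p) * F (t * l) \<partial>lborel)"
    unfolding mellin_def by (rule nn_integral_scale_subst[OF _ t]) simp
  also have "\<dots> = ennreal t * mellin p (\<lambda>l. ennreal (t powr p) * F (t * l))" unfolding mellin_def using t
    by (intro arg_cong[where f="(*) (ennreal t)"] nn_integral_cong) (simp add: powr_mult ennreal_mult mult_ac split: split_indicator)
  also have "\<dots> = ennreal (t powr (p + 1)) * mellin p (\<lambda>l. F (t * l))"
    using t by (simp add: mellin_cmult mult.assoc[symmetric] ennreal_mult[symmetric] powr_add mult.commute[of t])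
  finally show ?thesis .
qed

lemma mellin_swap:
  assumes "sigma_finite_measure M" and [measurable]: "(\<lambda>(w, l). G w l) \<in> borel_measurable (M \<Otimes>\<^sub>M borel)"
  shows "mellin p (\<lambda>l. \<integral>\<^sup>+w. G w l \<partial>M) = (\<integral>\<^sup>+w. mellin p (G w) \<partial>M)"
proof -
  interpret sigma_finite_measure M by fact
  interpret pair_sigma_finite M lborel ..
  have "mellin p (\<lambda>l. \<integral>\<^sup>+w. G w l \<partial>M) = (\<integral>\<^sup>+l. (\<integral>\<^sup>+w. ennreal (l powr p) * G w l * indicator {0<..} l \<partial>M) \<partial>lborel)"
    unfolding mellin_def by (intro nn_integral_cong) (simp add: nn_integral_cmult nn_integral_multc)
  also have "\<dots> = (\<integral>\<^sup>+w. mellin p (G w) \<partial>M)" unfolding mellin_def by (rule Fubini') simp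
  finally show ?thesis .
qed

context stable_points
begin

text \<open>The moment of order -\<theta> of the total mass, as \<open>moment_T\<close> shows for
  \<theta> > -\<gamma>.\<close>

definition mom :: "real \<Rightarrow> real" where "mom \<theta> = Gamma (\<theta> / \<gamma> + 1) / Gamma (\<theta> + 1)"

lemma mom_pos: assumes "- \<gamma> < \<theta>" shows "0 < mom \<theta>"
proof -
  have "- 1 < \<theta> / \<gamma>" using assms \<gamma> by (simp add: field_simps)
  then show ?thesis unfolding mom_def using assms \<gamma> by (intro divide_pos_pos Gamma_real_pos) auto
qed

text \<open>Balances the constants on the two sides of \<open>radial_split\<close>; it is the
  functional equation of Gamma, used in numerator and denominator of
  \<open>mom (\<theta> + \<gamma>)\<close>.\<close>

lemma mom_add:
  assumes "- \<gamma> < \<theta>"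
  shows "1 / Beta (1 - \<gamma>) (\<theta> + \<gamma>) * (Gamma (1 - \<gamma>) / \<gamma>) / mom (\<theta> + \<gamma>) = 1 / mom \<theta>"
proof -
  have p: "0 < \<theta> + \<gamma>" "0 < \<theta> + 1" "0 < \<theta> / \<gamma> + 1" "0 < 1 - \<gamma>" using assms \<gamma> by (auto simp: field_simps)
  define a b c d where "a = Gamma (1 - \<gamma>)" and "b = Gamma (\<theta> + \<gamma>)" and "c = Gamma (\<theta> + 1)" and "d = Gamma (\<theta> / \<gamma> + 1)"
  have pos: "0 < a" "0 < b" "0 < c" "0 < d" unfolding a_def b_def c_def d_def using p by (auto intro!: Gamma_real_pos)
  have 1: "Beta (1 - \<gamma>) (\<theta> + \<gamma>) = a * b / c" by (simp add: Beta_def a_def b_def c_def add.commute)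
  have "mom (\<theta> + \<gamma>) = Gamma ((\<theta> / \<gamma> + 1) + 1) / Gamma (\<theta> + \<gamma> + 1)" using \<gamma> by (simp add: mom_def add_divide_distrib)
  also have "\<dots> = ((\<theta> / \<gamma> + 1) * d) / ((\<theta> + \<gamma>) * b)" using p by (simp only: Gamma_plus1_pos d_def b_def)
  also have "\<theta> / \<gamma> + 1 = (\<theta> + \<gamma>) / \<gamma>" using \<gamma> by (simp add: add_divide_distrib)
  also have "((\<theta> + \<gamma>) / \<gamma> * d) / ((\<theta> + \<gamma>) * b) = d / (\<gamma> * b)" using p(1) by simp
  finally have 2: "mom (\<theta> + \<gamma>) = d / (\<gamma> * b)" .
  have 3: "mom \<theta> = d / c" by (simp add: mom_def c_def d_def)
  show ?thesis unfolding 1 2 3 a_def[symmetric] using pos \<gamma> by (simp add: field_simps)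
qed

lemma X_component [measurable]: "(\<lambda>w. X w i) \<in> borel_measurable W"
  by (rule measurable_compose[OF X_meas PinfM_component])

text \<open>\<open>LX\<close> and \<open>LJ\<close> are the tilted Laplace functionals of the
  normalized and of the original points, seen as functions of the scale l.\<close>

definition LX :: "real \<Rightarrow> (real \<Rightarrow> ennreal) \<Rightarrow> real \<Rightarrow> ennreal" where
  "LX \<theta> \<phi> l = (\<integral>\<^sup>+w. ennreal (T w powr (- \<theta>)) * nexp (\<Sum>i. \<phi> (l * X w i)) \<partial>W)"

definition LJ :: "real \<Rightarrow> (real \<Rightarrow> ennreal) \<Rightarrow> real \<Rightarrow> ennreal" where
  "LJ \<theta> \<phi> l = (\<integral>\<^sup>+w. ennreal (T w powr (- \<theta>)) * nexp (\<Sum>i. \<phi> (l * J i w)) \<partial>W)"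

lemma LX_measurable [measurable]: "\<phi> \<in> borel_measurable borel \<Longrightarrow> LX \<theta> \<phi> \<in> borel_measurable borel"
proof -
  assume [measurable]: "\<phi> \<in> borel_measurable borel"
  show ?thesis unfolding LX_def[abs_def] by measurable
qed

text \<open>Substituting T * l for l inside the expectation absorbs the normalization; l powr p and
  dl together contribute p + 1 to the power of T.\<close>

lemma mellin_LX:
  assumes [measurable]: "\<phi> \<in> borel_measurable borel"
  shows "mellin p (LX \<theta> \<phi>) = mellin p (LJ (\<theta> - p - 1) \<phi>)"
proof -
  have "mellin p (LX \<theta> \<phi>) = (\<integral>\<^sup>+w. mellin p (\<lambda>l. ennreal (T w powr (- \<theta>)) * nexp (\<Sum>i. \<phi> (l * X w i))) \<partial>W)"
    unfolding LX_def by (rule mellin_swap[OF sigma_finite_measure_axioms]) simp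
  also have "\<dots> = (\<integral>\<^sup>+w. mellin p (\<lambda>l. ennreal (T w powr (- (\<theta> - p - 1))) * nexp (\<Sum>i. \<phi> (l * J i w))) \<partial>W)"
  proof (rule nn_integral_cong_AE)
    show "AE w in W. mellin p (\<lambda>l. ennreal (T w powr (- \<theta>)) * nexp (\<Sum>i. \<phi> (l * X w i)))
      = mellin p (\<lambda>l. ennreal (T w powr (- (\<theta> - p - 1))) * nexp (\<Sum>i. \<phi> (l * J i w)))" using AE_T AE_X
    proof eventually_elim
      case (elim w)
      define t where "t = T w"
      have t: "0 < t" using elim by (simp add: t_def)
      have x: "(t * l) * X w i = l * J i w" for l i using elim by (simp add: t_def)
      have "t powr (p + 1) * t powr (- \<theta>) = t powr (- (\<theta> - p - 1))" by (simp add: powr_add[symmetric] algebra_simps)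
      then have e: "ennreal (t powr (p + 1)) * ennreal (t powr (- \<theta>)) = ennreal (t powr (- (\<theta> - p - 1)))"
        by (simp only: ennreal_mult[symmetric] powr_ge_zero)
      have "mellin p (\<lambda>l. ennreal (t powr (- \<theta>)) * nexp (\<Sum>i. \<phi> (l * X w i)))
        = ennreal (t powr (p + 1)) * mellin p (\<lambda>l. ennreal (t powr (- \<theta>)) * nexp (\<Sum>i. \<phi> (l * J i w)))"
        by (subst mellin_scale[OF _ t]) (simp_all only: x, measurable)
      then show ?case unfolding t_def[symmetric] by (simp add: mellin_cmult mult.assoc[symmetric] e[simplified])
    qed
  qed
  also have "\<dots> = mellin p (LJ (\<theta> - p - 1) \<phi>)"
    unfolding LJ_def by (rule mellin_swap[OF sigma_finite_measure_axioms, symmetric]) simp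
  finally show ?thesis .
qed

lemma pexp_scale:
  assumes [measurable]: "\<phi> \<in> borel_measurable borel" and c: "0 < c"
  shows "pexp (\<lambda>x. \<phi> (c * x)) = ennreal (c powr \<gamma>) * pexp \<phi>"
  unfolding pexp_def by (rule nn_integral_stable_scale[OF _ c \<gamma>]) simp

lemma tilt_int_scale:
  assumes [measurable]: "\<phi> \<in> borel_measurable borel" and c: "0 < c"
  shows "tilt_int (\<lambda>x. \<phi> (c * x)) = ennreal (c powr (\<gamma> - 1)) * tilt_int \<phi>"
proof -
  have "tilt_int (\<lambda>x. \<phi> (c * x)) = (\<integral>\<^sup>+x. ennreal (1 / c) * (ennreal (c * x) * nexp (\<phi> (c * x))) \<partial>\<nu>)"
    unfolding tilt_int_def
  proof (rule nn_integral_cong_eventually[OF AE_stable_intensity_pos])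
    fix x :: real assume "0 < x"
    then have "ennreal x = ennreal (1 / c) * ennreal (c * x)" using c by (simp add: ennreal_mult[symmetric])
    then show "ennreal x * nexp (\<phi> (c * x)) = ennreal (1 / c) * (ennreal (c * x) * nexp (\<phi> (c * x)))" by (metis mult.assoc)
  qed
  also have "\<dots> = ennreal (1 / c) * (\<integral>\<^sup>+x. ennreal (c * x) * nexp (\<phi> (c * x)) \<partial>\<nu>)" by (rule nn_integral_cmult) simp
  also have "(\<integral>\<^sup>+x. ennreal (c * x) * nexp (\<phi> (c * x)) \<partial>\<nu>) = ennreal (c powr \<gamma>) * tilt_int \<phi>"
    unfolding tilt_int_def by (rule nn_integral_stable_scale[OF _ c \<gamma>, of "\<lambda>x. ennreal x * nexp (\<phi> x)"]) simp
  also have "ennreal (1 / c) * (ennreal (c powr \<gamma>) * tilt_int \<phi>) = ennreal (c powr (\<gamma> - 1)) * tilt_int \<phi>"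
    using c by (simp add: mult.assoc[symmetric] ennreal_mult[symmetric] powr_diff)
  finally show ?thesis .
qed

text \<open>With p = \<theta> exactly one factor T is left over, and the Palm formula
  \<open>nn_integral_T_nexp\<close> evaluates it.\<close>

lemma mellin_LX_shifted:
  assumes [measurable]: "\<phi> \<in> borel_measurable borel" and fin: "tilt_int \<phi> < \<top>"
  shows "mellin \<theta> (LX \<theta> \<phi>) = tilt_int \<phi> * mellin (\<theta> + \<gamma> - 1) (\<lambda>l. nexp (ennreal (l powr \<gamma>) * pexp \<phi>))"
proof -
  have "mellin \<theta> (LX \<theta> \<phi>) = mellin \<theta> (\<lambda>l. tilt_int \<phi> * (ennreal (l powr (\<gamma> - 1)) * nexp (ennreal (l powr \<gamma>) * pexp \<phi>)))"
    unfolding mellin_LX[OF assms(1)]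
  proof (rule mellin_cong)
    fix l :: real assume l: "0 < l"
    have "LJ (\<theta> - \<theta> - 1) \<phi> l = (\<integral>\<^sup>+w. ennreal (T w) * nexp (\<Sum>i. \<phi> (l * J i w)) \<partial>W)"
      unfolding LJ_def by (rule nn_integral_cong_eventually[OF AE_T]) simp
    also have "\<dots> = tilt_int (\<lambda>x. \<phi> (l * x)) * nexp (pexp (\<lambda>x. \<phi> (l * x)))"
      by (rule nn_integral_T_nexp) (use fin in \<open>simp_all add: tilt_int_scale[OF _ l] ennreal_mult_less_top\<close>)
    finally show "LJ (\<theta> - \<theta> - 1) \<phi> l = tilt_int \<phi> * (ennreal (l powr (\<gamma> - 1)) * nexp (ennreal (l powr \<gamma>) * pexp \<phi>))"
      unfolding tilt_int_scale[OF assms(1) l] pexp_scale[OF assms(1) l] by (simp only: mult_ac)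
  qed
  also have "\<dots> = tilt_int \<phi> * mellin \<theta> (\<lambda>l. ennreal (l powr (\<gamma> - 1)) * nexp (ennreal (l powr \<gamma>) * pexp \<phi>))"
    by (rule mellin_cmult) simp
  also have "mellin \<theta> (\<lambda>l. ennreal (l powr (\<gamma> - 1)) * nexp (ennreal (l powr \<gamma>) * pexp \<phi>)) = mellin (\<theta> + \<gamma> - 1) (\<lambda>l. nexp (ennreal (l powr \<gamma>) * pexp \<phi>))"
    unfolding mellin_def
    by (intro nn_integral_cong) (simp add: mult.assoc[symmetric] ennreal_mult[symmetric] powr_add[symmetric] add_diff_eq)
  finally show ?thesis .
qed

text \<open>With p = s - 1 the powers of T cancel, and the plain Laplace functional applies.\<close>

lemma mellin_LX_plain:
  assumes [measurable]: "\<phi> \<in> borel_measurable borel"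
  shows "mellin (s - 1) (LX s \<phi>) = mellin (s - 1) (\<lambda>l. nexp (ennreal (l powr \<gamma>) * pexp \<phi>))"
  unfolding mellin_LX[OF assms]
proof (rule mellin_cong)
  fix l :: real assume l: "0 < l"
  have "LJ (s - (s - 1) - 1) \<phi> l = (\<integral>\<^sup>+w. nexp (\<Sum>i. \<phi> (l * J i w)) \<partial>W)"
    unfolding LJ_def by (rule nn_integral_cong_eventually[OF AE_T]) simp
  also have "\<dots> = nexp (pexp (\<lambda>x. \<phi> (l * x)))" by (rule laplace_functional) simp
  finally show "LJ (s - (s - 1) - 1) \<phi> l = nexp (ennreal (l powr \<gamma>) * pexp \<phi>)" by (simp add: pexp_scale[OF _ l])
qed

lemma tilt_int_linear: "tilt_int ennreal = ennreal \<gamma>"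
proof -
  define c where "c = Gamma (1 - \<gamma>)"
  have c: "0 < c" using \<gamma> by (auto simp: c_def intro!: Gamma_real_pos)
  have "tilt_int ennreal = (\<integral>\<^sup>+x. ennreal (\<gamma> / c) * (ennreal (x powr (1 - \<gamma> - 1) * exp (- (1 * x))) * indicator {0<..} x) \<partial>lborel)"
    unfolding tilt_int_def
  proof (subst nn_integral_stable, simp, rule nn_integral_cong)
    fix x :: real
    have "x * exp (- x) * (\<gamma> / c * x powr (- \<gamma> - 1)) = \<gamma> / c * (x powr (1 - \<gamma> - 1) * exp (- (1 * x)))" if "0 < x"
      using that powr_add[of x 1 "- \<gamma> - 1"] by simp
    then show "ennreal x * nexp (ennreal x) * ennreal (\<gamma> / Gamma (1 - \<gamma>) * x powr (- \<gamma> - 1)) * indicator {0<..} x =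
      ennreal (\<gamma> / c) * (ennreal (x powr (1 - \<gamma> - 1) * exp (- (1 * x))) * indicator {0<..} x)"
      unfolding c_def[symmetric] using c \<gamma> by (auto simp: nexp_ennreal ennreal_mult[symmetric] split: split_indicator)
  qed
  also have "\<dots> = ennreal (\<gamma> / c) * ennreal (c / 1 powr (1 - \<gamma>))"
    unfolding c_def using \<gamma> by (subst nn_integral_cmult) (simp_all only: nn_integral_Gamma, simp_all)
  finally show ?thesis using c \<gamma> by (simp add: ennreal_mult[symmetric])
qed

text \<open>Taken at \<phi> = identity, where the normalized masses sum to 1: \<open>LX\<close> is
  then the unknown moment times exp(-l). Its Mellin transform is also given by
  \<open>mellin_LX_shifted\<close>, so two Gamma integrals determine the moment.\<close>

lemma moment_T:
  assumes \<theta>: "- \<gamma> < \<theta>"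
  shows "(\<integral>\<^sup>+w. ennreal (T w powr (- \<theta>)) \<partial>W) = ennreal (mom \<theta>)"
proof -
  define m where "m = (\<integral>\<^sup>+w. ennreal (T w powr (- \<theta>)) \<partial>W)"
  define a b where "a = Gamma (\<theta> + 1)" and "b = Gamma (\<theta> / \<gamma> + 1)"
  have p: "0 < \<theta> + 1" "0 < \<theta> / \<gamma> + 1" using \<theta> \<gamma> by (auto simp: field_simps)
  have ab: "0 < a" "0 < b" unfolding a_def b_def using p by (auto intro!: Gamma_real_pos)
  have "mellin \<theta> (LX \<theta> ennreal) = mellin \<theta> (\<lambda>l. m * ennreal (exp (- l)))"
  proof (rule mellin_cong)
    fix l :: real assume l: "0 < l"
    have "(\<Sum>i. ennreal (l * X w i)) = ennreal l" for w
      using l Pinf_props(3)[OF X_Pinf] X_Pinf[of w] by (simp add: ennreal_mult Pinf_iff)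
    then show "LX \<theta> ennreal l = m * ennreal (exp (- l))"
      using l unfolding LX_def m_def by (simp add: nexp_ennreal nn_integral_multc)
  qed
  also have "\<dots> = m * mellin \<theta> (\<lambda>l. ennreal (exp (- l)))" by (rule mellin_cmult) simp
  also have "mellin \<theta> (\<lambda>l. ennreal (exp (- l))) = ennreal a"
    using nn_integral_Gamma[OF p(1), of 1] by (simp add: mellin_def a_def ennreal_mult)
  finally have 1: "mellin \<theta> (LX \<theta> ennreal) = m * ennreal a" .
  have "mellin (\<theta> + \<gamma> - 1) (\<lambda>l. nexp (ennreal (l powr \<gamma>)))
    = (\<integral>\<^sup>+u\<in>{0<..}. ennreal ((u powr (1 / \<gamma>)) powr (\<theta> + \<gamma> - 1)) * nexp (ennreal ((u powr (1 / \<gamma>)) powr \<gamma>)) * ennreal (\<bar>1 / \<gamma>\<bar> * u powr (1 / \<gamma> - 1)) \<partial>lborel)"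
    unfolding mellin_def by (rule nn_integral_powr_subst) (use \<gamma> in simp_all)
  also have "\<dots> = (\<integral>\<^sup>+u. ennreal (1 / \<gamma>) * (ennreal (u powr (\<theta> / \<gamma> + 1 - 1) * exp (- (1 * u))) * indicator {0<..} u) \<partial>lborel)"
  proof (rule nn_integral_cong)
    fix u :: real
    have "(u powr (1 / \<gamma>)) powr (\<theta> + \<gamma> - 1) * u powr (1 / \<gamma> - 1) = u powr ((1 / \<gamma>) * (\<theta> + \<gamma> - 1) + (1 / \<gamma> - 1))"
      by (simp add: powr_powr powr_add)
    also have "(1 / \<gamma>) * (\<theta> + \<gamma> - 1) + (1 / \<gamma> - 1) = \<theta> / \<gamma>" using \<gamma> by (simp add: field_simps)
    finally have "(u powr (1 / \<gamma>)) powr (\<theta> + \<gamma> - 1) * exp (- u) * (1 / \<gamma> * u powr (1 / \<gamma> - 1)) = 1 / \<gamma> * (u powr (\<theta> / \<gamma>) * exp (- u))"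
      by simp
    then show "ennreal ((u powr (1 / \<gamma>)) powr (\<theta> + \<gamma> - 1)) * nexp (ennreal ((u powr (1 / \<gamma>)) powr \<gamma>)) * ennreal (\<bar>1 / \<gamma>\<bar> * u powr (1 / \<gamma> - 1)) * indicator {0<..} u
      = ennreal (1 / \<gamma>) * (ennreal (u powr (\<theta> / \<gamma> + 1 - 1) * exp (- (1 * u))) * indicator {0<..} u)"
      using \<gamma> by (cases "0 < u") (simp_all add: powr_powr nexp_ennreal ennreal_mult[symmetric])
  qed
  also have "\<dots> = ennreal (1 / \<gamma>) * ennreal (b / 1 powr (\<theta> / \<gamma> + 1))"
    unfolding b_def using p(2) by (subst nn_integral_cmult, simp, subst nn_integral_Gamma) simp_all
  finally have "mellin (\<theta> + \<gamma> - 1) (\<lambda>l. nexp (ennreal (l powr \<gamma>))) = ennreal (b / \<gamma>)"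
    using ab \<gamma> by (simp add: ennreal_mult[symmetric])
  then have "m * ennreal a = ennreal b"
    using mellin_LX_shifted[of ennreal \<theta>] pexp_linear[of 1] ab \<gamma> by (simp add: 1 tilt_int_linear ennreal_mult[symmetric])
  moreover have "m = (m * ennreal a) * ennreal (1 / a)" using ab by (simp add: mult.assoc ennreal_mult[symmetric])
  ultimately have "m = ennreal b * ennreal (1 / a)" by simp
  then show ?thesis using ab by (simp add: m_def mom_def a_def[symmetric] b_def[symmetric] ennreal_mult[symmetric])
qed

text \<open>The law PD(\<gamma>,\<theta>) as a change of measure; \<open>PD_law_eq\<close>
  identifies it with the stick-breaking law.\<close>

definition PD_tilted :: "real \<Rightarrow> (nat \<Rightarrow> real) measure" where
  "PD_tilted \<theta> = distr (density W (\<lambda>w. ennreal (T w powr (- \<theta>) / mom \<theta>))) PinfM X"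

lemma PD_tilted_sets [measurable_cong, simp]: "sets (PD_tilted \<theta>) = sets PinfM" by (simp add: PD_tilted_def)

lemma PD_tilted_space [simp]: "space (PD_tilted \<theta>) = Pinf" by (simp add: PD_tilted_def)

lemma nn_integral_PD_tilted:
  assumes [measurable]: "F \<in> borel_measurable PinfM" and \<theta>: "- \<gamma> < \<theta>"
  shows "(\<integral>\<^sup>+p. F p \<partial>PD_tilted \<theta>) = ennreal (1 / mom \<theta>) * (\<integral>\<^sup>+w. ennreal (T w powr (- \<theta>)) * F (X w) \<partial>W)"
proof -
  have "(\<integral>\<^sup>+p. F p \<partial>PD_tilted \<theta>) = (\<integral>\<^sup>+w. F (X w) \<partial>density W (\<lambda>w. ennreal (T w powr (- \<theta>) / mom \<theta>)))"
    unfolding PD_tilted_def by (rule nn_integral_distr) simp_all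
  also have "\<dots> = (\<integral>\<^sup>+w. ennreal (T w powr (- \<theta>) / mom \<theta>) * F (X w) \<partial>W)" by (rule nn_integral_density) simp_all
  also have "\<dots> = (\<integral>\<^sup>+w. ennreal (1 / mom \<theta>) * (ennreal (T w powr (- \<theta>)) * F (X w)) \<partial>W)"
  proof (rule nn_integral_cong)
    fix w
    have "ennreal (T w powr (- \<theta>) / mom \<theta>) = ennreal (1 / mom \<theta>) * ennreal (T w powr (- \<theta>))"
      using mom_pos[OF \<theta>] by (subst ennreal_mult[symmetric]) auto
    then show "ennreal (T w powr (- \<theta>) / mom \<theta>) * F (X w) = ennreal (1 / mom \<theta>) * (ennreal (T w powr (- \<theta>)) * F (X w))"
      by (simp add: mult.assoc)
  qed
  also have "\<dots> = ennreal (1 / mom \<theta>) * (\<integral>\<^sup>+w. ennreal (T w powr (- \<theta>)) * F (X w) \<partial>W)" by (rule nn_integral_cmult) simp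
  finally show ?thesis .
qed

lemma prob_space_PD_tilted: assumes \<theta>: "- \<gamma> < \<theta>" shows "prob_space (PD_tilted \<theta>)"
proof
  have "emeasure (PD_tilted \<theta>) (space (PD_tilted \<theta>)) = (\<integral>\<^sup>+p. 1 \<partial>PD_tilted \<theta>)" by simp
  also have "\<dots> = ennreal (1 / mom \<theta>) * ennreal (mom \<theta>)"
    using nn_integral_PD_tilted[OF _ \<theta>, of "\<lambda>_. 1"] moment_T[OF \<theta>] by simp
  also have "\<dots> = 1" using mom_pos[OF \<theta>] by (simp add: ennreal_mult[symmetric])
  finally show "emeasure (PD_tilted \<theta>) (space (PD_tilted \<theta>)) = 1" .
qed

lemma PinfM_functional [measurable]:
  "\<phi> \<in> borel_measurable borel \<Longrightarrow> (\<lambda>p. nexp (\<Sum>i. \<phi> (c * p i))) \<in> borel_measurable PinfM"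
proof -
  assume [measurable]: "\<phi> \<in> borel_measurable borel"
  note [measurable] = PinfM_component
  show ?thesis by measurable
qed

text \<open>The Laplace functional of a partition with law PD(\<gamma>,\<theta>) dilated by c; the
  stick-breaking recursion is an equation for this quantity.\<close>

definition frag :: "(real \<Rightarrow> ennreal) \<Rightarrow> real \<Rightarrow> real \<Rightarrow> ennreal" where
  "frag \<phi> \<theta> c = (\<integral>\<^sup>+p. nexp (\<Sum>i. \<phi> (c * p i)) \<partial>PD_tilted \<theta>)"

lemma frag_LX: "\<phi> \<in> borel_measurable borel \<Longrightarrow> - \<gamma> < \<theta> \<Longrightarrow> frag \<phi> \<theta> = (\<lambda>c. ennreal (1 / mom \<theta>) * LX \<theta> \<phi> c)"
  unfolding frag_def LX_def by (intro ext) (simp add: nn_integral_PD_tilted)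

lemma frag_measurable [measurable]: "\<phi> \<in> borel_measurable borel \<Longrightarrow> - \<gamma> < \<theta> \<Longrightarrow> frag \<phi> \<theta> \<in> borel_measurable borel"
  by (simp add: frag_LX)

text \<open>Both sides are evaluated by undoing the normalization: the left one by the Palm formula for
  \<open>T\<close>, the right one by convolution of the size-biased mass with the independent remainder.\<close>

lemma radial_split:
  assumes [measurable]: "\<phi> \<in> borel_measurable borel" and fin: "tilt_int \<phi> < \<top>" and \<theta>: "- \<gamma> < \<theta>"
  shows "mellin \<theta> (frag \<phi> \<theta>) = mellin \<theta> (\<lambda>l. \<integral>\<^sup>+r. nexp (\<phi> (l * r)) * frag \<phi> (\<theta> + \<gamma>) (l * (1 - r)) \<partial>beta_law (1 - \<gamma>) (\<theta> + \<gamma>))"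
    (is "?L = mellin \<theta> ?R")
proof -
  let ?s = "\<theta> + \<gamma>"
  let ?c = "ennreal (1 / Beta (1 - \<gamma>) ?s)"
  let ?a = "ennreal (1 / mom ?s)"
  have s: "0 < ?s" "- \<gamma> < ?s" "0 < 1 - \<gamma>" using \<theta> \<gamma> by auto
  define E where "E = LX ?s \<phi>"
  have [measurable]: "E \<in> borel_measurable borel" unfolding E_def by simp
  have fr: "frag \<phi> ?s = (\<lambda>c. ?a * E c)" unfolding E_def by (rule frag_LX) (simp_all add: s)
  define Z where "Z = mellin (?s - 1) (\<lambda>l. nexp (ennreal (l powr \<gamma>) * pexp \<phi>))"
  have L: "?L = ennreal (1 / mom \<theta>) * (tilt_int \<phi> * Z)"
    by (simp add: frag_LX \<theta> mellin_cmult mellin_LX_shifted[OF _ fin] Z_def)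
  have B: "0 < Beta (1 - \<gamma>) ?s" using s by (intro Beta_pos)
  \<comment> \<open>\<open>?f\<close> is the size-biased intensity up to a constant, damped by
    \<phi>, and \<open>?g\<close> belongs to the remainder; the powers are arranged so that the Beta
    density appears in the proportion r.\<close>
  let ?f = "\<lambda>x. ennreal (x powr (- \<gamma>)) * nexp (\<phi> x)" and ?g = "\<lambda>y. ennreal (y powr (?s - 1)) * E y"
  define I where "I l = (\<integral>\<^sup>+r\<in>{0<..<1}. ?f (l * r) * ?g (l * (1 - r)) \<partial>lborel)" for l
  have Im [measurable]: "I \<in> borel_measurable borel" unfolding I_def[abs_def] by measurable
  have ac: "x * (a * (b * y)) = a * (b * (x * y))" for a b x y :: ennreal by (simp only: mult_ac)
  have R: "ennreal (l powr \<theta>) * ?R l = ?a * (?c * (ennreal l * I l))" if l: "0 < l" for l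
  proof -
    let ?b = "\<lambda>r. ennreal (r powr (1 - \<gamma> - 1) * (1 - r) powr (?s - 1)) * (nexp (\<phi> (l * r)) * E (l * (1 - r))) * indicator {0<..<1} r"
    have "?R l = (\<integral>\<^sup>+r. ?a * (nexp (\<phi> (l * r)) * E (l * (1 - r))) \<partial>beta_law (1 - \<gamma>) ?s)"
      by (rule nn_integral_cong) (simp only: fr, rule mult.left_commute)
    also have "\<dots> = ?a * (\<integral>\<^sup>+r. nexp (\<phi> (l * r)) * E (l * (1 - r)) \<partial>beta_law (1 - \<gamma>) ?s)"
      by (rule nn_integral_cmult) (rule measurable_beta_law, simp)
    also have "(\<integral>\<^sup>+r. nexp (\<phi> (l * r)) * E (l * (1 - r)) \<partial>beta_law (1 - \<gamma>) ?s) = ?c * (\<integral>\<^sup>+r. ?b r \<partial>lborel)"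
      by (rule nn_integral_beta_law[OF _ s(3,1)]) simp
    finally have 1: "?R l = ?a * (?c * (\<integral>\<^sup>+r. ?b r \<partial>lborel))" .
    have "ennreal (l powr \<theta>) * ?R l = ?a * (?c * (ennreal (l powr \<theta>) * (\<integral>\<^sup>+r. ?b r \<partial>lborel)))" unfolding 1 by (rule ac)
    also have "ennreal (l powr \<theta>) * (\<integral>\<^sup>+r. ?b r \<partial>lborel) = (\<integral>\<^sup>+r. ennreal (l powr \<theta>) * ?b r \<partial>lborel)"
      by (rule nn_integral_cmult[symmetric], measurable)
    also have "(\<integral>\<^sup>+r. ennreal (l powr \<theta>) * ?b r \<partial>lborel) = (\<integral>\<^sup>+r. ennreal l * (?f (l * r) * ?g (l * (1 - r)) * indicator {0<..<1} r) \<partial>lborel)"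
    proof (rule nn_integral_cong)
      fix r :: real
      show "ennreal (l powr \<theta>) * ?b r = ennreal l * (?f (l * r) * ?g (l * (1 - r)) * indicator {0<..<1} r)"
      proof (cases "r \<in> {0<..<1}")
        case r: True
        have "l * ((l * r) powr (- \<gamma>) * (l * (1 - r)) powr (?s - 1)) = (l powr 1 * l powr (- \<gamma>) * l powr (?s - 1)) * (r powr (- \<gamma>) * (1 - r) powr (?s - 1))"
          using l r by (simp add: powr_mult)
        also have "l powr 1 * l powr (- \<gamma>) * l powr (?s - 1) = l powr \<theta>"
          by (simp only: powr_add[symmetric]) (simp add: algebra_simps)
        finally have "l powr \<theta> * (r powr (1 - \<gamma> - 1) * (1 - r) powr (?s - 1)) = l * ((l * r) powr (- \<gamma>) * (l * (1 - r)) powr (?s - 1))" by simp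
        then have e: "ennreal (l powr \<theta>) * ennreal (r powr (1 - \<gamma> - 1) * (1 - r) powr (?s - 1)) = ennreal l * (ennreal ((l * r) powr (- \<gamma>)) * ennreal ((l * (1 - r)) powr (?s - 1)))"
          using l by (simp add: ennreal_mult[symmetric])
        show ?thesis using arg_cong[OF e, of "\<lambda>z. z * (nexp (\<phi> (l * r)) * E (l * (1 - r)))"] r by (simp add: mult_ac)
      qed simp
    qed
    also have "\<dots> = ennreal l * I l" unfolding I_def by (rule nn_integral_cmult) simp
    finally show ?thesis .
  qed
  have "mellin \<theta> ?R = (\<integral>\<^sup>+l. ?a * (?c * (ennreal l * I l * indicator {0<..} l)) \<partial>lborel)"
    unfolding mellin_def by (intro nn_integral_cong) (simp add: R split: split_indicator)
  also have "\<dots> = ?a * (?c * (\<integral>\<^sup>+l\<in>{0<..}. ennreal l * I l \<partial>lborel))" by (simp add: nn_integral_cmult)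
  also have "(\<integral>\<^sup>+l\<in>{0<..}. ennreal l * I l \<partial>lborel)
    = (\<integral>\<^sup>+x\<in>{0<..}. ?f x \<partial>lborel) * (\<integral>\<^sup>+y\<in>{0<..}. ?g y \<partial>lborel)"
    unfolding I_def by (rule nn_integral_convolution[symmetric]) simp_all
  also have "(\<integral>\<^sup>+y\<in>{0<..}. ?g y \<partial>lborel) = Z"
    using mellin_LX_plain[OF assms(1), of ?s] unfolding Z_def E_def mellin_def .
  also have "(\<integral>\<^sup>+x\<in>{0<..}. ?f x \<partial>lborel) = ennreal (Gamma (1 - \<gamma>) / \<gamma>) * tilt_int \<phi>"
  proof -
    have G: "0 < Gamma (1 - \<gamma>)" using s(3) by (rule Gamma_real_pos)
    let ?t = "\<lambda>x. ennreal x * nexp (\<phi> x) * ennreal (\<gamma> / Gamma (1 - \<gamma>) * x powr (- \<gamma> - 1)) * indicator {0<..} x"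
    have "ennreal (Gamma (1 - \<gamma>) / \<gamma>) * tilt_int \<phi> = (\<integral>\<^sup>+x. ennreal (Gamma (1 - \<gamma>) / \<gamma>) * ?t x \<partial>lborel)"
      unfolding tilt_int_def by (subst nn_integral_stable) (simp_all add: nn_integral_cmult)
    also have "\<dots> = (\<integral>\<^sup>+x\<in>{0<..}. ?f x \<partial>lborel)"
    proof (rule nn_integral_cong)
      fix x :: real
      show "ennreal (Gamma (1 - \<gamma>) / \<gamma>) * ?t x = ?f x * indicator {0<..} x"
      proof (cases "0 < x")
        case True
        define g where "g = Gamma (1 - \<gamma>)"
        have g: "0 < g" using G by (simp add: g_def)
        have "g / \<gamma> * (x * (\<gamma> / g * x powr (- \<gamma> - 1))) = x powr 1 * x powr (- \<gamma> - 1)" using g \<gamma> True by simp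
        also have "\<dots> = x powr (- \<gamma>)" by (simp only: powr_add[symmetric]) simp
        finally have r: "g / \<gamma> * (x * (\<gamma> / g * x powr (- \<gamma> - 1))) = x powr (- \<gamma>)" .
        have "ennreal (g / \<gamma>) * (ennreal x * ennreal (\<gamma> / g * x powr (- \<gamma> - 1))) = ennreal (x powr (- \<gamma>))"
          unfolding r[symmetric] using g \<gamma> True by (subst (1 2) ennreal_mult) auto
        from arg_cong[OF this, of "\<lambda>z. z * nexp (\<phi> x)"] show ?thesis unfolding g_def using True by (simp add: mult_ac)
      qed simp
    qed
    finally show ?thesis by simp
  qed
  also have "?a * (?c * (ennreal (Gamma (1 - \<gamma>) / \<gamma>) * tilt_int \<phi> * Z)) = ennreal (1 / mom \<theta>) * (tilt_int \<phi> * Z)"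
  proof -
    have nn: "0 \<le> 1 / mom ?s" "0 \<le> 1 / Beta (1 - \<gamma>) ?s" "0 \<le> Gamma (1 - \<gamma>) / \<gamma>"
      using mom_pos[OF s(2)] B \<gamma> less_imp_le[OF Gamma_real_pos[OF s(3)]] by auto
    have "1 / mom ?s * (1 / Beta (1 - \<gamma>) ?s * (Gamma (1 - \<gamma>) / \<gamma>)) = 1 / mom \<theta>"
      using mom_add[OF \<theta>] by (simp add: mult_ac)
    then have "?a * (?c * ennreal (Gamma (1 - \<gamma>) / \<gamma>)) = ennreal (1 / mom \<theta>)"
      using nn by (metis ennreal_mult mult_nonneg_nonneg)
    from arg_cong[OF this, of "\<lambda>z. z * (tilt_int \<phi> * Z)"] show ?thesis by (simp only: mult_ac)
  qed
  finally show ?thesis using L by simp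
qed

end

section \<open>Disintegration along the total mass\<close>

context stable_points
begin

text \<open>Instead of the counts \<open>N\<close> themselves, the variances of \<open>exp (- N / a)\<close> are summed: they are given by
  the Laplace transform of the Poisson law.\<close>

lemma AE_count_limit:
  "AE w in W. (\<lambda>k. real (card {i. lt_eps \<gamma> k \<le> J i w}) / (real (Suc k))\<^sup>2) \<longlonglongrightarrow> 1 / Gamma (1 - \<gamma>)"
proof -
  define a where "a k = (real (Suc k))\<^sup>2" for k
  define \<kappa> where "\<kappa> = 1 / Gamma (1 - \<gamma>)"
  define N where "N k w = card {i. J i w \<in> {lt_eps \<gamma> k..}}" for k w
  define Y where "Y k w = exp (- (1 / a k) * real (N k w))" for k w
  \<comment> \<open>The mean of \<open>Y k\<close>, read off from the Laplace transform of the
    Poisson count.\<close>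
  define \<mu> where "\<mu> k = exp (- ((1 - exp (- (1 / a k))) * (\<kappa> * a k)))" for k
  let ?d = "\<lambda>k w. (Y k w - \<mu> k)\<^sup>2"
  have a0: "0 < a k" and a1: "1 \<le> a k" for k by (auto simp: a_def)
  have \<kappa>0: "0 < \<kappa>" using \<gamma> by (simp add: \<kappa>_def)
  have fin: "emeasure \<nu> {lt_eps \<gamma> k..} < \<infinity>" for k by (simp add: emeasure_\<nu>_Ici lt_eps_pos)
  have m: "measure \<nu> {lt_eps \<gamma> k..} = \<kappa> * a k" for k
  proof -
    have "lt_eps \<gamma> k powr (- \<gamma>) = a k"
      using lt_eps_powr[OF \<gamma>(1), of k] by (simp add: powr_minus_divide a_def del: of_nat_Suc)
    moreover have "0 \<le> a k / Gamma (1 - \<gamma>)"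
      using \<gamma> a0[of k] by (intro divide_nonneg_nonneg less_imp_le[OF Gamma_real_pos]) auto
    ultimately show ?thesis by (simp add: measure_def emeasure_\<nu>_Ici lt_eps_pos \<kappa>_def)
  qed
  have [measurable]: "N k \<in> W \<rightarrow>\<^sub>M count_space UNIV" for k unfolding N_def by (rule count_meas) (use fin in auto)
  have [measurable]: "Y k \<in> borel_measurable W" for k unfolding Y_def by measurable
  have lap: "(\<integral>\<^sup>+w. ennreal (exp (- c * real (N k w))) \<partial>W) = ennreal (exp (- ((1 - exp (- c)) * (\<kappa> * a k))))"
    if "0 \<le> c" for c k by (rule nn_integral_poisson_count)
       (use that \<kappa>0 a0[of k] count_law[OF _ fin, of k] m[of k] in \<open>auto simp: N_def\<close>)
  have EY: "expectation (Y k) = \<mu> k" for k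
    unfolding Y_def \<mu>_def using lap[of "1 / a k" k] a0[of k] by (subst integral_eq_nn_integral) auto
  have Y2: "(Y k w)\<^sup>2 = exp (- (2 / a k) * real (N k w))" for k w by (simp add: Y_def exp_double[symmetric])
  have EY2: "expectation (\<lambda>w. (Y k w)\<^sup>2) = exp (- ((1 - exp (- (2 / a k))) * (\<kappa> * a k)))" for k
    unfolding Y2 using lap[of "2 / a k" k] a0[of k] by (subst integral_eq_nn_integral) auto
  have Y1: "Y k w \<le> 1" "0 \<le> Y k w" for k w using a0[of k] by (auto simp: Y_def)
  have iY: "integrable W (Y k)" for k by (rule integrable_const_bound[where B=1]) (use Y1 in auto)
  have iY2: "integrable W (\<lambda>w. (Y k w)\<^sup>2)" for k
    by (rule integrable_const_bound[where B=1]) (use Y1 in \<open>auto simp: power_le_one\<close>)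
  have var: "expectation (\<lambda>w. ?d k w) \<le> \<kappa> / a k" for k
  proof -
    define x where "x = 1 / a k"
    define e where "e = exp (- x)"
    define E2 where "E2 = exp (- ((1 - e\<^sup>2) * (\<kappa> / x)))"
    let ?z = "(1 - e)\<^sup>2 * (\<kappa> / x)"
    have x: "0 < x" using a0[of k] by (simp add: x_def)
    have ak: "\<kappa> * a k = \<kappa> / x" by (simp add: x_def)
    have e: "0 < e" "e \<le> 1" "1 - e \<le> x" using x exp_ge_add_one_self[of "- x"] by (auto simp: e_def)
    have e2: "exp (- (2 / a k)) = e\<^sup>2" by (simp add: e_def x_def exp_double[symmetric])
    have eE2: "expectation (\<lambda>w. (Y k w)\<^sup>2) = E2" unfolding EY2 E2_def e2 ak ..
    \<comment> \<open>From 2 (1 - e) = (1 - e^2) + (1 - e)^2. It splits the squared mean into the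
      second moment times exp(-z), so the variance is E2 (1 - exp(-z)) and at most z.\<close>
    have ident: "2 * (- ((1 - e) * c)) = - ((1 - e\<^sup>2) * c) + - ((1 - e)\<^sup>2 * c)" for c
      by (simp add: power2_eq_square algebra_simps)
    have "(\<mu> k)\<^sup>2 = exp (2 * (- ((1 - e) * (\<kappa> / x))))"
      unfolding \<mu>_def ak x_def[symmetric] e_def[symmetric] exp_double ..
    also have "2 * (- ((1 - e) * (\<kappa> / x))) = - ((1 - e\<^sup>2) * (\<kappa> / x)) + - (?z)" by (rule ident)
    finally have \<mu>2: "(\<mu> k)\<^sup>2 = E2 * exp (- (?z))" unfolding exp_add E2_def .
    have "variance (Y k) = E2 - (\<mu> k)\<^sup>2" using variance_eq[OF iY iY2] by (simp add: EY eE2)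
    also have "\<dots> = E2 * (1 - exp (- (?z)))" unfolding \<mu>2 by (simp add: algebra_simps)
    also have "\<dots> \<le> 1 * (?z)"
    proof (rule mult_mono)
      have "e\<^sup>2 \<le> 1" using e by (simp add: power_le_one)
      then show "E2 \<le> 1" unfolding E2_def using \<kappa>0 x by simp
      show "1 - exp (- (?z)) \<le> ?z" using exp_ge_add_one_self[of "- (?z)"] by simp
    qed (use \<kappa>0 x in auto)
    also have "\<dots> \<le> x\<^sup>2 * (\<kappa> / x)"
      using e \<kappa>0 x power_mono[of "1 - e" x 2] by (simp add: divide_right_mono mult_right_mono)
    also have "\<dots> = \<kappa> / a k" using x by (simp add: x_def power2_eq_square)
    finally show ?thesis by (simp add: EY)
  qed
  \<comment> \<open>This summability is the reason for sampling along squares.\<close>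
  have summ: "summable (\<lambda>k. \<kappa> / a k)"
  proof -
    have "summable (\<lambda>n. inverse (real (Suc n) ^ 2))"
      by (rule summable_Suc_iff[THEN iffD2]) (rule inverse_power_summable, simp)
    from summable_mult[OF this, of \<kappa>] show ?thesis by (simp add: a_def divide_inverse)
  qed
  have "(\<integral>\<^sup>+w. (\<Sum>k. ennreal (?d k w)) \<partial>W) = (\<Sum>k. \<integral>\<^sup>+w. ennreal (?d k w) \<partial>W)" by (rule nn_integral_suminf) simp
  also have "\<dots> \<le> (\<Sum>k. ennreal (\<kappa> / a k))"
  proof (intro suminf_le summableI)
    fix k
    have i: "integrable W (\<lambda>w. ?d k w)" using iY[of k] iY2[of k] by (simp add: power2_diff)
    have "(\<integral>\<^sup>+w. ennreal (?d k w) \<partial>W) = ennreal (expectation (\<lambda>w. ?d k w))" by (rule nn_integral_eq_integral[OF i]) simp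
    then show "(\<integral>\<^sup>+w. ennreal (?d k w) \<partial>W) \<le> ennreal (\<kappa> / a k)" using var by (simp add: ennreal_leI)
  qed
  also have "\<dots> = ennreal (\<Sum>k. \<kappa> / a k)" by (rule suminf_ennreal2[OF _ summ]) (use \<kappa>0 a0 in \<open>auto intro: less_imp_le\<close>)
  finally have "(\<integral>\<^sup>+w. (\<Sum>k. ennreal (?d k w)) \<partial>W) \<noteq> \<infinity>" by (auto simp: top_unique)
  then have AEf: "AE w in W. (\<Sum>k. ennreal (?d k w)) \<noteq> \<infinity>" by (intro nn_integral_PInf_AE) simp_all
  have \<mu>lim: "\<mu> \<longlonglongrightarrow> exp (- \<kappa>)"
  proof -
    have "(\<lambda>h. (exp (0 + h) - exp 0) / h) \<midarrow>0\<rightarrow> exp (0::real)" using DERIV_exp[of "0::real"] by (simp only: DERIV_def)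
    then have D: "(\<lambda>h. (exp h - 1) / h) \<midarrow>0\<rightarrow> (1::real)" by simp
    have "(\<lambda>k. inverse (real (Suc k))) \<longlonglongrightarrow> 0" by (rule LIMSEQ_inverse_real_of_nat)
    from tendsto_minus[OF tendsto_power[OF this, of 2]] have "(\<lambda>k. - (1 / a k)) \<longlonglongrightarrow> 0"
      by (simp add: a_def inverse_eq_divide power_divide)
    then have "filterlim (\<lambda>k. - (1 / a k)) (at 0) sequentially" using a0 by (intro filterlim_atI) (auto simp: less_le)
    from filterlim_compose[OF D this] have "(\<lambda>k. (exp (- (1 / a k)) - 1) / (- (1 / a k))) \<longlonglongrightarrow> 1" .
    moreover have "(exp (- (1 / a k)) - 1) / (- (1 / a k)) = (1 - exp (- (1 / a k))) * a k" for k
      using a0[of k] by (simp add: field_simps)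
    ultimately have "(\<lambda>k. (1 - exp (- (1 / a k))) * a k) \<longlonglongrightarrow> 1" by simp
    from tendsto_exp[OF tendsto_minus[OF tendsto_mult_left[OF this, of \<kappa>]]]
    show ?thesis unfolding \<mu>_def[abs_def] by (simp add: mult_ac)
  qed
  show ?thesis using AEf
  proof eventually_elim
    case (elim w)
    have "summable (\<lambda>k. ?d k w)" by (rule summable_suminf_not_top) (use elim in auto)
    then have "(\<lambda>k. ?d k w) \<longlonglongrightarrow> 0" by (rule summable_LIMSEQ_zero)
    from tendsto_real_sqrt[OF this] have "(\<lambda>k. Y k w - \<mu> k) \<longlonglongrightarrow> 0" by (simp add: tendsto_rabs_zero_iff)
    from tendsto_add[OF this \<mu>lim] have "(\<lambda>k. Y k w) \<longlonglongrightarrow> exp (- \<kappa>)" by simp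
    from tendsto_minus[OF tendsto_ln[OF this]] have "(\<lambda>k. - ln (Y k w)) \<longlonglongrightarrow> \<kappa>" by simp
    then show ?case by (simp add: Y_def N_def a_def \<kappa>_def del: of_nat_Suc)
  qed
qed

text \<open>Counts of \<open>X\<close> at level \<epsilon> are counts of \<open>J\<close> at level T
  * \<epsilon>, so the local time is T powr (-\<gamma>). Conditioning on the inverse local time is
  thus conditioning on the total mass.\<close>

lemma AE_inverse_local_time: "AE w in W. inverse_local_time \<gamma> (X w) = T w"
  using AE_count_limit AE_X AE_T AE_J_decseq AE_J
proof eventually_elim
  case (elim w)
  define t where "t = T w"
  have t: "0 < t" using elim by (simp add: t_def)
  have J: "J i w = t * X w i" for i using elim(2) by (simp add: t_def)
  have fin: "0 < x \<Longrightarrow> finite {i. x \<le> J i w}" for x using decseq_level_set(1)[of "\<lambda>i. J i w" x] elim by simp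
  have lim: "((\<lambda>\<epsilon>. \<epsilon> powr \<gamma> * real (card {i. \<epsilon> \<le> J i w})) \<longlongrightarrow> 1 / Gamma (1 - \<gamma>)) (at_right 0)"
    using local_time_limit_iff[OF \<gamma>(1) fin, THEN iffD2, OF _ elim(1)] by simp
  have "filterlim (\<lambda>\<epsilon>. t * \<epsilon>) (at_right 0) (at_right 0)"
  proof (rule tendsto_imp_filterlim_at_right)
    show "((\<lambda>\<epsilon>. t * \<epsilon>) \<longlongrightarrow> 0) (at_right 0)" using tendsto_mult_left[OF tendsto_ident_at, of t 0 "{0<..}"] by simp
    show "\<forall>\<^sub>F \<epsilon> in at_right 0. 0 < t * \<epsilon>"
      using eventually_at_right_less[of "0::real"] by eventually_elim (use t in simp)
  qed
  from filterlim_compose[OF lim this]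
  have "((\<lambda>\<epsilon>. t powr (- \<gamma>) * ((t * \<epsilon>) powr \<gamma> * real (card {i. t * \<epsilon> \<le> J i w}))) \<longlongrightarrow> t powr (- \<gamma>) * (1 / Gamma (1 - \<gamma>))) (at_right 0)"
    by (rule tendsto_mult_left)
  moreover have "\<forall>\<^sub>F \<epsilon> in at_right 0. t powr (- \<gamma>) * ((t * \<epsilon>) powr \<gamma> * real (card {i. t * \<epsilon> \<le> J i w})) = \<epsilon> powr \<gamma> * real (card {i. \<epsilon> \<le> X w i})"
    using eventually_at_right_less[of "0::real"] by eventually_elim (use t in \<open>simp add: J powr_mult powr_minus\<close>)
  ultimately have "((\<lambda>\<epsilon>. \<epsilon> powr \<gamma> * real (card {i. \<epsilon> \<le> X w i})) \<longlongrightarrow> t powr (- \<gamma>) * (1 / Gamma (1 - \<gamma>))) (at_right 0)"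
    by (rule Lim_transform_eventually)
  then have "Lim (at_right 0) (\<lambda>\<epsilon>. \<epsilon> powr \<gamma> * real (card {i. \<epsilon> \<le> X w i})) = t powr (- \<gamma>) * (1 / Gamma (1 - \<gamma>))"
    by (intro tendsto_Lim) auto
  moreover have "0 < Gamma (1 - \<gamma>)" using \<gamma> by (intro Gamma_real_pos) simp
  ultimately have "local_time \<gamma> (X w) = t powr (- \<gamma>)"
    unfolding local_time_def by (metis (no_types, lifting) less_irrefl mult.left_commute mult.right_neutral nonzero_mult_div_cancel_left times_divide_eq_right)
  then show ?case unfolding inverse_local_time_def using t \<gamma> by (simp add: powr_powr t_def)
qed

end

section \<open>Conditional laws given the total mass\<close>

locale stable_pk = stable_points +
  fixes f :: "real \<Rightarrow> real" and K :: "real \<Rightarrow> (nat \<Rightarrow> real) measure"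
  assumes f_nonneg: "\<And>t. 0 \<le> f t" and f_borel [measurable]: "f \<in> borel_measurable borel"
    and f_density: "distributed W lborel (total J) (\<lambda>t. ennreal (f t))"
    and K: "regular_cond_law W PinfM (normalized J) (total J) K"
begin

lemma nn_integral_T:
  assumes "g \<in> borel_measurable borel"
  shows "(\<integral>\<^sup>+w. g (T w) \<partial>W) = (\<integral>\<^sup>+t. ennreal (f t) * g t \<partial>lborel)"
  using distributed_nn_integral[OF f_density, of g] assms by simp

lemma nn_integral_T_pos:
  assumes "g \<in> borel_measurable borel"
  shows "(\<integral>\<^sup>+w. g (T w) \<partial>W) = (\<integral>\<^sup>+t\<in>{0<..}. ennreal (f t) * g t \<partial>lborel)"
proof -
  have "(\<integral>\<^sup>+w. g (T w) \<partial>W) = (\<integral>\<^sup>+w. g (T w) * indicator {0<..} (T w) \<partial>W)"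
    by (rule nn_integral_cong_eventually[OF AE_T]) simp
  also have "\<dots> = (\<integral>\<^sup>+t. ennreal (f t) * (g t * indicator {0<..} t) \<partial>lborel)"
    by (rule nn_integral_T) (use assms in measurable)
  finally show ?thesis by (simp add: mult.assoc)
qed

text \<open>\<open>K\<close> is constrained only at positive arguments; a constant value elsewhere
  makes it a measurable kernel on the whole line.\<close>

definition K' :: "real \<Rightarrow> (nat \<Rightarrow> real) measure" where
  "K' t = (if t \<in> {0<..} then K t else return PinfM unit_seq)"

lemma K_meas: "K \<in> restrict_space borel {0<..} \<rightarrow>\<^sub>M prob_algebra PinfM" using K by (simp add: regular_cond_law_def)

lemma K'_meas [measurable]: "K' \<in> borel \<rightarrow>\<^sub>M prob_algebra PinfM" unfolding K'_def[abs_def]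
proof (rule measurable_If_restrict_space_iff[THEN iffD2, OF _ conjI])
  show "K \<in> restrict_space borel {x. x \<in> {0<..}} \<rightarrow>\<^sub>M prob_algebra PinfM" by (simp only: Collect_mem_eq K_meas)
  have "return PinfM unit_seq \<in> space (prob_algebra PinfM)"
    using prob_space_return[of unit_seq PinfM] unit_seq_Pinf by (simp add: space_prob_algebra)
  then show "(\<lambda>x. return PinfM unit_seq) \<in> restrict_space borel {x. x \<notin> {0<..}} \<rightarrow>\<^sub>M prob_algebra PinfM" by simp
qed auto

lemma K'_kernel: "prob_space (K' t)" "sets (K' t) = sets PinfM"
  using measurable_space[OF K'_meas, of t] by (simp_all add: space_prob_algebra)

lemma emeasure_K'_measurable: "A \<in> sets PinfM \<Longrightarrow> (\<lambda>t. emeasure (K' t) A) \<in> borel_measurable borel"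
  using measurable_compose[OF measurable_prob_algebraD[OF K'_meas] measurable_emeasure_subprob_algebra] by simp

text \<open>The two measures on the line agree on Borel sets by the defining property of the
  conditional law; the weight r is then integrated against both.\<close>

lemma disintegration:
  assumes A [measurable]: "A \<in> sets PinfM" and [measurable]: "r \<in> borel_measurable borel"
  shows "(\<integral>\<^sup>+w. r (T w) * indicator A (X w) \<partial>W) = (\<integral>\<^sup>+w. r (T w) * emeasure (K' (T w)) A \<partial>W)"
proof -
  note [measurable] = emeasure_K'_measurable[OF A]
  let ?\<mu> = "distr (density W (\<lambda>w. indicator A (X w))) borel T"
  let ?\<nu> = "density (distr W borel T) (\<lambda>t. emeasure (K' t) A)"
  have "?\<mu> = ?\<nu>"
  proof (rule measure_eqI)
    fix B assume "B \<in> sets ?\<mu>"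
    then have B [measurable]: "B \<in> sets borel" by simp
    have "emeasure ?\<mu> B = (\<integral>\<^sup>+w. indicator A (X w) * indicator (T -` B \<inter> space W) w \<partial>W)"
      by (simp add: emeasure_distr emeasure_density)
    also have "\<dots> = (\<integral>\<^sup>+w. indicator {w\<in>space W. T w \<in> B \<and> X w \<in> A} w \<partial>W)"
      by (intro nn_integral_cong) (simp split: split_indicator)
    also have "\<dots> = emeasure W {w\<in>space W. T w \<in> B \<and> X w \<in> A}" by (rule nn_integral_indicator) measurable
    \<comment> \<open>The defining property speaks of \<open>normalized J\<close> and of Borel sets
      inside the positive half-line; both changes affect a null set only.\<close>
    also have "\<dots> = emeasure W {w\<in>space W. T w \<in> B \<inter> {0<..} \<and> normalized J w \<in> A}"
    proof (rule emeasure_eq_AE)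
      show "AE w in W. (w \<in> {w\<in>space W. T w \<in> B \<and> X w \<in> A}) \<longleftrightarrow> (w \<in> {w\<in>space W. T w \<in> B \<inter> {0<..} \<and> normalized J w \<in> A})"
        using AE_X AE_T by eventually_elim auto
      show "{w\<in>space W. T w \<in> B \<and> X w \<in> A} \<in> sets W" by measurable
      have [measurable]: "(\<lambda>w. normalized J w) \<in> W \<rightarrow>\<^sub>M seq_borel"
        unfolding normalized_def by (rule measurable_PiM_single') auto
      have [measurable]: "A \<in> sets seq_borel" using sets_PinfM_subset[OF A] by simp
      show "{w\<in>space W. T w \<in> B \<inter> {0<..} \<and> normalized J w \<in> A} \<in> sets W" by measurable
    qed
    also have "\<dots> = (\<integral>\<^sup>+w. emeasure (K (T w)) A * indicator (B \<inter> {0<..}) (T w) \<partial>W)"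
      using conjunct2[OF K[unfolded regular_cond_law_def], rule_format, OF A, of "B \<inter> {0<..}"] B by simp
    also have "\<dots> = (\<integral>\<^sup>+w. emeasure (K' (T w)) A * indicator B (T w) \<partial>W)"
      by (rule nn_integral_cong_eventually[OF AE_T]) (auto simp: K'_def split: split_indicator)
    also have "\<dots> = emeasure ?\<nu> B" by (subst emeasure_density) (simp_all add: nn_integral_distr)
    finally show "emeasure ?\<mu> B = emeasure ?\<nu> B" .
  qed simp
  from arg_cong[OF this, of "\<lambda>\<mu>. \<integral>\<^sup>+t. r t \<partial>\<mu>"] show ?thesis
    by (simp add: nn_integral_distr nn_integral_density mult.commute)
qed

text \<open>The reparametrization \<open>g\<close> is kept general because one mixture is indexed by
  s with total mass s powr (- 1 / \<beta>).\<close>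

lemma emeasure_mixture_kernel:
  assumes g: "g \<in> borel_measurable borel" "\<And>s. 0 < s \<Longrightarrow> 0 < g s"
    and \<rho>m: "(\<lambda>s. ennreal (\<rho> s)) \<in> borel_measurable (restrict_space lborel {0<..})" and A: "A \<in> sets PinfM"
  shows "emeasure (mixture (\<lambda>s. K (g s)) \<rho>) A = (\<integral>\<^sup>+s\<in>{0<..}. ennreal (\<rho> s) * emeasure (K' (g s)) A \<partial>lborel)"
proof -
  let ?R = "restrict_space lborel {0<..} :: real measure"
  have sR: "sets (density ?R (\<lambda>s. ennreal (\<rho> s))) = sets (restrict_space borel {0<..})"
    by (simp add: sets_restrict_space)
  have "g \<in> restrict_space borel {0<..} \<rightarrow>\<^sub>M restrict_space borel {0<..}"
    by (rule measurable_restrict_space2) (use g in \<open>auto simp: space_restrict_space intro: measurable_restrict_space1\<close>)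
  from measurable_compose[OF this measurable_prob_algebraD[OF K_meas]]
  have Km: "(\<lambda>s. K (g s)) \<in> density ?R (\<lambda>s. ennreal (\<rho> s)) \<rightarrow>\<^sub>M subprob_algebra PinfM"
    using measurable_cong_sets[OF sR refl] by blast
  have "emeasure (mixture (\<lambda>s. K (g s)) \<rho>) A = (\<integral>\<^sup>+s. emeasure (K (g s)) A \<partial>density ?R (\<lambda>s. ennreal (\<rho> s)))"
    unfolding mixture_def by (rule emeasure_bind[OF _ Km A]) (simp add: space_restrict_space)
  also have "\<dots> = (\<integral>\<^sup>+s. emeasure (K' (g s)) A \<partial>density ?R (\<lambda>s. ennreal (\<rho> s)))"
    by (intro nn_integral_cong) (simp add: K'_def g(2) space_restrict_space)
  also have "\<dots> = (\<integral>\<^sup>+s. ennreal (\<rho> s) * emeasure (K' (g s)) A \<partial>?R)"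
    by (rule nn_integral_density[OF \<rho>m], rule measurable_restrict_space1) (simp add: measurable_compose[OF g(1) emeasure_K'_measurable[OF A]])
  also have "\<dots> = (\<integral>\<^sup>+s\<in>{0<..}. ennreal (\<rho> s) * emeasure (K' (g s)) A \<partial>lborel)" by (rule nn_integral_restrict_space) simp
  finally show ?thesis .
qed

lemma nn_integral_T_kernel:
  assumes [measurable]: "r \<in> borel_measurable borel" and r0: "\<And>t. 0 < t \<Longrightarrow> 0 \<le> r t" and A: "A \<in> sets PinfM"
  shows "(\<integral>\<^sup>+t\<in>{0<..}. ennreal (r t * f t) * emeasure (K' t) A \<partial>lborel) = (\<integral>\<^sup>+w. ennreal (r (T w)) * indicator A (X w) \<partial>W)"
proof -
  note [measurable] = emeasure_K'_measurable[OF A]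
  have "(\<integral>\<^sup>+t\<in>{0<..}. ennreal (r t * f t) * emeasure (K' t) A \<partial>lborel)
    = (\<integral>\<^sup>+s\<in>{0<..}. ennreal (f s) * (ennreal (r s) * emeasure (K' s) A) \<partial>lborel)"
    using r0 f_nonneg by (intro nn_integral_cong) (auto simp: ennreal_mult mult_ac split: split_indicator)
  also have "\<dots> = (\<integral>\<^sup>+w. ennreal (r (T w)) * emeasure (K' (T w)) A \<partial>W)" by (rule nn_integral_T_pos[symmetric]) simp
  also have "\<dots> = (\<integral>\<^sup>+w. ennreal (r (T w)) * indicator A (X w) \<partial>W)" by (rule disintegration[OF A, symmetric]) simp
  finally show ?thesis .
qed

text \<open>Translates Poisson-Kingman mixtures into changes of measure: the mixing density r * f
  corresponds to the density r(T) for the normalized points.\<close>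

lemma emeasure_mixture:
  assumes [measurable]: "r \<in> borel_measurable borel" and r0: "\<And>t. 0 < t \<Longrightarrow> 0 \<le> r t"
    and \<rho>: "\<And>t. 0 < t \<Longrightarrow> \<rho> t = r t * f t" and A: "A \<in> sets PinfM"
  shows "emeasure (mixture K \<rho>) A = (\<integral>\<^sup>+w. ennreal (r (T w)) * indicator A (X w) \<partial>W)"
proof -
  have "(\<lambda>s. ennreal (\<rho> s)) \<in> borel_measurable (restrict_space lborel {0<..})"
  proof (subst measurable_cong)
    show "s \<in> space (restrict_space lborel {0<..}) \<Longrightarrow> ennreal (\<rho> s) = ennreal (r s * f s)" for s by (simp add: \<rho> space_restrict_space)
    show "(\<lambda>s. ennreal (r s * f s)) \<in> borel_measurable (restrict_space lborel {0<..})" by (rule measurable_restrict_space1) simp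
  qed
  from emeasure_mixture_kernel[where g="\<lambda>s. s", OF _ _ this A]
  have "emeasure (mixture K \<rho>) A = (\<integral>\<^sup>+s\<in>{0<..}. ennreal (\<rho> s) * emeasure (K' s) A \<partial>lborel)" by simp
  also have "\<dots> = (\<integral>\<^sup>+s\<in>{0<..}. ennreal (r s * f s) * emeasure (K' s) A \<partial>lborel)"
    by (intro nn_integral_cong) (simp add: \<rho> split: split_indicator)
  finally show ?thesis using nn_integral_T_kernel[OF assms(1) r0 A] by simp
qed

lemma sets_mixture [simp]: "sets (mixture K \<rho>) = sets PinfM"
proof -
  have "sets (K s) = sets PinfM" if "0 < s" for s
    using measurable_space[OF K_meas, of s] that by (simp add: space_prob_algebra space_restrict_space)
  then show ?thesis unfolding mixture_def by (intro sets_bind) (auto simp: space_restrict_space intro!: exI[of _ 1])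
qed

end

section \<open>Coagulation\<close>

context stable_points
begin

text \<open>Given the points, their marks are independent; averaging over the marks turns the joint Laplace
  transform of the sums over the classes into a Laplace functional of the points.\<close>

lemma marked_sums_law:
  fixes U :: "real measure" and I :: "nat \<Rightarrow> real set" and q :: "nat \<Rightarrow> real"
  assumes U: "prob_space U" and SU[measurable_cong]: "sets U = sets borel" and I[measurable]: "\<And>l. I l \<in> sets borel"
    and disj: "disjoint_family I" and q: "\<And>l. 0 \<le> q l" "\<And>l. emeasure U (I l) = ennreal (q l)"
  shows "distr (W \<Otimes>\<^sub>M PiM UNIV (\<lambda>_::nat. U)) seq_borel
      (\<lambda>(w, t) l. enn2real (\<Sum>k. ennreal (J k w) * indicator (I l) (t k)))
    = distr (PiM UNIV (\<lambda>_::nat. W)) seq_borel (\<lambda>v l. q l powr (1 / \<gamma>) * T (v l))"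
proof -
  let ?S = "\<lambda>l w t. enn2real (\<Sum>k. ennreal (J k w) * indicator (I l) (t k))"
  let ?UN = "PiM UNIV (\<lambda>_::nat. U)"
  interpret U: prob_space U by fact
  interpret UN: prob_space ?UN by (intro prob_space_PiM U)
  interpret WN: prob_space "PiM UNIV (\<lambda>_::nat. W)" by (intro prob_space_PiM prob_space_axioms)
  interpret pair: pair_prob_space W ?UN ..
  have tm: "(\<lambda>t. t k) \<in> ?UN \<rightarrow>\<^sub>M borel" for k :: nat
    using measurable_component_singleton[of k UNIV "\<lambda>_. U"] by (simp add: measurable_cong_sets[OF refl SU])
  have wm[measurable]: "(\<lambda>v. T (v k)) \<in> borel_measurable (PiM UNIV (\<lambda>_::nat. W))" for k by measurable
  have "distr (W \<Otimes>\<^sub>M ?UN) seq_borel (\<lambda>z l. (case z of (w, t) \<Rightarrow> ?S l w t))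
    = distr (PiM UNIV (\<lambda>_::nat. W)) seq_borel (\<lambda>v l. q l powr (1 / \<gamma>) * T (v l))"
  proof (rule seq_law_eqI_laplace)
    show "prob_space (W \<Otimes>\<^sub>M ?UN)" by (rule pair.prob_space_axioms)
    show "prob_space (PiM UNIV (\<lambda>_::nat. W))" by (rule WN.prob_space_axioms)
    note tm[measurable]
    show "(\<lambda>z. (case z of (w, t) \<Rightarrow> ?S l w t)) \<in> borel_measurable (W \<Otimes>\<^sub>M ?UN)" for l by measurable
    show "AE v in PiM UNIV (\<lambda>_. W). 0 \<le> q l powr (1 / \<gamma>) * T (v l)" for l
    proof -
      have "AE w in W. 0 < T w" using AE_T by eventually_elim simp
      then have "AE v in PiM UNIV (\<lambda>_. W). 0 < T (v l)" by (intro AE_PiM_component) (auto intro: prob_space_axioms)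
      then show ?thesis by eventually_elim (auto intro: less_imp_le)
    qed
    fix c :: "nat \<Rightarrow> real" and n :: nat assume c: "\<And>l. 0 \<le> c l"
    let ?E = "\<lambda>l x. ennreal (1 - exp (- (c l * x)))"
    \<comment> \<open>Contribution to the exponent of a point of size x with mark t; only the class
      containing t contributes.\<close>
    define \<phi> where "\<phi> t x = (\<Sum>l<n. ennreal (c l) * (ennreal x * indicator (I l) t))" for t x :: real
    let ?n = "\<lambda>x. (\<integral>\<^sup>+t. nexp (\<phi> t x) \<partial>U)"
    define \<Phi> where "\<Phi> x = nln (?n x)" for x
    note tm[measurable del]
    have \<phi>m1[measurable]: "(\<lambda>t. \<phi> t x) \<in> borel_measurable U" for x unfolding \<phi>_def by measurable
    have \<Phi>m[measurable]: "\<Phi> \<in> borel_measurable borel" unfolding \<Phi>_def[abs_def] \<phi>_def by measurable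
    have int_le: "?n x \<le> 1" for x
      using nn_integral_mono[of U "\<lambda>t. nexp (\<phi> t x)" "\<lambda>_. 1"] by (simp add: U.emeasure_space_1)
    have one_minus: "1 - nexp (\<Phi> x) = (\<Sum>l<n. ennreal (q l) * ?E l x)" if x: "0 < x" for x
    proof -
      \<comment> \<open>Since the classes are disjoint, 1 - exp(-\<phi>) splits into one term for
        each class. The Laplace exponent becomes a sum over the classes, which is the independence
        of the class sums.\<close>
      have pt: "nexp (\<phi> t x) + (\<Sum>l<n. ?E l x * indicator (I l) t) = 1" for t
      proof (cases "\<exists>l<n. t \<in> I l")
        case True
        then obtain l where l: "l < n" "t \<in> I l" by auto
        have other: "t \<notin> I k" if "k \<noteq> l" for k using disj l(2) that by (auto simp: disjoint_family_on_def)
        have "\<phi> t x = ennreal (c l) * (ennreal x * indicator (I l) t) + (\<Sum>k\<in>{..<n}-{l}. ennreal (c k) * (ennreal x * indicator (I k) t))"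
          unfolding \<phi>_def by (rule sum.remove) (use l in auto)
        also have "(\<Sum>k\<in>{..<n}-{l}. ennreal (c k) * (ennreal x * indicator (I k) t)) = 0"
          using other by (intro sum.neutral) auto
        finally have 1: "\<phi> t x = ennreal (c l * x)" using l c[of l] x by (simp add: ennreal_mult)
        have "(\<Sum>l<n. ?E l x * indicator (I l) t) = ?E l x * indicator (I l) t
            + (\<Sum>k\<in>{..<n}-{l}. ?E k x * indicator (I k) t)" by (rule sum.remove) (use l in auto)
        also have "(\<Sum>k\<in>{..<n}-{l}. ?E k x * indicator (I k) t) = 0" using other by (intro sum.neutral) auto
        finally show ?thesis using l c[of l] x unfolding 1
          by (simp add: nexp_ennreal ennreal_plus[symmetric] del: ennreal_plus)
      next
        case False
        then have "\<phi> t x = 0" "(\<Sum>l<n. ?E l x * indicator (I l) t) = 0" unfolding \<phi>_def by (auto intro!: sum.neutral)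
        then show ?thesis by simp
      qed
      have "1 = (\<integral>\<^sup>+t. nexp (\<phi> t x) + (\<Sum>l<n. ?E l x * indicator (I l) t) \<partial>U)"
        unfolding pt by (simp add: U.emeasure_space_1)
      also have "\<dots> = ?n x + (\<integral>\<^sup>+t. (\<Sum>l<n. ?E l x * indicator (I l) t) \<partial>U)" by (rule nn_integral_add) measurable
      also have "(\<integral>\<^sup>+t. (\<Sum>l<n. ?E l x * indicator (I l) t) \<partial>U)
          = (\<Sum>l<n. \<integral>\<^sup>+t. ?E l x * indicator (I l) t \<partial>U)" by (rule nn_integral_sum) measurable
      also have "(\<Sum>l<n. \<integral>\<^sup>+t. ?E l x * indicator (I l) t \<partial>U) = (\<Sum>l<n. ennreal (q l) * ?E l x)"
        by (intro sum.cong refl, subst nn_integral_cmult_indicator) (auto simp: q SU mult.commute)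
      finally have "1 - ?n x = (\<Sum>l<n. ennreal (q l) * ?E l x)"
        using int_le[of x] by (metis ennreal_add_diff_cancel_left infinity_ennreal_def le_less_trans ennreal_one_less_top less_irrefl)
      then show ?thesis unfolding \<Phi>_def nexp_nln[OF int_le] .
    qed
    have pexp\<Phi>: "pexp \<Phi> = (\<Sum>l<n. ennreal (q l * c l powr \<gamma>))"
    proof -
      have "pexp \<Phi> = (\<integral>\<^sup>+x. (\<Sum>l<n. ennreal (q l) * ?E l x) \<partial>\<nu>)"
        unfolding pexp_def by (rule nn_integral_cong_eventually[OF AE_stable_intensity_pos]) (rule one_minus)
      also have "\<dots> = (\<Sum>l<n. \<integral>\<^sup>+x. ennreal (q l) * ?E l x \<partial>\<nu>)" by (rule nn_integral_sum) simp
      also have "\<dots> = (\<Sum>l<n. ennreal (q l * c l powr \<gamma>))"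
      proof (rule sum.cong[OF refl])
        fix l
        have "(\<integral>\<^sup>+x. ennreal (q l) * ?E l x \<partial>\<nu>) = ennreal (q l) * (\<integral>\<^sup>+x. ?E l x \<partial>\<nu>)" by (rule nn_integral_cmult) simp
        also have "(\<integral>\<^sup>+x. ?E l x \<partial>\<nu>) = ennreal (c l powr \<gamma>)"
          using nn_integral_stable_laplace[OF \<gamma>, of "c l"] c[of l] by (cases "c l = 0") auto
        finally show "(\<integral>\<^sup>+x. ennreal (q l) * ?E l x \<partial>\<nu>) = ennreal (q l * c l powr \<gamma>)"
          using q(1)[of l] by (simp add: ennreal_mult)
      qed
      finally show ?thesis .
    qed
    note tm[measurable]
    have "(\<integral>\<^sup>+z. ennreal (exp (- (\<Sum>l<n. c l * (case z of (w, t) \<Rightarrow> ?S l w t)))) \<partial>(W \<Otimes>\<^sub>M ?UN))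
      = (\<integral>\<^sup>+w. (\<integral>\<^sup>+t. ennreal (exp (- (\<Sum>l<n. c l * ?S l w t))) \<partial>?UN) \<partial>W)"
      by (subst UN.nn_integral_fst[symmetric]) simp_all
    also have "\<dots> = (\<integral>\<^sup>+w. (\<integral>\<^sup>+t. nexp (\<Sum>k. \<phi> (t k) (J k w)) \<partial>?UN) \<partial>W)"
    proof (rule nn_integral_cong_eventually[OF AE_sum_finite], rule nn_integral_cong)
      fix w and t :: "nat \<Rightarrow> real" assume fin: "(\<Sum>i. ennreal (J i w)) < \<top>"
      have fin': "(\<Sum>k. ennreal (J k w) * indicator (I l) (t k)) < \<top>" for l
      proof (rule le_less_trans[OF _ fin], intro suminf_le summableI)
        show "ennreal (J k w) * indicator (I l) (t k) \<le> ennreal (J k w)" for k by (auto split: split_indicator)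
      qed
      have "(\<Sum>k. \<phi> (t k) (J k w)) = (\<Sum>l<n. \<Sum>k. ennreal (c l) * (ennreal (J k w) * indicator (I l) (t k)))"
        unfolding \<phi>_def by (rule suminf_sum) auto
      also have "\<dots> = (\<Sum>l<n. ennreal (c l * ?S l w t))" using fin' c by (intro sum.cong refl) (simp add: ennreal_mult)
      also have "\<dots> = ennreal (\<Sum>l<n. c l * ?S l w t)" using c by (intro sum_ennreal) simp
      finally show "ennreal (exp (- (\<Sum>l<n. c l * ?S l w t))) = nexp (\<Sum>k. \<phi> (t k) (J k w))"
        using c by (simp add: nexp_ennreal sum_nonneg)
    qed
    also have "\<dots> = (\<integral>\<^sup>+w. nexp (\<Sum>k. \<Phi> (J k w)) \<partial>W)"
      unfolding \<Phi>_def by (intro nn_integral_cong nn_integral_PiM_nexp_suminf U) simp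
    also have "\<dots> = nexp (\<Sum>l<n. ennreal (q l * c l powr \<gamma>))" by (simp add: laplace_functional pexp\<Phi>)
    also have "\<dots> = (\<Prod>l<n. ennreal (exp (- (q l * c l powr \<gamma>))))"
      unfolding nexp_sum[OF finite_lessThan] by (intro prod.cong refl nexp_ennreal mult_nonneg_nonneg q) simp
    also have "\<dots> = (\<Prod>l<n. \<integral>\<^sup>+w. ennreal (exp (- (c l * q l powr (1 / \<gamma>) * T w))) \<partial>W)"
    proof (rule prod.cong[OF refl])
      fix l
      \<comment> \<open>Keeping a fraction q of the points has the same effect on the Laplace
        exponent as scaling all points by q powr (1 / \<gamma>).\<close>
      have "(c l * q l powr (1 / \<gamma>)) powr \<gamma> = q l * c l powr \<gamma>"
        using c[of l] q(1)[of l] \<gamma> by (simp add: powr_mult powr_powr)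
      then show "ennreal (exp (- (q l * c l powr \<gamma>))) = (\<integral>\<^sup>+w. ennreal (exp (- (c l * q l powr (1 / \<gamma>) * T w))) \<partial>W)"
        using laplace_T[of "c l * q l powr (1 / \<gamma>)"] c[of l] by simp
    qed
    also have "\<dots> = (\<integral>\<^sup>+v. (\<Prod>l<n. ennreal (exp (- (c l * q l powr (1 / \<gamma>) * T (v l))))) \<partial>PiM UNIV (\<lambda>_. W))"
      by (rule nn_integral_PiM_prod[symmetric]) (auto intro: prob_space_axioms)
    also have "\<dots> = (\<integral>\<^sup>+v. ennreal (exp (- (\<Sum>l<n. c l * (q l powr (1 / \<gamma>) * T (v l))))) \<partial>PiM UNIV (\<lambda>_. W))"
      by (intro nn_integral_cong) (simp add: prod_ennreal exp_sum[symmetric] sum_negf mult.assoc)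
    finally show "(\<integral>\<^sup>+z. ennreal (exp (- (\<Sum>l<n. c l * (case z of (w, t) \<Rightarrow> ?S l w t)))) \<partial>(W \<Otimes>\<^sub>M ?UN))
      = (\<integral>\<^sup>+v. ennreal (exp (- (\<Sum>l<n. c l * (q l powr (1 / \<gamma>) * T (v l))))) \<partial>PiM UNIV (\<lambda>_. W))" .
  qed auto
  then show ?thesis by (simp add: split_beta')
qed

end

text \<open>Markov's inequality for the counting measure.\<close>

lemma level_set_finite:
  fixes m :: "'i \<Rightarrow> real"
  assumes "(\<integral>\<^sup>+i. ennreal (m i) \<partial>count_space I) < \<top>" "0 < x"
  shows "finite {i\<in>I. x \<le> m i}"
proof (rule ccontr)
  assume "\<not> ?thesis"
  then have "emeasure (count_space I) {i\<in>I. x \<le> m i} = \<top>" by (simp add: emeasure_count_space)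
  moreover have "ennreal x * emeasure (count_space I) {i\<in>I. x \<le> m i} \<le> (\<integral>\<^sup>+i. ennreal (m i) \<partial>count_space I)"
  proof -
    have "ennreal x * emeasure (count_space I) {i\<in>I. x \<le> m i} = (\<integral>\<^sup>+i\<in>{i\<in>I. x \<le> m i}. ennreal x \<partial>count_space I)"
      by (rule nn_integral_cmult_indicator[symmetric]) auto
    also have "\<dots> \<le> (\<integral>\<^sup>+i. ennreal (m i) \<partial>count_space I)"
      by (intro nn_integral_mono) (auto split: split_indicator intro: ennreal_leI)
    finally show ?thesis .
  qed
  ultimately show False using assms by (simp add: ennreal_mult_top)
qed

lemma ranked_sums:
  fixes m :: "'i \<Rightarrow> real"
  assumes s: "(\<integral>\<^sup>+i. ennreal (m i) \<partial>count_space I) = ennreal s" "0 \<le> s"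
  shows "summable (ranked I m)" "suminf (ranked I m) = s"
proof -
  have fin: "0 < x \<Longrightarrow> finite {i\<in>I. x \<le> m i}" for x by (rule level_set_finite) (simp add: s)
  have eq: "(\<Sum>n. ennreal (ranked I m n)) = ennreal s"
    using suminf_ranked[where \<phi>=ennreal, OF fin] s by (simp add: ennreal_neg)
  have nn: "0 \<le> ranked I m n" for n by (rule ranked_nonneg[OF fin])
  show sm: "summable (ranked I m)" by (rule summable_suminf_not_top) (use nn eq in auto)
  have "ennreal (suminf (ranked I m)) = ennreal s" using suminf_ennreal2[OF nn sm] eq by simp
  then show "suminf (ranked I m) = s" using suminf_nonneg[OF sm nn] s(2) by (subst (asm) ennreal_inj) auto
qed

lemma ranked_scale:
  assumes fin: "\<And>x. 0 < x \<Longrightarrow> finite {i\<in>I. x \<le> m i}" and c: "0 < c"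
  shows "ranked I (\<lambda>i. c * m i) = (\<lambda>n. c * ranked I m n)"
proof
  fix n
  have lev: "{i\<in>I. x \<le> c * m i} = {i\<in>I. x / c \<le> m i}" for x using c by (auto simp: field_simps)
  have fin': "0 < x \<Longrightarrow> finite {i\<in>I. x \<le> c * m i}" for x unfolding lev using c by (intro fin) simp
  have *: "x \<le> ranked I (\<lambda>i. c * m i) n \<longleftrightarrow> x \<le> c * ranked I m n" if x: "0 < x" for x
  proof -
    have "x \<le> ranked I (\<lambda>i. c * m i) n \<longleftrightarrow> Suc n \<le> card {i\<in>I. x / c \<le> m i}"
      using le_ranked_iff[where n=n, OF fin' x] unfolding lev .
    also have "\<dots> \<longleftrightarrow> x / c \<le> ranked I m n" using le_ranked_iff[where n=n, OF fin, of "x / c"] x c by simp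
    also have "\<dots> \<longleftrightarrow> x \<le> c * ranked I m n" using c by (simp add: field_simps)
    finally show ?thesis .
  qed
  have "0 \<le> ranked I (\<lambda>i. c * m i) n" "0 \<le> c * ranked I m n"
    using ranked_nonneg[where n=n, OF fin'] ranked_nonneg[where n=n, OF fin] c by simp_all
  with *[of "ranked I (\<lambda>i. c * m i) n"] *[of "c * ranked I m n"]
  show "ranked I (\<lambda>i. c * m i) n = c * ranked I m n" by linarith
qed

lemma normseq_scale:
  assumes "summable a" "0 < c"
  shows "normseq (\<lambda>i. c * a i) = normseq a" using assms by (simp add: normseq_def suminf_mult)

section \<open>Uniform marks and the interval partition generated by the jumps of a bridge\<close>

abbreviation unif :: "real measure" where "unif \<equiv> uniform_measure lborel {0..1}"
abbreviation unif_seq :: "(nat \<Rightarrow> real) measure" where "unif_seq \<equiv> PiM UNIV (\<lambda>_. unif)"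

lemma prob_space_unif: "prob_space unif" by (rule prob_space_uniform_measure) auto

lemma prob_space_unif_seq: "prob_space unif_seq" by (intro prob_space_PiM prob_space_unif)

lemma sets_unif_seq [measurable_cong]: "sets unif_seq = sets seq_borel" by (intro sets_PiM_cong) auto

lemma emeasure_unif: "A \<in> sets borel \<Longrightarrow> A \<subseteq> {0..1} \<Longrightarrow> emeasure unif A = emeasure lborel A"
  by (subst emeasure_uniform_measure) (auto simp: Int_absorb1 divide_ennreal_def)

lemma emeasure_unif_singleton: "emeasure unif {x} = 0"
proof -
  have "emeasure unif {x} = emeasure lborel ({0..1} \<inter> {x}) / emeasure lborel {0..1::real}"
    by (rule emeasure_uniform_measure) auto
  moreover have "emeasure lborel ({0..1} \<inter> {x}) \<le> emeasure lborel {x}" by (intro emeasure_mono) auto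
  ultimately show ?thesis by simp
qed

lemma AE_unif_seq_component: "AE x in unif. Q x \<Longrightarrow> AE u in unif_seq. \<forall>k. Q (u k)"
  unfolding AE_all_countable by (intro allI AE_PiM_component prob_space_unif) auto

text \<open>Coordinate i is drawn last: given all others, it hits the value of coordinate j with
  probability 0.\<close>

lemma AE_unif_seq_inj: "AE u in unif_seq. inj u"
proof -
  have "AE u in unif_seq. u i \<noteq> u j" if ij: "i \<noteq> j" for i j
  proof -
    let ?R = "PiM (UNIV - {i}) (\<lambda>_. unif)"
    interpret R: prob_space ?R by (intro prob_space_PiM prob_space_unif)
    interpret U: prob_space unif by (rule prob_space_unif)
    interpret pair_sigma_finite unif ?R ..
    have ins: "insert i (UNIV - {i}) = UNIV" by auto
    have jm[measurable]: "(\<lambda>X. X j) \<in> borel_measurable ?R"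
      using measurable_component_singleton[of j "UNIV - {i}" "\<lambda>_. unif"] ij by (simp cong: measurable_cong_sets)
    have um[measurable]: "(\<lambda>u. u k) \<in> borel_measurable unif_seq" for k
      using measurable_component_singleton[of k UNIV "\<lambda>_. unif"] by (simp cong: measurable_cong_sets)
    have upd: "(\<lambda>(x, X). X(i := x)) \<in> unif \<Otimes>\<^sub>M ?R \<rightarrow>\<^sub>M unif_seq"
    proof -
      have "(\<lambda>z. (\<lambda>(f, y). f(i := y)) ((\<lambda>(x, y). (y, x)) z)) \<in> unif \<Otimes>\<^sub>M ?R \<rightarrow>\<^sub>M PiM (insert i (UNIV - {i})) (\<lambda>_. unif)"
        by (rule measurable_compose[OF measurable_pair_swap' measurable_add_dim])
      then show ?thesis unfolding ins by (simp add: split_beta')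
    qed
    have m: "{u \<in> space unif_seq. u i = u j} \<in> sets unif_seq" by measurable
    have "emeasure unif_seq {u \<in> space unif_seq. u i = u j} = (\<integral>\<^sup>+u. indicator {u \<in> space unif_seq. u i = u j} u \<partial>unif_seq)"
      by (rule nn_integral_indicator[OF m, symmetric])
    also have "\<dots> = (\<integral>\<^sup>+u. indicator {u \<in> space unif_seq. u i = u j} u \<partial>distr (unif \<Otimes>\<^sub>M ?R) unif_seq (\<lambda>(x, X). X(i := x)))"
      using distr_pair_PiM_eq_PiM[of "UNIV - {i}" "\<lambda>_. unif" i] prob_space_unif unfolding ins by simp
    also have "\<dots> = (\<integral>\<^sup>+z. indicator {u \<in> space unif_seq. u i = u j} (case z of (x, X) \<Rightarrow> X(i := x)) \<partial>(unif \<Otimes>\<^sub>M ?R))"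
      by (rule nn_integral_distr[OF upd]) (use m in simp)
    also have "\<dots> = (\<integral>\<^sup>+X. (\<integral>\<^sup>+x. indicator {u \<in> space unif_seq. u i = u j} (X(i := x)) \<partial>unif) \<partial>?R)"
    proof -
      have gm: "(\<lambda>z. indicator {u \<in> space unif_seq. u i = u j} (case z of (x, X) \<Rightarrow> X(i := x)) :: ennreal) \<in> borel_measurable (unif \<Otimes>\<^sub>M ?R)"
        by (rule measurable_compose[OF upd]) (use m in simp)
      show ?thesis using nn_integral_snd[OF gm] by simp
    qed
    also have "\<dots> = (\<integral>\<^sup>+X. 0 \<partial>?R)"
    proof (rule nn_integral_cong)
      fix X
      have "(\<integral>\<^sup>+x. indicator {u \<in> space unif_seq. u i = u j} (X(i := x)) \<partial>unif) \<le> (\<integral>\<^sup>+x. indicator {X j} x \<partial>unif)"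
        using ij by (intro nn_integral_mono) (auto split: split_indicator)
      also have "\<dots> = 0" using emeasure_unif_singleton[of "X j"] by simp
      finally show "(\<integral>\<^sup>+x. indicator {u \<in> space unif_seq. u i = u j} (X(i := x)) \<partial>unif) = 0" by simp
    qed
    finally have "emeasure unif_seq {u \<in> space unif_seq. u i = u j} = 0" by simp
    then show ?thesis using m by (intro AE_I[of _ _ "{u \<in> space unif_seq. u i = u j}"]) auto
  qed
  then have "AE u in unif_seq. \<forall>i j. i \<noteq> j \<longrightarrow> u i \<noteq> u j" unfolding AE_all_countable by (auto intro: AE_I2)
  then show ?thesis by eventually_elim (auto simp: inj_def)
qed

definition cut_l :: "(nat \<Rightarrow> real) \<Rightarrow> (nat \<Rightarrow> real) \<Rightarrow> nat \<Rightarrow> real" where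
  "cut_l q u l = (\<Sum>m. q m * (if u m < u l then 1 else 0))"

definition cut_r :: "(nat \<Rightarrow> real) \<Rightarrow> (nat \<Rightarrow> real) \<Rightarrow> nat \<Rightarrow> real" where
  "cut_r q u l = (\<Sum>m. q m * (if u m \<le> u l then 1 else 0))"

text \<open>The gap left in the range of \<open>bridge q u\<close> by its jump at
  \<open>u l\<close>; for a partition q and injective u its length is q l. The end points are left
  out, being null under the uniform marks.\<close>

definition cell :: "(nat \<Rightarrow> real) \<Rightarrow> (nat \<Rightarrow> real) \<Rightarrow> nat \<Rightarrow> real set" where
  "cell q u l = {cut_l q u l<..<cut_r q u l}"

lemma summable_Pinf_if: "q \<in> Pinf \<Longrightarrow> summable (\<lambda>m. q m * (if Q m then 1 else 0))"
  by (rule summable_comparison_test'[OF Pinf_props(4)[of q], of 0]) (auto simp: Pinf_props(3))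

lemma cut_facts:
  assumes q: "q \<in> Pinf" and u: "inj u"
  shows "0 \<le> cut_l q u l" "cut_r q u l \<le> 1" "cut_r q u l - cut_l q u l = q l"
    and cut_mono: "u l < u m \<Longrightarrow> cut_r q u l \<le> cut_l q u m"
proof -
  note sm = summable_Pinf_if[OF q]
  show "0 \<le> cut_l q u l" unfolding cut_l_def by (intro suminf_nonneg sm) (auto simp: Pinf_props(3)[OF q])
  have "cut_r q u l \<le> suminf q" unfolding cut_r_def
    by (intro suminf_le sm Pinf_props(4) q) (auto simp: Pinf_props(3)[OF q])
  then show "cut_r q u l \<le> 1" using Pinf_props(5)[OF q] by simp
  have "cut_r q u l - cut_l q u l = (\<Sum>m. q m * (if u m \<le> u l then 1 else 0) - q m * (if u m < u l then 1 else 0))"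
    unfolding cut_l_def cut_r_def by (rule suminf_diff[OF sm sm])
  also have "\<dots> = (\<Sum>m\<in>{l}. q m * (if u m \<le> u l then 1 else 0) - q m * (if u m < u l then 1 else 0))"
    using u by (intro suminf_finite) (auto simp: inj_eq le_less)
  finally show "cut_r q u l - cut_l q u l = q l" by simp
  show "cut_r q u l \<le> cut_l q u m" if "u l < u m"
    unfolding cut_l_def cut_r_def by (intro suminf_le sm) (use that in \<open>auto simp: Pinf_props(3)[OF q]\<close>)
qed

lemma cell_disjoint:
  assumes q: "q \<in> Pinf" and u: "inj u"
  shows "disjoint_family (cell q u)"
proof (unfold disjoint_family_on_def, intro ballI impI)
  fix l m :: nat assume "l \<noteq> m"
  then have "u l < u m \<or> u m < u l" using u by (metis injD linorder_neqE)
  then show "cell q u l \<inter> cell q u m = {}"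
    using cut_mono[OF q u, of l m] cut_mono[OF q u, of m l] by (auto simp: cell_def)
qed

lemma cell_sets [measurable]: "cell q u l \<in> sets borel" by (simp add: cell_def)

lemma emeasure_cell:
  assumes q: "q \<in> Pinf" and u: "inj u"
  shows "emeasure unif (cell q u l) = ennreal (q l)"
proof -
  note c = cut_facts[OF q u, of l]
  have "emeasure unif (cell q u l) = emeasure lborel (cell q u l)"
    using c by (intro emeasure_unif) (auto simp: cell_def)
  then show ?thesis using c Pinf_props(3)[OF q, of l] by (simp add: cell_def)
qed

text \<open>The cells are disjoint, and their total length is the sum of q, which is 1.\<close>

lemma AE_cells:
  assumes q: "q \<in> Pinf" and u: "inj u"
  shows "AE t in unif_seq. \<forall>k. \<exists>l. t k \<in> cell q u l"
proof (rule AE_unif_seq_component)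
  interpret prob_space unif by (rule prob_space_unif)
  have "emeasure unif (\<Union>l. cell q u l) = (\<Sum>l. emeasure unif (cell q u l))"
    by (rule suminf_emeasure[symmetric]) (auto simp: cell_disjoint[OF q u])
  also have "\<dots> = 1" using q unfolding emeasure_cell[OF q u] Pinf_iff by simp
  finally have "AE t in unif. t \<in> (\<Union>l. cell q u l)" by (intro AE_in_set_eq_1[THEN iffD2]) (auto simp: measure_def)
  then show "AE t in unif. \<exists>l. t \<in> cell q u l" by eventually_elim auto
qed

text \<open>The total mass of the terms of \<open>v\<close> whose mark falls into the cell of \<open>l\<close>; the value 0 off the event
  \<open>inj u\<close> keeps the level sets finite everywhere.\<close>

definition blk :: "(nat \<Rightarrow> real) \<Rightarrow> (nat \<Rightarrow> real) \<Rightarrow> (nat \<Rightarrow> real) \<Rightarrow> (nat \<Rightarrow> real) \<Rightarrow> nat \<Rightarrow> real" where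
  "blk v q u t l = (if inj u then enn2real (\<Sum>k. ennreal (v k) * indicator (cell q u l) (t k)) else 0)"

lemma blk_nonneg: "0 \<le> blk v q u t l" by (simp add: blk_def)

lemma blk_finite:
  assumes "v \<in> Pinf" shows "(\<Sum>k. ennreal (v k) * indicator A (t k)) < \<top>"
proof -
  have "(\<Sum>k. ennreal (v k) * indicator A (t k)) \<le> (\<Sum>k. ennreal (v k))"
    by (intro suminf_le summableI) (auto split: split_indicator)
  also have "\<dots> < \<top>" using assms by (simp add: Pinf_iff)
  finally show ?thesis .
qed

lemma blk_sum:
  assumes v: "v \<in> Pinf" and q: "q \<in> Pinf"
  shows "(\<Sum>l. ennreal (blk v q u t l)) \<le> 1"
    and "inj u \<Longrightarrow> (\<And>k. \<exists>l. t k \<in> cell q u l) \<Longrightarrow> (\<Sum>l. ennreal (blk v q u t l)) = 1"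
proof -
  have eq: "(\<Sum>l. ennreal (blk v q u t l)) = (\<Sum>k. ennreal (v k) * (\<Sum>l. indicator (cell q u l) (t k)))" if u: "inj u"
  proof -
    have "(\<Sum>l. ennreal (blk v q u t l)) = (\<Sum>l. \<Sum>k. ennreal (v k) * indicator (cell q u l) (t k))"
      using u by (simp add: blk_def ennreal_enn2real[OF blk_finite[OF v]])
    also have "\<dots> = (\<integral>\<^sup>+l. (\<Sum>k. ennreal (v k) * indicator (cell q u l) (t k)) \<partial>count_space UNIV)"
      by (simp add: nn_integral_count_space_nat)
    also have "\<dots> = (\<Sum>k. \<integral>\<^sup>+l. ennreal (v k) * indicator (cell q u l) (t k) \<partial>count_space UNIV)"
      by (rule nn_integral_suminf) simp
    also have "\<dots> = (\<Sum>k. ennreal (v k) * (\<Sum>l. indicator (cell q u l) (t k)))" by (simp add: nn_integral_count_space_nat)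
    finally show ?thesis .
  qed
  have ind: "(\<Sum>l. indicator (cell q u l) x) = (indicator (\<Union>l. cell q u l) x :: ennreal)" if u: "inj u" for x
    by (rule suminf_indicator[OF cell_disjoint[OF q u]])
  have v1: "(\<Sum>k. ennreal (v k)) = 1" using v by (simp add: Pinf_iff)
  show "(\<Sum>l. ennreal (blk v q u t l)) \<le> 1"
  proof (cases "inj u")
    case True
    have "(\<Sum>k. ennreal (v k) * (\<Sum>l. indicator (cell q u l) (t k))) \<le> (\<Sum>k. ennreal (v k))"
      unfolding ind[OF True] by (intro suminf_le summableI) (auto split: split_indicator)
    then show ?thesis using eq[OF True] v1 by simp
  qed (simp add: blk_def)
  show "(\<Sum>l. ennreal (blk v q u t l)) = 1" if u: "inj u" and t: "\<And>k. \<exists>l. t k \<in> cell q u l"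
  proof -
    have "(indicator (\<Union>l. cell q u l) (t k) :: ennreal) = 1" for k using t[of k] by auto
    then show ?thesis using eq[OF u] v1 unfolding ind[OF u] by simp
  qed
qed

lemma blk_level:
  assumes "v \<in> Pinf" "q \<in> Pinf" "0 < x"
  shows "finite {l\<in>UNIV. x \<le> c * blk v q u t l}"
proof -
  have "summable (blk v q u t)"
    by (rule summable_suminf_not_top) (use blk_nonneg blk_sum(1)[OF assms(1,2), of u t] in \<open>auto simp: top_unique\<close>)
  from summable_level_set[OF summable_mult[OF this, of c] assms(3)] show ?thesis by simp
qed

lemma measurable_blk:
  assumes [measurable]: "\<And>k. (\<lambda>w. v w k) \<in> borel_measurable M" "\<And>k. (\<lambda>w. q w k) \<in> borel_measurable M"
    "\<And>k. (\<lambda>w. u w k) \<in> borel_measurable M" "\<And>k. (\<lambda>w. t w k) \<in> borel_measurable M"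
  shows "(\<lambda>w. blk (v w) (q w) (u w) (t w) l) \<in> borel_measurable M"
proof -
  have [measurable]: "(\<lambda>w. cut_l (q w) (u w) l) \<in> borel_measurable M" "(\<lambda>w. cut_r (q w) (u w) l) \<in> borel_measurable M"
    unfolding cut_l_def cut_r_def by measurable
  have [measurable]: "Measurable.pred M (\<lambda>w. inj (u w))" unfolding inj_def by measurable
  have "(\<lambda>w. indicator (cell (q w) (u w) l) (t w k) :: ennreal) =
     (\<lambda>w. if cut_l (q w) (u w) l < t w k \<and> t w k < cut_r (q w) (u w) l then 1 else 0)" for k
    by (auto simp: cell_def fun_eq_iff split: split_indicator)
  then have [measurable]: "(\<lambda>w. indicator (cell (q w) (u w) l) (t w k) :: ennreal) \<in> borel_measurable M" for k by simp
  show ?thesis unfolding blk_def by measurable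
qed

text \<open>Normalizing changes nothing on the almost sure event where the masses sum to 1; off that
  event it forces the value into \<open>Pinf\<close>.\<close>

definition coag :: "(nat \<Rightarrow> real) \<Rightarrow> (nat \<Rightarrow> real) \<Rightarrow> (nat \<Rightarrow> real) \<Rightarrow> (nat \<Rightarrow> real) \<Rightarrow> nat \<Rightarrow> real" where
  "coag v q u t = normseq (ranked UNIV (blk v q u t))"

text \<open>The generalized inverse of \<open>bridge q u\<close> sends a mark in the cell of l to
  \<open>u l\<close>. The composition therefore carries the mass \<open>v k\<close> at the image of
  \<open>t k\<close>, and its jumps are the class sums.\<close>

lemma bridge_coag:
  assumes v: "v \<in> Pinf" and q: "q \<in> Pinf" and u: "inj u" and u01: "\<And>l. u l \<in> {0<..1}"
    and t: "\<And>k. \<exists>l. t k \<in> cell q u l"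
  shows "ranked_masses (bridge v t \<circ> bridge q u) = ranked UNIV (blk v q u t)"
    and "ranked UNIV (blk v q u t) = coag v q u t"
proof -
  \<comment> \<open>\<open>lab k\<close> is the class of the k-th term of v, and \<open>w k\<close>
    the place where its mass sits after the composition.\<close>
  obtain lab where lab: "\<And>k. t k \<in> cell q u (lab k)" using t by metis
  define w where "w k = u (lab k)" for k
  have w01: "w k \<in> {0<..1}" for k using u01 by (simp add: w_def)
  note smv = summable_Pinf_if[OF v] and smq = summable_Pinf_if[OF q]
  have lab_iff: "t k \<in> cell q u l \<longleftrightarrow> w k = u l" for k l
    using lab[of k] cell_disjoint[OF q u] u by (auto simp: w_def disjoint_family_on_def inj_eq)
  have comp: "bridge v t (bridge q u y) = (\<Sum>k. v k * (if w k \<le> y then 1 else 0))" for y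
  proof -
    \<comment> \<open>A mark lies below the value of the bridge at y exactly if the jump that
      produced its cell is located at or before y.\<close>
    have "t k \<le> bridge q u y \<longleftrightarrow> w k \<le> y" for k
    proof
      assume le: "w k \<le> y"
      have "cut_r q u (lab k) \<le> bridge q u y"
        unfolding cut_r_def bridge_def by (intro suminf_le smq) (use le in \<open>auto simp: w_def Pinf_props(3)[OF q]\<close>)
      then show "t k \<le> bridge q u y" using lab[of k] by (simp add: cell_def)
    next
      assume le: "t k \<le> bridge q u y"
      show "w k \<le> y"
      proof (rule ccontr)
        assume "\<not> w k \<le> y"
        then have "bridge q u y \<le> cut_l q u (lab k)"
          unfolding cut_l_def bridge_def by (intro suminf_le smq) (auto simp: w_def Pinf_props(3)[OF q])
        then show False using lab[of k] le by (simp add: cell_def)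
      qed
    qed
    then show ?thesis unfolding bridge_def[of v] by simp
  qed
  have mass: "mass_at (bridge v t \<circ> bridge q u) y = (\<Sum>k. v k * (if w k = y then 1 else 0))" if y: "y \<in> {0..1}" for y
  proof (cases "y = 0")
    case True
    \<comment> \<open>All positions are positive, so no mass sits at 0, where \<open>mass_at\<close>
      is the value of the function itself and not a jump.\<close>
    have "w k \<noteq> 0" "\<not> w k \<le> 0" for k using w01[of k] by auto
    then show ?thesis using True by (simp add: mass_at_def comp)
  next
    case False
    \<comment> \<open>The left limit is taken term by term: each term is constant for z close to y
      on the left, and the terms are dominated by v.\<close>
    have "((\<lambda>z. \<Sum>k. v k * (if w k \<le> z then 1 else 0)) \<longlongrightarrow> (\<Sum>k. v k * (if w k < y then 1 else 0))) (at_left y)"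
    proof (rule tannerys_theorem[THEN conjunct2, THEN conjunct2])
      show "((\<lambda>z. v k * (if w k \<le> z then 1 else 0)) \<longlongrightarrow> v k * (if w k < y then 1 else 0)) (at_left y)" for k
      proof (rule tendsto_eventually)
        show "\<forall>\<^sub>F z in at_left y. v k * (if w k \<le> z then 1 else 0) = v k * (if w k < y then 1 else 0)"
        proof (cases "w k < y")
          case True
          have "\<forall>\<^sub>F z in at_left y. z \<in> {w k<..<y}" by (rule eventually_at_left_real[OF True])
          then show ?thesis by eventually_elim (use True in auto)
        next
          case False
          have "\<forall>\<^sub>F z in at_left y. z \<in> {y - 1<..<y}" by (rule eventually_at_left_real) simp
          then show ?thesis by eventually_elim (use False in auto)
        qed
      qed
      show "\<forall>\<^sub>F (k, z) in at_top \<times>\<^sub>F at_left y. norm (v k * (if w k \<le> z then 1 else 0)) \<le> v k"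
        by (rule always_eventually) (auto simp: Pinf_props(3)[OF v])
      show "summable v" by (rule Pinf_props(4)[OF v])
    qed (rule trivial_limit_at_left_real)
    then have "Lim (at_left y) (\<lambda>z. \<Sum>k. v k * (if w k \<le> z then 1 else 0)) = (\<Sum>k. v k * (if w k < y then 1 else 0))"
      by (rule tendsto_Lim[OF trivial_limit_at_left_real])
    then have "mass_at (bridge v t \<circ> bridge q u) y = (\<Sum>k. v k * (if w k \<le> y then 1 else 0)) - (\<Sum>k. v k * (if w k < y then 1 else 0))"
      using False by (simp add: mass_at_def comp comp_def)
    also have "\<dots> = (\<Sum>k. v k * (if w k \<le> y then 1 else 0) - v k * (if w k < y then 1 else 0))"
      by (rule suminf_diff[OF smv smv])
    also have "\<dots> = (\<Sum>k. v k * (if w k = y then 1 else 0))" by (intro suminf_cong) auto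
    finally show ?thesis .
  qed
  have blk: "blk v q u t l = (\<Sum>k. v k * (if w k = u l then 1 else 0))" for l
  proof -
    have "(\<Sum>k. ennreal (v k) * indicator (cell q u l) (t k)) = (\<Sum>k. ennreal (v k * (if w k = u l then 1 else 0)))"
      by (intro suminf_cong) (simp add: indicator_def lab_iff)
    also have "\<dots> = ennreal (\<Sum>k. v k * (if w k = u l then 1 else 0))"
      by (rule suminf_ennreal2[OF _ smv]) (simp add: Pinf_props(3)[OF v])
    finally show ?thesis using u suminf_nonneg[OF smv] Pinf_props(3)[OF v] by (simp add: blk_def)
  qed
  have lev: "{y\<in>{0..1}. x \<le> mass_at (bridge v t \<circ> bridge q u) y} = u ` {l\<in>UNIV. x \<le> blk v q u t l}" if x: "0 < x" for x
  proof (intro equalityI subsetI)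
    fix y assume "y \<in> {y\<in>{0..1}. x \<le> mass_at (bridge v t \<circ> bridge q u) y}"
    then have y: "y \<in> {0..1}" "x \<le> (\<Sum>k. v k * (if w k = y then 1 else 0))" using mass[of y] by auto
    have "\<exists>k. w k = y"
    proof (rule ccontr)
      assume "\<not> ?thesis"
      then show False using y(2) x by simp
    qed
    then obtain k where "w k = y" by auto
    then have "y = u (lab k)" by (simp add: w_def)
    then show "y \<in> u ` {l\<in>UNIV. x \<le> blk v q u t l}" using y(2) blk[of "lab k"] by auto
  next
    fix y assume "y \<in> u ` {l\<in>UNIV. x \<le> blk v q u t l}"
    then obtain l where l: "y = u l" "x \<le> blk v q u t l" by auto
    have "y \<in> {0..1}" using u01[of l] l by auto
    then show "y \<in> {y\<in>{0..1}. x \<le> mass_at (bridge v t \<circ> bridge q u) y}" using mass[of y] blk[of l] l by auto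
  qed
  have fin: "finite {l\<in>UNIV. x \<le> blk v q u t l}" if "0 < x" for x using blk_level[OF v q that, of 1 u t] by simp
  show "ranked_masses (bridge v t \<circ> bridge q u) = ranked UNIV (blk v q u t)" unfolding ranked_masses_def
  proof (rule ranked_cong_card)
    fix x :: real assume x: "0 < x"
    show "finite {y\<in>{0..1}. x \<le> mass_at (bridge v t \<circ> bridge q u) y}"
      unfolding lev[OF x] using fin[OF x] by (rule finite_imageI)
    show "finite {l\<in>UNIV. x \<le> blk v q u t l}" by (rule fin[OF x])
    show "card {y\<in>{0..1}. x \<le> mass_at (bridge v t \<circ> bridge q u) y} = card {l\<in>UNIV. x \<le> blk v q u t l}"
      unfolding lev[OF x] using u by (intro card_image) (auto simp: inj_on_def)
  qed
  have s1: "(\<integral>\<^sup>+l. ennreal (blk v q u t l) \<partial>count_space UNIV) = ennreal 1"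
    using blk_sum(2)[OF v q u t] by (simp add: nn_integral_count_space_nat)
  have "normseq (ranked UNIV (blk v q u t)) = (\<lambda>i. ranked UNIV (blk v q u t) i / suminf (ranked UNIV (blk v q u t)))"
    by (rule normseq_eqI[OF ranked_decseq[OF fin] ranked_nonneg[OF fin] ranked_sums(1)[OF s1]]) (simp_all add: ranked_sums(2)[OF s1])
  then show "ranked UNIV (blk v q u t) = coag v q u t" unfolding coag_def by (simp add: ranked_sums(2)[OF s1])
qed

lemma sigma_finite_stable_intensity: "sigma_finite_measure (stable_intensity \<gamma>)" unfolding stable_intensity_def
  by (subst sigma_finite_measure.sigma_finite_iff_density_finite[OF lborel.sigma_finite_measure_axioms]) (auto split: split_indicator)

lemma AE_pair_fst:
  assumes "prob_space M" "prob_space N" "AE x in M. Q x"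
  shows "AE z in M \<Otimes>\<^sub>M N. Q (fst z)"
proof -
  interpret N: prob_space N by fact
  have "distr (M \<Otimes>\<^sub>M N) M fst = M" by (rule N.distr_pair_fst)
  then show ?thesis by (intro AE_distrD[of fst "M \<Otimes>\<^sub>M N" M Q]) (use assms(3) in \<open>simp_all only: measurable_fst\<close>)
qed

lemma AE_pair_snd:
  assumes "prob_space M" "prob_space N" "AE x in N. Q x"
  shows "AE z in M \<Otimes>\<^sub>M N. Q (snd z)"
proof -
  interpret M: prob_space M by fact
  interpret N: prob_space N by fact
  interpret pair_prob_space M N ..
  have "distr (M \<Otimes>\<^sub>M N) N snd = N"
  proof (rule measure_eqI)
    fix A assume "A \<in> sets (distr (M \<Otimes>\<^sub>M N) N snd)"
    then have A: "A \<in> sets N" by simp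
    have "emeasure (distr (M \<Otimes>\<^sub>M N) N snd) A = emeasure (M \<Otimes>\<^sub>M N) (space M \<times> A)"
      using A sets.sets_into_space[OF A] by (subst emeasure_distr) (auto intro!: arg_cong[where f="emeasure (M \<Otimes>\<^sub>M N)"] simp: space_pair_measure)
    also have "\<dots> = emeasure N A" using A by (subst N.emeasure_pair_measure_Times) (auto simp: M.emeasure_space_1)
    finally show "emeasure (distr (M \<Otimes>\<^sub>M N) N snd) A = emeasure N A" .
  qed simp
  then show ?thesis by (intro AE_distrD[of snd "M \<Otimes>\<^sub>M N" N Q]) (use assms(3) in \<open>simp_all only: measurable_snd\<close>)
qed

section \<open>The coagulation of two independent stable processes\<close>

locale coag_setup = A: stable_points \<alpha> WA JA + B: stable_points "\<beta> / \<alpha>" WB JB + C: stable_points \<beta> WC JC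
  for \<alpha> \<beta> :: real and WA :: "'a measure" and JA and WB :: "'b measure" and JB and WC :: "'c measure" and JC +
  assumes ba: "\<beta> < \<alpha>"
begin

text \<open>Exponent of the average over one class: the class attached to a point x of the process
  \<open>B\<close> has mass x powr (1 / \<alpha>) times a fresh copy of the \<alpha>-stable
  total.\<close>

definition mixlog :: "(real \<Rightarrow> ennreal) \<Rightarrow> real \<Rightarrow> ennreal" where
  "mixlog \<phi> x = nln (\<integral>\<^sup>+w. nexp (\<phi> (x powr (1 / \<alpha>) * A.T w)) \<partial>WA)"

lemma nexp_mixlog:
  assumes [measurable]: "\<phi> \<in> borel_measurable borel"
  shows "1 - nexp (mixlog \<phi> x) = (\<integral>\<^sup>+w. 1 - nexp (\<phi> (x powr (1 / \<alpha>) * A.T w)) \<partial>WA)"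
proof -
  have le: "(\<integral>\<^sup>+w. nexp (\<phi> (x powr (1 / \<alpha>) * A.T w)) \<partial>WA) \<le> 1"
    using nn_integral_mono[of WA "\<lambda>w. nexp (\<phi> (x powr (1 / \<alpha>) * A.T w))" "\<lambda>_. 1"] by (simp add: A.emeasure_space_1)
  then have fin: "(\<integral>\<^sup>+w. nexp (\<phi> (x powr (1 / \<alpha>) * A.T w)) \<partial>WA) \<noteq> \<infinity>" by (auto simp: top_unique)
  have "(\<integral>\<^sup>+w. 1 - nexp (\<phi> (x powr (1 / \<alpha>) * A.T w)) \<partial>WA) = (\<integral>\<^sup>+w. 1 \<partial>WA) - (\<integral>\<^sup>+w. nexp (\<phi> (x powr (1 / \<alpha>) * A.T w)) \<partial>WA)"
    by (rule nn_integral_diff[OF _ _ fin]) auto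
  then show ?thesis unfolding mixlog_def nexp_nln[OF le] by (simp add: A.emeasure_space_1)
qed

text \<open>The power 1 / \<alpha> maps the intensity of index \<beta> / \<alpha> to a multiple of
  the one of index \<beta>, and an independent factor \<open>A.T\<close> multiplies that by its
  moment of order \<beta>. The two constants are reciprocal, so exactly the \<beta>-stable exponent
  remains.\<close>

lemma pexp_mixlog:
  assumes [measurable]: "\<phi> \<in> borel_measurable borel"
  shows "B.pexp (mixlog \<phi>) = C.pexp \<phi>"
proof -
  have b: "0 < \<beta>" "\<beta> < \<alpha>" "\<alpha> < 1" using C.\<gamma> A.\<gamma> ba by auto
  let ?g = "Gamma (1 - \<beta>)" and ?h = "Gamma (1 - \<beta> / \<alpha>)"
  have "B.pexp (mixlog \<phi>) = (\<integral>\<^sup>+x. (\<integral>\<^sup>+w. 1 - nexp (\<phi> (x powr (1 / \<alpha>) * A.T w)) \<partial>WA) \<partial>stable_intensity (\<beta> / \<alpha>))"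
    unfolding B.pexp_def by (simp add: nexp_mixlog)
  also have "\<dots> = (\<integral>\<^sup>+w. (\<integral>\<^sup>+x. 1 - nexp (\<phi> (x powr (1 / \<alpha>) * A.T w)) \<partial>stable_intensity (\<beta> / \<alpha>)) \<partial>WA)"
    by (rule pair_sigma_finite.Fubini')
       (auto simp: pair_sigma_finite_def A.sigma_finite_measure_axioms sigma_finite_stable_intensity)
  also have "\<dots> = (\<integral>\<^sup>+w. ennreal (?g / ?h) * (ennreal (A.T w powr \<beta>) * C.pexp \<phi>) \<partial>WA)"
  proof (rule nn_integral_cong_eventually[OF A.AE_T])
    fix w assume "summable (\<lambda>i. JA i w) \<and> (\<Sum>i. ennreal (JA i w)) = ennreal (A.T w) \<and> 0 < A.T w"
    then have T: "0 < A.T w" by simp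
    have "(\<integral>\<^sup>+x. 1 - nexp (\<phi> (x powr (1 / \<alpha>) * A.T w)) \<partial>stable_intensity (\<beta> / \<alpha>))
       = ennreal (?g / ?h) * (\<integral>\<^sup>+x. 1 - nexp (\<phi> (x * A.T w)) \<partial>stable_intensity \<beta>)"
      by (rule nn_integral_stable_powr[OF _ b]) simp
    also have "(\<integral>\<^sup>+x. 1 - nexp (\<phi> (x * A.T w)) \<partial>stable_intensity \<beta>) = ennreal (A.T w powr \<beta>) * C.pexp \<phi>"
      using nn_integral_stable_scale[of "\<lambda>x. 1 - nexp (\<phi> x)" "A.T w" \<beta>] T C.\<gamma> by (simp add: C.pexp_def mult.commute)
    finally show "(\<integral>\<^sup>+x. 1 - nexp (\<phi> (x powr (1 / \<alpha>) * A.T w)) \<partial>stable_intensity (\<beta> / \<alpha>))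
       = ennreal (?g / ?h) * (ennreal (A.T w powr \<beta>) * C.pexp \<phi>)" .
  qed
  also have "\<dots> = ennreal (?g / ?h) * ((\<integral>\<^sup>+w. ennreal (A.T w powr \<beta>) \<partial>WA) * C.pexp \<phi>)"
    by (simp add: nn_integral_cmult nn_integral_multc)
  also have "\<dots> = ennreal (?g / ?h) * (ennreal (?h / ?g) * C.pexp \<phi>)"
    using A.moment_T[of "- \<beta>"] b by (simp add: A.mom_def add.commute)
  also have "\<dots> = C.pexp \<phi>" by (rule ennreal_frac_inverse[symmetric]) (use b in \<open>auto intro!: Gamma_real_pos\<close>)
  finally show ?thesis .
qed

abbreviation BA where "BA \<equiv> WB \<Otimes>\<^sub>M WA"
abbreviation P where "P \<equiv> (WB \<Otimes>\<^sub>M unif_seq) \<Otimes>\<^sub>M (WA \<Otimes>\<^sub>M unif_seq)"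

text \<open>The classes sum to 1 almost surely, so this is the total of the rescaled classes; by
  \<open>coag_law\<close> it has the law of the \<beta>-stable total.\<close>

definition tot where "tot z = A.T (fst (snd z)) * B.T (fst (fst z)) powr (1 / \<alpha>)"

definition blocks where "blocks z = blk (A.X (fst (snd z))) (B.X (fst (fst z))) (snd (fst z)) (snd (snd z))"

lemma prob_space_P: "prob_space P"
  by (intro prob_space_pair A.prob_space_axioms B.prob_space_axioms prob_space_unif_seq)

lemma tot_meas [measurable]: "tot \<in> borel_measurable P" unfolding tot_def[abs_def] by measurable

lemma unif_seq_component: "(\<lambda>u. u k) \<in> borel_measurable unif_seq"
  using measurable_component_singleton[of k UNIV "\<lambda>_. unif"] by (simp cong: measurable_cong_sets)

lemma blocks_meas [measurable]: "(\<lambda>z. blocks z l) \<in> borel_measurable P" unfolding blocks_def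
proof (rule measurable_blk)
  show "(\<lambda>z. A.X (fst (snd z)) k) \<in> borel_measurable P" for k
    by (rule measurable_compose[OF _ PinfM_component]) measurable
  show "(\<lambda>z. B.X (fst (fst z)) k) \<in> borel_measurable P" for k
    by (rule measurable_compose[OF _ PinfM_component]) measurable
  show "(\<lambda>z. snd (fst z) k) \<in> borel_measurable P" for k by (rule measurable_compose[OF _ unif_seq_component]) measurable
  show "(\<lambda>z. snd (snd z) k) \<in> borel_measurable P" for k by (rule measurable_compose[OF _ unif_seq_component]) measurable
qed

text \<open>The process \<open>B\<close> and the marks that place its jumps are frozen, so the cells
  are fixed sets and \<open>marked_sums_law\<close> applies. The factor
  \<open>B.T w powr (1 / \<alpha>)\<close> turns the normalized mass of a class back into a point of
  \<open>B\<close>.\<close>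

lemma blocks_inner:
  assumes [measurable]: "\<phi> \<in> borel_measurable borel" and u: "inj u" and T: "0 < B.T w" and J: "\<And>i. JB i w = B.T w * B.X w i"
  shows "(\<integral>\<^sup>+y. nexp (\<Sum>l. \<phi> (tot ((w, u), y) * blocks ((w, u), y) l)) \<partial>(WA \<Otimes>\<^sub>M unif_seq)) = nexp (\<Sum>l. mixlog \<phi> (JB l w))"
proof -
  let ?q = "B.X w" and ?c = "B.T w powr (1 / \<alpha>)"
  define Y where "Y y l = enn2real (\<Sum>k. ennreal (JA k (fst y)) * indicator (cell ?q u l) (snd y k))" for y and l :: nat
  note [measurable] = unif_seq_component
  have Ym[measurable]: "(\<lambda>y. Y y l) \<in> borel_measurable (WA \<Otimes>\<^sub>M unif_seq)" for l
  proof -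
    have [measurable]: "(\<lambda>y. snd y k) \<in> borel_measurable (WA \<Otimes>\<^sub>M unif_seq)" for k
      by (rule measurable_compose[OF measurable_snd unif_seq_component])
    show ?thesis unfolding Y_def by measurable
  qed
  have Ym2: "Y \<in> WA \<Otimes>\<^sub>M unif_seq \<rightarrow>\<^sub>M seq_borel" by (rule measurable_PiM_single') auto
  have "AE y in WA \<Otimes>\<^sub>M unif_seq. (normalized JA (fst y) = A.X (fst y) \<and> (\<forall>i. JA i (fst y) = A.T (fst y) * A.X (fst y) i))"
    using AE_pair_fst[OF A.prob_space_axioms prob_space_unif_seq A.AE_X] .
  moreover have "AE y in WA \<Otimes>\<^sub>M unif_seq. (summable (\<lambda>i. JA i (fst y)) \<and> (\<Sum>i. ennreal (JA i (fst y))) = ennreal (A.T (fst y)) \<and> 0 < A.T (fst y))"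
    using AE_pair_fst[OF A.prob_space_axioms prob_space_unif_seq A.AE_T] .
  ultimately have "AE y in WA \<Otimes>\<^sub>M unif_seq. \<forall>l. tot ((w, u), y) * blocks ((w, u), y) l = ?c * Y y l"
  proof eventually_elim
    case (elim y)
    have "Y y l = A.T (fst y) * blk (A.X (fst y)) ?q u (snd y) l" for l
    proof -
      have "(\<Sum>k. ennreal (JA k (fst y)) * indicator (cell ?q u l) (snd y k)) = (\<Sum>k. ennreal (A.T (fst y)) * (ennreal (A.X (fst y) k) * indicator (cell ?q u l) (snd y k)))"
        using elim Pinf_props(3)[OF A.X_Pinf, of "fst y"] by (intro suminf_cong) (simp add: ennreal_mult mult.assoc)
      then show ?thesis using elim u by (simp add: Y_def blk_def enn2real_mult)
    qed
    then show ?case by (simp add: tot_def blocks_def mult_ac)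
  qed
  then have "(\<integral>\<^sup>+y. nexp (\<Sum>l. \<phi> (tot ((w, u), y) * blocks ((w, u), y) l)) \<partial>(WA \<Otimes>\<^sub>M unif_seq)) = (\<integral>\<^sup>+y. nexp (\<Sum>l. \<phi> (?c * Y y l)) \<partial>(WA \<Otimes>\<^sub>M unif_seq))"
    by (intro nn_integral_cong_AE) (auto elim: eventually_mono)
  also have "\<dots> = (\<integral>\<^sup>+a. nexp (\<Sum>l. \<phi> (?c * a l)) \<partial>distr (WA \<Otimes>\<^sub>M unif_seq) seq_borel Y)"
    by (rule nn_integral_distr[OF Ym2, symmetric]) simp
  also have "distr (WA \<Otimes>\<^sub>M unif_seq) seq_borel Y = distr (PiM UNIV (\<lambda>_::nat. WA)) seq_borel (\<lambda>v l. ?q l powr (1 / \<alpha>) * A.T (v l))"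
    using A.marked_sums_law[OF prob_space_unif _ cell_sets cell_disjoint[OF B.X_Pinf u] Pinf_props(3)[OF B.X_Pinf] emeasure_cell[OF B.X_Pinf u]]
    by (simp add: Y_def[abs_def] split_beta')
  also have "(\<integral>\<^sup>+a. nexp (\<Sum>l. \<phi> (?c * a l)) \<partial>distr (PiM UNIV (\<lambda>_::nat. WA)) seq_borel (\<lambda>v l. ?q l powr (1 / \<alpha>) * A.T (v l)))
     = (\<integral>\<^sup>+v. nexp (\<Sum>l. \<phi> (?c * (?q l powr (1 / \<alpha>) * A.T (v l)))) \<partial>PiM UNIV (\<lambda>_::nat. WA))"
    by (rule nn_integral_distr) (auto intro!: measurable_PiM_single')
  also have "\<dots> = nexp (\<Sum>l. nln (\<integral>\<^sup>+w'. nexp (\<phi> (?c * (?q l powr (1 / \<alpha>) * A.T w'))) \<partial>WA))"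
    by (rule nn_integral_PiM_nexp_suminf) (auto intro: A.prob_space_axioms)
  also have "\<dots> = nexp (\<Sum>l. mixlog \<phi> (JB l w))"
  proof -
    have "?c * (?q l powr (1 / \<alpha>) * x) = JB l w powr (1 / \<alpha>) * x" for l x
      using T Pinf_props(3)[OF B.X_Pinf, of w l] by (simp add: J powr_mult)
    then show ?thesis by (simp only: mixlog_def)
  qed
  finally show ?thesis .
qed

lemma blocks_laplace:
  assumes [measurable]: "\<phi> \<in> borel_measurable borel"
  shows "(\<integral>\<^sup>+z. nexp (\<Sum>l. \<phi> (tot z * blocks z l)) \<partial>P) = nexp (C.pexp \<phi>)"
proof -
  interpret P2: prob_space "WA \<Otimes>\<^sub>M unif_seq" by (intro prob_space_pair A.prob_space_axioms prob_space_unif_seq)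
  interpret UN: prob_space unif_seq by (rule prob_space_unif_seq)
  have mixlogm[measurable]: "mixlog \<phi> \<in> borel_measurable borel" unfolding mixlog_def[abs_def] by measurable
  have "(\<integral>\<^sup>+z. nexp (\<Sum>l. \<phi> (tot z * blocks z l)) \<partial>P) = (\<integral>\<^sup>+x. (\<integral>\<^sup>+y. nexp (\<Sum>l. \<phi> (tot (x, y) * blocks (x, y) l)) \<partial>(WA \<Otimes>\<^sub>M unif_seq)) \<partial>(WB \<Otimes>\<^sub>M unif_seq))"
    by (rule P2.nn_integral_fst[symmetric]) simp
  also have "\<dots> = (\<integral>\<^sup>+x. nexp (\<Sum>l. mixlog \<phi> (JB l (fst x))) \<partial>(WB \<Otimes>\<^sub>M unif_seq))"
  proof (rule nn_integral_cong_AE)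
    show "AE x in WB \<Otimes>\<^sub>M unif_seq. (\<integral>\<^sup>+y. nexp (\<Sum>l. \<phi> (tot (x, y) * blocks (x, y) l)) \<partial>(WA \<Otimes>\<^sub>M unif_seq)) = nexp (\<Sum>l. mixlog \<phi> (JB l (fst x)))"
      using AE_pair_fst[OF B.prob_space_axioms prob_space_unif_seq B.AE_X] AE_pair_fst[OF B.prob_space_axioms prob_space_unif_seq B.AE_T]
        AE_pair_snd[OF B.prob_space_axioms prob_space_unif_seq AE_unif_seq_inj]
    proof eventually_elim
      case (elim x)
      then show ?case using blocks_inner[of \<phi> "snd x" "fst x"] by simp
    qed
  qed
  also have "\<dots> = (\<integral>\<^sup>+w. (\<integral>\<^sup>+u. nexp (\<Sum>l. mixlog \<phi> (JB l (fst (w, u)))) \<partial>unif_seq) \<partial>WB)"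
    by (rule UN.nn_integral_fst[symmetric]) simp
  also have "\<dots> = (\<integral>\<^sup>+w. nexp (\<Sum>l. mixlog \<phi> (JB l w)) \<partial>WB)" by (simp add: UN.emeasure_space_1)
  also have "\<dots> = nexp (C.pexp \<phi>)" by (simp add: B.laplace_functional pexp_mixlog)
  finally show ?thesis .
qed

definition Z where "Z z = ranked UNIV (\<lambda>l. tot z * blocks z l)"

lemma blocks_level: "0 < x \<Longrightarrow> finite {l\<in>UNIV. x \<le> c * blocks z l}" unfolding blocks_def by (rule blk_level) auto

lemma Z_meas [measurable]: "Z \<in> P \<rightarrow>\<^sub>M seq_borel"
  unfolding Z_def[abs_def] by (rule measurable_ranked) (auto intro!: blocks_level[simplified])

lemma Z_law: "distr P seq_borel Z = distr WC seq_borel (\<lambda>w i. JC i w)"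
proof (rule ranked_law_eqI[OF prob_space_P C.prob_space_axioms Z_meas C.J_seq_meas])
  show "AE z in P. decseq (Z z) \<and> Z z \<longlonglongrightarrow> 0"
    unfolding Z_def by (intro AE_I2 conjI ranked_decseq ranked_tendsto_0 blocks_level)
  show "AE w in WC. decseq (\<lambda>i. JC i w) \<and> (\<lambda>i. JC i w) \<longlonglongrightarrow> 0" by (rule C.AE_J_decseq)
  fix \<phi> :: "real \<Rightarrow> ennreal" and e :: real
  assume \<phi>: "\<phi> \<in> borel_measurable borel" "0 < e" "\<And>x. x < e \<Longrightarrow> \<phi> x = 0"
  have "(\<Sum>i. \<phi> (Z z i)) = (\<Sum>l. \<phi> (tot z * blocks z l))" for z
    unfolding Z_def using suminf_ranked[OF blocks_level \<phi>(1), of "tot z" z] \<phi>(2,3) by (simp add: nn_integral_count_space_nat)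
  then show "(\<integral>\<^sup>+z. nexp (\<Sum>i. \<phi> (Z z i)) \<partial>P) = (\<integral>\<^sup>+w. nexp (\<Sum>i. \<phi> (JC i w)) \<partial>WC)"
    using blocks_laplace[OF \<phi>(1)] C.laplace_functional[OF \<phi>(1)] by simp
qed

lemma AE_blocks_sum: "AE z in P. (\<Sum>l. ennreal (blocks z l)) = 1 \<and> 0 < tot z"
proof -
  interpret P1: prob_space "WB \<Otimes>\<^sub>M unif_seq" by (intro prob_space_pair B.prob_space_axioms prob_space_unif_seq)
  interpret P2: prob_space "WA \<Otimes>\<^sub>M unif_seq" by (intro prob_space_pair A.prob_space_axioms prob_space_unif_seq)
  interpret pair_sigma_finite "WB \<Otimes>\<^sub>M unif_seq" "WA \<Otimes>\<^sub>M unif_seq" ..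
  have "AE z in P. (\<Sum>l. ennreal (blocks z l)) = 1"
  proof (rule AE_pair_measure)
    show "{z \<in> space P. (\<Sum>l. ennreal (blocks z l)) = 1} \<in> sets P" by measurable
    show "AE x in WB \<Otimes>\<^sub>M unif_seq. AE y in WA \<Otimes>\<^sub>M unif_seq. (\<Sum>l. ennreal (blocks (x, y) l)) = 1"
      using AE_pair_snd[OF B.prob_space_axioms prob_space_unif_seq AE_unif_seq_inj]
    proof eventually_elim
      case (elim x)
      show ?case using AE_pair_snd[OF A.prob_space_axioms prob_space_unif_seq AE_cells[OF B.X_Pinf elim, of "fst x"]]
        by eventually_elim (use elim in \<open>simp add: blocks_def blk_sum(2)\<close>)
    qed
  qed
  moreover have "AE z in P. 0 < B.T (fst (fst z))"
    using AE_pair_fst[OF P1.prob_space_axioms P2.prob_space_axioms AE_pair_fst[OF B.prob_space_axioms prob_space_unif_seq B.AE_T]]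
    by eventually_elim simp
  moreover have "AE z in P. 0 < A.T (fst (snd z))"
    using AE_pair_snd[OF P1.prob_space_axioms P2.prob_space_axioms AE_pair_fst[OF A.prob_space_axioms prob_space_unif_seq A.AE_T]]
    by eventually_elim simp
  ultimately show ?thesis by eventually_elim (simp add: tot_def)
qed

text \<open>The total and the normalized classes are both functions of the ranked rescaled classes
  \<open>Z\<close>, so the equality of laws in \<open>Z_law\<close> transfers to the pair.\<close>

theorem coag_law:
  assumes [measurable]: "H \<in> borel_measurable borel" "S \<in> sets PinfM"
  shows "(\<integral>\<^sup>+z. H (tot z) * indicator S (coag (A.X (fst (snd z))) (B.X (fst (fst z))) (snd (fst z)) (snd (snd z))) \<partial>P)
    = (\<integral>\<^sup>+w. H (C.T w) * indicator S (C.X w) \<partial>WC)"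
proof -
  have "(\<integral>\<^sup>+z. H (tot z) * indicator S (coag (A.X (fst (snd z))) (B.X (fst (fst z))) (snd (fst z)) (snd (snd z))) \<partial>P)
     = (\<integral>\<^sup>+z. H (suminf (Z z)) * indicator S (normseq (Z z)) \<partial>P)"
  proof (rule nn_integral_cong_eventually[OF AE_blocks_sum])
    fix z assume *: "(\<Sum>l. ennreal (blocks z l)) = 1 \<and> 0 < tot z"
    have b1: "(\<integral>\<^sup>+l. ennreal (blocks z l) \<partial>count_space UNIV) = ennreal 1"
      using * by (simp add: nn_integral_count_space_nat)
    have Zs: "Z z = (\<lambda>n. tot z * ranked UNIV (blocks z) n)"
      unfolding Z_def by (rule ranked_scale) (use blocks_level[of _ 1 z] * in auto)
    have "normseq (Z z) = normseq (ranked UNIV (blocks z))"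
      unfolding Zs by (rule normseq_scale) (use ranked_sums(1)[OF b1] * in auto)
    moreover have "suminf (Z z) = tot z"
      unfolding Zs using suminf_mult[OF ranked_sums(1)[OF b1], of "tot z"] ranked_sums(2)[OF b1] by simp
    ultimately show "H (tot z) * indicator S (coag (A.X (fst (snd z))) (B.X (fst (fst z))) (snd (fst z)) (snd (snd z)))
        = H (suminf (Z z)) * indicator S (normseq (Z z))" by (simp add: coag_def blocks_def)
  qed
  also have "\<dots> = (\<integral>\<^sup>+a. H (suminf a) * indicator S (normseq a) \<partial>distr P seq_borel Z)"
    by (rule nn_integral_distr[symmetric]) simp_all
  also have "\<dots> = (\<integral>\<^sup>+a. H (suminf a) * indicator S (normseq a) \<partial>distr WC seq_borel (\<lambda>w i. JC i w))" unfolding Z_law ..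
  also have "\<dots> = (\<integral>\<^sup>+w. H (C.T w) * indicator S (C.X w) \<partial>WC)"
    by (subst nn_integral_distr) (simp_all add: C.X_def total_def)
  finally show ?thesis .
qed

end

section \<open>Stick breaking\<close>

lemma ranked_Pinf:
  fixes m :: "'i \<Rightarrow> real"
  assumes "(\<integral>\<^sup>+i. ennreal (m i) \<partial>count_space I) = 1"
  shows "ranked I m \<in> Pinf"
proof -
  have fin: "0 < x \<Longrightarrow> finite {i\<in>I. x \<le> m i}" for x by (rule level_set_finite) (simp add: assms)
  have "(\<Sum>n. ennreal (ranked I m n)) = 1"
    using suminf_ranked[where \<phi>=ennreal and m=m and I=I, OF fin] assms by (simp add: ennreal_neg)
  then show ?thesis using ranked_decseq[OF fin] ranked_nonneg[OF fin] by (auto simp: Pinf_iff decseq_Suc_iff)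
qed

lemma measurable_ranked_Pinf:
  fixes m :: "'a \<Rightarrow> 'i \<Rightarrow> real"
  assumes "\<And>i. i \<in> I \<Longrightarrow> (\<lambda>w. m w i) \<in> borel_measurable M" "countable I"
    and 1: "\<And>w. w \<in> space M \<Longrightarrow> (\<integral>\<^sup>+i. ennreal (m w i) \<partial>count_space I) = 1"
  shows "(\<lambda>w. ranked I (m w)) \<in> M \<rightarrow>\<^sub>M PinfM"
proof (rule measurable_PinfM)
  show "(\<lambda>w. ranked I (m w)) \<in> M \<rightarrow>\<^sub>M seq_borel"
    by (rule measurable_ranked[OF assms(1,2)]) (use 1 in \<open>auto intro!: level_set_finite\<close>)
qed (rule ranked_Pinf[OF 1])

text \<open>Both partitions are multiplied by an independent Gamma variable of shape \<theta> + 1.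
  As a partition sums to 1, the weight exp(-l) of its density equals exp(- sum l * A i), which
  accounts for the added identity; the weight l powr \<theta> gives the Mellin transform.
  Normalizing removes the scale again.\<close>

lemma radial_law_eqI:
  fixes A :: "'a \<Rightarrow> nat \<Rightarrow> real" and B :: "'b \<Rightarrow> nat \<Rightarrow> real"
  assumes M1: "prob_space M1" and M2: "prob_space M2" and \<theta>: "0 < \<theta> + 1"
    and A: "A \<in> M1 \<rightarrow>\<^sub>M PinfM" and B: "B \<in> M2 \<rightarrow>\<^sub>M PinfM"
    and eq: "\<And>\<psi>. \<psi> \<in> borel_measurable borel \<Longrightarrow> (\<And>x. x \<le> 0 \<Longrightarrow> \<psi> x = 0) \<Longrightarrow>
      mellin \<theta> (\<lambda>l. \<integral>\<^sup>+w. nexp (\<Sum>i. \<psi> (l * A w i) + ennreal (l * A w i)) \<partial>M1)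
      = mellin \<theta> (\<lambda>l. \<integral>\<^sup>+w. nexp (\<Sum>i. \<psi> (l * B w i) + ennreal (l * B w i)) \<partial>M2)"
    and F: "F \<in> borel_measurable PinfM"
  shows "(\<integral>\<^sup>+w. F (A w) \<partial>M1) = (\<integral>\<^sup>+w. F (B w) \<partial>M2)"
proof -
  let ?g = "gamma_law \<theta>"
  interpret g: prob_space ?g by (rule prob_space_gamma_law[OF \<theta>])
  have meas: "(\<lambda>z i. fst z * C (snd z) i) \<in> ?g \<Otimes>\<^sub>M N \<rightarrow>\<^sub>M seq_borel" if C: "C \<in> N \<rightarrow>\<^sub>M PinfM" for C :: "'c \<Rightarrow> nat \<Rightarrow> real" and N
  proof (rule measurable_PiM_single')
    fix i
    have [measurable]: "(\<lambda>w. C w i) \<in> borel_measurable N" by (rule measurable_compose[OF C PinfM_component])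
    show "(\<lambda>z. fst z * C (snd z) i) \<in> borel_measurable (?g \<Otimes>\<^sub>M N)" by measurable
  qed (auto simp: space_PiM)
  have P: "C w \<in> Pinf" if "C \<in> N \<rightarrow>\<^sub>M PinfM" "w \<in> space N" for C :: "'c \<Rightarrow> nat \<Rightarrow> real" and N w
    using measurable_space[OF that] by simp
  have pos: "AE z in ?g \<Otimes>\<^sub>M N. 0 < fst z \<and> C (snd z) \<in> Pinf"
    if "prob_space N" "C \<in> N \<rightarrow>\<^sub>M PinfM" for C :: "'c \<Rightarrow> nat \<Rightarrow> real" and N
    using AE_pair_fst[OF g.prob_space_axioms that(1) AE_gamma_law_pos] AE_space
    by eventually_elim (auto simp: space_pair_measure P[OF that(2)])
  have dec: "AE z in ?g \<Otimes>\<^sub>M N. decseq (\<lambda>i. fst z * C (snd z) i) \<and> (\<lambda>i. fst z * C (snd z) i) \<longlonglongrightarrow> 0"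
    if "prob_space N" "C \<in> N \<rightarrow>\<^sub>M PinfM" for C :: "'c \<Rightarrow> nat \<Rightarrow> real" and N using pos[OF that]
  proof eventually_elim
    case (elim z)
    then show ?case using Pinf_props(1,2)[of "C (snd z)"] tendsto_mult_right_zero[of "C (snd z)" sequentially "fst z"]
      by (auto simp: decseq_def intro: mult_left_mono)
  qed
  have int: "(\<integral>\<^sup>+z. nexp (\<Sum>i. \<psi> (fst z * C (snd z) i)) \<partial>(?g \<Otimes>\<^sub>M N)) =
      ennreal (1 / Gamma (\<theta> + 1)) * mellin \<theta> (\<lambda>l. \<integral>\<^sup>+w. nexp (\<Sum>i. \<psi> (l * C w i) + ennreal (l * C w i)) \<partial>N)"
    if N: "prob_space N" and C: "C \<in> N \<rightarrow>\<^sub>M PinfM" and [measurable]: "\<psi> \<in> borel_measurable borel" for C :: "'c \<Rightarrow> nat \<Rightarrow> real" and N \<psi>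
  proof -
    interpret N: prob_space N by fact
    let ?n = "\<lambda>l w. nexp (\<Sum>i. \<psi> (l * C w i))"
    let ?k = "\<lambda>l w. nexp (\<Sum>i. \<psi> (l * C w i) + ennreal (l * C w i))"
    have [measurable]: "(\<lambda>w. C w i) \<in> borel_measurable N" for i by (rule measurable_compose[OF C PinfM_component])
    have "(\<integral>\<^sup>+z. ?n (fst z) (snd z) \<partial>(?g \<Otimes>\<^sub>M N)) = (\<integral>\<^sup>+l. \<integral>\<^sup>+w. ?n l w \<partial>N \<partial>?g)"
      by (subst N.nn_integral_fst[symmetric]) simp_all
    also have "\<dots> = ennreal (1 / Gamma (\<theta> + 1)) * mellin \<theta> (\<lambda>l. ennreal (exp (- l)) * (\<integral>\<^sup>+w. ?n l w \<partial>N))"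
      unfolding mellin_def by (rule nn_integral_gamma_law[OF _ \<theta>]) simp
    also have "mellin \<theta> (\<lambda>l. ennreal (exp (- l)) * (\<integral>\<^sup>+w. ?n l w \<partial>N)) = mellin \<theta> (\<lambda>l. \<integral>\<^sup>+w. ?k l w \<partial>N)"
    proof (rule mellin_cong)
      fix l :: real assume l: "0 < l"
      have "ennreal (exp (- l)) * (\<integral>\<^sup>+w. ?n l w \<partial>N) = (\<integral>\<^sup>+w. ennreal (exp (- l)) * ?n l w \<partial>N)"
        by (rule nn_integral_cmult[symmetric]) simp
      also have "\<dots> = (\<integral>\<^sup>+w. ?k l w \<partial>N)"
      proof (rule nn_integral_cong)
        fix w assume "w \<in> space N"
        then have p: "C w \<in> Pinf" by (rule P[OF C])
        have "(\<Sum>i. \<psi> (l * C w i) + ennreal (l * C w i)) = (\<Sum>i. \<psi> (l * C w i)) + (\<Sum>i. ennreal (l * C w i))"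
          by (rule suminf_add[symmetric]) auto
        also have "(\<Sum>i. ennreal (l * C w i)) = ennreal l * (\<Sum>i. ennreal (C w i))"
          using l Pinf_props(3)[OF p] by (simp add: ennreal_mult)
        also have "\<dots> = ennreal l" using p by (simp add: Pinf_iff)
        finally show "ennreal (exp (- l)) * ?n l w = ?k l w" using l by (simp add: nexp_add nexp_ennreal mult.commute)
      qed
      finally show "ennreal (exp (- l)) * (\<integral>\<^sup>+w. ?n l w \<partial>N) = \<dots>" .
    qed
    finally show ?thesis .
  qed
  have law: "distr (?g \<Otimes>\<^sub>M M1) seq_borel (\<lambda>z i. fst z * A (snd z) i) = distr (?g \<Otimes>\<^sub>M M2) seq_borel (\<lambda>z i. fst z * B (snd z) i)"
  proof (rule ranked_law_eqI)
    show "prob_space (?g \<Otimes>\<^sub>M M1)" "prob_space (?g \<Otimes>\<^sub>M M2)" by (auto intro!: prob_space_pair g.prob_space_axioms M1 M2)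
    fix \<psi> :: "real \<Rightarrow> ennreal" and e :: real
    assume \<psi>: "\<psi> \<in> borel_measurable borel" "0 < e" "\<And>x. x < e \<Longrightarrow> \<psi> x = 0"
    then have "\<psi> x = 0" if "x \<le> 0" for x using that by auto
    from eq[OF \<psi>(1) this] show "(\<integral>\<^sup>+z. nexp (\<Sum>i. \<psi> (fst z * A (snd z) i)) \<partial>(?g \<Otimes>\<^sub>M M1)) = (\<integral>\<^sup>+z. nexp (\<Sum>i. \<psi> (fst z * B (snd z) i)) \<partial>(?g \<Otimes>\<^sub>M M2))"
      unfolding int[OF M1 A \<psi>(1)] int[OF M2 B \<psi>(1)] by simp
  qed (intro meas[OF A] meas[OF B] dec[OF M1 A] dec[OF M2 B])+
  have undo: "(\<integral>\<^sup>+s. F (normseq s) \<partial>distr (?g \<Otimes>\<^sub>M N) seq_borel (\<lambda>z i. fst z * C (snd z) i)) = (\<integral>\<^sup>+w. F (C w) \<partial>N)"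
    if N: "prob_space N" and C: "C \<in> N \<rightarrow>\<^sub>M PinfM" for C :: "'c \<Rightarrow> nat \<Rightarrow> real" and N
  proof -
    interpret N: prob_space N by fact
    have FC [measurable]: "(\<lambda>w. F (C w)) \<in> borel_measurable N" by (rule measurable_compose[OF C F])
    have "(\<integral>\<^sup>+s. F (normseq s) \<partial>distr (?g \<Otimes>\<^sub>M N) seq_borel (\<lambda>z i. fst z * C (snd z) i)) = (\<integral>\<^sup>+z. F (normseq (\<lambda>i. fst z * C (snd z) i)) \<partial>(?g \<Otimes>\<^sub>M N))"
      by (rule nn_integral_distr[OF meas[OF C]]) (simp add: measurable_compose[OF normseq_measurable F])
    also have "\<dots> = (\<integral>\<^sup>+z. F (C (snd z)) \<partial>(?g \<Otimes>\<^sub>M N))"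
    proof (rule nn_integral_cong_AE)
      show "AE z in ?g \<Otimes>\<^sub>M N. F (normseq (\<lambda>i. fst z * C (snd z) i)) = F (C (snd z))" using pos[OF N C]
      proof eventually_elim
        case (elim z)
        then have p: "C (snd z) \<in> Pinf" by simp
        have "normseq (C (snd z)) = C (snd z)" using normseq_eqI[of "C (snd z)"] Pinf_props[OF p] by simp
        then show ?case using elim normseq_scale[OF Pinf_props(4)[OF p], of "fst z"] by simp
      qed
    qed
    also have "\<dots> = (\<integral>\<^sup>+l. \<integral>\<^sup>+w. F (C w) \<partial>N \<partial>?g)" by (subst N.nn_integral_fst[symmetric]) simp_all
    also have "\<dots> = (\<integral>\<^sup>+w. F (C w) \<partial>N)" by (simp add: g.emeasure_space_1)
    finally show ?thesis .
  qed
  show ?thesis using arg_cong[OF law, of "\<lambda>R. \<integral>\<^sup>+s. F (normseq s) \<partial>R"] unfolding undo[OF M1 A] undo[OF M2 B] .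
qed

text \<open>Exchanges an independent variable for a coordinate that the integrand has not yet looked
  at; the stick-breaking recursion consumes one coordinate per step in this way.\<close>

lemma nn_integral_PiM_resample:
  fixes S :: "nat \<Rightarrow> 'a measure"
  assumes S: "\<And>i. prob_space (S i)"
    and G: "(\<lambda>(r, x). G r x) \<in> borel_measurable (PiM UNIV S \<Otimes>\<^sub>M S n)"
    and indep: "\<And>r x y. G (r(n := y)) x = (G r x :: ennreal)"
  shows "(\<integral>\<^sup>+r. (\<integral>\<^sup>+x. G r x \<partial>S n) \<partial>PiM UNIV S) = (\<integral>\<^sup>+r. G r (r n) \<partial>PiM UNIV S)"
proof -
  interpret n: prob_space "S n" by (rule S)
  interpret U: prob_space "PiM UNIV S" by (intro prob_space_PiM S)
  interpret pair_sigma_finite "S n" "PiM UNIV S" ..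
  have eq: "distr (S n \<Otimes>\<^sub>M PiM UNIV S) (PiM UNIV S) (\<lambda>(x, r). r(n := x)) = PiM UNIV S"
    using distr_pair_PiM_eq_PiM[of UNIV S n] S by simp
  have m1: "(\<lambda>(x, r). r(n := x)) \<in> S n \<Otimes>\<^sub>M PiM UNIV S \<rightarrow>\<^sub>M PiM UNIV S"
  proof -
    have "(\<lambda>z. (snd z)(n := fst z)) \<in> S n \<Otimes>\<^sub>M PiM UNIV S \<rightarrow>\<^sub>M PiM (insert n UNIV) S"
      by (rule measurable_fun_upd[where J=UNIV]) auto
    then show ?thesis by (simp add: case_prod_beta')
  qed
  have m2: "(\<lambda>r. G r (r n)) \<in> borel_measurable (PiM UNIV S)"
    using measurable_compose[OF measurable_Pair[OF measurable_ident measurable_component_singleton[of n UNIV S]] G] by simp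
  have m3: "(\<lambda>(x, r). G r x) \<in> borel_measurable (S n \<Otimes>\<^sub>M PiM UNIV S)"
    using measurable_compose[OF measurable_pair_swap' G] by (simp add: case_prod_beta')
  have "(\<integral>\<^sup>+r. G r (r n) \<partial>PiM UNIV S) = (\<integral>\<^sup>+r. G r (r n) \<partial>distr (S n \<Otimes>\<^sub>M PiM UNIV S) (PiM UNIV S) (\<lambda>(x, r). r(n := x)))"
    by (simp only: eq)
  also have "\<dots> = (\<integral>\<^sup>+z. (\<lambda>(x, r). G r x) z \<partial>(S n \<Otimes>\<^sub>M PiM UNIV S))"
    using m2 by (subst nn_integral_distr[OF m1]) (simp_all add: case_prod_beta' indep)
  also have "\<dots> = (\<integral>\<^sup>+r. (\<integral>\<^sup>+x. G r x \<partial>S n) \<partial>PiM UNIV S)" by (subst nn_integral_snd[symmetric, OF m3]) simp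
  finally show ?thesis by simp
qed

section \<open>The stick-breaking construction of PD(\<gamma>,\<theta>)\<close>

definition stick :: "(nat \<Rightarrow> real) \<Rightarrow> nat \<Rightarrow> real" where
  "stick r n = (\<Prod>i<n. 1 - r i)"

lemma stick_partial_sum: "(\<Sum>k<n. r k * stick r k) = 1 - stick r n"
  by (induction n) (simp_all add: stick_def algebra_simps)

lemma stick_fun_upd: "n \<le> m \<Longrightarrow> stick (r(m := y)) n = stick r n" unfolding stick_def by (rule prod.cong) auto

lemma stick_measurable [measurable]: "(\<And>i. (\<lambda>x. x i) \<in> borel_measurable M) \<Longrightarrow> (\<lambda>r. stick r n) \<in> borel_measurable M"
  unfolding stick_def by measurable

lemma beta_law_ident: "(\<lambda>x. x) \<in> borel_measurable (beta_law a b)"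
  using measurable_restrict_space1[of "\<lambda>x. x" borel borel "{0<..<1}"]
    measurable_cong_sets[OF beta_law_sets refl, of a b "borel :: real measure"] by simp

lemma nn_integral_beta_law_residual:
  assumes "0 < a" "0 < b"
  shows "(\<integral>\<^sup>+r. ennreal (1 - r) \<partial>beta_law a b) = ennreal (b / (a + b))"
proof -
  have "(\<integral>\<^sup>+r. ennreal (1 - r) \<partial>beta_law a b) =
      ennreal (1 / Beta a b) * (\<integral>\<^sup>+x\<in>{0<..<1}. ennreal (x powr (a - 1) * (1 - x) powr (b - 1)) * ennreal (1 - x) \<partial>lborel)"
    by (rule nn_integral_beta_law) (use assms in simp_all)
  also have "(\<integral>\<^sup>+x\<in>{0<..<1}. ennreal (x powr (a - 1) * (1 - x) powr (b - 1)) * ennreal (1 - x) \<partial>lborel)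
    = (\<integral>\<^sup>+x\<in>{0<..<1}. ennreal (x powr (a - 1) * (1 - x) powr (b + 1 - 1)) \<partial>lborel)"
  proof (rule nn_integral_cong)
    fix x :: real
    show "ennreal (x powr (a - 1) * (1 - x) powr (b - 1)) * ennreal (1 - x) * indicator {0<..<1} x
      = ennreal (x powr (a - 1) * (1 - x) powr (b + 1 - 1)) * indicator {0<..<1} x"
    proof (cases "x \<in> {0<..<1}")
      case True
      then have "(1 - x) powr (b + 1 - 1) = (1 - x) powr (b - 1) * (1 - x)" using powr_add[of "1 - x" "b - 1" 1] by simp
      then show ?thesis using True by (simp add: ennreal_mult mult.assoc)
    qed simp
  qed
  also have "\<dots> = ennreal (Beta a (b + 1))" by (rule nn_integral_Beta) (use assms in simp_all)
  also have "ennreal (1 / Beta a b) * ennreal (Beta a (b + 1)) = ennreal (b / (a + b))"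
  proof -
    define x y z where "x = Gamma a" and "y = Gamma b" and "z = Gamma (a + b)"
    have p: "0 < x" "0 < y" "0 < z" using assms by (auto simp: x_def y_def z_def intro!: Gamma_real_pos)
    have "Beta a (b + 1) = x * (b * y) / ((a + b) * z)"
      using assms unfolding Beta_def add.assoc[symmetric] by (simp add: Gamma_plus1_pos x_def y_def z_def)
    moreover have "Beta a b = x * y / z" by (simp add: Beta_def x_def y_def z_def)
    ultimately show ?thesis using p assms by (simp add: ennreal_mult[symmetric] Beta_pos)
  qed
  finally show ?thesis .
qed

text \<open>The mean residual stick is a product of factors 1 - m_i with m_i at least a constant
  times 1 / (i + 1). The harmonic series diverges, so the means tend to 0; the stick itself is
  decreasing.\<close>

lemma AE_stick_tendsto_0:
  assumes \<gamma>: "0 < \<gamma>" "\<gamma> < 1" and \<theta>: "- \<gamma> < \<theta>"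
  shows "AE r in PiM UNIV (\<lambda>k. beta_law (1 - \<gamma>) (\<theta> + real (Suc k) * \<gamma>)). stick r \<longlonglongrightarrow> 0"
proof -
  let ?m = "\<lambda>i. (1 - \<gamma>) / (1 + \<theta> + real i * \<gamma>)"
  let ?b = "\<lambda>k. \<theta> + real (Suc k) * \<gamma>"
  let ?S = "\<lambda>k. beta_law (1 - \<gamma>) (?b k)"
  let ?M = "PiM UNIV ?S"
  have b: "0 < ?b k" for k
  proof -
    have "?b k = (\<theta> + \<gamma>) + real k * \<gamma>" by (simp add: algebra_simps)
    moreover have "0 \<le> real k * \<gamma>" using \<gamma> by simp
    ultimately show ?thesis using \<theta> by linarith
  qed
  have S: "prob_space (?S k)" for k using b[of k] \<gamma> by (intro prob_space_beta_law) auto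
  have comp [measurable]: "(\<lambda>r. r i) \<in> borel_measurable ?M" for i
    by (rule measurable_compose[OF measurable_component_singleton[where i=i and I=UNIV and M="?S"] beta_law_ident]) simp
  have r01: "0 < r i \<and> r i < 1" if "r \<in> space ?M" for r i using that by (auto simp: space_PiM PiE_iff)
  have E: "(\<integral>\<^sup>+r. ennreal (stick r n) \<partial>?M) = ennreal (\<Prod>i<n. 1 - ?m i)" for n
  proof -
    have "(\<integral>\<^sup>+r. ennreal (stick r n) \<partial>?M) = (\<integral>\<^sup>+r. (\<Prod>i<n. ennreal (1 - r i)) \<partial>?M)"
      by (rule nn_integral_cong) (use r01 in \<open>auto simp: stick_def prod_ennreal less_imp_le\<close>)
    also have "\<dots> = (\<Prod>i<n. \<integral>\<^sup>+r. ennreal (1 - r) \<partial>?S i)"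
      by (rule nn_integral_PiM_prod[OF S]) (rule measurable_beta_law, simp)
    also have "\<dots> = (\<Prod>i<n. ennreal (1 - ?m i))"
    proof (rule prod.cong[OF refl])
      fix i
      have "0 < 1 + \<theta> + real i * \<gamma>" using b[of i] \<gamma> by (simp add: algebra_simps)
      then have "?b i / (1 - \<gamma> + ?b i) = 1 - ?m i" by (simp add: field_simps)
      then show "(\<integral>\<^sup>+r. ennreal (1 - r) \<partial>?S i) = ennreal (1 - ?m i)"
        using nn_integral_beta_law_residual[OF _ b[of i], of "1 - \<gamma>"] \<gamma> by simp
    qed
    also have "\<dots> = ennreal (\<Prod>i<n. 1 - ?m i)"
    proof (rule prod_ennreal)
      fix i
      have "1 - \<gamma> < 1 + \<theta> + real i * \<gamma>" "0 < 1 + \<theta> + real i * \<gamma>" using b[of i] \<gamma> by (simp_all add: algebra_simps)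
      then show "0 \<le> 1 - ?m i" by (simp add: field_simps)
    qed
    finally show ?thesis .
  qed
  \<comment> \<open>Ensures 1 + \<theta> + i * \<gamma> <= C * (i + 1) for all i.\<close>
  define C where "C = 2 + \<bar>\<theta>\<bar>"
  have le: "(\<Prod>i<n. 1 - ?m i) \<le> exp (- ((1 - \<gamma>) / C) * harm n)" for n
  proof -
    have "(\<Prod>i<n. 1 - ?m i) \<le> (\<Prod>i<n. exp (- ((1 - \<gamma>) / C) * inverse (real (Suc i))))"
    proof (rule prod_mono)
      fix i
      have p: "1 - \<gamma> < 1 + \<theta> + real i * \<gamma>" "0 < 1 + \<theta> + real i * \<gamma>" using b[of i] \<gamma> by (simp_all add: algebra_simps)
      have "1 + \<theta> + real i * \<gamma> \<le> C + real i" unfolding C_def using \<gamma> mult_left_mono[of \<gamma> 1 "real i"] by auto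
      also have "\<dots> \<le> C * real (Suc i)" using mult_right_mono[of 1 C "real i"] by (simp add: C_def algebra_simps)
      finally have "(1 - \<gamma>) / (C * real (Suc i)) \<le> ?m i"
        using p \<gamma> by (intro divide_left_mono mult_pos_pos) (auto simp: C_def)
      then have "exp (- (?m i)) \<le> exp (- ((1 - \<gamma>) / (C * real (Suc i))))" by simp
      moreover have "1 - ?m i \<le> exp (- (?m i))" using exp_ge_add_one_self[of "- (?m i)"] by simp
      moreover have "exp (- ((1 - \<gamma>) / (C * real (Suc i)))) = exp (- ((1 - \<gamma>) / C) * inverse (real (Suc i)))" by (simp add: inverse_eq_divide)
      ultimately have "1 - ?m i \<le> exp (- ((1 - \<gamma>) / C) * inverse (real (Suc i)))" by linarith
      moreover have "0 \<le> 1 - ?m i" using p by (simp add: field_simps)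
      ultimately show "0 \<le> 1 - ?m i \<and> 1 - ?m i \<le> exp (- ((1 - \<gamma>) / C) * inverse (real (Suc i)))" by simp
    qed
    also have "\<dots> = exp (- ((1 - \<gamma>) / C) * harm n)"
    proof -
      have "harm n = (\<Sum>i<n. inverse (real (Suc i)))" by (induction n) (simp_all add: harm_Suc harm_def)
      then show ?thesis by (simp only: exp_sum[OF finite_lessThan, symmetric] sum_distrib_left)
    qed
    finally show ?thesis .
  qed
  have lim: "(\<lambda>n. exp (- ((1 - \<gamma>) / C) * harm n)) \<longlonglongrightarrow> 0"
  proof (rule filterlim_compose[OF exp_at_bot])
    have "- ((1 - \<gamma>) / C) < 0" using \<gamma> by (simp add: C_def)
    then show "LIM n sequentially. - ((1 - \<gamma>) / C) * harm n :> at_bot"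
      by (rule filterlim_tendsto_neg_mult_at_bot[OF tendsto_const _ harm_at_top])
  qed
  \<comment> \<open>The infimum over n has mean 0 and vanishes almost surely; by monotonicity of the
    stick it is the limit.\<close>
  have "(\<integral>\<^sup>+r. (INF n. ennreal (stick r n)) \<partial>?M) \<le> ennreal (exp (- ((1 - \<gamma>) / C) * harm n))" for n
  proof -
    have "(\<integral>\<^sup>+r. (INF n. ennreal (stick r n)) \<partial>?M) \<le> (\<integral>\<^sup>+r. ennreal (stick r n) \<partial>?M)"
      by (intro nn_integral_mono INF_lower) simp
    also have "\<dots> \<le> ennreal (exp (- ((1 - \<gamma>) / C) * harm n))" unfolding E using le by (rule ennreal_leI)
    finally show ?thesis .
  qed
  then have "(\<integral>\<^sup>+r. (INF n. ennreal (stick r n)) \<partial>?M) \<le> 0"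
    by (intro LIMSEQ_le_const[OF tendsto_ennrealI[OF lim, simplified]]) auto
  then have "AE r in ?M. (INF n. ennreal (stick r n)) = 0" by (subst nn_integral_0_iff_AE[symmetric]) auto
  then show ?thesis using AE_space
  proof eventually_elim
    case (elim r)
    have r: "0 < r i" "r i < 1" for i using r01[OF elim(2)] by auto
    have nn: "0 \<le> stick r n" for n unfolding stick_def by (rule prod_nonneg) (use r in \<open>simp add: less_imp_le\<close>)
    have "decseq (stick r)"
    proof (intro decseq_SucI)
      fix n show "stick r (Suc n) \<le> stick r n"
        using mult_left_mono[of "1 - r n" 1 "stick r n"] nn[of n] r[of n] by (simp add: stick_def)
    qed
    then have "decseq (\<lambda>n. ennreal (stick r n))" by (auto simp: decseq_def intro: ennreal_leI)
    from LIMSEQ_INF[OF this] have "(\<lambda>n. ennreal (stick r n)) \<longlonglongrightarrow> ennreal 0" using elim(1) by simp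
    then show "stick r \<longlonglongrightarrow> 0" by (subst (asm) tendsto_ennreal_iff) (auto simp: nn)
  qed
qed

lemma split_seq_Pinf:
  assumes "p \<in> Pinf" "r \<in> {0<..<1}"
  shows "(\<integral>\<^sup>+i. ennreal (split_seq r p i) \<partial>count_space UNIV) = 1"
  using split_seq_sum(1)[OF assms(1)] assms(2) by (simp add: nn_integral_count_space_nat)

lemma level_Pinf:
  assumes "(\<integral>\<^sup>+i. ennreal (m i) \<partial>count_space I) = 1" "0 < x"
  shows "finite {i\<in>I. x \<le> m i}" by (rule level_set_finite) (simp_all add: assms)

context stable_points
begin

lemma split_measurable:
  assumes \<theta>: "- \<gamma> < \<theta>"
  shows "(\<lambda>z. fst z) \<in> borel_measurable (beta_law a b \<Otimes>\<^sub>M PD_tilted \<theta>)" "(\<lambda>z. snd z i) \<in> borel_measurable (beta_law a b \<Otimes>\<^sub>M PD_tilted \<theta>)"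
proof -
  show "(\<lambda>z. fst z) \<in> borel_measurable (beta_law a b \<Otimes>\<^sub>M PD_tilted \<theta>)"
    by (rule measurable_compose[OF measurable_fst beta_law_ident])
  show "(\<lambda>z. snd z i) \<in> borel_measurable (beta_law a b \<Otimes>\<^sub>M PD_tilted \<theta>)"
    by (rule measurable_compose[OF measurable_snd]) (use PinfM_component[of i] in \<open>simp cong: measurable_cong_sets\<close>)
qed

lemma split_functional:
  assumes \<theta>: "- \<gamma> < \<theta>" and [measurable]: "\<phi> \<in> borel_measurable borel" and \<phi>0: "\<And>x. x \<le> 0 \<Longrightarrow> \<phi> x = 0" and l: "0 \<le> l"
  shows "(\<integral>\<^sup>+z. nexp (\<Sum>i. \<phi> (l * ranked UNIV (split_seq (fst z) (snd z)) i)) \<partial>(beta_law (1 - \<gamma>) (\<theta> + \<gamma>) \<Otimes>\<^sub>M PD_tilted (\<theta> + \<gamma>)))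
    = (\<integral>\<^sup>+r. nexp (\<phi> (l * r)) * frag \<phi> (\<theta> + \<gamma>) (l * (1 - r)) \<partial>beta_law (1 - \<gamma>) (\<theta> + \<gamma>))"
proof -
  let ?b = "beta_law (1 - \<gamma>) (\<theta> + \<gamma>)" and ?P = "PD_tilted (\<theta> + \<gamma>)"
  have s: "- \<gamma> < \<theta> + \<gamma>" using \<theta> \<gamma> by simp
  interpret P: prob_space ?P by (rule prob_space_PD_tilted[OF s])
  note [measurable] = PinfM_component split_measurable[OF s]
  have "(\<integral>\<^sup>+z. nexp (\<Sum>i. \<phi> (l * ranked UNIV (split_seq (fst z) (snd z)) i)) \<partial>(?b \<Otimes>\<^sub>M ?P))
    = (\<integral>\<^sup>+z. nexp (\<phi> (l * fst z)) * nexp (\<Sum>i. \<phi> (l * (1 - fst z) * snd z i)) \<partial>(?b \<Otimes>\<^sub>M ?P))"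
  proof (rule nn_integral_cong)
    fix z assume "z \<in> space (?b \<Otimes>\<^sub>M ?P)"
    then have z: "snd z \<in> Pinf" "fst z \<in> {0<..<1}" by (auto simp: space_pair_measure)
    have "(\<Sum>i. \<phi> (l * ranked UNIV (split_seq (fst z) (snd z)) i)) = (\<Sum>i. \<phi> (l * split_seq (fst z) (snd z) i))"
      using suminf_ranked[where \<phi>="\<lambda>x. \<phi> (l * x)" and m="split_seq (fst z) (snd z)" and I=UNIV, OF level_Pinf[OF split_seq_Pinf[OF z]]] l
      by (simp add: \<phi>0 mult_nonneg_nonpos nn_integral_count_space_nat)
    also have "\<dots> = \<phi> (l * fst z) + (\<Sum>i. \<phi> (l * ((1 - fst z) * snd z i)))"
      by (rule suminf_split_seq[where g="\<lambda>x. \<phi> (l * x)"])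
    finally show "nexp (\<Sum>i. \<phi> (l * ranked UNIV (split_seq (fst z) (snd z)) i)) = nexp (\<phi> (l * fst z)) * nexp (\<Sum>i. \<phi> (l * (1 - fst z) * snd z i))"
      by (simp add: nexp_add mult.assoc)
  qed
  also have "\<dots> = (\<integral>\<^sup>+r. \<integral>\<^sup>+p. nexp (\<phi> (l * r)) * nexp (\<Sum>i. \<phi> (l * (1 - r) * p i)) \<partial>?P \<partial>?b)"
    by (subst P.nn_integral_fst[symmetric]) simp_all
  also have "\<dots> = (\<integral>\<^sup>+r. nexp (\<phi> (l * r)) * frag \<phi> (\<theta> + \<gamma>) (l * (1 - r)) \<partial>?b)"
    unfolding frag_def by (intro nn_integral_cong nn_integral_cmult) simp
  finally show ?thesis .
qed

text \<open>Removing a Beta-distributed piece and shrinking an independent partition with parameter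
  \<theta> + \<gamma> has the right radial transform by \<open>radial_split\<close>;
  \<open>radial_law_eqI\<close> converts this into equality of laws.\<close>

lemma PD_split:
  assumes \<theta>: "- \<gamma> < \<theta>" and F: "F \<in> borel_measurable PinfM"
  shows "(\<integral>\<^sup>+p. F p \<partial>PD_tilted \<theta>) =
    (\<integral>\<^sup>+z. F (ranked UNIV (split_seq (fst z) (snd z))) \<partial>(beta_law (1 - \<gamma>) (\<theta> + \<gamma>) \<Otimes>\<^sub>M PD_tilted (\<theta> + \<gamma>)))"
proof (rule radial_law_eqI[OF _ _ _ _ _ _ F])
  let ?b = "beta_law (1 - \<gamma>) (\<theta> + \<gamma>)" and ?P = "PD_tilted (\<theta> + \<gamma>)"
  have s: "- \<gamma> < \<theta> + \<gamma>" using \<theta> \<gamma> by simp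
  interpret b: prob_space ?b by (rule prob_space_beta_law) (use \<theta> \<gamma> in auto)
  interpret P: prob_space ?P by (rule prob_space_PD_tilted[OF s])
  note [measurable] = PinfM_component split_measurable[OF s]
  show "prob_space (PD_tilted \<theta>)" by (rule prob_space_PD_tilted[OF \<theta>])
  show "prob_space (?b \<Otimes>\<^sub>M ?P)" by (intro prob_space_pair) unfold_locales
  show "0 < \<theta> + 1" using \<theta> \<gamma> by simp
  show "(\<lambda>p. p) \<in> PD_tilted \<theta> \<rightarrow>\<^sub>M PinfM" by simp
  show "(\<lambda>z. ranked UNIV (split_seq (fst z) (snd z))) \<in> ?b \<Otimes>\<^sub>M ?P \<rightarrow>\<^sub>M PinfM"
  proof (rule measurable_ranked_Pinf)
    show "(\<lambda>z. split_seq (fst z) (snd z) i) \<in> borel_measurable (?b \<Otimes>\<^sub>M ?P)" for i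
      by (cases i) (simp_all add: split_seq_def)
  qed (auto simp: space_pair_measure intro!: split_seq_Pinf)
  fix \<psi> :: "real \<Rightarrow> ennreal" assume [measurable]: "\<psi> \<in> borel_measurable borel" and \<psi>0: "\<And>x. x \<le> 0 \<Longrightarrow> \<psi> x = 0"
  \<comment> \<open>The identity contributed by the random scale makes \<open>tilt_int\<close>
    finite, whatever \<psi> is.\<close>
  define \<phi> where "\<phi> x = \<psi> x + ennreal x" for x
  have [measurable]: "\<phi> \<in> borel_measurable borel" unfolding \<phi>_def[abs_def] by measurable
  have \<phi>0: "x \<le> 0 \<Longrightarrow> \<phi> x = 0" for x by (simp add: \<phi>_def \<psi>0 ennreal_neg)
  have "tilt_int \<phi> \<le> tilt_int ennreal"
    unfolding tilt_int_def by (intro nn_integral_mono mult_left_mono nexp_antimono) (simp_all add: \<phi>_def)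
  then have fin: "tilt_int \<phi> < \<top>" unfolding tilt_int_linear by (rule le_less_trans) simp
  have "mellin \<theta> (frag \<phi> \<theta>) = mellin \<theta> (\<lambda>l. \<integral>\<^sup>+z. nexp (\<Sum>i. \<phi> (l * ranked UNIV (split_seq (fst z) (snd z)) i)) \<partial>(?b \<Otimes>\<^sub>M ?P))"
    unfolding radial_split[OF \<open>\<phi> \<in> borel_measurable borel\<close> fin \<theta>]
    by (rule mellin_cong) (use split_functional[OF \<theta> \<open>\<phi> \<in> borel_measurable borel\<close> \<phi>0] in simp)
  then show "mellin \<theta> (\<lambda>l. \<integral>\<^sup>+p. nexp (\<Sum>i. \<psi> (l * p i) + ennreal (l * p i)) \<partial>PD_tilted \<theta>)
    = mellin \<theta> (\<lambda>l. \<integral>\<^sup>+z. nexp (\<Sum>i. \<psi> (l * ranked UNIV (split_seq (fst z) (snd z)) i) + ennreal (l * ranked UNIV (split_seq (fst z) (snd z)) i)) \<partial>(?b \<Otimes>\<^sub>M ?P))"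
    unfolding \<phi>_def frag_def .
qed

lemma frag_split:
  assumes \<theta>: "- \<gamma> < \<theta>" and [measurable]: "\<phi> \<in> borel_measurable borel" and \<phi>0: "\<And>x. x \<le> 0 \<Longrightarrow> \<phi> x = 0" and c: "0 \<le> c"
  shows "frag \<phi> \<theta> c = (\<integral>\<^sup>+r. nexp (\<phi> (c * r)) * frag \<phi> (\<theta> + \<gamma>) (c * (1 - r)) \<partial>beta_law (1 - \<gamma>) (\<theta> + \<gamma>))"
  using PD_split[OF \<theta> PinfM_functional[OF assms(2)], of c] split_functional[OF \<theta> assms(2) \<phi>0 c] by (simp add: frag_def)

lemma frag_le_1: "- \<gamma> < \<theta> \<Longrightarrow> frag \<phi> \<theta> c \<le> 1"
proof -
  assume \<theta>: "- \<gamma> < \<theta>"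
  interpret pr: prob_space "PD_tilted \<theta>" by (rule prob_space_PD_tilted[OF \<theta>])
  have "frag \<phi> \<theta> c \<le> (\<integral>\<^sup>+p. 1 \<partial>PD_tilted \<theta>)" unfolding frag_def by (rule nn_integral_mono) simp
  then show ?thesis by (simp add: pr.emeasure_space_1[simplified])
qed

text \<open>No mass of a partition exceeds 1, so after dilation by c < e all of them stay below e,
  where \<phi> vanishes.\<close>

lemma frag_eq_1:
  assumes \<theta>: "- \<gamma> < \<theta>" and \<phi>0: "\<And>x. x < e \<Longrightarrow> \<phi> x = 0" and c: "0 \<le> c" "c < e"
  shows "frag \<phi> \<theta> c = 1"
proof -
  interpret pr: prob_space "PD_tilted \<theta>" by (rule prob_space_PD_tilted[OF \<theta>])
  have "frag \<phi> \<theta> c = (\<integral>\<^sup>+p. 1 \<partial>PD_tilted \<theta>)" unfolding frag_def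
  proof (rule nn_integral_cong)
    fix p assume "p \<in> space (PD_tilted \<theta>)"
    then have p: "p \<in> Pinf" by simp
    have "p i \<le> 1" for i using sum_le_suminf[OF Pinf_props(4)[OF p], of "{i}"] Pinf_props(3,5)[OF p] by simp
    then have "c * p i < e" for i using mult_left_mono[of "p i" 1 c] c by (simp add: le_less_trans)
    then show "nexp (\<Sum>i. \<phi> (c * p i)) = 1" by (simp add: \<phi>0)
  qed
  then show ?thesis by (simp add: pr.emeasure_space_1[simplified])
qed

lemma stick_nonneg:
  assumes "\<And>i. 0 < r i \<and> r i < 1" shows "0 \<le> stick r n"
  unfolding stick_def by (rule prod_nonneg) (use assms in \<open>simp add: less_imp_le\<close>)

context
  fixes \<theta> :: real
  assumes \<theta>: "- \<gamma> < \<theta>"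
begin

abbreviation "sticks k \<equiv> beta_law (1 - \<gamma>) (\<theta> + real (Suc k) * \<gamma>)"
abbreviation "sticksM \<equiv> PiM UNIV sticks"

lemma stick_param: "- \<gamma> < \<theta> + real n * \<gamma>" using \<theta> \<gamma> mult_nonneg_nonneg[of "real n" \<gamma>] by linarith

lemma prob_sticks: "prob_space (sticks k)"
  using stick_param[of k] \<gamma> by (intro prob_space_beta_law) (auto simp: algebra_simps)

lemma prob_sticksM: "prob_space sticksM" by (intro prob_space_PiM prob_sticks)

lemma sticks_component: "(\<lambda>r. r i) \<in> borel_measurable sticksM"
  by (rule measurable_compose[OF measurable_component_singleton[where i=i and I=UNIV and M=sticks] beta_law_ident]) simp

lemma sticks_01: "r \<in> space sticksM \<Longrightarrow> 0 < r i \<and> r i < 1" by (auto simp: space_PiM PiE_iff)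

text \<open>\<open>frag_split\<close> iterated n times: the parameter grows by \<gamma> with each
  break, and the residual stick is the dilation of the part not yet broken.\<close>

lemma frag_sticks:
  assumes [measurable]: "\<phi> \<in> borel_measurable borel" and \<phi>0: "\<And>x. x \<le> 0 \<Longrightarrow> \<phi> x = 0"
  shows "frag \<phi> \<theta> 1 = (\<integral>\<^sup>+r. (\<Prod>k<n. nexp (\<phi> (stick r k * r k))) * frag \<phi> (\<theta> + real n * \<gamma>) (stick r n) \<partial>sticksM)"
proof (induction n)
  case 0
  interpret pr: prob_space sticksM by (rule prob_sticksM)
  show ?case by (simp add: stick_def pr.emeasure_space_1[simplified])
next
  case (Suc n)
  note [measurable] = sticks_component frag_measurable[OF assms(1) stick_param[of "Suc n"]]
  let ?f = "frag \<phi> (\<theta> + real (Suc n) * \<gamma>)"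
  define G where "G r x = (\<Prod>k<n. nexp (\<phi> (stick r k * r k))) * (nexp (\<phi> (stick r n * x)) * ?f (stick r n * (1 - x)))" for r x
  have st [measurable]: "(\<lambda>z. stick (fst z) m) \<in> borel_measurable (sticksM \<Otimes>\<^sub>M sticks n)" for m
    by (rule measurable_compose[OF measurable_fst stick_measurable[OF sticks_component]])
  have co [measurable]: "(\<lambda>z. fst z m) \<in> borel_measurable (sticksM \<Otimes>\<^sub>M sticks n)" for m
    by (rule measurable_compose[OF measurable_fst sticks_component])
  have sn [measurable]: "(\<lambda>z. snd z) \<in> borel_measurable (sticksM \<Otimes>\<^sub>M sticks n)"
    by (rule measurable_compose[OF measurable_snd beta_law_ident])
  have "(\<integral>\<^sup>+r. (\<Prod>k<n. nexp (\<phi> (stick r k * r k))) * frag \<phi> (\<theta> + real n * \<gamma>) (stick r n) \<partial>sticksM)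
    = (\<integral>\<^sup>+r. (\<integral>\<^sup>+x. G r x \<partial>sticks n) \<partial>sticksM)"
  proof (rule nn_integral_cong)
    fix r assume "r \<in> space sticksM"
    then have s: "0 \<le> stick r n" by (intro stick_nonneg sticks_01)
    have e: "\<theta> + real n * \<gamma> + \<gamma> = \<theta> + real (Suc n) * \<gamma>" by (simp add: algebra_simps)
    have "frag \<phi> (\<theta> + real n * \<gamma>) (stick r n) = (\<integral>\<^sup>+x. nexp (\<phi> (stick r n * x)) * ?f (stick r n * (1 - x)) \<partial>sticks n)"
      using frag_split[OF stick_param assms s, of n] unfolding e .
    also have "(\<Prod>k<n. nexp (\<phi> (stick r k * r k))) * \<dots> = (\<integral>\<^sup>+x. G r x \<partial>sticks n)"
      unfolding G_def by (rule nn_integral_cmult[symmetric], rule measurable_beta_law, measurable)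
    finally show "(\<Prod>k<n. nexp (\<phi> (stick r k * r k))) * frag \<phi> (\<theta> + real n * \<gamma>) (stick r n) = (\<integral>\<^sup>+x. G r x \<partial>sticks n)" .
  qed
  also have "\<dots> = (\<integral>\<^sup>+r. G r (r n) \<partial>sticksM)"
  proof (rule nn_integral_PiM_resample[OF prob_sticks])
    show "(\<lambda>(r, x). G r x) \<in> borel_measurable (sticksM \<Otimes>\<^sub>M sticks n)" unfolding G_def case_prod_beta' by measurable
    show "G (r(n := y)) x = G r x" for r x y
    proof -
      have "(\<Prod>k<n. nexp (\<phi> (stick (r(n := y)) k * (r(n := y)) k))) = (\<Prod>k<n. nexp (\<phi> (stick r k * r k)))"
        by (rule prod.cong) (auto simp: stick_fun_upd)
      then show ?thesis by (simp add: G_def stick_fun_upd)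
    qed
  qed
  also have "\<dots> = (\<integral>\<^sup>+r. (\<Prod>k<Suc n. nexp (\<phi> (stick r k * r k))) * ?f (stick r (Suc n)) \<partial>sticksM)"
    by (intro nn_integral_cong) (simp add: G_def stick_def mult.assoc)
  finally show ?case using Suc.IH by simp
qed

lemma stick_masses_total:
  assumes "r \<in> space sticksM"
  shows "(\<integral>\<^sup>+k. ennreal (r k * stick r k) \<partial>count_space UNIV) \<le> 1"
proof -
  have nn: "0 \<le> r k * stick r k" for k
    using sticks_01[OF assms] stick_nonneg[OF sticks_01[OF assms]] by (simp add: less_imp_le)
  have "(\<Sum>k<n. ennreal (r k * stick r k)) \<le> 1" for n
    using stick_partial_sum[where r=r and n=n] stick_nonneg[OF sticks_01[OF assms], where n=n] nn by (simp add: sum_ennreal)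
  then have "(\<Sum>k. ennreal (r k * stick r k)) \<le> 1" unfolding suminf_eq_SUP by (intro SUP_least) simp
  then show ?thesis by (simp add: nn_integral_count_space_nat)
qed

text \<open>The residual stick tends to 0, and once it is shorter than e the unbroken part is
  invisible to a test function vanishing below e. The constant left side of
  \<open>frag_sticks\<close> thus equals the Laplace functional of the complete stick-breaking
  sequence.\<close>

lemma PD_law_eq: "PD_law \<gamma> \<theta> = PD_tilted \<theta>"
proof -
  interpret S: prob_space sticksM by (rule prob_sticksM)
  interpret P: prob_space "PD_tilted \<theta>" by (rule prob_space_PD_tilted[OF \<theta>])
  note [measurable] = sticks_component
  let ?B = "\<lambda>r. ranked UNIV (\<lambda>k. r k * stick r k)"
  have fin: "finite {k \<in> UNIV. x \<le> r k * stick r k}" if "r \<in> space sticksM" "0 < x" for r x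
    by (rule level_set_finite) (use stick_masses_total[OF that(1)] that(2) in \<open>auto intro: le_less_trans\<close>)
  have B: "?B \<in> sticksM \<rightarrow>\<^sub>M seq_borel" by (rule measurable_ranked) (use fin in simp_all)
  have law: "distr (PD_tilted \<theta>) seq_borel (\<lambda>p. p) = distr sticksM seq_borel ?B"
  proof (rule ranked_law_eqI)
    show "(\<lambda>p. p) \<in> PD_tilted \<theta> \<rightarrow>\<^sub>M seq_borel" using PinfM_measurable_id by simp
    show "AE p in PD_tilted \<theta>. decseq p \<and> p \<longlonglongrightarrow> 0" using AE_space by eventually_elim (auto dest: Pinf_props(1,2))
    show "AE r in sticksM. decseq (?B r) \<and> ?B r \<longlonglongrightarrow> 0"
      using AE_space by eventually_elim (auto intro!: ranked_decseq ranked_tendsto_0 fin[simplified])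
    fix \<phi> :: "real \<Rightarrow> ennreal" and e :: real
    assume \<phi>: "\<phi> \<in> borel_measurable borel" "0 < e" and small: "\<And>x. x < e \<Longrightarrow> \<phi> x = 0"
    note [measurable] = \<phi>(1)
    let ?e = "\<lambda>r. nexp (\<Sum>k. \<phi> (stick r k * r k))"
    let ?F = "\<lambda>n r. (\<Prod>k<n. nexp (\<phi> (stick r k * r k))) * frag \<phi> (\<theta> + real n * \<gamma>) (stick r n)"
    have \<phi>0: "\<phi> x = 0" if "x \<le> 0" for x using that \<phi>(2) small by auto
    have m: "(\<lambda>r. ?F n r) \<in> borel_measurable sticksM" for n
      using frag_measurable[OF \<phi>(1) stick_param, of n] by measurable
    define I where "I n = (\<integral>\<^sup>+r. ?F n r \<partial>sticksM)" for n
    have I: "I = (\<lambda>n. frag \<phi> \<theta> 1)" unfolding I_def using frag_sticks[OF \<phi>(1) \<phi>0] by (intro ext) simp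
    have "I \<longlonglongrightarrow> (\<integral>\<^sup>+r. ?e r \<partial>sticksM)" unfolding I_def[abs_def]
    proof (rule nn_integral_nexp_tendsto[OF prob_sticksM m])
      show "AE r in sticksM. (\<lambda>n. ?F n r) \<longlonglongrightarrow> ?e r" using AE_stick_tendsto_0[OF \<gamma> \<theta>] AE_space
      proof eventually_elim
        case (elim r)
        have "\<forall>\<^sub>F n in sequentially. stick r n < e" using order_tendstoD(2)[OF elim(1) \<phi>(2)] .
        then have "\<forall>\<^sub>F n in sequentially. (\<Prod>k<n. nexp (\<phi> (stick r k * r k))) = ?F n r"
          by eventually_elim (simp add: frag_eq_1[OF stick_param small] stick_nonneg sticks_01[OF elim(2)])
        from Lim_transform_eventually[OF nexp_suminf_tendsto this] show ?case .
      qed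
      show "?F n r \<le> 1" for n r
        using mult_mono[OF prod_le_1[of "{..<n}" "\<lambda>k. nexp (\<phi> (stick r k * r k))"] frag_le_1[OF stick_param[of n]]] by simp
    qed simp
    then have "frag \<phi> \<theta> 1 = (\<integral>\<^sup>+r. ?e r \<partial>sticksM)" unfolding I LIMSEQ_const_iff .
    also have "\<dots> = (\<integral>\<^sup>+r. nexp (\<Sum>k. \<phi> (?B r k)) \<partial>sticksM)"
    proof (rule nn_integral_cong)
      fix r assume r: "r \<in> space sticksM"
      show "?e r = nexp (\<Sum>k. \<phi> (?B r k))"
        using suminf_ranked[where \<phi>=\<phi> and I=UNIV and m="\<lambda>k. r k * stick r k", OF fin[OF r] \<phi>(1) \<phi>0]
        by (simp add: nn_integral_count_space_nat mult.commute)
    qed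
    finally show "(\<integral>\<^sup>+p. nexp (\<Sum>i. \<phi> (p i)) \<partial>PD_tilted \<theta>) = (\<integral>\<^sup>+r. nexp (\<Sum>i. \<phi> (?B r i)) \<partial>sticksM)"
      by (simp add: frag_def)
  qed (intro P.prob_space_axioms prob_sticksM B)+
  \<comment> \<open>\<open>PD_law\<close> restricts a law on all sequences to \<open>Pinf\<close>;
    the tilted law already lives there, so the restriction returns it unchanged.\<close>
  let ?R = "restrict_space (distr (PD_tilted \<theta>) seq_borel (\<lambda>p. p)) Pinf"
  have "PD_law \<gamma> \<theta> = ?R" unfolding PD_law_def law stick_def[abs_def] by simp
  also have "\<dots> = PD_tilted \<theta>"
  proof (rule measure_eqI)
    show s: "sets (?R) = sets (PD_tilted \<theta>)" by (simp add: PinfM_def sets_restrict_space)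
    fix A assume "A \<in> sets (?R)"
    then have A: "A \<in> sets seq_borel" "A \<subseteq> Pinf" "A \<in> sets PinfM" using sets_PinfM_subset[of A] unfolding s by simp_all
    show "emeasure (?R) A = emeasure (PD_tilted \<theta>) A"
      using A PinfM_measurable_id by (subst emeasure_restrict_space) (auto simp: emeasure_distr Int_absorb2 Int_absorb1)
  qed
  finally show ?thesis .
qed

end

end

section \<open>Fragmentation\<close>

definition frag_seq :: "(nat \<Rightarrow> real) \<Rightarrow> (nat \<Rightarrow> nat \<Rightarrow> real) \<Rightarrow> nat \<Rightarrow> real" where
  "frag_seq p q = ranked UNIV (\<lambda>(i, l). p i * q i l)"

lemma frag_total:
  assumes p: "p \<in> Pinf" and q: "\<And>i. q i \<in> Pinf"
  shows "(\<integral>\<^sup>+z. ennreal ((\<lambda>(i, l). p i * q i l) z) \<partial>count_space UNIV) = 1"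
proof -
  have "(\<Sum>l. ennreal (p i * q i l)) = ennreal (p i)" for i
  proof -
    have "(\<Sum>l. ennreal (p i * q i l)) = (\<Sum>l. ennreal (p i) * ennreal (q i l))"
      using Pinf_props(3)[OF p] Pinf_props(3)[OF q] by (simp add: ennreal_mult)
    also have "\<dots> = ennreal (p i)" using q[of i] by (simp add: Pinf_iff)
    finally show ?thesis .
  qed
  moreover have "(\<Sum>i. ennreal (p i)) = 1" using p by (simp add: Pinf_iff)
  ultimately show ?thesis using nn_integral_fst_count_space[of "\<lambda>z. ennreal ((\<lambda>(i, l). p i * q i l) z)"]
    by (simp add: nn_integral_count_space_nat)
qed

lemma suminf_frag_seq:
  assumes p: "p \<in> Pinf" and q: "\<And>i. q i \<in> Pinf" and [measurable]: "\<phi> \<in> borel_measurable borel"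
    and \<phi>0: "\<And>x. x \<le> 0 \<Longrightarrow> \<phi> x = 0" and c: "0 \<le> c"
  shows "(\<Sum>n. \<phi> (c * frag_seq p q n)) = (\<Sum>i. \<Sum>l. \<phi> (c * p i * q i l) :: ennreal)"
proof -
  have "(\<Sum>n. \<phi> (c * frag_seq p q n)) = (\<integral>\<^sup>+z. \<phi> (c * (\<lambda>(i, l). p i * q i l) z) \<partial>count_space UNIV)"
    unfolding frag_seq_def by (rule suminf_ranked[where \<phi>="\<lambda>x. \<phi> (c * x)"])
       (use c in \<open>auto intro!: level_Pinf[OF frag_total[OF p q], simplified] \<phi>0 mult_nonneg_nonpos\<close>)
  also have "\<dots> = (\<Sum>i. \<Sum>l. \<phi> (c * p i * q i l))"
    using nn_integral_fst_count_space[of "\<lambda>z. \<phi> (c * (\<lambda>(i, l). p i * q i l) z)"]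
    by (simp add: nn_integral_count_space_nat mult.assoc)
  finally show ?thesis .
qed

lemma frag_seq_Pinf: "p \<in> Pinf \<Longrightarrow> (\<And>i. q i \<in> Pinf) \<Longrightarrow> frag_seq p q \<in> Pinf"
  unfolding frag_seq_def by (rule ranked_Pinf[OF frag_total])

lemma frag_seq_measurable:
  assumes f: "f \<in> M \<rightarrow>\<^sub>M PinfM" and g: "\<And>i. (\<lambda>x. g x i) \<in> M \<rightarrow>\<^sub>M PinfM"
  shows "(\<lambda>x. frag_seq (f x) (g x)) \<in> M \<rightarrow>\<^sub>M PinfM" unfolding frag_seq_def
proof (rule measurable_ranked_Pinf)
  have [measurable]: "(\<lambda>x. f x i) \<in> borel_measurable M" "(\<lambda>x. g x i l) \<in> borel_measurable M" for i l
    using measurable_compose[OF f PinfM_component] measurable_compose[OF g PinfM_component] by simp_all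
  show "(\<lambda>x. (\<lambda>(i, l). f x i * g x i l) z) \<in> borel_measurable M" for z by (cases z) simp
  show "(\<integral>\<^sup>+z. ennreal ((\<lambda>(i, l). f x i * g x i l) z) \<partial>count_space UNIV) = 1" if "x \<in> space M" for x
    by (rule frag_total) (use measurable_space[OF f that] measurable_space[OF g that] in simp_all)
qed simp

context coag_setup
begin

abbreviation "PDm \<equiv> A.PD_tilted (- \<beta>)"
abbreviation "D \<equiv> PiM (UNIV :: nat set) (\<lambda>_. PDm)"

lemma PDm: "- \<alpha> < - \<beta>" using ba by simp

lemma prob_space_D: "prob_space D" by (intro prob_space_PiM A.prob_space_PD_tilted PDm)

lemma D_component: "(\<lambda>q. q i) \<in> D \<rightarrow>\<^sub>M PinfM" using measurable_component_singleton[of i UNIV "\<lambda>_. PDm"] by simp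

lemma D_Pinf: "q \<in> space D \<Longrightarrow> q i \<in> Pinf" using measurable_space[OF D_component, of q i] by simp

text \<open>Each \<beta>-stable point v receives an independent partition with law
  PD(\<alpha>,-\<beta>). The tilt T powr \<beta> of that law is exactly what the \<beta>-stable
  intensity needs to absorb the normalization, so the points of the \<alpha>-stable process reappear
  and their Laplace functional applies.\<close>

lemma pexp_frag:
  assumes [measurable]: "\<phi> \<in> borel_measurable borel" and e: "0 < e" and small: "\<And>x. x < e \<Longrightarrow> \<phi> x = 0"
  shows "A.pexp \<phi> < \<top>"
    and "C.pexp (\<lambda>v. nln (A.frag \<phi> (- \<beta>) v)) = ennreal (enn2real (A.pexp \<phi>) powr (\<beta> / \<alpha>))"
proof -
  let ?j = "\<lambda>v w. nexp (\<Sum>i. \<phi> (v * JA i w))"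
  let ?g = "\<lambda>v w. ennreal (A.T w powr \<beta>) * (1 - nexp (\<Sum>i. \<phi> (v * A.X w i)))"
  have b: "0 < \<beta>" "\<beta> < \<alpha>" "\<alpha> < 1" "0 < \<alpha>" "\<beta> < 1" using C.\<gamma> A.\<gamma> ba by auto
  have "A.pexp \<phi> \<le> (\<integral>\<^sup>+x. indicator {e..} x \<partial>A.\<nu>)" unfolding A.pexp_def
    by (intro nn_integral_mono) (auto simp: small split: split_indicator)
  also have "\<dots> < \<top>" using A.emeasure_\<nu>_Ici[OF e] by simp
  finally show fin: "A.pexp \<phi> < \<top>" .
  define r where "r = enn2real (A.pexp \<phi>)"
  have r: "A.pexp \<phi> = ennreal r" "0 \<le> r" using fin by (auto simp: r_def)
  define m where "m = A.mom (- \<beta>)"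
  have m: "0 < m" unfolding m_def by (rule A.mom_pos[OF PDm])
  have [measurable]: "A.frag \<phi> (- \<beta>) \<in> borel_measurable borel" by (rule A.frag_measurable[OF _ PDm]) simp
  interpret nu: sigma_finite_measure C.\<nu> by (rule sigma_finite_stable_intensity)
  interpret pr: pair_sigma_finite WA C.\<nu> ..
  have sets_nu [measurable_cong]: "sets C.\<nu> = sets borel" by (simp add: stable_intensity_def)
  have "C.pexp (\<lambda>v. nln (A.frag \<phi> (- \<beta>) v)) = (\<integral>\<^sup>+v. 1 - A.frag \<phi> (- \<beta>) v \<partial>C.\<nu>)"
    unfolding C.pexp_def by (simp add: nexp_nln A.frag_le_1[OF PDm])
  also have "\<dots> = (\<integral>\<^sup>+v. ennreal (1 / m) * (\<integral>\<^sup>+w. ?g v w \<partial>WA) \<partial>C.\<nu>)"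
  proof (rule nn_integral_cong)
    fix v
    let ?n = "\<lambda>w. nexp (\<Sum>i. \<phi> (v * A.X w i))" and ?t = "\<lambda>w. ennreal (A.T w powr \<beta>)"
    have t: "(\<integral>\<^sup>+w. ?t w \<partial>WA) = ennreal m" using A.moment_T[OF PDm] by (simp add: m_def)
    have tn: "?t w * ?n w \<le> ?t w" for w using mult_left_mono[OF nexp_le_1, of "?t w"] by simp
    have le: "(\<integral>\<^sup>+w. ?t w * ?n w \<partial>WA) \<le> ennreal m" unfolding t[symmetric] by (intro nn_integral_mono tn)
    have "(\<integral>\<^sup>+w. ?t w * (1 - ?n w) \<partial>WA) = (\<integral>\<^sup>+w. ?t w - ?t w * ?n w \<partial>WA)"
      by (intro nn_integral_cong) (simp add: ennreal_right_diff_distrib)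
    also have "\<dots> = (\<integral>\<^sup>+w. ?t w \<partial>WA) - (\<integral>\<^sup>+w. ?t w * ?n w \<partial>WA)"
      by (rule nn_integral_diff) (use le in \<open>auto simp: top_unique tn\<close>)
    finally have d: "(\<integral>\<^sup>+w. ?t w * (1 - ?n w) \<partial>WA) = ennreal m - (\<integral>\<^sup>+w. ?t w * ?n w \<partial>WA)" unfolding t .
    have f: "A.frag \<phi> (- \<beta>) v = ennreal (1 / m) * (\<integral>\<^sup>+w. ?t w * ?n w \<partial>WA)"
      unfolding A.frag_def m_def using A.nn_integral_PD_tilted[OF A.PinfM_functional PDm, of \<phi> v] by simp
    show "1 - A.frag \<phi> (- \<beta>) v = ennreal (1 / m) * (\<integral>\<^sup>+w. ?t w * (1 - ?n w) \<partial>WA)"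
      unfolding d f using m by (simp add: ennreal_right_diff_distrib ennreal_mult[symmetric])
  qed
  also have "\<dots> = ennreal (1 / m) * (\<integral>\<^sup>+v. (\<integral>\<^sup>+w. ?g v w \<partial>WA) \<partial>C.\<nu>)" by (rule nn_integral_cmult) simp
  also have "(\<integral>\<^sup>+v. (\<integral>\<^sup>+w. ?g v w \<partial>WA) \<partial>C.\<nu>)
    = (\<integral>\<^sup>+w. (\<integral>\<^sup>+v. ?g v w \<partial>C.\<nu>) \<partial>WA)" by (rule pr.Fubini') simp
  also have "\<dots> = (\<integral>\<^sup>+w. (\<integral>\<^sup>+v. 1 - ?j v w \<partial>C.\<nu>) \<partial>WA)"
  proof (rule nn_integral_cong_AE)
    show "AE w in WA. (\<integral>\<^sup>+v. ?g v w \<partial>C.\<nu>) = (\<integral>\<^sup>+v. 1 - ?j v w \<partial>C.\<nu>)" using A.AE_T A.AE_X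
    proof eventually_elim
      case (elim w)
      define t where "t = A.T w"
      have t: "0 < t" using elim by (simp add: t_def)
      have x: "v * JA i w = t * v * A.X w i" for v i using elim by (simp add: t_def)
      have "(\<integral>\<^sup>+v. ennreal (t powr \<beta>) * (1 - nexp (\<Sum>i. \<phi> (v * A.X w i))) \<partial>C.\<nu>) = ennreal (t powr \<beta>) * (\<integral>\<^sup>+v. 1 - nexp (\<Sum>i. \<phi> (v * A.X w i)) \<partial>C.\<nu>)"
        by (rule nn_integral_cmult) simp
      also have "\<dots> = (\<integral>\<^sup>+v. 1 - nexp (\<Sum>i. \<phi> (t * v * A.X w i)) \<partial>C.\<nu>)"
        by (rule nn_integral_stable_scale[OF _ t C.\<gamma>, symmetric]) simp
      finally show ?case unfolding x t_def .
    qed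
  qed
  also have "\<dots> = (\<integral>\<^sup>+v. (\<integral>\<^sup>+w. 1 - ?j v w \<partial>WA) \<partial>C.\<nu>)" by (rule pr.Fubini'[symmetric]) simp
  also have "\<dots> = (\<integral>\<^sup>+v. 1 - nexp (ennreal (v powr \<alpha>) * ennreal r) \<partial>C.\<nu>)"
  proof (rule nn_integral_cong_eventually[OF AE_stable_intensity_pos])
    fix v :: real assume v: "0 < v"
    let ?n = "\<lambda>w. ?j v w"
    have n: "(\<integral>\<^sup>+w. ?n w \<partial>WA) = nexp (ennreal (v powr \<alpha>) * ennreal r)"
      using A.laplace_functional[of "\<lambda>x. \<phi> (v * x)"] A.pexp_scale[OF _ v, of \<phi>] by (simp add: r)
    have "(\<integral>\<^sup>+w. 1 - ?n w \<partial>WA) = (\<integral>\<^sup>+w. 1 \<partial>WA) - (\<integral>\<^sup>+w. ?n w \<partial>WA)" by (rule nn_integral_diff) (simp_all add: n)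
    then show "(\<integral>\<^sup>+w. 1 - ?n w \<partial>WA) = 1 - nexp (ennreal (v powr \<alpha>) * ennreal r)" by (simp add: n A.emeasure_space_1)
  qed
  also have "ennreal (1 / m) * \<dots> = (\<integral>\<^sup>+x. 1 - nexp (ennreal ((x powr (1 / \<alpha>)) powr \<alpha>) * ennreal r) \<partial>B.\<nu>)"
  proof -
    \<comment> \<open>The normalizer of the tilt is the reciprocal of the constant in
      \<open>nn_integral_stable_powr\<close>, so the substitution v = x powr (1 / \<alpha>) leads to
      the intensity of index \<beta> / \<alpha> without a factor.\<close>
    have "1 / m = Gamma (1 - \<beta>) / Gamma (1 - \<beta> / \<alpha>)" by (simp add: m_def A.mom_def)
    then show ?thesis using nn_integral_stable_powr[OF _ b(1-3), of "\<lambda>v. 1 - nexp (ennreal (v powr \<alpha>) * ennreal r)"] by simp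
  qed
  also have "\<dots> = (\<integral>\<^sup>+x. ennreal (1 - exp (- (r * x))) \<partial>B.\<nu>)"
    by (rule nn_integral_cong_eventually[OF AE_stable_intensity_pos])
       (use r b in \<open>simp add: powr_powr ennreal_mult[symmetric] one_minus_nexp mult.commute\<close>)
  also have "\<dots> = ennreal (r powr (\<beta> / \<alpha>))"
    using r(2) nn_integral_stable_laplace[OF B.\<gamma>, of r] by (cases "r = 0") simp_all
  finally show "C.pexp (\<lambda>v. nln (A.frag \<phi> (- \<beta>) v)) = ennreal (enn2real (A.pexp \<phi>) powr (\<beta> / \<alpha>))" unfolding r_def .
qed

definition fragJ :: "'c \<times> (nat \<Rightarrow> nat \<Rightarrow> real) \<Rightarrow> nat \<Rightarrow> real" where
  "fragJ z n = C.T (fst z) * frag_seq (C.X (fst z)) (snd z) n"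

lemma frag_CX_measurable: "(\<lambda>z. frag_seq (C.X (fst z)) (snd z)) \<in> WC \<Otimes>\<^sub>M D \<rightarrow>\<^sub>M PinfM"
  by (rule frag_seq_measurable) (simp, rule measurable_compose[OF measurable_snd D_component])

lemma fragJ_measurable [measurable]: "fragJ \<in> WC \<Otimes>\<^sub>M D \<rightarrow>\<^sub>M seq_borel"
proof (rule measurable_PiM_single')
  fix n
  have [measurable]: "(\<lambda>z. frag_seq (C.X (fst z)) (snd z) n) \<in> borel_measurable (WC \<Otimes>\<^sub>M D)"
    using measurable_compose[OF frag_CX_measurable PinfM_component] .
  show "(\<lambda>z. fragJ z n) \<in> borel_measurable (WC \<Otimes>\<^sub>M D)" unfolding fragJ_def by measurable
qed (auto simp: space_PiM)

lemma AE_frag: "AE z in WC \<Otimes>\<^sub>M D. (0 < C.T (fst z) \<and> (\<forall>i. JC i (fst z) = C.T (fst z) * C.X (fst z) i)) \<and> (\<forall>i::nat. snd z i \<in> Pinf)"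
proof -
  have "AE w in WC. 0 < C.T w \<and> (\<forall>i. JC i w = C.T w * C.X w i)" using C.AE_T C.AE_X by eventually_elim auto
  from AE_pair_fst[OF C.prob_space_axioms prob_space_D this] show ?thesis using AE_space
    by eventually_elim (use D_Pinf in \<open>auto simp: space_pair_measure\<close>)
qed

abbreviation scaledJ where "scaledJ z i \<equiv> B.T (fst z) powr (1 / \<alpha>) * JA i (snd z)"

lemma scaled_measurable: "(\<lambda>z i. scaledJ z i) \<in> BA \<rightarrow>\<^sub>M seq_borel"
  by (rule measurable_PiM_single') (auto simp: space_PiM)

text \<open>Fragmenting the points of the \<open>\<beta>\<close>-stable process gives the points of the \<open>\<alpha>\<close>-stable process
  run up to the independent random time \<open>T\<^bsub>\<beta>/\<alpha>\<^esub>\<close>: both have the Laplace functional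
  \<open>exp (- a powr (\<beta> / \<alpha>))\<close>, \<open>a\<close> being the Laplace exponent of the \<open>\<alpha>\<close>-stable process.\<close>

lemma fragJ_law:
  "distr (WC \<Otimes>\<^sub>M D) seq_borel fragJ = distr BA seq_borel (\<lambda>z i. scaledJ z i)"
proof (rule ranked_law_eqI)
  interpret D: prob_space D by (rule prob_space_D)
  have b: "0 < \<beta>" "\<beta> < \<alpha>" "\<alpha> < 1" "0 < \<alpha>" using C.\<gamma> A.\<gamma> ba by auto
  show "prob_space (WC \<Otimes>\<^sub>M D)" "prob_space BA"
    by (intro prob_space_pair C.prob_space_axioms prob_space_D A.prob_space_axioms B.prob_space_axioms)+
  show "AE z in WC \<Otimes>\<^sub>M D. decseq (fragJ z) \<and> fragJ z \<longlonglongrightarrow> 0" using AE_frag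
  proof eventually_elim
    case (elim z)
    then have p: "frag_seq (C.X (fst z)) (snd z) \<in> Pinf" by (intro frag_seq_Pinf) auto
    show ?case using Pinf_props(1,2)[OF p] tendsto_mult_right_zero[of _ sequentially "C.T (fst z)"] elim
      by (auto simp: fragJ_def[abs_def] decseq_def intro: mult_left_mono)
  qed
  show "AE z in BA. decseq (\<lambda>i. scaledJ z i) \<and> (\<lambda>i. scaledJ z i) \<longlonglongrightarrow> 0"
  proof -
    have "AE w in WA. decseq (\<lambda>i. JA i w) \<and> (\<lambda>i. JA i w) \<longlonglongrightarrow> 0" using A.AE_J_decseq A.AE_J_tendsto by eventually_elim auto
    from AE_pair_snd[OF B.prob_space_axioms A.prob_space_axioms this] show ?thesis
      by eventually_elim (auto simp: decseq_def intro: mult_left_mono tendsto_mult_right_zero)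
  qed
  fix \<phi> :: "real \<Rightarrow> ennreal" and e :: real
  assume \<phi>: "\<phi> \<in> borel_measurable borel" "0 < e" and small: "\<And>x. x < e \<Longrightarrow> \<phi> x = 0"
  note [measurable] = \<phi>(1)
  have \<phi>0: "\<phi> x = 0" if "x \<le> 0" for x using that \<phi>(2) small by auto
  define r where "r = enn2real (A.pexp \<phi>)"
  have r: "A.pexp \<phi> = ennreal r" "0 \<le> r" using pexp_frag(1)[OF \<phi> small] by (auto simp: r_def)
  have Xm [measurable]: "(\<lambda>p. p i) \<in> borel_measurable PDm" for i
    using PinfM_component[of i] by (simp cong: measurable_cong_sets)
  have Dm [measurable]: "(\<lambda>z. snd z i l) \<in> borel_measurable (WC \<Otimes>\<^sub>M D)" for i l
    using measurable_compose[OF measurable_compose[OF measurable_snd D_component[of i]] PinfM_component[of l]] .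
  have [measurable]: "A.frag \<phi> (- \<beta>) \<in> borel_measurable borel" by (rule A.frag_measurable[OF _ PDm]) simp
  have "(\<integral>\<^sup>+z. nexp (\<Sum>n. \<phi> (fragJ z n)) \<partial>(WC \<Otimes>\<^sub>M D)) = (\<integral>\<^sup>+z. nexp (\<Sum>i. \<Sum>l. \<phi> (JC i (fst z) * snd z i l)) \<partial>(WC \<Otimes>\<^sub>M D))"
  proof (rule nn_integral_cong_eventually[OF AE_frag])
    fix z assume z: "(0 < C.T (fst z) \<and> (\<forall>i. JC i (fst z) = C.T (fst z) * C.X (fst z) i)) \<and> (\<forall>i::nat. snd z i \<in> Pinf)"
    then have "(\<Sum>n. \<phi> (fragJ z n)) = (\<Sum>i. \<Sum>l. \<phi> (C.T (fst z) * C.X (fst z) i * snd z i l))"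
      unfolding fragJ_def by (intro suminf_frag_seq \<phi>0) auto
    then show "nexp (\<Sum>n. \<phi> (fragJ z n)) = nexp (\<Sum>i. \<Sum>l. \<phi> (JC i (fst z) * snd z i l))" using z by simp
  qed
  also have "\<dots> = (\<integral>\<^sup>+w. \<integral>\<^sup>+q. nexp (\<Sum>i. \<Sum>l. \<phi> (JC i w * q i l)) \<partial>D \<partial>WC)"
    by (subst D.nn_integral_fst[symmetric]) simp_all
  also have "\<dots> = (\<integral>\<^sup>+w. nexp (\<Sum>i. nln (A.frag \<phi> (- \<beta>) (JC i w))) \<partial>WC)" unfolding A.frag_def
    by (intro nn_integral_cong nn_integral_PiM_nexp_suminf A.prob_space_PD_tilted PDm) simp
  also have "\<dots> = nexp (C.pexp (\<lambda>v. nln (A.frag \<phi> (- \<beta>) v)))" by (rule C.laplace_functional) simp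
  also have "\<dots> = ennreal (exp (- (r powr (\<beta> / \<alpha>))))"
    using pexp_frag(2)[OF \<phi> small] nexp_ennreal[of "r powr (\<beta> / \<alpha>)"] by (simp add: r_def)
  also have "\<dots> = (\<integral>\<^sup>+w. ennreal (exp (- (r * B.T w))) \<partial>WB)" by (rule B.laplace_T[OF r(2), symmetric])
  also have "\<dots> = (\<integral>\<^sup>+w'. \<integral>\<^sup>+w. nexp (\<Sum>i. \<phi> (B.T w' powr (1 / \<alpha>) * JA i w)) \<partial>WA \<partial>WB)"
  proof (rule nn_integral_cong_eventually[OF B.AE_T])
    fix w' assume *: "summable (\<lambda>i. JB i w') \<and> (\<Sum>i. ennreal (JB i w')) = ennreal (B.T w') \<and> 0 < B.T w'"
    define c where "c = B.T w' powr (1 / \<alpha>)"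
    have c: "0 < c" using * by (simp add: c_def)
    have "c powr \<alpha> = B.T w'" using * b by (simp add: c_def powr_powr)
    then have "(\<integral>\<^sup>+w. nexp (\<Sum>i. \<phi> (c * JA i w)) \<partial>WA) = nexp (ennreal (B.T w') * ennreal r)"
      using A.laplace_functional[of "\<lambda>x. \<phi> (c * x)"] A.pexp_scale[OF _ c, of \<phi>] by (simp add: r(1))
    then show "ennreal (exp (- (r * B.T w'))) = (\<integral>\<^sup>+w. nexp (\<Sum>i. \<phi> (B.T w' powr (1 / \<alpha>) * JA i w)) \<partial>WA)"
      unfolding c_def using * r(2) by (simp add: ennreal_mult[symmetric] nexp_ennreal mult.commute)
  qed
  also have "\<dots> = (\<integral>\<^sup>+z. nexp (\<Sum>i. \<phi> (scaledJ z i)) \<partial>BA)"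
    by (subst A.nn_integral_fst[symmetric]) simp_all
  finally show "(\<integral>\<^sup>+z. nexp (\<Sum>i. \<phi> (fragJ z i)) \<partial>(WC \<Otimes>\<^sub>M D)) = (\<integral>\<^sup>+z. nexp (\<Sum>i. \<phi> (scaledJ z i)) \<partial>BA)" .
qed (rule fragJ_measurable scaled_measurable)+

text \<open>As for \<open>coag_law\<close>: total and normalized masses are functions of the
  fragmented points, so the equality in \<open>fragJ_law\<close> carries over to the pair.\<close>

theorem frag_law:
  assumes [measurable]: "H \<in> borel_measurable borel" "S \<in> sets PinfM"
  shows "(\<integral>\<^sup>+z. H (C.T (fst z)) * indicator S (frag_seq (C.X (fst z)) (snd z)) \<partial>(WC \<Otimes>\<^sub>M D))
    = (\<integral>\<^sup>+z. H (A.T (snd z) * B.T (fst z) powr (1 / \<alpha>)) * indicator S (A.X (snd z)) \<partial>BA)"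
proof -
  let ?G = "\<lambda>a. H (suminf a) * indicator S (normseq a)"
  have "(\<integral>\<^sup>+z. H (C.T (fst z)) * indicator S (frag_seq (C.X (fst z)) (snd z)) \<partial>(WC \<Otimes>\<^sub>M D)) = (\<integral>\<^sup>+z. ?G (fragJ z) \<partial>(WC \<Otimes>\<^sub>M D))"
  proof (rule nn_integral_cong_eventually[OF AE_frag])
    fix z assume z: "(0 < C.T (fst z) \<and> (\<forall>i. JC i (fst z) = C.T (fst z) * C.X (fst z) i)) \<and> (\<forall>i::nat. snd z i \<in> Pinf)"
    then have p: "frag_seq (C.X (fst z)) (snd z) \<in> Pinf" by (intro frag_seq_Pinf) auto
    have "suminf (fragJ z) = C.T (fst z)"
      using suminf_mult[OF Pinf_props(4)[OF p], of "C.T (fst z)"] Pinf_props(5)[OF p] by (simp add: fragJ_def[abs_def])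
    moreover have "normseq (fragJ z) = frag_seq (C.X (fst z)) (snd z)"
      using z normseq_scale[OF Pinf_props(4)[OF p], of "C.T (fst z)"] normseq_eqI[of "frag_seq (C.X (fst z)) (snd z)"] Pinf_props[OF p]
      by (simp add: fragJ_def[abs_def])
    ultimately show "H (C.T (fst z)) * indicator S (frag_seq (C.X (fst z)) (snd z)) = ?G (fragJ z)" by simp
  qed
  also have "\<dots> = (\<integral>\<^sup>+a. ?G a \<partial>distr (WC \<Otimes>\<^sub>M D) seq_borel fragJ)" by (rule nn_integral_distr[symmetric]) simp_all
  also have "\<dots> = (\<integral>\<^sup>+z. ?G (\<lambda>i. scaledJ z i) \<partial>BA)"
    unfolding fragJ_law by (rule nn_integral_distr[OF scaled_measurable]) simp
  also have "\<dots> = (\<integral>\<^sup>+z. H (A.T (snd z) * B.T (fst z) powr (1 / \<alpha>)) * indicator S (A.X (snd z)) \<partial>BA)"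
  proof (rule nn_integral_cong_AE)
    have "AE z in BA. 0 < B.T (fst z)"
      by (rule AE_pair_fst[OF B.prob_space_axioms A.prob_space_axioms]) (rule eventually_mono[OF B.AE_T], simp)
    moreover have "AE z in BA. summable (\<lambda>i. JA i (snd z))"
      by (rule AE_pair_snd[OF B.prob_space_axioms A.prob_space_axioms]) (rule eventually_mono[OF A.AE_T], simp)
    ultimately show "AE z in BA. ?G (\<lambda>i. scaledJ z i)
      = H (A.T (snd z) * B.T (fst z) powr (1 / \<alpha>)) * indicator S (A.X (snd z))"
    proof eventually_elim
      case (elim z)
      have c: "0 < B.T (fst z) powr (1 / \<alpha>)" using elim(1) by simp
      show ?case
        unfolding suminf_mult[OF elim(2)] normseq_scale[OF elim(2) c] by (simp add: A.X_def total_def mult.commute)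
    qed
  qed
  finally show ?thesis .
qed

end

section \<open>Moments and Mittag-Leffler functions\<close>

text \<open>Keeps only the part of the Gamma integral beyond R. As R is free, Gamma outgrows every
  geometric sequence.\<close>

lemma Gamma_ge_powr:
  fixes y R :: real
  assumes y: "1 \<le> y" and R: "0 < R"
  shows "R powr (y - 1) * exp (- R) \<le> Gamma y"
proof -
  have "ennreal (R powr (y - 1)) * ennreal (exp (- R)) = ennreal (R powr (y - 1)) * (\<integral>\<^sup>+x\<in>{R..}. ennreal (exp (- x)) \<partial>lborel)"
  proof -
    have "(\<integral>\<^sup>+x\<in>{R..}. ennreal (exp (- x)) \<partial>lborel) = ennreal (0 - (- exp (- R)))"
    proof (rule nn_integral_FTC_atLeast)
      show "((\<lambda>x. - exp (- x)) has_real_derivative exp (- x)) (at x)" for x :: real by (auto intro!: derivative_eq_intros)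
      have "((\<lambda>x::real. - exp (- x)) \<longlongrightarrow> - 0) at_top"
        by (intro tendsto_minus filterlim_compose[OF exp_at_bot filterlim_uminus_at_bot_at_top])
      then show "((\<lambda>x::real. - exp (- x)) \<longlongrightarrow> 0) at_top" by simp
    qed auto
    then show ?thesis by simp
  qed
  also have "\<dots> = (\<integral>\<^sup>+x. ennreal (R powr (y - 1)) * (ennreal (exp (- x)) * indicator {R..} x) \<partial>lborel)"
    by (rule nn_integral_cmult[symmetric]) simp
  also have "\<dots> \<le> (\<integral>\<^sup>+x\<in>{0<..}. ennreal (x powr (y - 1) * exp (- (1 * x))) \<partial>lborel)"
    using y R by (intro nn_integral_mono) (auto simp: ennreal_mult[symmetric] intro!: ennreal_leI mult_right_mono powr_mono2 split: split_indicator)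
  also have "\<dots> = ennreal (Gamma y)" using nn_integral_Gamma[of y 1] y by simp
  finally have "ennreal (R powr (y - 1) * exp (- R)) \<le> ennreal (Gamma y)" by (simp add: ennreal_mult)
  moreover have "0 < Gamma y" using y by (intro Gamma_real_pos) simp
  ultimately show ?thesis by (simp add: ennreal_le_iff)
qed

context stable_points
begin

lemma summable_mom_index:
  assumes x: "0 \<le> x"
  shows "summable (\<lambda>l. x ^ l / fact l * mom (real (j + l) * \<gamma>))"
proof -
  \<comment> \<open>R powr \<gamma> = 4 * x + 1 bounds (x / R powr \<gamma>) ^ l by (1/4) ^ l, which
    leaves (1/2) ^ l after the binomial bound 2 ^ (j + l).\<close>
  define R where "R = (4 * x + 1) powr (1 / \<gamma>)"
  have R: "0 < R" "R powr \<gamma> = 4 * x + 1" using x \<gamma> by (auto simp: R_def powr_powr)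
  define C where "C = exp R * (R powr (- (real j * \<gamma>)) * (2 ^ j * fact j))"
  have C: "0 \<le> C" by (simp add: C_def)
  have bound: "norm (x ^ l / fact l * mom (real (j + l) * \<gamma>)) \<le> C * (1 / 2) ^ l" for l
  proof -
    have G: "Gamma (real (j + l) * \<gamma> / \<gamma> + 1) = fact (j + l)" using \<gamma> Gamma_fact[of "j + l", where 'a=real] by (simp add: add.commute)
    have p: "0 \<le> real (j + l) * \<gamma>" using \<gamma> by simp
    have "R powr (real (j + l) * \<gamma>) * exp (- R) \<le> Gamma (real (j + l) * \<gamma> + 1)"
      using Gamma_ge_powr[of "real (j + l) * \<gamma> + 1" R] p R by simp
    then have "mom (real (j + l) * \<gamma>) \<le> fact (j + l) / (R powr (real (j + l) * \<gamma>) * exp (- R))"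
      unfolding mom_def G using R by (intro divide_left_mono mult_pos_pos) (auto intro: less_le_trans[of 0 "R powr (real (j + l) * \<gamma>) * exp (- R)"])
    also have "\<dots> = fact (j + l) * (exp R * R powr (- (real j * \<gamma>)) / (R powr \<gamma>) ^ l)"
    proof -
      have "R powr (real (j + l) * \<gamma>) = R powr (real j * \<gamma>) * (R powr \<gamma>) ^ l"
        using R(1) by (simp add: powr_power powr_add[symmetric] algebra_simps)
      then show ?thesis using R by (simp add: exp_minus powr_minus field_simps)
    qed
    finally have m: "mom (real (j + l) * \<gamma>) \<le> fact (j + l) * (exp R * R powr (- (real j * \<gamma>)) / (4 * x + 1) ^ l)" unfolding R(2) .
    have "fact (j + l) / fact l = (fact j * real ((j + l) choose j) :: real)" by (simp add: binomial_fact)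
    also have "real ((j + l) choose j) \<le> 2 ^ (j + l)"
      using binomial_le_pow2[of "j + l" j] by (metis of_nat_le_iff of_nat_numeral of_nat_power)
    finally have f: "fact (j + l) / fact l \<le> (2 ^ j * fact j) * (2 :: real) ^ l" by (simp add: power_add mult_ac)
    have "norm (x ^ l / fact l * mom (real (j + l) * \<gamma>)) = x ^ l / fact l * mom (real (j + l) * \<gamma>)"
    proof -
      have "- \<gamma> < real (j + l) * \<gamma>" using p \<gamma> by linarith
      from mom_pos[OF this] show ?thesis using x by (simp only: real_norm_def) (intro abs_of_nonneg mult_nonneg_nonneg, simp_all)
    qed
    also have "\<dots> \<le> x ^ l / fact l * (fact (j + l) * (exp R * R powr (- (real j * \<gamma>)) / (4 * x + 1) ^ l))"
      using x by (intro mult_left_mono m) simp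
    also have "\<dots> = (exp R * R powr (- (real j * \<gamma>))) * (x / (4 * x + 1)) ^ l * (fact (j + l) / fact l)"
      by (simp add: power_divide mult_ac)
    also have "\<dots> \<le> (exp R * R powr (- (real j * \<gamma>))) * (1 / 4) ^ l * ((2 ^ j * fact j) * 2 ^ l)"
    proof (intro mult_mono f power_mono mult_left_mono)
      show "x / (4 * x + 1) \<le> 1 / 4" using x by (simp add: field_simps)
    qed (use x in auto)
    also have "\<dots> = C * (1 / 2) ^ l"
    proof -
      have "(1 / 4 :: real) ^ l * 2 ^ l = (1 / 2) ^ l" by (simp add: power_mult_distrib[symmetric])
      then have "(exp R * R powr (- (real j * \<gamma>))) * (1 / 4) ^ l * ((2 ^ j * fact j) * 2 ^ l) = C * ((1 / 4) ^ l * 2 ^ l)" by (simp add: C_def mult_ac)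
      then show ?thesis by (simp only: \<open>(1 / 4 :: real) ^ l * 2 ^ l = (1 / 2) ^ l\<close>)
    qed
    finally show ?thesis .
  qed
  show ?thesis
  proof (rule summable_comparison_test'[where N=0])
    show "summable (\<lambda>l. C * (1 / 2) ^ l)" by (rule summable_mult, rule summable_geometric) simp
  qed (rule bound)
qed

lemma integrable_T_powr:
  assumes "- \<gamma> < \<theta>"
  shows "integrable W (\<lambda>w. T w powr (- \<theta>))" "(\<integral>w. T w powr (- \<theta>) \<partial>W) = mom \<theta>"
proof -
  have "has_bochner_integral W (\<lambda>w. T w powr (- \<theta>)) (mom \<theta>)"
    by (rule has_bochner_integral_nn_integral) (use moment_T[OF assms] mom_pos[OF assms] in simp_all)
  then show "integrable W (\<lambda>w. T w powr (- \<theta>))" "(\<integral>w. T w powr (- \<theta>) \<partial>W) = mom \<theta>"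
    by (auto simp: has_bochner_integral_iff)
qed

text \<open>For \<delta> <= \<gamma> the power T powr (- n \<delta>) is at most 1 + T powr (- n
  \<gamma>), so the case \<delta> = \<gamma> dominates. Smaller \<delta> occurs for the
  \<alpha>-stable total with \<delta> = \<beta>.\<close>

lemma summable_mom:
  assumes x: "0 \<le> x" and \<delta>: "0 \<le> \<delta>" "\<delta> \<le> \<gamma>"
  shows "summable (\<lambda>l. x ^ l / fact l * mom (real (j + l) * \<delta>))"
proof (rule summable_comparison_test')
  show "summable (\<lambda>l. x ^ l / fact l + x ^ l / fact l * mom (real (j + l) * \<gamma>))"
  proof (rule summable_add[OF _ summable_mom_index[OF x]])
    show "summable (\<lambda>l. x ^ l / fact l)" using summable_exp[of x] by (simp add: field_simps)
  qed
  fix l :: nat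
  have p: "0 \<le> real (j + l) * \<delta>" "0 \<le> real (j + l) * \<gamma>" using \<gamma> \<delta> by simp_all
  then have p': "- \<gamma> < real (j + l) * \<delta>" "- \<gamma> < real (j + l) * \<gamma>" using \<gamma> by linarith+
  have "mom (real (j + l) * \<delta>) = (\<integral>w. T w powr (- (real (j + l) * \<delta>)) \<partial>W)" using integrable_T_powr(2)[OF p'(1)] by simp
  also have "\<dots> \<le> (\<integral>w. 1 + T w powr (- (real (j + l) * \<gamma>)) \<partial>W)"
  proof (rule integral_mono_AE)
    show "AE w in W. T w powr (- (real (j + l) * \<delta>)) \<le> 1 + T w powr (- (real (j + l) * \<gamma>))" using AE_T
    proof eventually_elim
      case (elim w)
      have le: "real (j + l) * \<delta> \<le> real (j + l) * \<gamma>" using \<delta> by (intro mult_left_mono) auto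
      show ?case
      proof (cases "1 \<le> T w")
        case True
        then have "T w powr (- (real (j + l) * \<delta>)) \<le> T w powr 0" using p by (intro powr_mono) auto
        then show ?thesis using True by (simp add: add_increasing2)
      next
        case False
        then have "T w powr (- (real (j + l) * \<delta>)) \<le> T w powr (- (real (j + l) * \<gamma>))"
          using elim le by (intro powr_mono') auto
        then show ?thesis by simp
      qed
    qed
  qed (use integrable_T_powr(1)[OF p'(1)] integrable_T_powr(1)[OF p'(2)] in auto)
  also have "\<dots> = 1 + mom (real (j + l) * \<gamma>)" using integrable_T_powr[OF p'(2)] by (simp add: prob_space)
  finally have "mom (real (j + l) * \<delta>) \<le> 1 + mom (real (j + l) * \<gamma>)" .
  then have "x ^ l / fact l * mom (real (j + l) * \<delta>) \<le> x ^ l / fact l * (1 + mom (real (j + l) * \<gamma>))"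
    using x by (intro mult_left_mono) auto
  then show "norm (x ^ l / fact l * mom (real (j + l) * \<delta>)) \<le> x ^ l / fact l + x ^ l / fact l * mom (real (j + l) * \<gamma>)"
    using x mom_pos[OF p'(1)] by (simp add: distrib_left)
qed

text \<open>Common unnormalized form of the exponential factors in the theorem: for \<delta> =
  \<gamma> it is a Mittag-Leffler function times a moment, and for the \<alpha>-stable total with
  \<delta> = \<beta> it gives \<open>EA\<close>.\<close>

definition expmom :: "nat \<Rightarrow> real \<Rightarrow> real \<Rightarrow> real" where
  "expmom j \<delta> x = (\<integral>w. exp (- (x * T w powr (- \<delta>))) * T w powr (- (real j * \<delta>)) \<partial>W)"

context
  fixes j :: nat and \<delta> :: real
  assumes \<delta>: "0 \<le> \<delta>" "\<delta> \<le> \<gamma>"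
begin

lemma expmom_index: "- \<gamma> < real n * \<delta>"
proof -
  have "0 \<le> real n * \<delta>" using \<delta> by simp
  then show ?thesis using \<gamma> by linarith
qed

lemma integrable_expmom:
  assumes x: "0 \<le> x"
  shows "integrable W (\<lambda>w. exp (- (x * T w powr (- \<delta>))) * T w powr (- (real j * \<delta>)))"
proof (rule Bochner_Integration.integrable_bound[OF integrable_T_powr(1)[OF expmom_index[of j]]])
  show "AE w in W. norm (exp (- (x * T w powr (- \<delta>))) * T w powr (- (real j * \<delta>))) \<le> norm (T w powr (- (real j * \<delta>)))"
    using x by (intro AE_I2) (simp add: mult_left_le_one_le)
qed simp

lemma nn_integral_expmom:
  assumes x: "0 \<le> x"
  shows "(\<integral>\<^sup>+w. ennreal (exp (- (x * T w powr (- \<delta>))) * T w powr (- (real j * \<delta>))) \<partial>W) = ennreal (expmom j \<delta> x)"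
  unfolding expmom_def by (rule nn_integral_eq_integral[OF integrable_expmom[OF x]]) simp

lemma expmom_pos:
  assumes x: "0 \<le> x"
  shows "0 < expmom j \<delta> x"
proof -
  have "(\<integral>\<^sup>+w. ennreal (exp (- (x * T w powr (- \<delta>))) * T w powr (- (real j * \<delta>))) \<partial>W) \<noteq> 0"
  proof
    assume "(\<integral>\<^sup>+w. ennreal (exp (- (x * T w powr (- \<delta>))) * T w powr (- (real j * \<delta>))) \<partial>W) = 0"
    then have "AE w in W. ennreal (exp (- (x * T w powr (- \<delta>))) * T w powr (- (real j * \<delta>))) = 0"
      by (subst (asm) nn_integral_0_iff_AE) auto
    then have "AE w in W. False" using AE_T by eventually_elim (auto simp: ennreal_eq_0_iff mult_le_0_iff not_le)
    then show False by simp
  qed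
  then show ?thesis unfolding nn_integral_expmom[OF x] by (simp add: ennreal_eq_0_iff)
qed

text \<open>Expansion of the exponential under the expectation; the exchange is justified by the
  absolute convergence of the moment series in \<open>summable_mom\<close>.\<close>

lemma expmom_sums:
  assumes x: "0 \<le> x"
  shows "(\<lambda>l. (- x) ^ l / fact l * mom (real (j + l) * \<delta>)) sums expmom j \<delta> x"
proof -
  let ?F = "\<lambda>l w. (- x) ^ l / fact l * T w powr (- (real (j + l) * \<delta>))"
  have int: "integrable W (?F l)" for l by (intro integrable_mult_right integrable_T_powr(1) expmom_index)
  have nint: "(\<integral>w. norm (?F l w) \<partial>W) = x ^ l / fact l * mom (real (j + l) * \<delta>)" for l
    using integrable_T_powr(2)[OF expmom_index[of "j + l"]] x by (simp add: abs_mult power_abs)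
  have pt: "AE w in W. (\<lambda>l. ?F l w) sums (exp (- (x * T w powr (- \<delta>))) * T w powr (- (real j * \<delta>)))
      \<and> summable (\<lambda>l. norm (?F l w))" using AE_T
  proof eventually_elim
    case (elim w)
    define u where "u = T w powr (- \<delta>)"
    define v where "v = T w powr (- (real j * \<delta>))"
    have u: "T w powr (- (real (j + l) * \<delta>)) = u ^ l * v" for l
      using elim by (simp add: u_def v_def powr_power powr_add[symmetric] algebra_simps)
    have "?F l w = v * ((- (x * u)) ^ l /\<^sub>R fact l)" for l
      unfolding u by (simp add: field_simps power_mult_distrib[symmetric])
    moreover have "(\<lambda>l. v * ((- (x * u)) ^ l /\<^sub>R fact l)) sums (v * exp (- (x * u)))" by (intro sums_mult exp_converges)
    moreover have "summable (\<lambda>l. norm (v * ((- (x * u)) ^ l /\<^sub>R fact l)))"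
      using summable_mult[OF summable_norm_exp[of "- (x * u)"], of "\<bar>v\<bar>"] by (simp add: abs_mult norm_mult)
    ultimately show ?case by (simp add: u_def v_def mult.commute)
  qed
  have "(\<lambda>l. integral\<^sup>L W (?F l)) sums (\<integral>w. (\<Sum>l. ?F l w) \<partial>W)"
  proof (rule sums_integral[OF int])
    show "AE w in W. summable (\<lambda>l. norm (?F l w))" using pt by eventually_elim simp
    show "summable (\<lambda>l. \<integral>w. norm (?F l w) \<partial>W)" unfolding nint by (rule summable_mom[OF x \<delta>])
  qed
  also have "(\<integral>w. (\<Sum>l. ?F l w) \<partial>W) = expmom j \<delta> x" unfolding expmom_def
    by (rule integral_cong_AE) (use pt in \<open>auto elim!: eventually_mono simp: sums_iff\<close>)
  also have "(\<lambda>l. integral\<^sup>L W (?F l)) = (\<lambda>l. (- x) ^ l / fact l * mom (real (j + l) * \<delta>))"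
    using integrable_T_powr(2)[OF expmom_index] by (simp only: Bochner_Integration.integral_mult_right_zero)
  finally show ?thesis .
qed

end

lemma mittag_leffler_expmom:
  assumes x: "0 \<le> x"
  shows "mittag_leffler (real j + 1) \<gamma> (real j * \<gamma> + 1) (- x) = expmom j \<gamma> x / mom (real j * \<gamma>)"
proof -
  have \<delta>: "0 \<le> \<gamma>" "\<gamma> \<le> \<gamma>" using \<gamma> by auto
  have "(- x) ^ l / fact l * (Gamma (real j + 1 + real l) * Gamma (real j * \<gamma> + 1)) / (Gamma (real j + 1) * Gamma (\<gamma> * real l + (real j * \<gamma> + 1)))
    = (- x) ^ l / fact l * mom (real (j + l) * \<gamma>) / mom (real j * \<gamma>)" for l
  proof -
    have "mom (real (j + l) * \<gamma>) = Gamma (real j + 1 + real l) / Gamma (\<gamma> * real l + (real j * \<gamma> + 1))"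
    proof -
      have "real (j + l) * \<gamma> / \<gamma> = real j + real l" using \<gamma> by simp
      then show ?thesis unfolding mom_def by (simp add: algebra_simps)
    qed
    moreover have "mom (real j * \<gamma>) = Gamma (real j + 1) / Gamma (real j * \<gamma> + 1)" using \<gamma> by (simp add: mom_def)
    ultimately show ?thesis by (simp add: mult_ac)
  qed
  then show ?thesis
    unfolding mittag_leffler_def using sums_divide[OF expmom_sums[OF \<delta> x, of j], of "mom (real j * \<gamma>)"] by (simp add: sums_iff)
qed

lemma expmom_measurable [measurable]: "expmom j \<delta> \<in> borel_measurable borel"
  unfolding expmom_def[abs_def] by (rule borel_measurable_lebesgue_integral) simp

end

context stable_pk
begin

lemma law_of_f: "law_of f = distr W lborel T" using f_density by (simp add: distributed_def law_of_def)

lemma neg_moment_f: "- \<gamma> < \<theta> \<Longrightarrow> neg_moment f \<theta> = mom \<theta>"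
  unfolding neg_moment_def law_of_f by (subst integral_distr) (simp_all add: integrable_T_powr(2))

lemma integral_f_tilt:
  assumes \<theta>: "- \<gamma> < \<theta>" and [measurable]: "g \<in> borel_measurable borel"
  shows "(\<integral>t. g t \<partial>law_of (f_tilt f \<theta>)) = (\<integral>w. g (T w) * T w powr (- \<theta>) \<partial>W) / mom \<theta>"
proof -
  have "(\<integral>t. g t \<partial>law_of (f_tilt f \<theta>)) = (\<integral>t. (t powr (- \<theta>) * f t / mom \<theta>) * g t \<partial>lborel)"
    unfolding law_of_def f_tilt_def neg_moment_f[OF \<theta>]
    using mom_pos[OF \<theta>] f_nonneg by (subst integral_density) (auto intro!: AE_I2 divide_nonneg_pos mult_nonneg_nonneg)
  also have "\<dots> = (\<integral>t. f t * (g t * t powr (- \<theta>) / mom \<theta>) \<partial>lborel)"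
    by (intro Bochner_Integration.integral_cong) (simp_all add: mult_ac)
  also have "\<dots> = (\<integral>t. g t * t powr (- \<theta>) / mom \<theta> \<partial>law_of f)"
    unfolding law_of_def using f_nonneg by (subst integral_density) auto
  also have "\<dots> = (\<integral>w. g (T w) * T w powr (- \<theta>) / mom \<theta> \<partial>W)" unfolding law_of_f by (subst integral_distr) simp_all
  finally show ?thesis by simp
qed

end

section \<open>The joint law and its marginals\<close>

locale pk_family =
  coag_setup \<alpha> \<beta> "\<Omega> \<alpha>" "J \<alpha>" "\<Omega> (\<beta> / \<alpha>)" "J (\<beta> / \<alpha>)" "\<Omega> \<beta>" "J \<beta>" +
  A: stable_pk \<alpha> "\<Omega> \<alpha>" "J \<alpha>" "f \<alpha>" "PDc \<alpha>" +
  B: stable_pk "\<beta> / \<alpha>" "\<Omega> (\<beta> / \<alpha>)" "J (\<beta> / \<alpha>)" "f (\<beta> / \<alpha>)" "PDc (\<beta> / \<alpha>)" +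
  C: stable_pk \<beta> "\<Omega> \<beta>" "J \<beta>" "f \<beta>" "PDc \<beta>"
  for \<alpha> \<beta> :: real and \<Omega> :: "real \<Rightarrow> 'w measure" and J and f and PDc
begin

abbreviation "WA \<equiv> \<Omega> \<alpha>"
abbreviation "WB \<equiv> \<Omega> (\<beta> / \<alpha>)"
abbreviation "WC \<equiv> \<Omega> \<beta>"
abbreviation "tt z \<equiv> A.T (snd z) * B.T (fst z) powr (1 / \<alpha>)"

lemma nn_integral_BA:
  assumes [measurable]: "g \<in> borel_measurable BA"
  shows "(\<integral>\<^sup>+z. g z \<partial>BA) = (\<integral>\<^sup>+b. \<integral>\<^sup>+a. g (b, a) \<partial>WA \<partial>WB)"
    and "(\<integral>\<^sup>+z. g z \<partial>BA) = (\<integral>\<^sup>+a. \<integral>\<^sup>+b. g (b, a) \<partial>WB \<partial>WA)"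
proof -
  interpret pr: pair_sigma_finite WB WA ..
  show "(\<integral>\<^sup>+z. g z \<partial>BA) = (\<integral>\<^sup>+b. \<integral>\<^sup>+a. g (b, a) \<partial>WA \<partial>WB)" by (rule A.nn_integral_fst[symmetric]) fact
  show "(\<integral>\<^sup>+z. g z \<partial>BA) = (\<integral>\<^sup>+a. \<integral>\<^sup>+b. g (b, a) \<partial>WB \<partial>WA)" by (rule pr.nn_integral_snd[symmetric]) fact
qed

text \<open>Each kernel is integrated against the law of its total mass, so the mixture becomes an
  expectation over the independent processes \<open>A\<close> and \<open>B\<close>. Rectangles
  generate the product.\<close>

lemma emeasure_joint_law_Times:
  fixes h :: "real \<Rightarrow> real"
  assumes [measurable]: "h \<in> borel_measurable borel" and h0: "\<And>t. 0 \<le> h t"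
    and A [measurable]: "A \<in> sets PinfM" and B [measurable]: "B \<in> sets PinfM"
  shows "emeasure (joint_law f PDc \<alpha> \<beta> h) (A \<times> B) =
    (\<integral>\<^sup>+z. ennreal (h (tt z)) * (indicator A (A.X (snd z)) * indicator B (B.X (fst z))) \<partial>BA)"
proof -
  let ?I = "\<lambda>y. (\<integral>\<^sup>+a. ennreal (h (A.T a * y powr (1 / \<alpha>))) * indicator A (A.X a) \<partial>WA)"
  let ?R = "restrict_space lborel {0<..} :: real measure"
  let ?g = "\<lambda>(s, y). ennreal (h (s * y powr (1 / \<alpha>)) * f (\<beta> / \<alpha>) y * f \<alpha> s)"
  let ?K = "\<lambda>(s, y). PDc \<alpha> s \<Otimes>\<^sub>M PDc (\<beta> / \<alpha>) y"
  have sR: "sets ?R = sets (restrict_space borel {0<..})" by (simp add: sets_restrict_space)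
  interpret R: sigma_finite_measure ?R
    by (rule sigma_finite_measure_restrict_space[OF lborel.sigma_finite_measure_axioms]) simp
  interpret RR: pair_sigma_finite ?R ?R ..
  have id: "(\<lambda>x. x) \<in> borel_measurable ?R"
    using measurable_restrict_space1[of "\<lambda>x. x" borel borel "{0<..}"] measurable_cong_sets[OF sR refl, of "borel :: real measure"] by simp
  note [measurable] = measurable_compose[OF measurable_fst id] measurable_compose[OF measurable_snd id]
    A.emeasure_K'_measurable[OF A] B.emeasure_K'_measurable[OF B]
  have gm: "?g \<in> borel_measurable (?R \<Otimes>\<^sub>M ?R)" unfolding case_prod_beta' by measurable
  have KA: "PDc \<alpha> \<in> ?R \<rightarrow>\<^sub>M prob_algebra PinfM" and KB: "PDc (\<beta> / \<alpha>) \<in> ?R \<rightarrow>\<^sub>M prob_algebra PinfM"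
    using A.K_meas B.K_meas measurable_cong_sets[OF sR refl] by blast+
  have K: "?K \<in> ?R \<Otimes>\<^sub>M ?R \<rightarrow>\<^sub>M prob_algebra (PinfM \<Otimes>\<^sub>M PinfM)" unfolding case_prod_beta'
    by (intro measurable_pair_prob measurable_compose[OF measurable_fst KA] measurable_compose[OF measurable_snd KB])
  then have K1: "?K \<in> density (?R \<Otimes>\<^sub>M ?R) ?g \<rightarrow>\<^sub>M subprob_algebra (PinfM \<Otimes>\<^sub>M PinfM)"
    using measurable_prob_algebraD by simp
  have AB: "A \<times> B \<in> sets (PinfM \<Otimes>\<^sub>M PinfM)" by simp
  have Ke: "(\<lambda>z. emeasure (?K z) (A \<times> B)) \<in> borel_measurable (?R \<Otimes>\<^sub>M ?R)"
    by (rule measurable_compose[OF measurable_prob_algebraD[OF K] measurable_emeasure_subprob_algebra[OF AB]])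
  have Em: "emeasure (PDc \<alpha> s \<Otimes>\<^sub>M PDc (\<beta> / \<alpha>) y) (A \<times> B) = emeasure (A.K' s) A * emeasure (B.K' y) B" if "0 < s" "0 < y" for s y
  proof -
    interpret b: prob_space "B.K' y" by (rule B.K'_kernel)
    have "emeasure (A.K' s \<Otimes>\<^sub>M B.K' y) (A \<times> B) = emeasure (A.K' s) A * emeasure (B.K' y) B"
      by (rule b.emeasure_pair_measure_Times) (simp_all add: A.K'_kernel B.K'_kernel)
    then show ?thesis using that by (simp add: A.K'_def B.K'_def)
  qed
  have "emeasure (joint_law f PDc \<alpha> \<beta> h) (A \<times> B) = (\<integral>\<^sup>+z. emeasure (?K z) (A \<times> B) \<partial>density (?R \<Otimes>\<^sub>M ?R) ?g)"
    unfolding joint_law_def by (rule emeasure_bind[OF _ K1 AB]) (auto simp: space_pair_measure space_restrict_space)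
  also have "\<dots> = (\<integral>\<^sup>+z. ?g z * emeasure (?K z) (A \<times> B) \<partial>(?R \<Otimes>\<^sub>M ?R))" by (rule nn_integral_density[OF gm Ke])
  also have "\<dots> = (\<integral>\<^sup>+y. \<integral>\<^sup>+s. ?g (s, y) * emeasure (?K (s, y)) (A \<times> B) \<partial>?R \<partial>?R)"
    by (rule RR.nn_integral_snd[OF borel_measurable_times_ennreal[OF gm Ke], symmetric])
  also have "\<dots> = (\<integral>\<^sup>+y. ennreal (f (\<beta> / \<alpha>) y) * (?I y * emeasure (B.K' y) B) \<partial>?R)"
  proof (rule nn_integral_cong)
    fix y assume "y \<in> space ?R"
    then have y: "0 < y" by (simp add: space_restrict_space)
    let ?c = "ennreal (f (\<beta> / \<alpha>) y) * emeasure (B.K' y) B"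
    have "(\<integral>\<^sup>+s. ?g (s, y) * emeasure (?K (s, y)) (A \<times> B) \<partial>?R)
      = (\<integral>\<^sup>+s\<in>{0<..}. ?c * (ennreal (h (s * y powr (1 / \<alpha>)) * f \<alpha> s) * emeasure (A.K' s) A) \<partial>lborel)"
      by (subst nn_integral_restrict_space)
         (use y h0 A.f_nonneg B.f_nonneg in \<open>auto intro!: nn_integral_cong simp: Em ennreal_mult mult_ac split: split_indicator\<close>)
    also have "\<dots> = ?c * (\<integral>\<^sup>+s\<in>{0<..}. ennreal (h (s * y powr (1 / \<alpha>)) * f \<alpha> s) * emeasure (A.K' s) A \<partial>lborel)"
      by (simp add: nn_integral_cmult[symmetric] mult.assoc)
    also have "(\<integral>\<^sup>+s\<in>{0<..}. ennreal (h (s * y powr (1 / \<alpha>)) * f \<alpha> s) * emeasure (A.K' s) A \<partial>lborel)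
      = ?I y" by (rule A.nn_integral_T_kernel[OF _ _ A]) (simp_all add: h0)
    finally show "(\<integral>\<^sup>+s. ?g (s, y) * emeasure (?K (s, y)) (A \<times> B) \<partial>?R) = ennreal (f (\<beta> / \<alpha>) y) * (?I y * emeasure (B.K' y) B)"
      by (simp add: mult_ac)
  qed
  also have "\<dots> = (\<integral>\<^sup>+y. ennreal (f (\<beta> / \<alpha>) y) * (?I y * emeasure (B.K' y) B) * indicator {0<..} y \<partial>lborel)"
    by (rule nn_integral_restrict_space) simp
  also have "\<dots> = (\<integral>\<^sup>+b. ?I (B.T b) * emeasure (B.K' (B.T b)) B \<partial>WB)" by (rule B.nn_integral_T_pos[symmetric]) measurable
  also have "\<dots> = (\<integral>\<^sup>+b. ?I (B.T b) * indicator B (B.X b) \<partial>WB)" by (rule B.disintegration[OF B, symmetric]) measurable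
  also have "\<dots> = (\<integral>\<^sup>+z. ennreal (h (tt z)) * (indicator A (A.X (snd z)) * indicator B (B.X (fst z))) \<partial>BA)"
    by (subst nn_integral_BA(1)) (simp_all add: nn_integral_multc[symmetric] mult.assoc)
  finally show ?thesis .
qed

text \<open>The sigma-algebra and the finiteness of the joint law are hypotheses, because in the
  application both follow from its being the law of \<open>(Vt, Q)\<close>.\<close>

lemma nn_integral_joint_law:
  fixes h :: "real \<Rightarrow> real"
  assumes h [measurable]: "h \<in> borel_measurable borel" and h0: "\<And>t. 0 \<le> h t"
    and s: "sets (joint_law f PDc \<alpha> \<beta> h) = sets (PinfM \<Otimes>\<^sub>M PinfM)" and fin: "finite_measure (joint_law f PDc \<alpha> \<beta> h)"
    and G [measurable]: "G \<in> borel_measurable (PinfM \<Otimes>\<^sub>M PinfM)"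
  shows "(\<integral>\<^sup>+z. G z \<partial>joint_law f PDc \<alpha> \<beta> h) =
    (\<integral>\<^sup>+z. ennreal (h (tt z)) * G (A.X (snd z), B.X (fst z)) \<partial>BA)"
proof -
  let ?J = "joint_law f PDc \<alpha> \<beta> h" and ?S = "PinfM \<Otimes>\<^sub>M PinfM"
  let ?E = "{A \<times> B |A B. A \<in> sets PinfM \<and> B \<in> sets PinfM}"
  let ?D = "distr (density BA (\<lambda>z. ennreal (h (tt z)))) ?S (\<lambda>z. (A.X (snd z), B.X (fst z)))"
  have x [measurable]: "(\<lambda>z. (A.X (snd z), B.X (fst z))) \<in> BA \<rightarrow>\<^sub>M ?S" by measurable
  have "?J = ?D"
  proof (rule measure_eqI_generator_eq[OF Int_stable_pair_measure_generator[of PinfM PinfM], where \<Omega>="Pinf \<times> Pinf" and A="\<lambda>_. Pinf \<times> Pinf"])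
    fix E assume "E \<in> ?E"
    then obtain A B where E: "E = A \<times> B" and AB [measurable]: "A \<in> sets PinfM" "B \<in> sets PinfM" by auto
    have "emeasure ?D E = (\<integral>\<^sup>+z. indicator E z \<partial>?D)" unfolding E by simp
    also have "\<dots> = (\<integral>\<^sup>+z. ennreal (h (tt z)) * (indicator A (A.X (snd z)) * indicator B (B.X (fst z))) \<partial>BA)"
      unfolding E by (simp add: nn_integral_distr nn_integral_density indicator_times)
    finally show "emeasure ?J E = emeasure ?D E" unfolding E emeasure_joint_law_Times[OF h h0 AB] by simp
  next
    show "?E \<subseteq> Pow (Pinf \<times> Pinf)" using sets.sets_into_space[of _ PinfM] by fastforce
    show "sets ?J = sigma_sets (Pinf \<times> Pinf) ?E" "sets ?D = sigma_sets (Pinf \<times> Pinf) ?E"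
      by (simp_all add: s sets_pair_measure)
    show "emeasure ?J (Pinf \<times> Pinf) \<noteq> \<infinity>" for i :: nat using finite_measure.emeasure_finite[OF fin] by simp
    show "range (\<lambda>_. Pinf \<times> Pinf) \<subseteq> ?E" using sets.top[of PinfM] by (auto intro!: exI[of _ Pinf])
  qed auto
  then show ?thesis by (simp add: nn_integral_distr nn_integral_density)
qed

end

section \<open>Measurability of the coagulation and the joint law of the marks\<close>

lemma seq_component:
  assumes "v \<in> N \<rightarrow>\<^sub>M seq_borel" shows "(\<lambda>x. v x k) \<in> borel_measurable N"
  using measurable_compose[OF assms measurable_component_singleton[of k UNIV "\<lambda>_. borel"]] by simp

lemma coag_measurable:
  assumes v: "v \<in> N \<rightarrow>\<^sub>M PinfM" and q: "q \<in> N \<rightarrow>\<^sub>M PinfM" and u: "u \<in> N \<rightarrow>\<^sub>M seq_borel" and t: "t \<in> N \<rightarrow>\<^sub>M seq_borel"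
  shows "(\<lambda>x. coag (v x) (q x) (u x) (t x)) \<in> N \<rightarrow>\<^sub>M PinfM" unfolding coag_def
proof (rule measurable_compose[OF measurable_ranked normseq_measurable])
  show "(\<lambda>x. blk (v x) (q x) (u x) (t x) l) \<in> borel_measurable N" for l
    by (intro measurable_blk measurable_compose[OF v PinfM_component] measurable_compose[OF q PinfM_component] seq_component u t)
  show "finite {l \<in> UNIV. e \<le> blk (v x) (q x) (u x) (t x) l}" if "x \<in> space N" "0 < e" for x e
    using blk_level[of "v x" "q x" e 1] measurable_space[OF v that(1)] measurable_space[OF q that(1)] that(2) by simp
qed simp

lemma cell_pred_measurable:
  assumes q: "q \<in> N \<rightarrow>\<^sub>M PinfM" and u: "u \<in> N \<rightarrow>\<^sub>M seq_borel" and t: "t \<in> N \<rightarrow>\<^sub>M seq_borel"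
  shows "Measurable.pred N (\<lambda>x. inj (u x) \<and> (\<forall>l. u x l \<in> {0<..1}) \<and> (\<forall>k. \<exists>l. t x k \<in> cell (q x) (u x) l))"
proof -
  note [measurable] = measurable_compose[OF q PinfM_component] seq_component[OF u] seq_component[OF t]
  have [measurable]: "(\<lambda>w. cut_l (q w) (u w) l) \<in> borel_measurable N" "(\<lambda>w. cut_r (q w) (u w) l) \<in> borel_measurable N" for l
    unfolding cut_l_def cut_r_def by measurable
  show ?thesis unfolding inj_def cell_def greaterThanLessThan_iff greaterThanAtMost_iff by measurable
qed

lemma AE_unif_seq_pos: "AE u in unif_seq. \<forall>l. u l \<in> {0<..1}"
proof (rule AE_unif_seq_component)
  have "AE x in unif. x \<in> {0..1}" by (rule AE_uniform_measureI) auto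
  moreover have "AE x in unif. x \<noteq> 0" by (rule AE_I[of _ _ "{0}"]) (auto simp: emeasure_unif_singleton)
  ultimately show "AE x in unif. x \<in> {0<..1}" by eventually_elim auto
qed

lemma AE_coag_regular:
  assumes N: "prob_space N" and sN: "sets N = sets (PinfM \<Otimes>\<^sub>M PinfM)"
  shows "AE z in N \<Otimes>\<^sub>M (unif_seq \<Otimes>\<^sub>M unif_seq). inj (snd (snd z)) \<and> (\<forall>l. snd (snd z) l \<in> {0<..1})
    \<and> (\<forall>k. \<exists>l. fst (snd z) k \<in> cell (snd (fst z)) (snd (snd z)) l)"
proof -
  interpret N: prob_space N by fact
  interpret U: prob_space unif_seq by (rule prob_space_unif_seq)
  interpret UU: pair_prob_space unif_seq unif_seq ..
  interpret NU: pair_sigma_finite N "unif_seq \<Otimes>\<^sub>M unif_seq" ..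
  have idu: "(\<lambda>x. x) \<in> unif_seq \<rightarrow>\<^sub>M seq_borel" by (rule measurable_ident_sets[OF sets_unif_seq])
  have q: "(\<lambda>z. snd (fst z)) \<in> N \<Otimes>\<^sub>M (unif_seq \<Otimes>\<^sub>M unif_seq) \<rightarrow>\<^sub>M PinfM"
    by (rule measurable_compose[OF measurable_fst]) (simp add: measurable_cong_sets[OF sN refl])
  show ?thesis
  proof (rule NU.AE_pair_measure)
    show "{z \<in> space (N \<Otimes>\<^sub>M (unif_seq \<Otimes>\<^sub>M unif_seq)). inj (snd (snd z)) \<and> (\<forall>l. snd (snd z) l \<in> {0<..1})
        \<and> (\<forall>k. \<exists>l. fst (snd z) k \<in> cell (snd (fst z)) (snd (snd z)) l)} \<in> sets (N \<Otimes>\<^sub>M (unif_seq \<Otimes>\<^sub>M unif_seq))"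
      unfolding pred_def[symmetric]
      by (intro cell_pred_measurable q measurable_compose[OF _ idu] measurable_compose[OF measurable_snd] measurable_fst measurable_snd)
    show "AE x in N. AE y in unif_seq \<Otimes>\<^sub>M unif_seq. inj (snd (snd (x, y))) \<and> (\<forall>l. snd (snd (x, y)) l \<in> {0<..1})
        \<and> (\<forall>k. \<exists>l. fst (snd (x, y)) k \<in> cell (snd (fst (x, y))) (snd (snd (x, y))) l)"
    proof (rule AE_I2)
      fix x assume "x \<in> space N"
      then have "x \<in> Pinf \<times> Pinf" unfolding sets_eq_imp_space_eq[OF sN] space_pair_measure space_PinfM .
      then have p: "snd x \<in> Pinf" by (simp add: mem_Times_iff)
      let ?P = "\<lambda>t u. inj u \<and> (\<forall>l. u l \<in> {0<..1}) \<and> (\<forall>k. \<exists>l. t k \<in> cell (snd x) u l)"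
      have m: "{y \<in> space (unif_seq \<Otimes>\<^sub>M unif_seq). ?P (fst y) (snd y)} \<in> sets (unif_seq \<Otimes>\<^sub>M unif_seq)"
        unfolding pred_def[symmetric]
        by (intro cell_pred_measurable measurable_const measurable_compose[OF measurable_fst idu] measurable_compose[OF measurable_snd idu]) (simp add: p)
      \<comment> \<open>The exceptional set for t depends on u through the cells, so u is chosen
        first; the order is then swapped, since the pair lists t first.\<close>
      have "AE u in unif_seq. AE t in unif_seq. ?P t u" using AE_unif_seq_inj AE_unif_seq_pos
      proof eventually_elim
        case (elim u)
        show ?case using AE_cells[OF p elim(1)] by eventually_elim (use elim in blast)
      qed
      then have "AE t in unif_seq. AE u in unif_seq. ?P t u" using UU.AE_commute[OF m] by blast
      then have "AE y in unif_seq \<Otimes>\<^sub>M unif_seq. ?P (fst y) (snd y)" by (intro UU.AE_pair_measure[OF m]) simp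
      then show "AE y in unif_seq \<Otimes>\<^sub>M unif_seq. inj (snd (snd (x, y))) \<and> (\<forall>l. snd (snd (x, y)) l \<in> {0<..1})
        \<and> (\<forall>k. \<exists>l. fst (snd (x, y)) k \<in> cell (snd (fst (x, y))) (snd (snd (x, y))) l)" by simp
    qed
  qed
qed

text \<open>One independent family over \<open>nat + nat\<close> splits into two independent
  sequences, one for each summand.\<close>

lemma unif_pair_law:
  fixes Ut U :: "nat \<Rightarrow> 'a \<Rightarrow> real"
  assumes M: "prob_space M"
    and Ut: "\<And>k. distr M borel (Ut k) = unif" and U: "\<And>l. distr M borel (U l) = unif"
    and ind: "prob_space.indep_vars M (\<lambda>_. borel) (\<lambda>i. case i of Inl k \<Rightarrow> Ut k | Inr l \<Rightarrow> U l) (UNIV :: (nat + nat) set)"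
  shows "distr M (seq_borel \<Otimes>\<^sub>M seq_borel) (\<lambda>w. (\<lambda>k. Ut k w, \<lambda>l. U l w)) = unif_seq \<Otimes>\<^sub>M unif_seq"
proof -
  interpret prob_space M by fact
  let ?X = "\<lambda>i. case i of Inl k \<Rightarrow> Ut k | Inr l \<Rightarrow> U l"
  have rvX: "random_variable borel (?X i)" for i using ind by (simp add: indep_vars_def)
  have rv: "random_variable borel (Ut k)" "random_variable borel (U k)" for k
    using rvX[of "Inl k"] rvX[of "Inr k"] by simp_all
  have "distr M (PiM UNIV (\<lambda>_. borel)) (\<lambda>w i. ?X i w) = PiM UNIV (\<lambda>i. distr M borel (?X i))"
    using indep_vars_iff_distr_eq_PiM'[where I=UNIV and M'="\<lambda>_. borel" and X="?X"] rvX ind by (simp add: restrict_def)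
  also have "(\<lambda>i. distr M borel (?X i)) = (\<lambda>_. unif)" by (rule ext) (simp add: Ut U split: sum.split)
  finally have law: "distr M (PiM UNIV (\<lambda>_. borel)) (\<lambda>w i. ?X i w) = PiM UNIV (\<lambda>_. unif)" .
  have meas: "(\<lambda>w i. ?X i w) \<in> M \<rightarrow>\<^sub>M PiM UNIV (\<lambda>_. borel)"
    by (rule measurable_PiM_single') (use rvX in \<open>auto simp: space_PiM\<close>)
  have proj: "distr M seq_borel (\<lambda>w k. ?X (g k) w) = unif_seq" if g: "inj g" for g :: "nat \<Rightarrow> nat + nat"
  proof -
    have "distr M seq_borel (\<lambda>w k. ?X (g k) w) = distr (distr M (PiM UNIV (\<lambda>_. borel)) (\<lambda>w i. ?X i w)) seq_borel (\<lambda>r k. r (g k))"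
      by (subst distr_distr[OF _ meas]) (auto simp: comp_def intro!: measurable_PiM_single')
    also have "\<dots> = distr (PiM UNIV (\<lambda>_. unif)) unif_seq (\<lambda>r. \<lambda>k\<in>UNIV. r (g k))"
      unfolding law by (rule distr_cong) (simp_all add: sets_unif_seq restrict_def)
    also have "\<dots> = unif_seq" by (rule distr_PiM_reindex) (use g prob_space_unif in auto)
    finally show ?thesis .
  qed
  have "distr M seq_borel (\<lambda>w k. Ut k w) = unif_seq" "distr M seq_borel (\<lambda>w k. U k w) = unif_seq"
    using proj[of Inl] proj[of Inr] by simp_all
  moreover have "indep_var seq_borel (\<lambda>w k. Ut k w) seq_borel (\<lambda>w k. U k w)"
  proof -
    have "indep_var (PiM (range Inl) (\<lambda>_. borel)) (\<lambda>w. restrict (\<lambda>i. ?X i w) (range Inl)) (PiM (range Inr) (\<lambda>_. borel)) (\<lambda>w. restrict (\<lambda>i. ?X i w) (range Inr))"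
      by (rule indep_var_restrict[OF ind]) auto
    moreover have "(\<lambda>r k. r (Inl k)) \<in> PiM (range Inl) (\<lambda>_ :: nat + nat. borel :: real measure) \<rightarrow>\<^sub>M seq_borel"
      by (rule measurable_PiM_single') (auto simp: space_PiM)
    moreover have "(\<lambda>r k. r (Inr k)) \<in> PiM (range Inr) (\<lambda>_ :: nat + nat. borel :: real measure) \<rightarrow>\<^sub>M seq_borel"
      by (rule measurable_PiM_single') (auto simp: space_PiM)
    ultimately show ?thesis
      using indep_var_compose[of _ _ _ _ "\<lambda>r k. r (Inl k)" seq_borel "\<lambda>r k. r (Inr k)" seq_borel] by (fastforce simp: comp_def)
  qed
  ultimately show ?thesis unfolding indep_var_distribution_eq by simp
qed

context coag_setup
begin

text \<open>\<open>coag_law\<close> with the marks integrated innermost, the form in which it meets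
  a pair \<open>(Vt, Q)\<close> that is independent of its marks.\<close>

theorem coag_law_pair:
  assumes [measurable]: "H \<in> borel_measurable borel" "S \<in> sets PinfM"
  shows "(\<integral>\<^sup>+z. H (A.T (snd z) * B.T (fst z) powr (1 / \<alpha>)) *
      (\<integral>\<^sup>+v. indicator S (coag (A.X (snd z)) (B.X (fst z)) (snd v) (fst v)) \<partial>(unif_seq \<Otimes>\<^sub>M unif_seq)) \<partial>BA)
    = (\<integral>\<^sup>+w. H (C.T w) * indicator S (C.X w) \<partial>WC)"
proof -
  interpret U: prob_space unif_seq by (rule prob_space_unif_seq)
  interpret UU: pair_prob_space unif_seq unif_seq ..
  interpret BA: pair_prob_space WB WA ..
  interpret BU: pair_prob_space WB unif_seq ..
  interpret AU: pair_prob_space WA unif_seq ..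
  interpret UA: pair_sigma_finite unif_seq WA ..
  have idu [measurable]: "(\<lambda>x. x) \<in> unif_seq \<rightarrow>\<^sub>M seq_borel" by (rule measurable_ident_sets[OF sets_unif_seq])
  have cm [measurable]: "(\<lambda>x. coag (A.X (a x)) (B.X (b x)) (u x) (t x)) \<in> N \<rightarrow>\<^sub>M PinfM"
    if "a \<in> N \<rightarrow>\<^sub>M WA" "b \<in> N \<rightarrow>\<^sub>M WB" "u \<in> N \<rightarrow>\<^sub>M unif_seq" "t \<in> N \<rightarrow>\<^sub>M unif_seq" for a b u t and N :: "'x measure"
    by (intro coag_measurable measurable_compose[OF that(1) A.X_meas] measurable_compose[OF that(2) B.X_meas] measurable_compose[OF that(3) idu] measurable_compose[OF that(4) idu])
  let ?F = "\<lambda>b u a t. H (A.T a * B.T b powr (1 / \<alpha>)) * indicator S (coag (A.X a) (B.X b) u t)"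
  have "(\<integral>\<^sup>+w. H (C.T w) * indicator S (C.X w) \<partial>WC) = (\<integral>\<^sup>+z. ?F (fst (fst z)) (snd (fst z)) (fst (snd z)) (snd (snd z)) \<partial>P)"
    using coag_law[OF assms] by (simp add: tot_def)
  also have "\<dots> = (\<integral>\<^sup>+x. \<integral>\<^sup>+y. ?F (fst x) (snd x) (fst y) (snd y) \<partial>(WA \<Otimes>\<^sub>M unif_seq) \<partial>(WB \<Otimes>\<^sub>M unif_seq))"
    by (subst AU.nn_integral_fst[symmetric]) simp_all
  also have "\<dots> = (\<integral>\<^sup>+b. \<integral>\<^sup>+u. \<integral>\<^sup>+y. ?F b u (fst y) (snd y) \<partial>(WA \<Otimes>\<^sub>M unif_seq) \<partial>unif_seq \<partial>WB)"
    by (subst U.nn_integral_fst[symmetric]) simp_all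
  also have "\<dots> = (\<integral>\<^sup>+b. \<integral>\<^sup>+u. \<integral>\<^sup>+a. \<integral>\<^sup>+t. ?F b u a t \<partial>unif_seq \<partial>WA \<partial>unif_seq \<partial>WB)"
    by (intro nn_integral_cong) (subst U.nn_integral_fst[symmetric], simp_all)
  also have "\<dots> = (\<integral>\<^sup>+b. \<integral>\<^sup>+a. \<integral>\<^sup>+u. \<integral>\<^sup>+t. ?F b u a t \<partial>unif_seq \<partial>unif_seq \<partial>WA \<partial>WB)"
    by (intro nn_integral_cong AU.Fubini') simp
  also have "\<dots> = (\<integral>\<^sup>+b. \<integral>\<^sup>+a. H (A.T a * B.T b powr (1 / \<alpha>)) * (\<integral>\<^sup>+v. indicator S (coag (A.X a) (B.X b) (snd v) (fst v)) \<partial>(unif_seq \<Otimes>\<^sub>M unif_seq)) \<partial>WA \<partial>WB)"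
  proof (intro nn_integral_cong)
    fix b a assume ab: "b \<in> space WB" "a \<in> space WA"
    have j [measurable]: "(\<lambda>v. coag (A.X a) (B.X b) (snd v) (fst v)) \<in> unif_seq \<Otimes>\<^sub>M unif_seq \<rightarrow>\<^sub>M PinfM"
      by (rule cm) (use ab in simp_all)
    have "H (A.T a * B.T b powr (1 / \<alpha>)) * (\<integral>\<^sup>+v. indicator S (coag (A.X a) (B.X b) (snd v) (fst v)) \<partial>(unif_seq \<Otimes>\<^sub>M unif_seq))
      = (\<integral>\<^sup>+v. ?F b (snd v) a (fst v) \<partial>(unif_seq \<Otimes>\<^sub>M unif_seq))" by (rule nn_integral_cmult[symmetric]) simp
    also have "\<dots> = (\<integral>\<^sup>+u. \<integral>\<^sup>+t. ?F b u a t \<partial>unif_seq \<partial>unif_seq)" by (subst UU.nn_integral_snd[symmetric]) simp_all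
    finally show "(\<integral>\<^sup>+u. \<integral>\<^sup>+t. ?F b u a t \<partial>unif_seq \<partial>unif_seq) = H (A.T a * B.T b powr (1 / \<alpha>)) * (\<integral>\<^sup>+v. indicator S (coag (A.X a) (B.X b) (snd v) (fst v)) \<partial>(unif_seq \<Otimes>\<^sub>M unif_seq))" ..
  qed
  also have "\<dots> = (\<integral>\<^sup>+z. H (A.T (snd z) * B.T (fst z) powr (1 / \<alpha>)) *
      (\<integral>\<^sup>+v. indicator S (coag (A.X (snd z)) (B.X (fst z)) (snd v) (fst v)) \<partial>(unif_seq \<Otimes>\<^sub>M unif_seq)) \<partial>BA)"
    by (subst A.nn_integral_fst[symmetric]) simp_all
  finally show ?thesis by simp
qed

end

section \<open>The tilting density and its marginals\<close>

context pk_family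
begin

lemma index_bounds: "0 < \<beta>" "\<beta> < \<alpha>" "\<alpha> < 1" "0 < \<alpha>" "0 \<le> \<beta>" "\<beta> \<le> \<alpha>" "0 \<le> \<beta> / \<alpha>" using C.\<gamma> A.\<gamma> ba by auto

context
  fixes lam :: real and j :: nat
  assumes lam: "0 < lam"
begin

abbreviation "\<theta> \<equiv> real j * \<beta>"

text \<open>Normalizing constant of \<open>tilt\<close> under the \<beta>-stable total: the
  Mittag-Leffler value times the moment of order -\<theta>, by
  \<open>normalizing_constants\<close>.\<close>

definition mgf :: real where "mgf = C.expmom j \<beta> lam"

definition tilt :: "real \<Rightarrow> real" where
  "tilt t = exp (- lam * t powr (- \<beta>)) * t powr (- \<theta>) / mgf"

text \<open>\<open>tiltA\<close> and \<open>tiltB\<close> are what remains of \<open>tilt\<close> at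
  the product s * y powr (1 / \<alpha>) after the other total has been integrated out.\<close>

definition tiltA :: "real \<Rightarrow> real" where
  "tiltA s = s powr (- \<theta>) * B.expmom j (\<beta> / \<alpha>) (lam * s powr (- \<beta>)) / mgf"

definition tiltB :: "real \<Rightarrow> real" where
  "tiltB y = y powr (- (\<theta> / \<alpha>)) * A.expmom j \<beta> (lam * y powr (- \<beta> / \<alpha>)) / mgf"

lemma mgf_pos: "0 < mgf" unfolding mgf_def by (rule C.expmom_pos) (use index_bounds lam in auto)

lemma tilt_measurable [measurable]: "tilt \<in> borel_measurable borel" "tiltA \<in> borel_measurable borel" "tiltB \<in> borel_measurable borel"
  unfolding tilt_def[abs_def] tiltA_def[abs_def] tiltB_def[abs_def] by measurable

lemma expmomA_pos: "0 < A.expmom j \<beta> (lam * y powr (- \<beta> / \<alpha>))" by (rule A.expmom_pos) (use index_bounds lam in auto)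

lemma expmomB_pos: "0 < B.expmom j (\<beta> / \<alpha>) (lam * s powr (- \<beta>))" by (rule B.expmom_pos) (use index_bounds lam in auto)

lemma tilt_nonneg: "0 \<le> tilt t" "0 \<le> tiltA t" "0 \<le> tiltB t"
  unfolding tilt_def tiltA_def tiltB_def using mgf_pos expmomA_pos[of t] expmomB_pos[of t] by (auto intro!: divide_nonneg_pos mult_nonneg_nonneg)

text \<open>Because (y powr (1 / \<alpha>)) powr (-\<beta>) = y powr (-\<beta> / \<alpha>), the
  exponent is a product of powers of s and y. With one total fixed, the weight is of the type of
  \<open>expmom\<close> in the other.\<close>

lemma tilt_mult:
  assumes "0 < s" "0 < y"
  shows "tilt (s * y powr (1 / \<alpha>)) = y powr (- (\<theta> / \<alpha>)) / mgf * (exp (- ((lam * y powr (- \<beta> / \<alpha>)) * s powr (- \<beta>))) * s powr (- \<theta>))"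
    and "tilt (s * y powr (1 / \<alpha>)) = s powr (- \<theta>) / mgf * (exp (- ((lam * s powr (- \<beta>)) * y powr (- (\<beta> / \<alpha>)))) * y powr (- (real j * (\<beta> / \<alpha>))))"
  using assms by (simp_all add: tilt_def powr_mult powr_powr mult_ac)

lemma nn_integral_tilt_A:
  assumes y: "0 < y"
  shows "(\<integral>\<^sup>+a. ennreal (tilt (A.T a * y powr (1 / \<alpha>))) \<partial>WA) = ennreal (tiltB y)"
proof -
  let ?x = "lam * y powr (- \<beta> / \<alpha>)" and ?c = "y powr (- (\<theta> / \<alpha>)) / mgf"
  have "(\<integral>\<^sup>+a. ennreal (tilt (A.T a * y powr (1 / \<alpha>))) \<partial>WA) = (\<integral>\<^sup>+a. ennreal ?c * ennreal (exp (- (?x * A.T a powr (- \<beta>))) * A.T a powr (- \<theta>)) \<partial>WA)"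
    by (rule nn_integral_cong_eventually[OF A.AE_T])
       (use y mgf_pos in \<open>simp add: tilt_mult(1) ennreal_mult[symmetric]\<close>)
  also have "\<dots> = ennreal ?c * ennreal (A.expmom j \<beta> ?x)"
    using lam index_bounds by (subst nn_integral_cmult) (simp_all add: A.nn_integral_expmom)
  also have "\<dots> = ennreal (tiltB y)" using mgf_pos expmomA_pos[of y] by (simp add: tiltB_def ennreal_mult[symmetric])
  finally show ?thesis .
qed

lemma nn_integral_tilt_B:
  assumes s: "0 < s"
  shows "(\<integral>\<^sup>+b. ennreal (tilt (s * B.T b powr (1 / \<alpha>))) \<partial>WB) = ennreal (tiltA s)"
proof -
  let ?x = "lam * s powr (- \<beta>)" and ?c = "s powr (- \<theta>) / mgf"
  have "(\<integral>\<^sup>+b. ennreal (tilt (s * B.T b powr (1 / \<alpha>))) \<partial>WB) = (\<integral>\<^sup>+b. ennreal ?c * ennreal (exp (- (?x * B.T b powr (- (\<beta> / \<alpha>)))) * B.T b powr (- (real j * (\<beta> / \<alpha>)))) \<partial>WB)"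
    by (rule nn_integral_cong_eventually[OF B.AE_T])
       (use s mgf_pos in \<open>simp add: tilt_mult(2) ennreal_mult[symmetric]\<close>)
  also have "\<dots> = ennreal ?c * (\<integral>\<^sup>+b. ennreal (exp (- (?x * B.T b powr (- (\<beta> / \<alpha>)))) * B.T b powr (- (real j * (\<beta> / \<alpha>)))) \<partial>WB)"
    by (rule nn_integral_cmult) simp
  also have "(\<integral>\<^sup>+b. ennreal (exp (- (?x * B.T b powr (- (\<beta> / \<alpha>)))) * B.T b powr (- (real j * (\<beta> / \<alpha>)))) \<partial>WB) = ennreal (B.expmom j (\<beta> / \<alpha>) ?x)"
    by (rule B.nn_integral_expmom) (use index_bounds lam in simp_all)
  also have "ennreal ?c * ennreal (B.expmom j (\<beta> / \<alpha>) ?x) = ennreal (tiltA s)"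
    using mgf_pos expmomB_pos[of s] by (simp add: tiltA_def ennreal_mult[symmetric])
  finally show ?thesis .
qed

lemma tilted_law_A:
  assumes [measurable]: "g \<in> borel_measurable PinfM"
  shows "(\<integral>\<^sup>+z. ennreal (tilt (tt z)) * g (A.X (snd z)) \<partial>BA) = (\<integral>\<^sup>+a. ennreal (tiltA (A.T a)) * g (A.X a) \<partial>WA)"
proof -
  have [measurable]: "(\<lambda>a. g (A.X a)) \<in> borel_measurable WA" by (rule measurable_compose[OF A.X_meas]) simp
  have "(\<integral>\<^sup>+z. ennreal (tilt (tt z)) * g (A.X (snd z)) \<partial>BA)
    = (\<integral>\<^sup>+a. \<integral>\<^sup>+b. ennreal (tilt (A.T a * B.T b powr (1 / \<alpha>))) * g (A.X a) \<partial>WB \<partial>WA)"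
    by (subst nn_integral_BA(2)) simp_all
  also have "\<dots> = (\<integral>\<^sup>+a. ennreal (tiltA (A.T a)) * g (A.X a) \<partial>WA)"
    by (rule nn_integral_cong_eventually[OF A.AE_T]) (simp add: nn_integral_multc nn_integral_tilt_B)
  finally show ?thesis .
qed

lemma tilted_law_B:
  assumes [measurable]: "g \<in> borel_measurable WB"
  shows "(\<integral>\<^sup>+z. ennreal (tilt (tt z)) * g (fst z) \<partial>BA) = (\<integral>\<^sup>+b. ennreal (tiltB (B.T b)) * g b \<partial>WB)"
proof -
  have "(\<integral>\<^sup>+z. ennreal (tilt (tt z)) * g (fst z) \<partial>BA)
    = (\<integral>\<^sup>+b. \<integral>\<^sup>+a. ennreal (tilt (A.T a * B.T b powr (1 / \<alpha>))) * g b \<partial>WA \<partial>WB)" by (subst nn_integral_BA(1)) simp_all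
  also have "\<dots> = (\<integral>\<^sup>+b. ennreal (tiltB (B.T b)) * g b \<partial>WB)"
    by (rule nn_integral_cong_eventually[OF B.AE_T]) (simp add: nn_integral_multc nn_integral_tilt_A)
  finally show ?thesis .
qed

lemma index_\<theta>: "- \<alpha> < \<theta>" "- \<beta> < \<theta>" "- (\<beta> / \<alpha>) < \<theta> / \<alpha>"
proof -
  have "0 \<le> \<theta>" "0 \<le> \<theta> / \<alpha>" "0 < \<beta> / \<alpha>" using index_bounds by simp_all
  then show "- \<alpha> < \<theta>" "- \<beta> < \<theta>" "- (\<beta> / \<alpha>) < \<theta> / \<alpha>" using index_bounds by linarith+
qed

text \<open>It reflects that the product in \<open>tot\<close> has the law of the \<beta>-stable
  total; the proof only cancels a Gamma factor.\<close>

lemma mom_factor: "C.mom \<theta> = A.mom \<theta> * B.mom (\<theta> / \<alpha>)"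
proof -
  have "0 < Gamma (\<theta> / \<alpha> + 1)" using index_\<theta>(1) index_bounds by (intro Gamma_real_pos) (simp add: field_simps)
  then show ?thesis using index_bounds by (simp add: A.mom_def B.mom_def C.mom_def)
qed

lemma normalizing_constants:
  shows "mittag_leffler (real j + 1) \<beta> (\<theta> + 1) (- lam) = mgf / C.mom \<theta>"
    and "mittag_leffler (real j + 1) (\<beta> / \<alpha>) (\<theta> / \<alpha> + 1) (- lam * s powr (- \<beta>)) = B.expmom j (\<beta> / \<alpha>) (lam * s powr (- \<beta>)) / B.mom (\<theta> / \<alpha>)"
    and "(\<integral>t. exp (- lam * y powr (- \<beta> / \<alpha>) * t powr (- \<beta>)) \<partial>law_of (f_tilt (f \<alpha>) \<theta>)) = A.expmom j \<beta> (lam * y powr (- \<beta> / \<alpha>)) / A.mom \<theta>"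
proof -
  show "mittag_leffler (real j + 1) \<beta> (\<theta> + 1) (- lam) = mgf / C.mom \<theta>"
    using C.mittag_leffler_expmom[of lam j] lam by (simp add: mgf_def)
  show "mittag_leffler (real j + 1) (\<beta> / \<alpha>) (\<theta> / \<alpha> + 1) (- lam * s powr (- \<beta>)) = B.expmom j (\<beta> / \<alpha>) (lam * s powr (- \<beta>)) / B.mom (\<theta> / \<alpha>)"
    using B.mittag_leffler_expmom[of "lam * s powr (- \<beta>)" j] lam by simp
  show "(\<integral>t. exp (- lam * y powr (- \<beta> / \<alpha>) * t powr (- \<beta>)) \<partial>law_of (f_tilt (f \<alpha>) \<theta>)) = A.expmom j \<beta> (lam * y powr (- \<beta> / \<alpha>)) / A.mom \<theta>"
    by (subst A.integral_f_tilt[OF index_\<theta>(1)]) (simp_all add: A.expmom_def)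
qed

context
  fixes M :: "'a measure" and Vt Q :: "'a \<Rightarrow> nat \<Rightarrow> real" and EB :: real and EA :: "real \<Rightarrow> real"
  assumes M: "prob_space M"
    and VQ_meas: "(\<lambda>w. (Vt w, Q w)) \<in> M \<rightarrow>\<^sub>M PinfM \<Otimes>\<^sub>M PinfM"
    and VQ_law: "distr M (PinfM \<Otimes>\<^sub>M PinfM) (\<lambda>w. (Vt w, Q w)) = joint_law f PDc \<alpha> \<beta> tilt"
    and EB: "EB = mgf / C.mom \<theta>" and EA: "\<And>y. EA y = A.expmom j \<beta> (lam * y powr (- \<beta> / \<alpha>)) / A.mom \<theta>"
begin

lemma Vt_meas: "Vt \<in> M \<rightarrow>\<^sub>M PinfM" and Q_meas: "Q \<in> M \<rightarrow>\<^sub>M PinfM"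
  using measurable_compose[OF VQ_meas measurable_fst] measurable_compose[OF VQ_meas measurable_snd] by simp_all

lemma nn_integral_VQ:
  assumes [measurable]: "G \<in> borel_measurable (PinfM \<Otimes>\<^sub>M PinfM)"
  shows "(\<integral>\<^sup>+w. G (Vt w, Q w) \<partial>M) = (\<integral>\<^sup>+z. ennreal (tilt (tt z)) * G (A.X (snd z), B.X (fst z)) \<partial>BA)"
proof -
  have s: "sets (joint_law f PDc \<alpha> \<beta> tilt) = sets (PinfM \<Otimes>\<^sub>M PinfM)" unfolding VQ_law[symmetric] by simp
  interpret M: prob_space M by fact
  have fin: "finite_measure (joint_law f PDc \<alpha> \<beta> tilt)"
    unfolding VQ_law[symmetric] by (intro prob_space.finite_measure M.prob_space_distr VQ_meas)
  have "(\<integral>\<^sup>+w. G (Vt w, Q w) \<partial>M) = (\<integral>\<^sup>+z. G z \<partial>distr M (PinfM \<Otimes>\<^sub>M PinfM) (\<lambda>w. (Vt w, Q w)))"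
    by (rule nn_integral_distr[OF VQ_meas, symmetric]) simp
  then show ?thesis unfolding VQ_law using nn_integral_joint_law[OF _ tilt_nonneg(1) s fin] by simp
qed

text \<open>Brings the mixing density into the shape weight times density of the total, as required
  by \<open>emeasure_mixture\<close>; the moments cancel by \<open>mom_factor\<close>.\<close>

lemma density_Q: "EA y / EB * f_tilt (f (\<beta> / \<alpha>)) (\<theta> / \<alpha>) y = tiltB y * f (\<beta> / \<alpha>) y"
  unfolding EA EB mom_factor f_tilt_def B.neg_moment_f[OF index_\<theta>(3)] tiltB_def
  using A.mom_pos[OF index_\<theta>(1)] B.mom_pos[OF index_\<theta>(3)] mgf_pos by (simp add: field_simps)

lemma density_Vt: "mittag_leffler (real j + 1) (\<beta> / \<alpha>) (\<theta> / \<alpha> + 1) (- lam * s powr (- \<beta>)) / EB * f_tilt (f \<alpha>) \<theta> s = tiltA s * f \<alpha> s"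
  unfolding normalizing_constants(2) EB mom_factor f_tilt_def A.neg_moment_f[OF index_\<theta>(1)] tiltA_def
  using A.mom_pos[OF index_\<theta>(1)] B.mom_pos[OF index_\<theta>(3)] mgf_pos by (simp add: field_simps)

lemma emeasure_Vt: "S \<in> sets PinfM \<Longrightarrow> emeasure (distr M PinfM Vt) S = (\<integral>\<^sup>+a. ennreal (tiltA (A.T a)) * indicator S (A.X a) \<partial>WA)"
proof -
  assume S [measurable]: "S \<in> sets PinfM"
  have "emeasure (distr M PinfM Vt) S = (\<integral>\<^sup>+w. indicator S (Vt w) \<partial>M)"
    using nn_integral_distr[OF Vt_meas, of "indicator S"] by simp
  also have "\<dots> = (\<integral>\<^sup>+z. ennreal (tilt (tt z)) * indicator S (A.X (snd z)) \<partial>BA)"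
    using nn_integral_VQ[of "\<lambda>z. indicator S (fst z)"] by simp
  also have "\<dots> = (\<integral>\<^sup>+a. ennreal (tiltA (A.T a)) * indicator S (A.X a) \<partial>WA)" by (rule tilted_law_A) simp
  finally show ?thesis .
qed

lemma Vt_law:
  "distr M PinfM Vt = mixture (PDc \<alpha>) (\<lambda>s. mittag_leffler (real j + 1) (\<beta> / \<alpha>) (\<theta> / \<alpha> + 1) (- lam * s powr (- \<beta>)) / EB * f_tilt (f \<alpha>) \<theta> s)"
proof (rule measure_eqI)
  fix S assume "S \<in> sets (distr M PinfM Vt)"
  then have S: "S \<in> sets PinfM" by simp
  show "emeasure (distr M PinfM Vt) S = emeasure (mixture (PDc \<alpha>) (\<lambda>s. mittag_leffler (real j + 1) (\<beta> / \<alpha>) (\<theta> / \<alpha> + 1) (- lam * s powr (- \<beta>)) / EB * f_tilt (f \<alpha>) \<theta> s)) S"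
    unfolding emeasure_Vt[OF S] by (rule A.emeasure_mixture[OF _ _ density_Vt S, symmetric]) (simp_all add: tilt_nonneg)
qed simp

lemma nn_integral_Q:
  assumes [measurable]: "g \<in> borel_measurable PinfM"
  shows "(\<integral>\<^sup>+w. g (Q w) \<partial>M) = (\<integral>\<^sup>+b. ennreal (tiltB (B.T b)) * g (B.X b) \<partial>WB)"
proof -
  have [measurable]: "(\<lambda>b. g (B.X b)) \<in> borel_measurable WB" by (rule measurable_compose[OF B.X_meas]) simp
  have "(\<integral>\<^sup>+w. g (Q w) \<partial>M) = (\<integral>\<^sup>+z. ennreal (tilt (tt z)) * g (B.X (fst z)) \<partial>BA)"
    using nn_integral_VQ[of "\<lambda>z. g (snd z)"] by simp
  also have "\<dots> = (\<integral>\<^sup>+b. ennreal (tiltB (B.T b)) * g (B.X b) \<partial>WB)" by (rule tilted_law_B) simp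
  finally show ?thesis .
qed

lemma Q_law: "distr M PinfM Q = mixture (PDc (\<beta> / \<alpha>)) (\<lambda>y. EA y / EB * f_tilt (f (\<beta> / \<alpha>)) (\<theta> / \<alpha>) y)"
proof (rule measure_eqI)
  fix S assume "S \<in> sets (distr M PinfM Q)"
  then have S [measurable]: "S \<in> sets PinfM" by simp
  have "emeasure (distr M PinfM Q) S = (\<integral>\<^sup>+b. ennreal (tiltB (B.T b)) * indicator S (B.X b) \<partial>WB)"
    using nn_integral_distr[OF Q_meas, of "indicator S"] nn_integral_Q[of "indicator S"] by simp
  also have "\<dots> = emeasure (mixture (PDc (\<beta> / \<alpha>)) (\<lambda>y. EA y / EB * f_tilt (f (\<beta> / \<alpha>)) (\<theta> / \<alpha>) y)) S"
    by (rule B.emeasure_mixture[OF _ _ density_Q S, symmetric]) (simp_all add: tilt_nonneg)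
  finally show "emeasure (distr M PinfM Q) S = emeasure (mixture (PDc (\<beta> / \<alpha>)) (\<lambda>y. EA y / EB * f_tilt (f (\<beta> / \<alpha>)) (\<theta> / \<alpha>) y)) S" .
qed simp

abbreviation "Lw w \<equiv> inverse_local_time (\<beta> / \<alpha>) (Q w)"

lemma L_meas: "(\<lambda>w. Lw w) \<in> borel_measurable M"
  by (rule measurable_compose[OF Q_meas inverse_local_time_measurable[OF B.\<gamma>(1)]])

text \<open>By \<open>B.AE_inverse_local_time\<close> the inverse local time of \<open>Q\<close>
  stands for the total of the process \<open>B\<close>, whose density is multiplied by
  \<open>tiltB\<close> under the change of measure.\<close>

lemma inverse_local_time_law:
  "distributed M lborel (\<lambda>w. inverse_local_time (\<beta> / \<alpha>) (Q w))
    (\<lambda>y. ennreal (EA y * f_tilt (f (\<beta> / \<alpha>)) (\<theta> / \<alpha>) y / EB) * indicator {0<..} y)"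
proof -
  have dens: "EA y * f_tilt (f (\<beta> / \<alpha>)) (\<theta> / \<alpha>) y / EB = tiltB y * f (\<beta> / \<alpha>) y" for y using density_Q[of y] by simp
  note [measurable] = inverse_local_time_measurable[OF B.\<gamma>(1)]
  have "distr M lborel (\<lambda>w. Lw w) = density lborel (\<lambda>y. ennreal (tiltB y * f (\<beta> / \<alpha>) y) * indicator {0<..} y)"
  proof (rule measure_eqI)
    fix S assume "S \<in> sets (distr M lborel (\<lambda>w. Lw w))"
    then have S [measurable]: "S \<in> sets borel" by simp
    have "emeasure (distr M lborel (\<lambda>w. Lw w)) S = (\<integral>\<^sup>+w. indicator S (Lw w) \<partial>M)"
      using nn_integral_distr[of "\<lambda>w. Lw w" M lborel "indicator S"] L_meas by simp
    also have "\<dots> = (\<integral>\<^sup>+b. ennreal (tiltB (B.T b)) * indicator S (inverse_local_time (\<beta> / \<alpha>) (B.X b)) \<partial>WB)"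
      by (rule nn_integral_Q[of "\<lambda>p. indicator S (inverse_local_time (\<beta> / \<alpha>) p)"]) simp
    also have "\<dots> = (\<integral>\<^sup>+b. ennreal (tiltB (B.T b)) * indicator S (B.T b) \<partial>WB)"
      by (rule nn_integral_cong_eventually[OF B.AE_inverse_local_time]) simp
    also have "\<dots> = (\<integral>\<^sup>+y\<in>{0<..}. ennreal (f (\<beta> / \<alpha>) y) * (ennreal (tiltB y) * indicator S y) \<partial>lborel)"
      by (rule B.nn_integral_T_pos) simp
    also have "\<dots> = (\<integral>\<^sup>+y. ennreal (tiltB y * f (\<beta> / \<alpha>) y) * indicator {0<..} y * indicator S y \<partial>lborel)"
      by (intro nn_integral_cong) (simp add: ennreal_mult tilt_nonneg B.f_nonneg mult_ac)
    also have "\<dots> = emeasure (density lborel (\<lambda>y. ennreal (tiltB y * f (\<beta> / \<alpha>) y) * indicator {0<..} y)) S"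
      by (rule emeasure_density[symmetric]) simp_all
    finally show "emeasure (distr M lborel (\<lambda>w. Lw w)) S = \<dots>" .
  qed simp
  then show ?thesis unfolding distributed_def dens using L_meas by simp
qed

text \<open>Quotient of the joint weight by its marginal \<open>tiltB\<close>: the conditional
  weight of the \<alpha>-stable total when the other total is y.\<close>

definition kernel_density :: "real \<Rightarrow> real \<Rightarrow> real" where
  "kernel_density y s = exp (- ((lam * y powr (- \<beta> / \<alpha>)) * s powr (- \<beta>))) * s powr (- \<theta>) / A.expmom j \<beta> (lam * y powr (- \<beta> / \<alpha>))"

lemma kernel_density_measurable [measurable]:
  "(\<lambda>x. kernel_density (u x) (v x)) \<in> borel_measurable N" if "u \<in> borel_measurable N" "v \<in> borel_measurable N" for u v and N :: "'x measure"
  using that unfolding kernel_density_def by measurable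

lemma kernel_density_nonneg: "0 \<le> kernel_density y s"
  unfolding kernel_density_def using expmomA_pos[of y] by (intro divide_nonneg_pos) auto

definition cond_kernel :: "real \<Rightarrow> (nat \<Rightarrow> real) measure" where
  "cond_kernel y = mixture (PDc \<alpha>) (\<lambda>s. kernel_density y s * f \<alpha> s)"

lemma cond_kernel_eq:
  "cond_kernel y = mixture (PDc \<alpha>) (\<lambda>s. exp (- lam * s powr (- \<beta>) * y powr (- \<beta> / \<alpha>)) / EA y * f_tilt (f \<alpha>) \<theta> s)"
proof -
  have "kernel_density y s * f \<alpha> s = exp (- lam * s powr (- \<beta>) * y powr (- \<beta> / \<alpha>)) / EA y * f_tilt (f \<alpha>) \<theta> s" for s
    unfolding EA f_tilt_def A.neg_moment_f[OF index_\<theta>(1)] kernel_density_def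
    using A.mom_pos[OF index_\<theta>(1)] expmomA_pos[of y] by (simp add: mult_ac)
  then show ?thesis by (simp add: cond_kernel_def)
qed

lemma emeasure_kernel:
  assumes S: "S \<in> sets PinfM"
  shows "emeasure (cond_kernel y) S = (\<integral>\<^sup>+a. ennreal (kernel_density y (A.T a)) * indicator S (A.X a) \<partial>WA)"
  unfolding cond_kernel_def by (rule A.emeasure_mixture[OF _ _ _ S]) (simp_all add: kernel_density_nonneg)

lemma sets_cond_kernel [simp]: "sets (cond_kernel y) = sets PinfM" by (simp add: cond_kernel_def)

lemma emeasure_kernel_measurable: "S \<in> sets PinfM \<Longrightarrow> (\<lambda>y. emeasure (cond_kernel y) S) \<in> borel_measurable borel"
proof -
  assume [measurable]: "S \<in> sets PinfM"
  have "(\<lambda>y. \<integral>\<^sup>+a. ennreal (kernel_density y (A.T a)) * indicator S (A.X a) \<partial>WA) \<in> borel_measurable borel" by measurable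
  then show ?thesis by (simp add: emeasure_kernel)
qed

lemma prob_space_kernel: "prob_space (cond_kernel y)"
proof
  have "space (cond_kernel y) = Pinf" using sets_eq_imp_space_eq[OF sets_cond_kernel] by simp
  then have "emeasure (cond_kernel y) (space (cond_kernel y)) = (\<integral>\<^sup>+a. ennreal (kernel_density y (A.T a)) \<partial>WA)"
    using emeasure_kernel[OF sets.top[of PinfM], of y] by simp
  also have "\<dots> = (\<integral>\<^sup>+a. ennreal (1 / A.expmom j \<beta> (lam * y powr (- \<beta> / \<alpha>))) * ennreal (exp (- ((lam * y powr (- \<beta> / \<alpha>)) * A.T a powr (- \<beta>))) * A.T a powr (- \<theta>)) \<partial>WA)"
    using expmomA_pos[of y] by (intro nn_integral_cong) (simp add: kernel_density_def ennreal_mult[symmetric])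
  also have "\<dots> = ennreal (1 / A.expmom j \<beta> (lam * y powr (- \<beta> / \<alpha>))) * ennreal (A.expmom j \<beta> (lam * y powr (- \<beta> / \<alpha>)))"
    using lam index_bounds by (subst nn_integral_cmult) (simp_all add: A.nn_integral_expmom)
  also have "\<dots> = 1" using expmomA_pos[of y] by (simp add: ennreal_mult[symmetric])
  finally show "emeasure (cond_kernel y) (space (cond_kernel y)) = 1" .
qed

lemma Vt_cond_law: "regular_cond_law M PinfM Vt (\<lambda>w. inverse_local_time (\<beta> / \<alpha>) (Q w)) cond_kernel"
  unfolding regular_cond_law_def
proof (intro conjI ballI impI)
  show "cond_kernel \<in> restrict_space borel {0<..} \<rightarrow>\<^sub>M prob_algebra PinfM"
  proof (rule measurable_restrict_space1, rule measurable_prob_algebraI[OF prob_space_kernel])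
    show "cond_kernel \<in> borel \<rightarrow>\<^sub>M subprob_algebra PinfM"
      by (rule measurable_subprob_algebra) (simp_all add: prob_space_imp_subprob_space prob_space_kernel emeasure_kernel_measurable)
  qed
  fix S and Y :: "real set" assume S [measurable]: "S \<in> sets PinfM" and Y [measurable]: "Y \<in> sets borel" and Y0: "Y \<subseteq> {0<..}"
  note [measurable] = inverse_local_time_measurable[OF B.\<gamma>(1)] emeasure_kernel_measurable[OF S] Vt_meas Q_meas
  let ?I = "inverse_local_time (\<beta> / \<alpha>)"
  have "emeasure M {w\<in>space M. ?I (Q w) \<in> Y \<and> Vt w \<in> S} = (\<integral>\<^sup>+w. indicator {w\<in>space M. ?I (Q w) \<in> Y \<and> Vt w \<in> S} w \<partial>M)"
    by (rule nn_integral_indicator[symmetric]) measurable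
  also have "\<dots> = (\<integral>\<^sup>+w. indicator Y (?I (Q w)) * indicator S (Vt w) \<partial>M)"
    by (intro nn_integral_cong) (simp split: split_indicator)
  also have "\<dots> = (\<integral>\<^sup>+z. ennreal (tilt (tt z)) * (indicator Y (?I (B.X (fst z))) * indicator S (A.X (snd z))) \<partial>BA)"
    using nn_integral_VQ[of "\<lambda>z. indicator Y (?I (snd z)) * indicator S (fst z)"] by simp
  also have "\<dots> = (\<integral>\<^sup>+b. \<integral>\<^sup>+a. ennreal (tilt (A.T a * B.T b powr (1 / \<alpha>))) * (indicator Y (?I (B.X b)) * indicator S (A.X a)) \<partial>WA \<partial>WB)"
    by (subst nn_integral_BA(1)) simp_all
  also have "\<dots> = (\<integral>\<^sup>+b. ennreal (tiltB (B.T b)) * (emeasure (cond_kernel (?I (B.X b))) S * indicator Y (?I (B.X b))) \<partial>WB)"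
  proof (rule nn_integral_cong_AE)
    show "AE b in WB. (\<integral>\<^sup>+a. ennreal (tilt (A.T a * B.T b powr (1 / \<alpha>))) * (indicator Y (?I (B.X b)) * indicator S (A.X a)) \<partial>WA)
      = ennreal (tiltB (B.T b)) * (emeasure (cond_kernel (?I (B.X b))) S * indicator Y (?I (B.X b)))"
      using B.AE_T B.AE_inverse_local_time
    proof eventually_elim
      case (elim b)
      \<comment> \<open>Almost surely the inverse local time of the normalized points is their total
        mass, so the conditioning value is this y. The weight then factors into
        \<open>tiltB y\<close> and the conditional weight.\<close>
      define y where "y = B.T b"
      have y: "0 < y" using elim by (simp add: y_def)
      have "(\<integral>\<^sup>+a. ennreal (tilt (A.T a * y powr (1 / \<alpha>))) * (indicator Y y * indicator S (A.X a)) \<partial>WA)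
        = (\<integral>\<^sup>+a. ennreal (tiltB y) * indicator Y y * (ennreal (kernel_density y (A.T a)) * indicator S (A.X a)) \<partial>WA)"
      proof (rule nn_integral_cong_eventually[OF A.AE_T])
        fix a assume "summable (\<lambda>i. J \<alpha> i a) \<and> (\<Sum>i. ennreal (J \<alpha> i a)) = ennreal (A.T a) \<and> 0 < A.T a"
        then have "tilt (A.T a * y powr (1 / \<alpha>)) = tiltB y * kernel_density y (A.T a)"
          using y expmomA_pos[of y] by (simp add: tilt_mult(1) tiltB_def kernel_density_def)
        then show "ennreal (tilt (A.T a * y powr (1 / \<alpha>))) * (indicator Y y * indicator S (A.X a))
          = ennreal (tiltB y) * indicator Y y * (ennreal (kernel_density y (A.T a)) * indicator S (A.X a))"
          by (simp add: ennreal_mult tilt_nonneg kernel_density_nonneg mult_ac)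
      qed
      also have "\<dots> = ennreal (tiltB y) * indicator Y y * emeasure (cond_kernel y) S"
        unfolding emeasure_kernel[OF S] by (rule nn_integral_cmult) simp
      finally show ?case using elim by (simp add: y_def mult_ac)
    qed
  qed
  also have "\<dots> = (\<integral>\<^sup>+w. emeasure (cond_kernel (?I (Q w))) S * indicator Y (?I (Q w)) \<partial>M)"
    by (rule nn_integral_Q[symmetric, of "\<lambda>p. emeasure (cond_kernel (?I p)) S * indicator Y (?I p)"]) measurable
  finally show "emeasure M {w\<in>space M. ?I (Q w) \<in> Y \<and> Vt w \<in> S} = (\<integral>\<^sup>+w. emeasure (cond_kernel (?I (Q w))) S * indicator Y (?I (Q w)) \<partial>M)" .
qed

end

end

end

section \<open>Laws of the coagulated and of the fragmented partition\<close>

context stable_pk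
begin

text \<open>For mixtures indexed by a power of the total mass; \<open>eq\<close> says that the
  densities correspond under s = t powr p, Jacobian included. It is applied with p =
  -\<beta>.\<close>

lemma emeasure_mixture_powr:
  assumes p: "p \<noteq> 0" and [measurable]: "\<rho> \<in> borel_measurable borel" and \<rho>0: "\<And>s. 0 < s \<Longrightarrow> 0 \<le> \<rho> s"
    and [measurable]: "r \<in> borel_measurable borel" and r0: "\<And>t. 0 < t \<Longrightarrow> 0 \<le> r t"
    and eq: "\<And>t. 0 < t \<Longrightarrow> \<rho> (t powr p) * (\<bar>p\<bar> * t powr (p - 1)) = r t * f t" and S: "S \<in> sets PinfM"
  shows "emeasure (mixture (\<lambda>s. K (s powr (1 / p))) \<rho>) S = (\<integral>\<^sup>+w. ennreal (r (T w)) * indicator S (X w) \<partial>W)"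
proof -
  note [measurable] = emeasure_K'_measurable[OF S]
  have "emeasure (mixture (\<lambda>s. K (s powr (1 / p))) \<rho>) S = (\<integral>\<^sup>+s\<in>{0<..}. ennreal (\<rho> s) * emeasure (K' (s powr (1 / p))) S \<partial>lborel)"
    by (rule emeasure_mixture_kernel[OF _ _ _ S]) (simp_all, rule measurable_restrict_space1, simp)
  also have "\<dots> = (\<integral>\<^sup>+t\<in>{0<..}. ennreal (\<rho> (t powr p)) * emeasure (K' ((t powr p) powr (1 / p))) S * ennreal (\<bar>p\<bar> * t powr (p - 1)) \<partial>lborel)"
    by (rule nn_integral_powr_subst[OF _ p]) simp
  also have "\<dots> = (\<integral>\<^sup>+t\<in>{0<..}. ennreal (r t * f t) * emeasure (K' t) S \<partial>lborel)"
  proof (rule nn_integral_cong)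
    fix t :: real
    have "ennreal (r t * f t) = ennreal (\<rho> (t powr p)) * ennreal (\<bar>p\<bar> * t powr (p - 1))" if "0 < t"
      using that \<rho>0 by (simp add: eq[symmetric] ennreal_mult)
    then show "ennreal (\<rho> (t powr p)) * emeasure (K' ((t powr p) powr (1 / p))) S * ennreal (\<bar>p\<bar> * t powr (p - 1)) * indicator {0<..} t
      = ennreal (r t * f t) * emeasure (K' t) S * indicator {0<..} t"
      using p by (cases "0 < t") (simp_all add: powr_powr mult_ac)
  qed
  also have "\<dots> = (\<integral>\<^sup>+w. ennreal (r (T w)) * indicator S (X w) \<partial>W)" by (rule nn_integral_T_kernel[OF _ r0 S]) simp
  finally show ?thesis .
qed

end

context pk_family
begin

context
  fixes lam :: real and j :: nat
  assumes lam: "0 < lam"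
begin

abbreviation "\<theta>' \<equiv> real j * \<beta>"

lemma expmomA_series:
  "(\<lambda>l. (- lam * y powr (- \<beta> / \<alpha>)) ^ l / fact l *
     (Gamma (\<beta> * (real j + real l) / \<alpha> + 1) * Gamma (real j * \<beta> + 1)) /
     (Gamma (real j * \<beta> / \<alpha> + 1) * Gamma (real j * \<beta> + real l * \<beta> + 1)))
   sums (A.expmom j \<beta> (lam * y powr (- \<beta> / \<alpha>)) / A.mom \<theta>')"
proof -
  let ?x = "lam * y powr (- \<beta> / \<alpha>)"
  have "(\<lambda>l. (- ?x) ^ l / fact l * A.mom (real (j + l) * \<beta>) / A.mom \<theta>') sums (A.expmom j \<beta> ?x / A.mom \<theta>')"
    by (intro sums_divide A.expmom_sums) (use lam index_bounds in auto)
  moreover have "(- ?x) ^ l / fact l * A.mom (real (j + l) * \<beta>) / A.mom \<theta>' =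
     (- lam * y powr (- \<beta> / \<alpha>)) ^ l / fact l *
     (Gamma (\<beta> * (real j + real l) / \<alpha> + 1) * Gamma (real j * \<beta> + 1)) /
     (Gamma (real j * \<beta> / \<alpha> + 1) * Gamma (real j * \<beta> + real l * \<beta> + 1))" for l
  proof -
    have "A.mom (real (j + l) * \<beta>) = Gamma (\<beta> * (real j + real l) / \<alpha> + 1) / Gamma (real j * \<beta> + real l * \<beta> + 1)"
      by (simp add: A.mom_def algebra_simps)
    moreover have "A.mom \<theta>' = Gamma (real j * \<beta> / \<alpha> + 1) / Gamma (real j * \<beta> + 1)" by (simp add: A.mom_def)
    ultimately show ?thesis by (simp add: mult_ac)
  qed
  ultimately show ?thesis by simp
qed

context
  fixes M :: "'a measure" and Vt Q V :: "'a \<Rightarrow> nat \<Rightarrow> real" and Ut U :: "nat \<Rightarrow> 'a \<Rightarrow> real" and EB :: real and EA :: "real \<Rightarrow> real"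
  assumes M: "prob_space M"
    and VQ_meas: "(\<lambda>w. (Vt w, Q w)) \<in> M \<rightarrow>\<^sub>M PinfM \<Otimes>\<^sub>M PinfM"
    and VQ_law: "distr M (PinfM \<Otimes>\<^sub>M PinfM) (\<lambda>w. (Vt w, Q w)) = joint_law f PDc \<alpha> \<beta> (tilt lam j)"
    and EB: "EB = mgf lam j / C.mom \<theta>'" and EA: "\<And>y. EA y = A.expmom j \<beta> (lam * y powr (- \<beta> / \<alpha>)) / A.mom \<theta>'"
    and Ut_unif: "\<And>k. distr M borel (Ut k) = unif" and U_unif: "\<And>l. distr M borel (U l) = unif"
    and unif_indep: "prob_space.indep_vars M (\<lambda>_. borel)
      (\<lambda>i. case i of Inl k \<Rightarrow> Ut k | Inr l \<Rightarrow> U l) (UNIV :: (nat + nat) set)"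
    and VQ_indep: "prob_space.indep_var M
      (PinfM \<Otimes>\<^sub>M PinfM) (\<lambda>w. (Vt w, Q w))
      (seq_borel \<Otimes>\<^sub>M seq_borel) (\<lambda>w. (\<lambda>k. Ut k w, \<lambda>l. U l w))"
    and V_meas: "V \<in> M \<rightarrow>\<^sub>M PinfM"
    and V: "AE w in M. V w =
      ranked_masses (bridge (Vt w) (\<lambda>k. Ut k w) \<circ> bridge (Q w) (\<lambda>l. U l w))"
begin

text \<open>Off a null set \<open>V\<close> is \<open>coag\<close> of the pair and its marks. The
  marks are independent of the pair and are integrated out first; \<open>nn_integral_VQ\<close> and
  \<open>coag_law_pair\<close> then turn the weight into a function of the \<beta>-stable total
  alone.\<close>

lemma emeasure_V:
  assumes S [measurable]: "S \<in> sets PinfM"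
  shows "emeasure (distr M PinfM V) S = (\<integral>\<^sup>+w. ennreal (tilt lam j (C.T w)) * indicator S (C.X w) \<partial>WC)"
proof -
  let ?c = "\<lambda>z. coag (fst (fst z)) (snd (fst z)) (snd (snd z)) (fst (snd z))"
  interpret M: prob_space M by fact
  interpret U: prob_space unif_seq by (rule prob_space_unif_seq)
  interpret UU: pair_prob_space unif_seq unif_seq ..
  let ?PP = "PinfM \<Otimes>\<^sub>M PinfM" and ?UU = "unif_seq \<Otimes>\<^sub>M unif_seq"
  let ?SS = "?PP \<Otimes>\<^sub>M (seq_borel \<Otimes>\<^sub>M seq_borel)"
  let ?N = "distr M ?PP (\<lambda>w. (Vt w, Q w))"
  let ?Z = "\<lambda>w. ((Vt w, Q w), ((\<lambda>k. Ut k w), (\<lambda>l. U l w)))"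
  interpret N: prob_space ?N by (rule M.prob_space_distr[OF VQ_meas])
  have idu: "(\<lambda>x. x) \<in> unif_seq \<rightarrow>\<^sub>M seq_borel" by (rule measurable_ident_sets[OF sets_unif_seq])
  have Z: "distr M ?SS ?Z = ?N \<Otimes>\<^sub>M ?UU"
    using VQ_indep unfolding M.indep_var_distribution_eq unif_pair_law[OF M Ut_unif U_unif unif_indep] by simp
  have Zm: "?Z \<in> M \<rightarrow>\<^sub>M ?SS"
    using VQ_indep unfolding M.indep_var_distribution_eq by (intro measurable_Pair1 measurable_Pair) auto
  have c: "(\<lambda>z. ?c z) \<in> ?SS \<rightarrow>\<^sub>M PinfM" by (rule coag_measurable) measurable
  have c': "(\<lambda>z. ?c z) \<in> ?PP \<Otimes>\<^sub>M ?UU \<rightarrow>\<^sub>M PinfM"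
    using c by (simp add: measurable_cong_sets[OF sets_pair_measure_cong[OF refl sets_pair_measure_cong[OF sets_unif_seq sets_unif_seq]] refl])
  have VP: "Vt w \<in> Pinf" "Q w \<in> Pinf" if "w \<in> space M" for w
    using measurable_space[OF VQ_meas that] by (auto simp: space_pair_measure)
  have "AE z in distr M ?SS ?Z. inj (snd (snd z)) \<and> (\<forall>l. snd (snd z) l \<in> {0<..1})
    \<and> (\<forall>k. \<exists>l. fst (snd z) k \<in> cell (snd (fst z)) (snd (snd z)) l)"
    unfolding Z by (rule AE_coag_regular[OF N.prob_space_axioms]) simp
  from AE_distrD[OF Zm this] have reg: "AE w in M. inj (\<lambda>l. U l w) \<and> (\<forall>l. U l w \<in> {0<..1})
    \<and> (\<forall>k. \<exists>l. Ut k w \<in> cell (Q w) (\<lambda>l. U l w) l)" by simp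
  have Vc: "AE w in M. V w = coag (Vt w) (Q w) (\<lambda>l. U l w) (\<lambda>k. Ut k w)" using V reg AE_space
  proof eventually_elim
    case (elim w)
    then show ?case using bridge_coag[OF VP, of w w "\<lambda>l. U l w" "\<lambda>k. Ut k w"] by simp
  qed
  define G where "G x = (\<integral>\<^sup>+v. indicator S (coag (fst x) (snd x) (snd v) (fst v)) \<partial>?UU)" for x
  have cS: "(\<lambda>z. indicator S (?c z) :: ennreal) \<in> borel_measurable (?PP \<Otimes>\<^sub>M ?UU)"
    using measurable_compose[OF c' borel_measurable_indicator[OF S]] by simp
  then have G [measurable]: "G \<in> borel_measurable ?PP"
    unfolding G_def[abs_def] by (intro UU.borel_measurable_nn_integral) (simp add: case_prod_beta')
  have "emeasure (distr M PinfM V) S = (\<integral>\<^sup>+w. indicator S (V w) \<partial>M)"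
    using nn_integral_distr[OF V_meas, of "indicator S"] by simp
  also have "\<dots> = (\<integral>\<^sup>+w. indicator S (coag (Vt w) (Q w) (\<lambda>l. U l w) (\<lambda>k. Ut k w)) \<partial>M)"
    by (rule nn_integral_cong_eventually[OF Vc]) simp
  also have "\<dots> = (\<integral>\<^sup>+z. indicator S (?c z) \<partial>distr M ?SS ?Z)"
    by (subst nn_integral_distr[OF Zm]) (use measurable_compose[OF c borel_measurable_indicator[OF S]] in simp_all)
  also have "\<dots> = (\<integral>\<^sup>+x. G x \<partial>?N)"
    using UU.nn_integral_fst[of "\<lambda>z. indicator S (?c z)" ?N] cS
    unfolding Z G_def by (simp add: measurable_cong_sets[OF sets_pair_measure_cong[OF sets_distr refl] refl])
  also have "\<dots> = (\<integral>\<^sup>+w. G (Vt w, Q w) \<partial>M)" by (rule nn_integral_distr[OF VQ_meas]) simp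
  also have "\<dots> = (\<integral>\<^sup>+z. ennreal (tilt lam j (tt z)) * G (A.X (snd z), B.X (fst z)) \<partial>BA)"
    by (rule nn_integral_VQ[OF lam M VQ_meas VQ_law EB EA G])
  also have "\<dots> = (\<integral>\<^sup>+w. ennreal (tilt lam j (C.T w)) * indicator S (C.X w) \<partial>WC)" unfolding G_def fst_conv snd_conv
    by (rule coag_law_pair[where H="\<lambda>t. ennreal (tilt lam j t)"]) (use tilt_measurable(1)[OF lam, of j] in simp_all)
  finally show ?thesis .
qed

lemma V_law:
  "distr M PinfM V = mixture (\<lambda>s. PDc \<beta> (s powr (- 1 / \<beta>))) (\<lambda>s. exp (- lam * s) * g_tilt \<beta> (f \<beta>) \<theta>' s / EB)"
    (is "_ = mixture ?K ?\<rho>")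
proof (rule measure_eqI)
  have m: "0 < C.mom \<theta>'" by (rule C.mom_pos[OF index_\<theta>(2)[OF lam]])
  have b: "0 < \<beta>" by (rule index_bounds)
  have N: "0 < mgf lam j" by (rule mgf_pos[OF lam])
  have em: "emeasure (mixture ?K ?\<rho>) S = (\<integral>\<^sup>+w. ennreal (tilt lam j (C.T w)) * indicator S (C.X w) \<partial>WC)" if S: "S \<in> sets PinfM" for S
  proof -
    have "emeasure (mixture (\<lambda>s. PDc \<beta> (s powr (1 / (- \<beta>)))) ?\<rho>) S = (\<integral>\<^sup>+w. ennreal (tilt lam j (C.T w)) * indicator S (C.X w) \<partial>WC)"
    proof (rule C.emeasure_mixture_powr[OF _ _ _ _ _ _ S])
      show "?\<rho> \<in> borel_measurable borel" unfolding g_tilt_def by measurable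
      show "0 \<le> ?\<rho> s" if "0 < s" for s
        using N m b C.f_nonneg by (auto simp: EB g_tilt_def C.neg_moment_f[OF index_\<theta>(2)[OF lam]] intro!: divide_nonneg_nonneg mult_nonneg_nonneg)
      show "?\<rho> (t powr (- \<beta>)) * (\<bar>- \<beta>\<bar> * t powr (- \<beta> - 1)) = tilt lam j t * f \<beta> t" if t: "0 < t" for t
      proof -
        have 1: "(t powr (- \<beta>)) powr (- 1 / \<beta>) = t" "(t powr (- \<beta>)) powr (\<theta>' / \<beta>) = t powr (- \<theta>')"
          using t b by (simp_all add: powr_powr mult.commute)
        \<comment> \<open>The power in the density of T powr (-\<beta>) and the Jacobian of the
          substitution cancel.\<close>
        have "(t powr (- \<beta>)) powr (- 1 / \<beta> - 1) * t powr (- \<beta> - 1) = t powr ((- \<beta>) * (- 1 / \<beta> - 1) + (- \<beta> - 1))"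
          by (simp only: powr_powr powr_add)
        also have "(- \<beta>) * (- 1 / \<beta> - 1) + (- \<beta> - 1) = 0" using b by (simp add: field_simps)
        finally have 2: "(t powr (- \<beta>)) powr (- 1 / \<beta> - 1) * t powr (- \<beta> - 1) = 1" using t by simp
        have "?\<rho> (t powr (- \<beta>)) * (\<bar>- \<beta>\<bar> * t powr (- \<beta> - 1))
          = exp (- lam * t powr (- \<beta>)) * t powr (- \<theta>') / mgf lam j * f \<beta> t * ((t powr (- \<beta>)) powr (- 1 / \<beta> - 1) * t powr (- \<beta> - 1))"
          unfolding EB g_tilt_def C.neg_moment_f[OF index_\<theta>(2)[OF lam]] 1 using m b N by (simp add: divide_simps)
        then show ?thesis unfolding 2 by (simp add: tilt_def[OF lam])
      qed
    qed (use b tilt_measurable(1)[OF lam, of j] tilt_nonneg(1)[OF lam, of j] in auto)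
    then show ?thesis by simp
  qed
  have sK: "sets (PDc \<beta> (s powr (- 1 / \<beta>))) = sets PinfM" if "0 < s" for s
    using measurable_space[OF C.K_meas, of "s powr (- 1 / \<beta>)"] that by (simp add: space_prob_algebra space_restrict_space)
  then show "sets (distr M PinfM V) = sets (mixture ?K ?\<rho>)"
    unfolding mixture_def by (subst sets_bind[where N=PinfM]) (auto simp: space_restrict_space intro!: exI[of _ 1])
  fix S assume "S \<in> sets (distr M PinfM V)"
  then have S: "S \<in> sets PinfM" by simp
  show "emeasure (distr M PinfM V) S = emeasure (mixture ?K ?\<rho>) S" unfolding emeasure_V[OF S] em[OF S] ..
qed

text \<open>\<open>V\<close> is distributed as the normalized \<beta>-stable points with weight
  \<open>tilt\<close> of their total. By \<open>frag_law\<close> its fragmentation is distributed as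
  the normalized \<alpha>-stable points with the same weight at the product of totals, and
  \<open>emeasure_Vt\<close> computes the same law for \<open>Vt\<close>.\<close>

lemma FRAG_law_V: "FRAG_law \<alpha> \<beta> (distr M PinfM V) = distr M PinfM Vt"
proof (rule measure_eqI)
  interpret M: prob_space M by fact
  interpret D: prob_space D by (rule prob_space_D)
  note [measurable] = tilt_measurable(1)[OF lam, of j]
  let ?N = "distr M PinfM V"
  interpret N: prob_space ?N by (rule M.prob_space_distr[OF V_meas])
  have N: "?N = distr (density WC (\<lambda>w. ennreal (tilt lam j (C.T w)))) PinfM C.X"
  proof (rule measure_eqI)
    fix S assume "S \<in> sets ?N"
    then have S [measurable]: "S \<in> sets PinfM" by simp
    show "emeasure ?N S = emeasure (distr (density WC (\<lambda>w. ennreal (tilt lam j (C.T w)))) PinfM C.X) S"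
      unfolding emeasure_V[OF S]
      by (subst emeasure_distr, simp, simp, subst emeasure_density) (auto intro!: nn_integral_cong split: split_indicator)
  qed simp
  have FL: "FRAG_law \<alpha> \<beta> ?N = distr (?N \<Otimes>\<^sub>M D) PinfM (\<lambda>z. frag_seq (fst z) (snd z))"
    unfolding FRAG_law_def A.PD_law_eq[OF PDm] frag_seq_def case_prod_beta' ..
  show "sets (FRAG_law \<alpha> \<beta> ?N) = sets (distr M PinfM Vt)" unfolding FL by simp
  fix S assume "S \<in> sets (FRAG_law \<alpha> \<beta> ?N)"
  then have S [measurable]: "S \<in> sets PinfM" unfolding FL by simp
  have fm: "(\<lambda>z. frag_seq (fst z) (snd z)) \<in> PinfM \<Otimes>\<^sub>M D \<rightarrow>\<^sub>M PinfM"
    by (rule frag_seq_measurable[OF measurable_fst]) (rule measurable_compose[OF measurable_snd D_component])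
  then have fm': "(\<lambda>z. frag_seq (fst z) (snd z)) \<in> ?N \<Otimes>\<^sub>M D \<rightarrow>\<^sub>M PinfM"
    by (simp add: measurable_cong_sets[OF sets_pair_measure_cong[OF sets_distr refl] refl])
  note fS = measurable_compose[OF fm borel_measurable_indicator[OF S]] and fS' = measurable_compose[OF fm' borel_measurable_indicator[OF S]]
  define G where "G p = (\<integral>\<^sup>+q. indicator S (frag_seq p q) \<partial>D)" for p
  have G [measurable]: "G \<in> borel_measurable PinfM"
    unfolding G_def[abs_def] by (rule D.borel_measurable_nn_integral) (use fS in \<open>simp add: case_prod_beta'\<close>)
  have GX [measurable]: "(\<lambda>w. G (C.X w)) \<in> borel_measurable WC" by (rule measurable_compose[OF C.X_meas G])
  have fC [measurable]: "(\<lambda>z. indicator S (frag_seq (C.X (fst z)) (snd z)) :: ennreal) \<in> borel_measurable (WC \<Otimes>\<^sub>M D)"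
    by (rule measurable_compose[OF frag_CX_measurable borel_measurable_indicator[OF S]])
  have "emeasure (FRAG_law \<alpha> \<beta> ?N) S = (\<integral>\<^sup>+z. indicator S (frag_seq (fst z) (snd z)) \<partial>(?N \<Otimes>\<^sub>M D))"
    unfolding FL using nn_integral_distr[OF fm', of "indicator S"] by simp
  also have "\<dots> = (\<integral>\<^sup>+p. G p \<partial>?N)" unfolding G_def using D.nn_integral_fst[OF fS'] by simp
  also have "\<dots> = (\<integral>\<^sup>+w. ennreal (tilt lam j (C.T w)) * G (C.X w) \<partial>WC)"
    unfolding N by (subst nn_integral_distr) (simp_all add: nn_integral_density)
  also have "\<dots> = (\<integral>\<^sup>+w. \<integral>\<^sup>+q. ennreal (tilt lam j (C.T w)) * indicator S (frag_seq (C.X w) q) \<partial>D \<partial>WC)"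
  proof (rule nn_integral_cong)
    fix w assume "w \<in> space WC"
    have "(\<lambda>q. indicator S (frag_seq (C.X w) q) :: ennreal) \<in> borel_measurable D"
      using measurable_compose[OF measurable_Pair1'[of "C.X w" PinfM D] fS] by simp
    then show "ennreal (tilt lam j (C.T w)) * G (C.X w) = (\<integral>\<^sup>+q. ennreal (tilt lam j (C.T w)) * indicator S (frag_seq (C.X w) q) \<partial>D)"
      unfolding G_def by (rule nn_integral_cmult[symmetric])
  qed
  also have "\<dots> = (\<integral>\<^sup>+z. ennreal (tilt lam j (C.T (fst z))) * indicator S (frag_seq (C.X (fst z)) (snd z)) \<partial>(WC \<Otimes>\<^sub>M D))"
    by (subst D.nn_integral_fst[symmetric]) simp_all
  also have "\<dots> = (\<integral>\<^sup>+z. ennreal (tilt lam j (tt z)) * indicator S (A.X (snd z)) \<partial>BA)"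
    by (rule frag_law[where H="\<lambda>t. ennreal (tilt lam j t)"]) simp_all
  also have "\<dots> = (\<integral>\<^sup>+a. ennreal (tiltA lam j (A.T a)) * indicator S (A.X a) \<partial>WA)" by (rule tilted_law_A[OF lam]) simp
  also have "\<dots> = emeasure (distr M PinfM Vt) S" by (rule emeasure_Vt[OF lam M VQ_meas VQ_law EB EA S, symmetric])
  finally show "emeasure (FRAG_law \<alpha> \<beta> ?N) S = emeasure (distr M PinfM Vt) S" .
qed

end

end

end

theorem proposition5p1:
  fixes \<Omega> :: "real \<Rightarrow> 'w measure"
    and J :: "real \<Rightarrow> nat \<Rightarrow> 'w \<Rightarrow> real"
    and f :: "real \<Rightarrow> real \<Rightarrow> real"
    and PDc :: "real \<Rightarrow> real \<Rightarrow> (nat \<Rightarrow> real) measure"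
    and M :: "'a measure"
    and Vt Q V :: "'a \<Rightarrow> nat \<Rightarrow> real"
    and Ut U :: "nat \<Rightarrow> 'a \<Rightarrow> real"
    and \<alpha> \<beta> lam :: real
    and j :: nat
    and \<theta> :: real and EB :: real and h :: "real \<Rightarrow> real" and EA :: "real \<Rightarrow> real"
  assumes points: "\<And>\<gamma>. 0 < \<gamma> \<Longrightarrow> \<gamma> < 1 \<Longrightarrow>
      ranked_poisson_points (\<Omega> \<gamma>) (stable_intensity \<gamma>) (J \<gamma>)"
    and f_nonneg: "\<And>\<gamma> t. 0 < \<gamma> \<Longrightarrow> \<gamma> < 1 \<Longrightarrow> 0 \<le> f \<gamma> t"
    and f_borel: "\<And>\<gamma>. 0 < \<gamma> \<Longrightarrow> \<gamma> < 1 \<Longrightarrow> f \<gamma> \<in> borel_measurable borel"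
    and f_density: "\<And>\<gamma>. 0 < \<gamma> \<Longrightarrow> \<gamma> < 1 \<Longrightarrow>
      distributed (\<Omega> \<gamma>) lborel (total (J \<gamma>)) (\<lambda>t. ennreal (f \<gamma> t))"
    and PDc: "\<And>\<gamma>. 0 < \<gamma> \<Longrightarrow> \<gamma> < 1 \<Longrightarrow>
      regular_cond_law (\<Omega> \<gamma>) PinfM (normalized (J \<gamma>)) (total (J \<gamma>)) (PDc \<gamma>)"
    and params: "0 < \<beta>" "\<beta> < \<alpha>" "\<alpha> < 1" "0 < lam"
    and \<theta>: "\<theta> = real j * \<beta>"
    and EB: "EB = mittag_leffler (real j + 1) \<beta> (\<theta> + 1) (- lam)"
    and h: "\<And>t. h t = exp (- lam * t powr (- \<beta>)) * t powr (- \<theta>) / (EB * neg_moment (f \<beta>) \<theta>)"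
    and EA: "\<And>y. EA y =
      (\<integral>t. exp (- lam * y powr (- \<beta> / \<alpha>) * t powr (- \<beta>)) \<partial>law_of (f_tilt (f \<alpha>) \<theta>))"
    and M: "prob_space M"
    and VQ_meas: "(\<lambda>\<omega>. (Vt \<omega>, Q \<omega>)) \<in> M \<rightarrow>\<^sub>M PinfM \<Otimes>\<^sub>M PinfM"
    and VQ_law: "distr M (PinfM \<Otimes>\<^sub>M PinfM) (\<lambda>\<omega>. (Vt \<omega>, Q \<omega>)) = joint_law f PDc \<alpha> \<beta> h"
    and Ut_unif: "\<And>k. distr M borel (Ut k) = uniform_measure lborel {0..1}"
    and U_unif: "\<And>l. distr M borel (U l) = uniform_measure lborel {0..1}"
    and unif_indep: "prob_space.indep_vars M (\<lambda>_. borel)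
      (\<lambda>i. case i of Inl k \<Rightarrow> Ut k | Inr l \<Rightarrow> U l) (UNIV :: (nat + nat) set)"
    and VQ_indep: "prob_space.indep_var M
      (PinfM \<Otimes>\<^sub>M PinfM) (\<lambda>\<omega>. (Vt \<omega>, Q \<omega>))
      (seq_borel \<Otimes>\<^sub>M seq_borel) (\<lambda>\<omega>. (\<lambda>k. Ut k \<omega>, \<lambda>l. U l \<omega>))"
    and V_meas: "V \<in> M \<rightarrow>\<^sub>M PinfM"
    and V: "AE \<omega> in M. V \<omega> =
      ranked_masses (bridge (Vt \<omega>) (\<lambda>k. Ut k \<omega>) \<circ> bridge (Q \<omega>) (\<lambda>l. U l \<omega>))"
  shows
    "distr M PinfM V =
      mixture (\<lambda>s. PDc \<beta> (s powr (- 1 / \<beta>))) (\<lambda>s. exp (- lam * s) * g_tilt \<beta> (f \<beta>) \<theta> s / EB)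
  \<and> distr M PinfM Q =
      mixture (PDc (\<beta> / \<alpha>)) (\<lambda>y. EA y / EB * f_tilt (f (\<beta> / \<alpha>)) (\<theta> / \<alpha>) y)
  \<and> distributed M lborel (\<lambda>\<omega>. inverse_local_time (\<beta> / \<alpha>) (Q \<omega>))
      (\<lambda>y. ennreal (EA y * f_tilt (f (\<beta> / \<alpha>)) (\<theta> / \<alpha>) y / EB) * indicator {0<..} y)
  \<and> (\<forall>y>0.
      (\<lambda>l. (- lam * y powr (- \<beta> / \<alpha>)) ^ l / fact l *
           (Gamma (\<beta> * (real j + real l) / \<alpha> + 1) * Gamma (real j * \<beta> + 1)) /
           (Gamma (real j * \<beta> / \<alpha> + 1) * Gamma (real j * \<beta> + real l * \<beta> + 1))) sums EA y)
  \<and> regular_cond_law M PinfM Vt (\<lambda>\<omega>. inverse_local_time (\<beta> / \<alpha>) (Q \<omega>))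
      (\<lambda>y. mixture (PDc \<alpha>)
         (\<lambda>s. exp (- lam * s powr (- \<beta>) * y powr (- \<beta> / \<alpha>)) / EA y * f_tilt (f \<alpha>) \<theta> s))
  \<and> distr M PinfM Vt =
      mixture (PDc \<alpha>) (\<lambda>s. mittag_leffler (real j + 1) (\<beta> / \<alpha>) (\<theta> / \<alpha> + 1) (- lam * s powr (- \<beta>)) / EB
                         * f_tilt (f \<alpha>) \<theta> s)
  \<and> FRAG_law \<alpha> \<beta> (distr M PinfM V) =
      mixture (PDc \<alpha>) (\<lambda>s. mittag_leffler (real j + 1) (\<beta> / \<alpha>) (\<theta> / \<alpha> + 1) (- lam * s powr (- \<beta>)) / EB
                         * f_tilt (f \<alpha>) \<theta> s)"
proof -
  have b: "0 < \<beta> / \<alpha>" "\<beta> / \<alpha> < 1" "0 < \<alpha>" "\<beta> < 1" using params by auto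
  have pk: "stable_pk \<gamma> (\<Omega> \<gamma>) (J \<gamma>) (f \<gamma>) (PDc \<gamma>)" if "0 < \<gamma>" "\<gamma> < 1" for \<gamma>
    using that points f_nonneg f_borel f_density PDc
    by (simp add: stable_pk_def stable_pk_axioms_def stable_points_def)
  \<comment> \<open>The family enters through the three indices \<alpha>, \<beta> / \<alpha> and
    \<beta>.\<close>
  interpret pk_family \<alpha> \<beta> \<Omega> J f PDc
    using pk[of \<alpha>] pk[of "\<beta> / \<alpha>"] pk[of \<beta>] params b
    by (simp add: pk_family_def coag_setup_def coag_setup_axioms_def stable_pk_def)
  note lam = params(4)
  have EB': "EB = mgf lam j / C.mom (real j * \<beta>)"
    unfolding EB \<theta> by (rule normalizing_constants(1)[OF lam])
  have EA': "EA y = A.expmom j \<beta> (lam * y powr (- \<beta> / \<alpha>)) / A.mom (real j * \<beta>)" for y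
    unfolding EA \<theta> by (rule normalizing_constants(3)[OF lam])
  have "0 < C.mom (real j * \<beta>)" by (rule C.mom_pos[OF index_\<theta>(2)[OF lam]])
  \<comment> \<open>The moment in h cancels the one in \<open>EB'\<close>, which leaves
    \<open>mgf\<close> as normalizing constant.\<close>
  then have "h = tilt lam j"
    using h by (intro ext) (simp add: tilt_def[OF lam] EB' \<theta> C.neg_moment_f[OF index_\<theta>(2)[OF lam]])
  then have VQ: "distr M (PinfM \<Otimes>\<^sub>M PinfM) (\<lambda>\<omega>. (Vt \<omega>, Q \<omega>)) = joint_law f PDc \<alpha> \<beta> (tilt lam j)"
    using VQ_law by simp
  note core = lam M VQ_meas VQ EB' EA'
  note allV = core Ut_unif U_unif unif_indep VQ_indep V_meas V
  have "(\<lambda>l. (- lam * y powr (- \<beta> / \<alpha>)) ^ l / fact l *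
           (Gamma (\<beta> * (real j + real l) / \<alpha> + 1) * Gamma (real j * \<beta> + 1)) /
           (Gamma (real j * \<beta> / \<alpha> + 1) * Gamma (real j * \<beta> + real l * \<beta> + 1))) sums EA y" for y
    unfolding EA' by (rule expmomA_series[OF lam])
  moreover have "FRAG_law \<alpha> \<beta> (distr M PinfM V) = distr M PinfM Vt"
    by (rule FRAG_law_V[OF allV])
  ultimately show ?thesis
    using V_law[OF allV] Q_law[OF core] inverse_local_time_law[OF core] Vt_law[OF core]
      Vt_cond_law[OF core] unfolding cond_kernel_eq[OF core] \<theta> by simp
qed

end
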